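(* Let $m=m(n)\ge1$ be integers with $m=o(n)$ as $n\to\infty$, and let $h_0,\dots,h_{n-1}:\mathbb{R}^m\to\mathbb{R}$ be measurable functions (which may depend on $n$). Let $R_{n,m}=\sum_{k=0}^{n-1}h_k(nS_k,\dots,nS_{k+m-1})$. Suppose that (i) $C_{n-m,m}\sim C_{n,m}$ and $B_{n-m,m}\sim B_{n,m}$ as $n\to\infty$; (ii) for some $r>2$, $$\frac{m^{r-1}}{\sigma_{n,m}^r}\sum_{k=0}^{n-1}E\left|g_{k,n}(X_k^m)\right|^r\to0\quad(n\to\infty).$$ Then, as $n\to\infty$, $$\frac{R_{n,m}-A_{n,m}}{\sigma_{n,m}}\xrightarrow{d}\mathcal N(0,1).$$
   Context: Spacings: let $0\le U_1\le U_2\le\dots\le U_{n-1}\le 1$ be the order statistics of a sample of size $n-1$ from the uniform distribution on $[0,1]$. Put $U_0=0$, $U_n=1$, and $U_k=1+U_{k-n}$ for $k\ge n$. The simple spacings are $S_k=U_{k+1}-U_k$, $k\ge 0$ (so $S_{n+j}=S_j$). Exponentials and notation: for $N\ge 1$ let $X_0,X_1,\dots,X_{N-1}$ be independent random variables with the standard exponential distribution (mean 1), with $X_{N+j}=X_j$; write $X_k^m=(X_k,\dots,X_{k+m-1})$ and $|X_k^m|=X_k+\dots+X_{k+m-1}$. For $N\in\{n,n-m\}$ put $$A_{N,m}=\sum_{k=0}^{N-1}E h_k(X_k^m),\quad C_{N,m}=\frac1N\sum_{k=0}^{N-1}\sum_{j=k-m+1}^{k+m-1}\operatorname{cov}\big(h_k(X_k^m),h_j(X_j^m)\big),\quad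 B_{N,m}=\frac1N\sum_{k=0}^{N-1}\operatorname{cov}\big(h_k(X_k^m),|X_k^m|\big),$$ $$\sigma_{N,m}^2=N\,(C_{N,m}-B_{N,m}^2),\qquad g_{k,N}(X_k^m)=h_k(X_k^m)-E h_k(X_k^m)-B_{N,m}(X_k-1),$$ where indices $j$ outside $\{0,\dots,N-1\}$ (of both $h_j$ and $X_j$) are understood modulo $N$. It is understood that $\sigma_{n,m}>0$ and that all moments occurring are finite. $a_n\sim b_n$ means $a_n/b_n\to1$; $\xrightarrow{d}$ is convergence in distribution; $\mathcal N(0,1)$ is the standard normal law. *)

theory Defs
  imports "HOL-Probability.Probability" "HOL-Library.Landau_Symbols"
begin

text \<open>
  Since the dimension \<open>m\<close> varies with \<open>n\<close>, a vector of \<open>\<real>\<^sup>m\<close> is an extensional function on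
  \<open>{..<m}\<close>, i.e. a point of the space of \<open>borel_vec m\<close> (the Borel sigma-algebra of \<open>\<real>\<^sup>m\<close>).
\<close>

abbreviation borel_vec :: "nat \<Rightarrow> (nat \<Rightarrow> real) measure" where
  "borel_vec m \<equiv> Pi\<^sub>M {..<m} (\<lambda>_. borel)"

text \<open>The vector \<open>(x\<^sub>k, \<dots>, x\<^bsub>k+m-1\<^esub>)\<close>, indices being taken modulo \<open>N\<close>.\<close>

definition cyc_window :: "nat \<Rightarrow> nat \<Rightarrow> (nat \<Rightarrow> real) \<Rightarrow> nat \<Rightarrow> (nat \<Rightarrow> real)" where
  "cyc_window N m x k = (\<lambda>i\<in>{..<m}. x ((k + i) mod N))"

text \<open>The \<open>j\<close>-th smallest (\<open>1 \<le> j \<le> l\<close>) of the sample \<open>v 0, \<dots>, v (l - 1)\<close>.\<close>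

definition order_stat :: "nat \<Rightarrow> (nat \<Rightarrow> real) \<Rightarrow> nat \<Rightarrow> real" where
  "order_stat l v j = sort (map v [0..<l]) ! (j - 1)"

text \<open>
  \<open>spacing_pt n v k\<close> is \<open>U\<^sub>k\<close> for the sample \<open>v 0, \<dots>, v (n - 2)\<close> of size \<open>n - 1\<close>; the summand
  \<open>k div n\<close> solves the recursion \<open>U\<^sub>k = 1 + U\<^bsub>k-n\<^esub>\<close> for \<open>k \<ge> n\<close> (see \<open>spacing_pt_shift\<close>).
\<close>

definition spacing_pt :: "nat \<Rightarrow> (nat \<Rightarrow> real) \<Rightarrow> nat \<Rightarrow> real" where
  "spacing_pt n v k =
     real (k div n) + (if k mod n = 0 then 0 else order_stat (n - 1) v (k mod n))"

definition spacing :: "nat \<Rightarrow> (nat \<Rightarrow> real) \<Rightarrow> nat \<Rightarrow> real" where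
  "spacing n v k = spacing_pt n v (Suc k) - spacing_pt n v k"

lemma spacing_pt_0: "spacing_pt n v 0 = 0"
  by (simp add: spacing_pt_def)

lemma spacing_pt_order_stat: "1 \<le> k \<Longrightarrow> k < n \<Longrightarrow> spacing_pt n v k = order_stat (n - 1) v k"
  by (simp add: spacing_pt_def)

lemma spacing_pt_n: "n \<ge> 1 \<Longrightarrow> spacing_pt n v n = 1"
  by (simp add: spacing_pt_def)

lemma spacing_pt_shift: "n \<ge> 1 \<Longrightarrow> k \<ge> n \<Longrightarrow> spacing_pt n v k = 1 + spacing_pt n v (k - n)"
  by (simp add: spacing_pt_def le_div_geq le_mod_geq)

definition spacing_stat ::
    "nat \<Rightarrow> nat \<Rightarrow> (nat \<Rightarrow> (nat \<Rightarrow> real) \<Rightarrow> real) \<Rightarrow> (nat \<Rightarrow> real) \<Rightarrow> real" where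
  "spacing_stat n m h v = (\<Sum>k<n. h k (\<lambda>i\<in>{..<m}. real n * spacing n v (k + i)))"

definition cov :: "'b measure \<Rightarrow> ('b \<Rightarrow> real) \<Rightarrow> ('b \<Rightarrow> real) \<Rightarrow> real" where
  "cov P Y Z = (LINT \<omega>|P. (Y \<omega> - (LINT \<omega>|P. Y \<omega>)) * (Z \<omega> - (LINT \<omega>|P. Z \<omega>)))"

text \<open>
  In the following, \<open>X 0, \<dots>, X (N - 1)\<close> are random variables on \<open>P\<close> and \<open>h 0, h 1, \<dots>\<close> are functions
  on \<open>\<real>\<^sup>m\<close>; \<open>Xwin\<close> is \<open>X\<^sub>k\<^sup>m\<close> and \<open>win_sum\<close> is \<open>|X\<^sub>k\<^sup>m|\<close>.
\<close>

definition Xwin :: "(nat \<Rightarrow> 'b \<Rightarrow> real) \<Rightarrow> nat \<Rightarrow> nat \<Rightarrow> nat \<Rightarrow> 'b \<Rightarrow> (nat \<Rightarrow> real)" where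
  "Xwin X N m k \<omega> = cyc_window N m (\<lambda>j. X j \<omega>) k"

definition win_sum :: "nat \<Rightarrow> (nat \<Rightarrow> real) \<Rightarrow> real" where
  "win_sum m x = (\<Sum>i<m. x i)"

definition A_const ::
    "'b measure \<Rightarrow> (nat \<Rightarrow> 'b \<Rightarrow> real) \<Rightarrow> (nat \<Rightarrow> (nat \<Rightarrow> real) \<Rightarrow> real) \<Rightarrow> nat \<Rightarrow> nat \<Rightarrow> real" where
  "A_const P X h N m = (\<Sum>k<N. LINT \<omega>|P. h k (Xwin X N m k \<omega>))"

text \<open>The inner sum runs over integers \<open>j\<close>, possibly negative, which are then reduced modulo \<open>N\<close>.\<close>

definition C_const ::
    "'b measure \<Rightarrow> (nat \<Rightarrow> 'b \<Rightarrow> real) \<Rightarrow> (nat \<Rightarrow> (nat \<Rightarrow> real) \<Rightarrow> real) \<Rightarrow> nat \<Rightarrow> nat \<Rightarrow> real" where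
  "C_const P X h N m =
     (\<Sum>k<N. \<Sum>j\<in>{int k - int m + 1..int k + int m - 1}.
        let j' = nat (j mod int N) in
          cov P (\<lambda>\<omega>. h k (Xwin X N m k \<omega>)) (\<lambda>\<omega>. h j' (Xwin X N m j' \<omega>))) / real N"

definition B_const ::
    "'b measure \<Rightarrow> (nat \<Rightarrow> 'b \<Rightarrow> real) \<Rightarrow> (nat \<Rightarrow> (nat \<Rightarrow> real) \<Rightarrow> real) \<Rightarrow> nat \<Rightarrow> nat \<Rightarrow> real" where
  "B_const P X h N m =
     (\<Sum>k<N. cov P (\<lambda>\<omega>. h k (Xwin X N m k \<omega>)) (\<lambda>\<omega>. win_sum m (Xwin X N m k \<omega>))) / real N"

definition sigma2_const ::
    "'b measure \<Rightarrow> (nat \<Rightarrow> 'b \<Rightarrow> real) \<Rightarrow> (nat \<Rightarrow> (nat \<Rightarrow> real) \<Rightarrow> real) \<Rightarrow> nat \<Rightarrow> nat \<Rightarrow> real" where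
  "sigma2_const P X h N m = real N * (C_const P X h N m - (B_const P X h N m)\<^sup>2)"

definition sigma_const ::
    "'b measure \<Rightarrow> (nat \<Rightarrow> 'b \<Rightarrow> real) \<Rightarrow> (nat \<Rightarrow> (nat \<Rightarrow> real) \<Rightarrow> real) \<Rightarrow> nat \<Rightarrow> nat \<Rightarrow> real" where
  "sigma_const P X h N m = sqrt (sigma2_const P X h N m)"

text \<open>The random variable \<open>g\<^bsub>k,N\<^esub>(X\<^sub>k\<^sup>m)\<close>, for \<open>k < N\<close>.\<close>

definition g_rv ::
    "'b measure \<Rightarrow> (nat \<Rightarrow> 'b \<Rightarrow> real) \<Rightarrow> (nat \<Rightarrow> (nat \<Rightarrow> real) \<Rightarrow> real) \<Rightarrow> nat \<Rightarrow> nat \<Rightarrow> nat \<Rightarrow> 'b \<Rightarrow> real" where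
  "g_rv P X h N m k \<omega> =
     h k (Xwin X N m k \<omega>) - (LINT \<omega>|P. h k (Xwin X N m k \<omega>)) - B_const P X h N m * (X k \<omega> - 1)"

text \<open>
  The Bochner integral of a non-integrable function is \<open>0\<close>, so finiteness of moments has to be
  stated. Square integrability of the \<open>h\<^sub>k(X\<^sub>k\<^sup>m)\<close> is finiteness of all moments in \<open>A\<close>, \<open>B\<close> and
  \<open>C\<close>: the inner sum of \<open>C\<close> contains the variance term \<open>j = k\<close>.
\<close>

definition finite_moments ::
    "'b measure \<Rightarrow> (nat \<Rightarrow> 'b \<Rightarrow> real) \<Rightarrow> (nat \<Rightarrow> (nat \<Rightarrow> real) \<Rightarrow> real) \<Rightarrow> nat \<Rightarrow> nat \<Rightarrow> bool" where
  "finite_moments P X h N m \<longleftrightarrow>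
     (\<forall>k<N. integrable P (\<lambda>\<omega>. h k (Xwin X N m k \<omega>)) \<and>
            integrable P (\<lambda>\<omega>. (h k (Xwin X N m k \<omega>))\<^sup>2))"

definition iid_uniform :: "'a measure \<Rightarrow> nat \<Rightarrow> (nat \<Rightarrow> 'a \<Rightarrow> real) \<Rightarrow> bool" where
  "iid_uniform M l V \<longleftrightarrow>
     prob_space M \<and> prob_space.indep_vars M (\<lambda>_. borel) V {..<l} \<and>
     (\<forall>i<l. distr M borel (V i) = uniform_measure lborel {0..1})"

definition iid_std_exponential :: "'b measure \<Rightarrow> nat \<Rightarrow> (nat \<Rightarrow> 'b \<Rightarrow> real) \<Rightarrow> bool" where
  "iid_std_exponential P N X \<longleftrightarrow>
     prob_space P \<and> prob_space.indep_vars P (\<lambda>_. borel) X {..<N} \<and>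
     (\<forall>j<N. distributed P lborel (X j) (exponential_density 1))"

end

theory Submission
  imports Defs "HOL-Real_Asymp.Real_Asymp"
begin

text \<open>
  With independent exponential \<open>X\<^sub>k\<close> and \<open>T = \<Sum> (X\<^sub>k - 1)\<close>, the scaled spacings have the law of the
  \<open>X\<^sub>k\<close> conditioned on \<open>T = 0\<close>. Since \<open>T\<close> vanishes on the spacings, \<open>R - A = Z(nS)\<close> for
  \<open>Z = \<Sum> g\<^sub>k\<close>, and here \<open>Var Z = \<sigma>\<^sup>2\<close> and \<open>Cov (Z, T) = 0\<close>.

  Cut the circle into blocks of length about \<open>m\<close>, so that \<open>Z / \<sigma>\<close> is a sum of block variables each of
  which involves two neighbouring blocks. Among \<open>K\<close> disjoint arcs of blocks one carries only \<open>O(1/K)\<close>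
  of the variance; leave it out. For the coordinates in the rest \<open>J\<close> conditioning means a density
  proportional to \<open>(1 - z/a)\<^sup>a e\<^sup>z\<close> at \<open>z = T\<^sub>J - 1\<close>, where \<open>a = n - 1 - |J|\<close> is of order \<open>n\<close>. This weight is
  bounded, hence the omitted part stays negligible, and it is close to \<open>exp (- T\<^sub>J\<^sup>2 / (2 a))\<close>, which is a
  Gaussian mixture of the characters \<open>exp (i u T\<^sub>J / sqrt a)\<close>. The conditional characteristic function
  of \<open>Z / \<sigma>\<close> is therefore a ratio of averages over \<open>u\<close> of unconditional characteristic functions of
  \<open>t Z / \<sigma> + u T\<^sub>J / sqrt a\<close>. These sums of locally dependent variables are rewritten with martingale
  differences and handled by a differential inequality for their characteristic function; the
  Gaussian averages then give \<open>exp (- t\<^sup>2 / 2)\<close>, since \<open>Z\<close> and \<open>T\<close> are uncorrelated.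
\<close>

section \<open>Functions of independent coordinates\<close>

text \<open>The event T = 0 is null, so the law of all n scaled spacings has no density relative to
  independent coordinates; something has to be left out. If only few coordinates were omitted, the
  normalised weight could be as large as sqrt (n / a), which is unbounded. Hence a positive fraction
  is given up, and the price is the variance that it carries. The number K of arcs is fixed before
  every other constant, so that all losses through n / a are bounded by functions of K. The factor
  m^(r-1) in the moment condition pays for passing from windows to sums over blocks of at most 2 m
  indices, by the power mean inequality. The variances of these block sums may add up to far more
  than \<sigma>^2, because neighbours can cancel, and the expansion of the characteristic function
  produces an error \<delta> times that total; this is the obstacle that the martingale differences
  remove. All estimates are uniform over chains of blocks: smallness is asked only of m / n and of
  the Lyapunov quotient. Thus functions that change with n need no separate limit argument.\<close>

definition dep :: "nat set \<Rightarrow> ((nat \<Rightarrow> real) \<Rightarrow> 'c) \<Rightarrow> bool" where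
  "dep A f \<longleftrightarrow> (\<forall>x y. (\<forall>i\<in>A. x i = y i) \<longrightarrow> f x = f y)"

text \<open>Resampling: the coordinates in \<open>A\<close> are kept from \<open>x\<close>, the
  others are taken from \<open>y\<close>. For two independent copies this preserves the product law,
  which turns conditioning on the coordinates in \<open>A\<close> into integration over
  \<open>y\<close>, and independence into disjointness of the sets in \<open>dep\<close>.\<close>

definition mix :: "nat set \<Rightarrow> (nat \<Rightarrow> real) \<Rightarrow> (nat \<Rightarrow> real) \<Rightarrow> (nat \<Rightarrow> real)" where
  "mix A x y = (\<lambda>i. if i \<in> A then x i else y i)"

lemma depD: "dep A f \<Longrightarrow> (\<And>i. i \<in> A \<Longrightarrow> x i = y i) \<Longrightarrow> f x = f y"
  by (auto simp: dep_def)

lemma dep_mono: "dep A f \<Longrightarrow> A \<subseteq> B \<Longrightarrow> dep B f"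
  by (auto simp: dep_def)

lemma dep_const: "dep A (\<lambda>_. c)"
  by (auto simp: dep_def)

lemma dep_coord: "i \<in> A \<Longrightarrow> dep A (\<lambda>x. x i)"
  by (auto simp: dep_def)

lemma dep_comp: "dep A f \<Longrightarrow> dep A (\<lambda>x. F (f x))"
  unfolding dep_def by metis

lemma dep_comp2: "dep A f \<Longrightarrow> dep A g \<Longrightarrow> dep A (\<lambda>x. F (f x) (g x))"
  unfolding dep_def by metis

lemma dep_sum: "(\<And>i. i \<in> I \<Longrightarrow> dep A (f i)) \<Longrightarrow> dep A (\<lambda>x. \<Sum>i\<in>I. f i x)"
  unfolding dep_def by (auto intro!: sum.cong)

lemma dep_mix_eq: "dep B f \<Longrightarrow> B \<subseteq> A \<Longrightarrow> f (mix A x y) = f x"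
  by (erule depD) (auto simp: mix_def)

lemma dep_mix_eq': "dep B f \<Longrightarrow> A \<inter> B = {} \<Longrightarrow> f (mix A x y) = f y"
  by (erule depD) (auto simp: mix_def)

locale iid_coordinates = real_distribution \<mu> for \<mu> :: "real measure"
begin

definition Om :: "(nat \<Rightarrow> real) measure" where "Om = Pi\<^sub>M UNIV (\<lambda>_. \<mu>)"

sublocale prod: product_prob_space "\<lambda>_::nat. \<mu>" UNIV
  by unfold_locales

sublocale Om: prob_space Om
  unfolding Om_def by (rule prod.P.prob_space_axioms)

sublocale Om2: pair_prob_space Om Om
  by unfold_locales

lemma space_Om [simp]: "space Om = UNIV"
  by (auto simp: Om_def space_PiM)

lemma prob_UNIV [simp]: "Om.prob UNIV = 1"
  using Om.prob_space by simp

lemma sets_Om [measurable_cong]: "sets Om = sets (Pi\<^sub>M UNIV (\<lambda>_. borel))"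
  unfolding Om_def by (intro sets_PiM_cong) auto

lemma measurable_coord [measurable]: "(\<lambda>x. x i) \<in> borel_measurable Om"
  by measurable

lemma measurable_mix [measurable]: "(\<lambda>p. mix A (fst p) (snd p)) \<in> measurable (Om \<Otimes>\<^sub>M Om) Om"
  unfolding mix_def measurable_cong_sets[OF refl sets_Om]
  by (rule measurable_PiM_single') (auto simp: space_PiM)

lemma measurable_mix' [measurable]: "mix A x \<in> measurable Om Om"
  using measurable_compose[OF measurable_Pair1'[of x Om Om] measurable_mix[of A]] by simp

text \<open>It suffices to compare cylinders. The preimage of a cylinder over \<open>J\<close> is a
  rectangle, with the constraints on \<open>J \<inter> A\<close> placed on the first copy and those
  on \<open>J - A\<close> on the second, so its measure factorises into the same product.\<close>

lemma distr_mix: "distr (Om \<Otimes>\<^sub>M Om) Om (\<lambda>p. mix A (fst p) (snd p)) = Om"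
proof -
  have "Pi\<^sub>M UNIV (\<lambda>_::nat. \<mu>) = distr (Om \<Otimes>\<^sub>M Om) Om (\<lambda>p. mix A (fst p) (snd p))"
  proof (rule measure_eqI_PiM_infinite[OF refl])
    fix F :: "nat \<Rightarrow> real set" and J :: "nat set"
    assume J: "finite J" "J \<subseteq> UNIV" and F: "\<And>i. i \<in> J \<Longrightarrow> F i \<in> sets \<mu>"
    let ?E = "\<lambda>J. prod_emb UNIV (\<lambda>_. \<mu>) J (Pi\<^sub>E J F)"
    have E: "?E J = {x. \<forall>i\<in>J. x i \<in> F i}" for J
      by (auto simp: prod_emb_def PiE_def Pi_def)
    have Es: "?E K \<in> sets Om" if "K \<subseteq> J" for K
      unfolding Om_def using that J F by (intro sets_PiM_I) (auto intro: finite_subset)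
    have "(\<lambda>p. mix A (fst p) (snd p)) -` ?E J \<inter> space (Om \<Otimes>\<^sub>M Om) = ?E (J \<inter> A) \<times> ?E (J - A)"
      unfolding E by (auto simp: mix_def space_pair_measure)
    then have "emeasure (distr (Om \<Otimes>\<^sub>M Om) Om (\<lambda>p. mix A (fst p) (snd p))) (?E J)
        = emeasure (Om \<Otimes>\<^sub>M Om) (?E (J \<inter> A) \<times> ?E (J - A))"
      using Es[of J] by (subst emeasure_distr) auto
    also have "\<dots> = emeasure Om (?E (J \<inter> A)) * emeasure Om (?E (J - A))"
      by (intro Om.emeasure_pair_measure_Times Es) auto
    also have "\<dots> = (\<Prod>i\<in>J \<inter> A. emeasure \<mu> (F i)) * (\<Prod>i\<in>J - A. emeasure \<mu> (F i))"
      unfolding Om_def using J F by (subst (1 2) prod.emeasure_PiM_emb) auto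
    also have "\<dots> = (\<Prod>i\<in>J. emeasure \<mu> (F i))"
      using J by (subst prod.union_disjoint[symmetric]) (auto intro!: prod.cong)
    also have "\<dots> = emeasure (Pi\<^sub>M UNIV (\<lambda>_. \<mu>)) (?E J)"
      using J F by (subst prod.emeasure_PiM_emb) auto
    finally show "emeasure (Pi\<^sub>M UNIV (\<lambda>_. \<mu>)) (?E J) = emeasure (distr (Om \<Otimes>\<^sub>M Om) Om (\<lambda>p. mix A (fst p) (snd p))) (?E J)"
      by simp
  qed (auto simp: sets_Om Om_def[symmetric] intro: Om.finite_measure_axioms)
  then show ?thesis by (simp add: Om_def)
qed

lemma integrable_mix:
  fixes f :: "(nat \<Rightarrow> real) \<Rightarrow> 'c::{banach, second_countable_topology}"
  assumes "integrable Om f"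
  shows "integrable (Om \<Otimes>\<^sub>M Om) (\<lambda>p. f (mix A (fst p) (snd p)))"
proof -
  have [measurable]: "f \<in> borel_measurable Om" using assms by auto
  have "integrable (distr (Om \<Otimes>\<^sub>M Om) Om (\<lambda>p. mix A (fst p) (snd p))) f"
    unfolding distr_mix by fact
  then show ?thesis by (subst (asm) integrable_distr_eq) auto
qed

lemma integral_mix:
  fixes f :: "(nat \<Rightarrow> real) \<Rightarrow> 'c::{banach, second_countable_topology}"
  assumes [measurable]: "f \<in> borel_measurable Om"
  shows "(LINT p|(Om \<Otimes>\<^sub>M Om). f (mix A (fst p) (snd p))) = (LINT x|Om. f x)"
  by (subst (2) distr_mix[of A, symmetric]) (simp add: integral_distr)

lemma nn_integral_mix:
  assumes [measurable]: "f \<in> borel_measurable Om"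
  shows "(\<integral>\<^sup>+ x. (\<integral>\<^sup>+ y. f (mix A x y) \<partial>Om) \<partial>Om) = (\<integral>\<^sup>+ x. f x \<partial>Om)"
proof -
  have "(\<integral>\<^sup>+ x. f x \<partial>Om) = (\<integral>\<^sup>+ p. f (mix A (fst p) (snd p)) \<partial>(Om \<Otimes>\<^sub>M Om))"
    by (subst (1) distr_mix[of A, symmetric]) (simp add: nn_integral_distr)
  also have "\<dots> = (\<integral>\<^sup>+ x. (\<integral>\<^sup>+ y. f (mix A x y) \<partial>Om) \<partial>Om)"
    by (subst Om.nn_integral_fst[symmetric]) auto
  finally show ?thesis by simp
qed

text \<open>A version of the conditional expectation given the coordinates in \<open>A\<close>.
  Being an integral over an independent copy it has a value at every point, and the coordinates on
  which it depends can be read off pointwise rather than almost surely.\<close>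

definition cexp :: "nat set \<Rightarrow> ((nat \<Rightarrow> real) \<Rightarrow> real) \<Rightarrow> (nat \<Rightarrow> real) \<Rightarrow> real" where
  "cexp A f x = (LINT y|Om. f (mix A x y))"

lemma cexp_measurable [measurable]:
  assumes [measurable]: "f \<in> borel_measurable Om"
  shows "cexp A f \<in> borel_measurable Om"
  unfolding cexp_def using measurable_mix[of A]
  by (intro Om.borel_measurable_lebesgue_integral) (simp add: split_beta')

lemma integrable_cexp: "integrable Om f \<Longrightarrow> integrable Om (cexp A f)"
  unfolding cexp_def using Om2.integrable_fst'[OF integrable_mix, of f A] by simp

lemma integral_cexp:
  assumes "integrable Om f" shows "(LINT x|Om. cexp A f x) = (LINT x|Om. f x)"
  using Om2.integral_fst'[OF integrable_mix[OF assms], of A] assms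
  by (simp add: cexp_def integral_mix)

lemma dep_cexp:
  assumes "dep B f" shows "dep (A \<inter> B) (cexp A f)"
  unfolding dep_def cexp_def
proof (intro allI impI)
  fix x y :: "nat \<Rightarrow> real" assume "\<forall>i\<in>A \<inter> B. x i = y i"
  then have "f (mix A x z) = f (mix A y z)" for z
    by (intro depD[OF assms]) (auto simp: mix_def)
  then show "(LINT z|Om. f (mix A x z)) = (LINT z|Om. f (mix A y z))" by simp
qed

lemma dep_cexp_mono: "dep B f \<Longrightarrow> A \<inter> B \<subseteq> C \<Longrightarrow> dep C (cexp A f)"
  by (blast intro: dep_mono dep_cexp)

text \<open>Average over the coordinates outside \<open>A \<union> B\<close>. This leaves
  \<open>g\<close> alone, and for \<open>f\<close> it is the same as averaging over those outside
  \<open>A\<close>, since \<open>f\<close> does not see the coordinates in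
  \<open>B - A\<close>.\<close>

lemma integral_mult_cexp:
  assumes int: "integrable Om (\<lambda>x. g x * f x)" and g: "dep B g" and f: "dep C f" and sub: "B \<inter> C \<subseteq> A"
    and meas [measurable]: "f \<in> borel_measurable Om"
  shows "(LINT x|Om. g x * f x) = (LINT x|Om. g x * cexp A f x)"
proof -
  have *: "cexp (A \<union> B) (\<lambda>x. g x * f x) x = g x * cexp A f x" for x
  proof -
    have "g (mix (A \<union> B) x y) = g x" for y
      by (intro dep_mix_eq[OF g]) auto
    moreover have "f (mix (A \<union> B) x y) = f (mix A x y)" for y
      using sub by (intro depD[OF f]) (auto simp: mix_def)
    ultimately show ?thesis by (simp add: cexp_def)
  qed
  show ?thesis using integral_cexp[OF int, of "A \<union> B"] by (simp add: *)
qed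

text \<open>If \<open>x\<close> supplies the coordinates in \<open>A\<close> and \<open>y\<close>
  all others, the product becomes \<open>f x * g y\<close> on a product space, where Fubini
  applies.\<close>

lemma
  fixes f g :: "(nat \<Rightarrow> real) \<Rightarrow> 'c::{real_normed_field, banach, second_countable_topology}"
  assumes f: "integrable Om f" "dep A f" and g: "integrable Om g" "dep B g" and disj: "A \<inter> B = {}"
  shows integrable_mult_indep: "integrable Om (\<lambda>x. f x * g x)"
    and integral_mult_indep: "(LINT x|Om. f x * g x) = (LINT x|Om. f x) * (LINT x|Om. g x)"
proof -
  have eq: "f (mix A x y) * g (mix A x y) = f x * g y" for x y
    using dep_mix_eq[OF f(2), of A x y] dep_mix_eq'[OF g(2) disj, of x y] by simp
  have [measurable]: "f \<in> borel_measurable Om" "g \<in> borel_measurable Om"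
    using f g by auto
  have int: "integrable (Om \<Otimes>\<^sub>M Om) (\<lambda>p. f (fst p) * g (snd p))"
    using f(1) g(1) by (intro Om2.Fubini_integrable) (auto simp: norm_mult)
  show "integrable Om (\<lambda>x. f x * g x)"
    by (subst distr_mix[of A, symmetric], subst integrable_distr_eq) (auto simp: eq int)
  have "(LINT x|Om. f x * g x) = (LINT p|(Om \<Otimes>\<^sub>M Om). f (fst p) * g (snd p))"
    by (subst integral_mix[of _ A, symmetric]) (auto simp: eq)
  also have "\<dots> = (LINT x|Om. f x) * (LINT x|Om. g x)"
    using Om2.integral_fst'[OF int] by simp
  finally show "(LINT x|Om. f x * g x) = (LINT x|Om. f x) * (LINT x|Om. g x)" .
qed

end

section \<open>Characteristic functions of locally dependent sums\<close>

text \<open>The smaller of x^2 and |x|^3. It is integrable as soon as second moments exist and yet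
  of third order for small arguments, so it measures the remainders of a second order expansion
  without third moments.\<close>

definition rho :: "real \<Rightarrow> real" where
  "rho x = x\<^sup>2 * min 1 \<bar>x\<bar>"

lemma rho_nonneg [simp]: "0 \<le> rho x"
  by (simp add: rho_def)

lemma rho_le_square: "rho x \<le> x\<^sup>2"
  by (simp add: rho_def mult_left_le)

lemma rho_measurable [measurable]: "rho \<in> borel_measurable borel"
  unfolding rho_def by measurable

lemma rho_mono: "\<bar>x\<bar> \<le> \<bar>y\<bar> \<Longrightarrow> rho x \<le> rho y"
  unfolding rho_def by (intro mult_mono abs_le_square_iff[THEN iffD1]) auto

lemma rho_mult_le:
  assumes "c \<ge> 1" shows "rho (c * x) \<le> c ^ 3 * rho x"
proof -
  have "min 1 \<bar>c * x\<bar> \<le> c * min 1 \<bar>x\<bar>"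
    using assms mult_mono[of 1 c 1 "\<bar>x\<bar>"] by (auto simp: min_def abs_mult)
  then have "(c * x)\<^sup>2 * min 1 \<bar>c * x\<bar> \<le> (c * x)\<^sup>2 * (c * min 1 \<bar>x\<bar>)"
    by (intro mult_left_mono) auto
  also have "\<dots> = c ^ 3 * rho x"
    by (simp add: rho_def power2_eq_square power3_eq_cube)
  finally show ?thesis by (simp add: rho_def)
qed

text \<open>The sum is at most the number of terms times the largest one, and scaling by c >= 1
  costs at most c^3.\<close>

lemma rho_sum_le:
  assumes fin: "finite I"
  shows "rho (\<Sum>i\<in>I. f i) \<le> real (card I) ^ 3 * (\<Sum>i\<in>I. rho (f i))"
proof (cases "I = {}")
  case False
  define M where "M = Max ((\<lambda>i. \<bar>f i\<bar>) ` I)"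
  have "M \<in> (\<lambda>i. \<bar>f i\<bar>) ` I"
    using fin False unfolding M_def by (intro Max_in) auto
  then obtain k where k: "k \<in> I" "M = \<bar>f k\<bar>" by auto
  have "\<bar>\<Sum>i\<in>I. f i\<bar> \<le> (\<Sum>i\<in>I. \<bar>f i\<bar>)" by (rule sum_abs)
  also have "\<dots> \<le> real (card I) * M"
    using fin by (intro sum_bounded_above) (auto simp: M_def)
  finally have "rho (\<Sum>i\<in>I. f i) \<le> rho (real (card I) * f k)"
    using k by (intro rho_mono) (auto simp: abs_mult)
  also have "\<dots> \<le> real (card I) ^ 3 * rho (f k)"
    using fin False by (intro rho_mult_le) (simp add: Suc_leI card_gt_0_iff)
  also have "\<dots> \<le> real (card I) ^ 3 * (\<Sum>i\<in>I. rho (f i))"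
    using k fin by (intro mult_left_mono member_le_sum) auto
  finally show ?thesis .
qed (simp add: rho_def)

lemma rho_add_le: "rho (x + y) \<le> 8 * (rho x + rho y)"
  using rho_sum_le[of "{True, False}" "\<lambda>b. if b then x else y"] by simp

text \<open>Replace all three numbers by the largest modulus. Every remainder in the expansion of
  the characteristic function has the form of the left-hand side.\<close>

lemma prod_min_le_rho: "\<bar>a\<bar> * \<bar>b\<bar> * min 1 \<bar>c\<bar> \<le> rho a + rho b + rho c"
proof -
  define M where "M = max \<bar>a\<bar> (max \<bar>b\<bar> \<bar>c\<bar>)"
  have "\<bar>a\<bar> * \<bar>b\<bar> * min 1 \<bar>c\<bar> \<le> M * M * min 1 M"
    unfolding M_def by (intro mult_mono) auto
  also have "\<dots> = rho M" by (auto simp: rho_def M_def power2_eq_square)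
  also have "\<dots> \<le> rho a + rho b + rho c"
  proof -
    have "rho M = rho a \<or> rho M = rho b \<or> rho M = rho c"
      unfolding M_def max_def by (auto simp: rho_def)
    then show ?thesis by (auto intro: add_increasing add_increasing2)
  qed
  finally show ?thesis .
qed

text \<open>Cut at \<delta>: below it the factor min 1 |x| is at most \<delta>, above it x^2 is at
  most \<delta>^(2-r) |x|^r. A sum of \<open>rho\<close> terms is thus controlled by \<delta> times
  a sum of second moments plus a multiple of a Lyapunov sum.\<close>

lemma rho_le_powr:
  assumes "\<delta> > 0" "r > 2"
  shows "rho x \<le> \<delta> * x\<^sup>2 + \<delta> powr (2 - r) * \<bar>x\<bar> powr r"
proof (cases "\<bar>x\<bar> \<le> \<delta>")
  case True
  have "rho x \<le> x\<^sup>2 * \<delta>"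
    unfolding rho_def using True by (intro mult_left_mono) auto
  then show ?thesis by (simp add: mult.commute add_increasing2)
next
  case False
  then have x: "\<bar>x\<bar> > 0" using assms by auto
  have "rho x \<le> \<bar>x\<bar> powr 2 * 1"
    unfolding rho_def using x by (intro mult_mono) (auto simp: powr_numeral)
  also have "\<dots> \<le> \<bar>x\<bar> powr 2 * (\<bar>x\<bar> / \<delta>) powr (r - 2)"
    using assms False by (intro mult_left_mono ge_one_powr_ge_zero) (auto simp: field_simps)
  also have "\<dots> = \<delta> powr (2 - r) * \<bar>x\<bar> powr r"
    using assms x by (simp add: powr_divide powr_diff field_simps)
  finally show ?thesis using assms by (simp add: add_increasing)
qed

text \<open>A quadratic remainder valid for all \<open>y\<close> yields the derivative at once. For
  characteristic functions such a remainder survives integration, so no limit has to be exchanged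
  with the integral.\<close>

lemma has_vector_derivative_quadratic:
  fixes f :: "real \<Rightarrow> 'a::real_normed_vector"
  assumes "\<And>y. norm (f y - f x - (y - x) *\<^sub>R d) \<le> C * (y - x)\<^sup>2"
  shows "(f has_vector_derivative d) (at x)"
  unfolding has_vector_derivative_def
proof (rule has_derivativeI_sandwich[where e = 1 and H = "\<lambda>y. C * \<bar>y - x\<bar>"])
  show "bounded_linear (\<lambda>h. h *\<^sub>R d)" by (rule bounded_linear_scaleR_left)
  show "((\<lambda>y. C * \<bar>y - x\<bar>) \<longlongrightarrow> 0) (at x)"
    by (auto intro!: tendsto_eq_intros)
  fix y assume "y \<noteq> x" "dist y x < 1"
  then show "norm (f y - f x - (y - x) *\<^sub>R d) / norm (y - x) \<le> C * \<bar>y - x\<bar>"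
  proof -
    have "norm (f y - f x - (y - x) *\<^sub>R d) \<le> C * \<bar>y - x\<bar> * \<bar>y - x\<bar>"
      using assms[of y] by (simp add: power2_eq_square mult.assoc flip: abs_mult)
    then have "norm (f y - f x - (y - x) *\<^sub>R d) / \<bar>y - x\<bar> \<le> C * \<bar>y - x\<bar>"
      using \<open>y \<noteq> x\<close> by (simp add: pos_divide_le_eq)
    then show ?thesis by simp
  qed
qed simp

lemma norm_iexp_sub_one_le: "cmod (iexp x - 1) \<le> 2 * min 1 \<bar>x\<bar>"
  using iexp_approx1[of x 0] iexp_approx2[of x 0] by simp

lemma norm_iexp_sub_linear_le:
  assumes "0 \<le> t" "t \<le> 1"
  shows "cmod (iexp (t * x) - 1 - \<i> * of_real (t * x)) \<le> 2 * (\<bar>x\<bar> * min 1 \<bar>x\<bar>)"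
proof -
  have "t * \<bar>x\<bar> \<le> \<bar>x\<bar>" "t\<^sup>2 * x\<^sup>2 \<le> x\<^sup>2"
    using assms by (auto simp: mult_left_le_one_le power_le_one)
  moreover have "cmod (iexp (t * x) - 1 - \<i> * of_real (t * x)) \<le> t\<^sup>2 * x\<^sup>2 / 2"
    using iexp_approx1[of "t * x" 1] by (simp add: power2_eq_square algebra_simps flip: abs_mult)
  moreover have "cmod (iexp (t * x) - 1 - \<i> * of_real (t * x)) \<le> 2 * (t * \<bar>x\<bar>)"
    using iexp_approx2[of "t * x" 1] assms by (simp add: abs_mult algebra_simps)
  ultimately have "cmod (iexp (t * x) - 1 - \<i> * of_real (t * x)) \<le> 2 * \<bar>x\<bar>"
    "cmod (iexp (t * x) - 1 - \<i> * of_real (t * x)) \<le> 2 * x\<^sup>2"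
    using zero_le_power2[of x] by linarith+
  then show ?thesis by (auto simp: min_def power2_eq_square)
qed

lemma abs_mult_le_squares:
  fixes a b :: real
  shows "\<bar>a * b\<bar> \<le> a\<^sup>2 + b\<^sup>2"
  using sum_squares_bound[of "\<bar>a\<bar>" "\<bar>b\<bar>"] mult_nonneg_nonneg[of "\<bar>a\<bar>" "\<bar>b\<bar>"]
  unfolding abs_mult power2_abs mult.assoc by linarith

section \<open>Second moments and differentiation of characteristic functions\<close>

context iid_coordinates
begin

lemma integrable_square_mult:
  fixes f g :: "(nat \<Rightarrow> real) \<Rightarrow> real"
  assumes [measurable]: "f \<in> borel_measurable Om" "g \<in> borel_measurable Om"
    and "integrable Om (\<lambda>x. (f x)\<^sup>2)" "integrable Om (\<lambda>x. (g x)\<^sup>2)"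
  shows "integrable Om (\<lambda>x. f x * g x)"
proof (rule Bochner_Integration.integrable_bound)
  show "integrable Om (\<lambda>x. (f x)\<^sup>2 + (g x)\<^sup>2)" using assms by auto
  show "AE x in Om. norm (f x * g x) \<le> norm ((f x)\<^sup>2 + (g x)\<^sup>2)"
    by (simp add: abs_mult_le_squares)
qed auto

lemma integrable_square_imp:
  fixes f :: "(nat \<Rightarrow> real) \<Rightarrow> real"
  assumes "f \<in> borel_measurable Om" "integrable Om (\<lambda>x. (f x)\<^sup>2)"
  shows "integrable Om f"
  using integrable_square_mult[of f "\<lambda>_. 1"] assms by simp

lemma integrable_square_sum:
  fixes f :: "'i \<Rightarrow> (nat \<Rightarrow> real) \<Rightarrow> real"
  assumes "\<And>i. i \<in> I \<Longrightarrow> f i \<in> borel_measurable Om"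
    "\<And>i. i \<in> I \<Longrightarrow> integrable Om (\<lambda>x. (f i x)\<^sup>2)"
  shows "integrable Om (\<lambda>x. (\<Sum>i\<in>I. f i x)\<^sup>2)"
  unfolding power2_eq_square sum_product
  using assms by (intro Bochner_Integration.integrable_sum integrable_square_mult) auto

lemma integrable_rho:
  assumes [measurable]: "f \<in> borel_measurable Om" and "integrable Om (\<lambda>x. (f x)\<^sup>2)"
  shows "integrable Om (\<lambda>x. rho (f x))"
  by (rule Bochner_Integration.integrable_bound[OF assms(2)]) (auto simp: rho_le_square)

lemma integrable_mult_iexp:
  fixes f S :: "(nat \<Rightarrow> real) \<Rightarrow> real"
  assumes "integrable Om f" and [measurable]: "S \<in> borel_measurable Om"
  shows "integrable Om (\<lambda>x. complex_of_real (f x) * iexp (S x))"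
  by (rule Bochner_Integration.integrable_bound[OF assms(1)])
    (use assms in \<open>auto simp: norm_mult\<close>)

lemma integrable_iexp_rv:
  fixes S :: "(nat \<Rightarrow> real) \<Rightarrow> real"
  assumes [measurable]: "S \<in> borel_measurable Om"
  shows "integrable Om (\<lambda>x. iexp (S x))"
  using integrable_mult_iexp[of "\<lambda>_. 1" S] by simp

lemma char_has_vector_derivative:
  fixes S :: "(nat \<Rightarrow> real) \<Rightarrow> real"
  assumes [measurable]: "S \<in> borel_measurable Om" and S2: "integrable Om (\<lambda>x. (S x)\<^sup>2)"
  shows "((\<lambda>t. LINT x|Om. iexp (t * S x)) has_vector_derivative
    (\<i> * (LINT x|Om. of_real (S x) * iexp (t * S x)))) (at t)"
proof (rule has_vector_derivative_quadratic)
  fix u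
  have S: "integrable Om S" using S2 by (rule integrable_square_imp[rotated]) auto
  have i1: "integrable Om (\<lambda>x. iexp (t * S x))" for t by (rule integrable_iexp_rv) auto
  have i2: "integrable Om (\<lambda>x. complex_of_real (S x) * iexp (t * S x))"
    using S by (rule integrable_mult_iexp) auto
  have "(LINT x|Om. iexp (u * S x)) - (LINT x|Om. iexp (t * S x)) -
      (u - t) *\<^sub>R (\<i> * (LINT x|Om. of_real (S x) * iexp (t * S x)))
    = (LINT x|Om. iexp (u * S x) - iexp (t * S x) - (u - t) *\<^sub>R (\<i> * (of_real (S x) * iexp (t * S x))))"
    using i1 i2 by simp
  also have "norm \<dots> \<le> (LINT x|Om. (u - t)\<^sup>2 * (S x)\<^sup>2)"
  proof (rule order_trans[OF integral_norm_bound], rule integral_mono)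
    fix x
    have "iexp (u * S x) = iexp (t * S x) * iexp ((u - t) * S x)"
      by (simp add: algebra_simps flip: exp_add)
    then have "iexp (u * S x) - iexp (t * S x) - (u - t) *\<^sub>R (\<i> * (of_real (S x) * iexp (t * S x)))
      = iexp (t * S x) * (iexp ((u - t) * S x) - 1 - \<i> * ((u - t) * S x))"
      by (simp add: algebra_simps scaleR_conv_of_real)
    then have "norm (iexp (u * S x) - iexp (t * S x) - (u - t) *\<^sub>R (\<i> * (of_real (S x) * iexp (t * S x))))
      = norm (iexp ((u - t) * S x) - 1 - \<i> * ((u - t) * S x))"
      by (simp add: norm_mult)
    also have "\<dots> \<le> ((u - t) * S x)\<^sup>2 / 2"
      using iexp_approx1[of "(u - t) * S x" 1] by (simp add: power2_eq_square algebra_simps)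
    also have "\<dots> \<le> (u - t)\<^sup>2 * (S x)\<^sup>2" by (simp add: power_mult_distrib)
    finally show "norm (iexp (u * S x) - iexp (t * S x) - (u - t) *\<^sub>R (\<i> * (of_real (S x) * iexp (t * S x))))
      \<le> (u - t)\<^sup>2 * (S x)\<^sup>2" .
  qed (use S2 i1 i2 in auto)
  also have "\<dots> = (LINT x|Om. (S x)\<^sup>2) * (u - t)\<^sup>2" by simp
  finally show "cmod ((LINT x|Om. iexp (u * S x)) - (LINT x|Om. iexp (t * S x)) -
      (u - t) *\<^sub>R (\<i> * (LINT x|Om. of_real (S x) * iexp (t * S x)))) \<le> (LINT x|Om. (S x)\<^sup>2) * (u - t)\<^sup>2" .
qed

end

section \<open>Second order expansion for sums of locally dependent variables\<close>

context iid_coordinates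
begin

text \<open>\<open>D j\<close> is independent of the terms at distance at least 2, and its product
  with a neighbouring term is independent of those at distance at least 3. Expanding the exponential
  in the near terms, the zeroth order vanishes because \<open>D j\<close> has mean zero, and the
  first order leaves a covariance times a characteristic function; all corrections are of third
  order. The constant is 3 * 750 with 750 = 6 * 5^3.\<close>

lemma char_derivative_term_bound:
  fixes D :: "nat \<Rightarrow> (nat \<Rightarrow> real) \<Rightarrow> real" and A :: "nat \<Rightarrow> nat set"
  assumes meas [measurable]: "\<And>i. i < Q \<Longrightarrow> D i \<in> borel_measurable Om"
    and sq: "\<And>i. i < Q \<Longrightarrow> integrable Om (\<lambda>x. (D i x)\<^sup>2)"
    and mean: "\<And>i. i < Q \<Longrightarrow> (LINT x|Om. D i x) = 0"
    and dep: "\<And>i. i < Q \<Longrightarrow> dep (A i) (D i)"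
    and disj: "\<And>i j. i + 2 \<le> j \<Longrightarrow> j < Q \<Longrightarrow> A i \<inter> A j = {}"
    and j: "j < Q" and t: "0 \<le> t" "t \<le> 1"
  defines "S \<equiv> (\<lambda>x. \<Sum>i<Q. D i x)"
  shows "cmod ((LINT x|Om. of_real (D j x) * iexp (t * S x))
      - \<i> * of_real t * of_real (LINT x|Om. D j x * S x) * (LINT x|Om. iexp (t * S x)))
    \<le> 2250 * (\<Sum>i | i < Q \<and> i \<le> j + 2 \<and> j \<le> i + 2. LINT x|Om. rho (D i x))"
proof -
  define N1 where "N1 = {i. i < Q \<and> i \<le> j + 1 \<and> j \<le> i + 1}"
  define N2 where "N2 = {i. i < Q \<and> i \<le> j + 2 \<and> j \<le> i + 2}"
  define R where "R = (\<Sum>i\<in>N2. LINT x|Om. rho (D i x))"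
  define T where "T I x = (\<Sum>i\<in>I. D i x)" for I x
  let ?I = "{..<Q}"
  have sub: "N1 \<subseteq> ?I" "N2 \<subseteq> ?I" "N1 \<subseteq> N2" "j \<in> N1" using j by (auto simp: N1_def N2_def)
  have Tm [measurable]: "T I \<in> borel_measurable Om" if "I \<subseteq> ?I" for I
    unfolding T_def using that by (intro borel_measurable_sum meas) auto
  have Tsq: "integrable Om (\<lambda>x. (T I x)\<^sup>2)" if "I \<subseteq> ?I" for I
    unfolding T_def using that by (intro integrable_square_sum meas sq) auto
  have Tint: "integrable Om (T I)" if "I \<subseteq> ?I" for I
    using integrable_square_imp[OF Tm[OF that] Tsq[OF that]] .
  have Trho: "integrable Om (\<lambda>x. rho (T I x))" if "I \<subseteq> ?I" for I
    using that by (intro integrable_rho Tm Tsq)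
  have Tdep: "dep (\<Union>i\<in>I. A i) (T I)" if "I \<subseteq> ?I" for I
    unfolding T_def using that by (intro dep_sum dep_mono[OF dep]) auto
  have Tadd: "T ?I x = T I x + T (?I - I) x" if "I \<subseteq> ?I" for I x
    unfolding T_def using that by (subst sum.subset_diff[of I]) auto
  \<comment> \<open>\<open>V\<close> collects the terms at distance at most 1 from \<open>j\<close>,
    \<open>U\<close> those at distance exactly 2; \<open>S1\<close> and \<open>S2\<close> are what
    remains of \<open>S\<close> after removing \<open>V\<close>, respectively
    \<open>W = U + V\<close>.\<close>
  define V U W S1 S2 where "V = T N1" and "U = T (N2 - N1)" and "W = T N2"
    and "S1 = T (?I - N1)" and "S2 = T (?I - N2)"
  have SI: "S = T ?I" by (simp add: S_def T_def fun_eq_iff)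
  have S1V: "S x = S1 x + V x" for x
    using Tadd[OF sub(1), of x] by (simp add: SI S1_def V_def)
  have S2W: "S x = S2 x + W x" for x
    using Tadd[OF sub(2), of x] by (simp add: SI S2_def W_def)
  have WUV: "W x = U x + V x" for x
    unfolding W_def U_def V_def T_def using sub by (subst sum.subset_diff[of N1]) (auto intro: finite_subset)
  have S12: "S1 x = S2 x + U x" for x
    using S1V[of x] S2W[of x] WUV[of x] by simp
  have [measurable]: "V \<in> borel_measurable Om" "U \<in> borel_measurable Om" "W \<in> borel_measurable Om"
    "S1 \<in> borel_measurable Om" "S2 \<in> borel_measurable Om" "S \<in> borel_measurable Om"
    "D j \<in> borel_measurable Om"
    unfolding V_def U_def W_def S1_def S2_def SI using sub j by (auto intro!: Tm meas)
  have Dint: "integrable Om (D j)" using integrable_square_imp[OF meas[OF j] sq[OF j]] .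
  have DT: "integrable Om (\<lambda>x. D j x * T I x)" if "I \<subseteq> ?I" for I
    using that j by (intro integrable_square_mult meas sq Tm Tsq)
  have DV: "integrable Om (\<lambda>x. D j x * V x)" unfolding V_def by (intro DT sub)

  have indep1: "A j \<inter> (\<Union>i\<in>?I - N1. A i) = {}"
  proof -
    have "A j \<inter> A i = {}" if "i \<in> ?I - N1" for i
      using that disj[of i j] disj[of j i] j by (cases "i + 2 \<le> j") (auto simp: N1_def)
    then show ?thesis by auto
  qed
  have indep2: "(\<Union>i\<in>N1. A i) \<inter> (\<Union>i\<in>?I - N2. A i) = {}"
  proof -
    have "A k \<inter> A i = {}" if "i \<in> ?I - N2" "k \<in> N1" for i k
      using that disj[of i k] disj[of k i] by (cases "i + 2 \<le> k") (auto simp: N1_def N2_def)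
    then show ?thesis by auto
  qed
  have depS1: "dep (\<Union>i\<in>?I - N1. A i) S1" and depS2: "dep (\<Union>i\<in>?I - N2. A i) S2"
    unfolding S1_def S2_def by (intro Tdep; simp)+
  have depV: "dep (\<Union>i\<in>N1. A i) (\<lambda>x. D j x * V x)"
    unfolding V_def using sub(1,4) j by (intro dep_comp2[where F = "(*)"] dep_mono[OF dep] Tdep) auto

  have e0: "(LINT x|Om. of_real (D j x) * iexp (t * S1 x)) = 0"
  proof -
    have "(LINT x|Om. of_real (D j x) * iexp (t * S1 x))
        = (LINT x|Om. complex_of_real (D j x)) * (LINT x|Om. iexp (t * S1 x))"
      using Dint by (intro integral_mult_indep[OF _ dep_comp[OF dep[OF j]] _ dep_comp[OF depS1] indep1] integrable_iexp_rv) auto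
    then show ?thesis using mean[OF j] by simp
  qed
  have e0': "(LINT x|Om. D j x * S1 x) = 0"
    using integral_mult_indep[OF Dint dep[OF j] _ depS1 indep1] mean[OF j] Tint[of "?I - N1"]
    by (simp add: S1_def)
  have e1: "(LINT x|Om. D j x * S x) = (LINT x|Om. D j x * V x)"
  proof -
    have "(LINT x|Om. D j x * S x) = (LINT x|Om. D j x * S1 x + D j x * V x)"
      by (simp add: S1V algebra_simps)
    also have "\<dots> = (LINT x|Om. D j x * S1 x) + (LINT x|Om. D j x * V x)"
      using DV DT[of "?I - N1"] by (intro Bochner_Integration.integral_add) (auto simp: S1_def)
    finally show ?thesis using e0' by simp
  qed
  have e2: "(LINT x|Om. of_real (D j x * V x) * iexp (t * S2 x))
      = of_real (LINT x|Om. D j x * V x) * (LINT x|Om. iexp (t * S2 x))"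
  proof -
    have "(LINT x|Om. of_real (D j x * V x) * iexp (t * S2 x))
        = (LINT x|Om. complex_of_real (D j x * V x)) * (LINT x|Om. iexp (t * S2 x))"
      using DV by (intro integral_mult_indep[OF _ dep_comp[OF depV] _ dep_comp[OF depS2] indep2] integrable_iexp_rv) (auto simp del: of_real_mult)
    also have "(LINT x|Om. complex_of_real (D j x * V x)) = of_real (LINT x|Om. D j x * V x)"
      by (rule integral_complex_of_real)
    finally show ?thesis .
  qed

  define e\<^sub>1 where "e\<^sub>1 x = of_real (D j x) * iexp (t * S1 x) * (iexp (t * V x) - 1 - \<i> * of_real (t * V x))" for x
  define e\<^sub>2 where "e\<^sub>2 x = of_real (D j x * V x) * (iexp (t * S1 x) - iexp (t * S2 x))" for x
  define e\<^sub>3 where "e\<^sub>3 x = iexp (t * S2 x) - iexp (t * S x)" for x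
  have j1: "integrable Om (\<lambda>x. complex_of_real (D j x) * iexp (t * s x))" if "s \<in> borel_measurable Om" for s
    using that by (intro integrable_mult_iexp Dint) auto
  have j2: "integrable Om (\<lambda>x. complex_of_real (D j x * V x) * iexp (t * s x))" if "s \<in> borel_measurable Om" for s
    using that by (intro integrable_mult_iexp DV) auto
  have pt: "iexp (t * (a + b)) = iexp (t * a) * iexp (t * b)" for a b
    by (simp add: algebra_simps flip: exp_add)
  have e1_alt: "e\<^sub>1 x = of_real (D j x) * iexp (t * S x) - of_real (D j x) * iexp (t * S1 x)
      - \<i> * of_real t * (of_real (D j x * V x) * iexp (t * S1 x))" for x
    unfolding e\<^sub>1_def S1V pt by (simp add: algebra_simps)
  have ie1: "integrable Om e\<^sub>1"
    unfolding e1_alt using j1[of S] j1[of S1] j2[of S1] by (auto simp del: of_real_mult)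
  have e2_alt: "e\<^sub>2 x = of_real (D j x * V x) * iexp (t * S1 x) - of_real (D j x * V x) * iexp (t * S2 x)" for x
    unfolding e\<^sub>2_def by (simp add: algebra_simps)
  have ie2: "integrable Om e\<^sub>2"
    unfolding e2_alt using j2[of S1] j2[of S2] by (auto simp del: of_real_mult)
  have ie3: "integrable Om e\<^sub>3"
    unfolding e\<^sub>3_def by (intro Bochner_Integration.integrable_diff integrable_iexp_rv) auto
  let ?c = "LINT x|Om. D j x * V x" and ?phi = "LINT x|Om. iexp (t * S x)"
  have E1: "(LINT x|Om. e\<^sub>1 x) = (LINT x|Om. of_real (D j x) * iexp (t * S x))
      - \<i> * of_real t * (LINT x|Om. of_real (D j x * V x) * iexp (t * S1 x))"
    unfolding e1_alt using j1[of S] j1[of S1] j2[of S1] e0 by (simp del: of_real_mult)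
  have E2: "(LINT x|Om. e\<^sub>2 x) = (LINT x|Om. of_real (D j x * V x) * iexp (t * S1 x))
      - of_real ?c * (LINT x|Om. iexp (t * S2 x))"
    unfolding e2_alt using j2[of S1] j2[of S2] e2 by (simp del: of_real_mult)
  have E3: "(LINT x|Om. e\<^sub>3 x) = (LINT x|Om. iexp (t * S2 x)) - ?phi"
    unfolding e\<^sub>3_def by (intro Bochner_Integration.integral_diff integrable_iexp_rv) auto
  \<comment> \<open>The three errors are the Taylor remainder in \<open>V\<close>, the replacement
    of \<open>S1\<close> by \<open>S2\<close> that makes the first order term factorise, and the
    return from \<open>S2\<close> to \<open>S\<close> in the factor that is left.\<close>
  have main: "(LINT x|Om. of_real (D j x) * iexp (t * S x)) - \<i> * of_real t * of_real (LINT x|Om. D j x * S x) * ?phi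
      = (LINT x|Om. e\<^sub>1 x) + \<i> * of_real t * (LINT x|Om. e\<^sub>2 x) + \<i> * of_real t * of_real ?c * (LINT x|Om. e\<^sub>3 x)"
    unfolding E1 E2 E3 e1 by (simp add: algebra_simps)

  define r where "r I = (LINT x|Om. rho (T I x))" for I
  \<comment> \<open>At most five indices lie within distance 2 of \<open>j\<close>; the factor 125 =
    5^3 comes from \<open>rho_sum_le\<close>.\<close>
  have r_bound: "r I \<le> 125 * R" if "I \<subseteq> N2" for I
  proof -
    have fin: "finite N2" using sub by (auto intro: finite_subset)
    have cI: "card I \<le> 5"
    proof -
      have "I \<subseteq> {j - 2..j + 2}" using that by (auto simp: N2_def)
      from card_mono[OF _ this] show ?thesis by simp
    qed
    have IQ: "I \<subseteq> ?I" using that sub by auto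
    have int: "integrable Om (\<lambda>x. rho (D i x))" if "i \<in> I" for i
      using that IQ by (intro integrable_rho meas sq) auto
    have "r I \<le> (LINT x|Om. 125 * (\<Sum>i\<in>I. rho (D i x)))"
      unfolding r_def
    proof (rule integral_mono)
      fix x
      have "rho (T I x) \<le> real (card I) ^ 3 * (\<Sum>i\<in>I. rho (D i x))"
        unfolding T_def using that fin by (intro rho_sum_le) (auto intro: finite_subset)
      also have "\<dots> \<le> 5 ^ 3 * (\<Sum>i\<in>I. rho (D i x))"
        using cI by (intro mult_right_mono power_mono) (auto intro: sum_nonneg)
      finally show "rho (T I x) \<le> 125 * (\<Sum>i\<in>I. rho (D i x))" by simp
    qed (use IQ int in \<open>auto intro!: Trho\<close>)
    also have "\<dots> = 125 * (\<Sum>i\<in>I. LINT x|Om. rho (D i x))"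
      using int by (simp add: Bochner_Integration.integral_sum)
    also have "\<dots> \<le> 125 * R"
      unfolding R_def using that fin by (intro mult_left_mono sum_mono2) (auto intro: Bochner_Integration.integral_nonneg)
    finally show ?thesis .
  qed
  have Dr: "D j x = T {j} x" for x by (simp add: T_def)
  have rD: "integrable Om (\<lambda>x. rho (D j x))" "(LINT x|Om. rho (D j x)) \<le> 125 * R"
    using r_bound[of "{j}"] sub Trho[of "{j}"] j unfolding r_def Dr by auto
  have rV: "integrable Om (\<lambda>x. rho (V x))" "(LINT x|Om. rho (V x)) \<le> 125 * R"
    and rU: "integrable Om (\<lambda>x. rho (U x))" "(LINT x|Om. rho (U x)) \<le> 125 * R"
    and rW: "integrable Om (\<lambda>x. rho (W x))" "(LINT x|Om. rho (W x)) \<le> 125 * R"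
    using r_bound[of N1] r_bound[of "N2 - N1"] r_bound[of N2] Trho[of N1] Trho[of "N2 - N1"] Trho[of N2] sub
    unfolding V_def U_def W_def r_def by auto

  have b1: "cmod (LINT x|Om. e\<^sub>1 x) \<le> 750 * R"
  proof -
    have "cmod (LINT x|Om. e\<^sub>1 x) \<le> (LINT x|Om. 2 * (rho (D j x) + rho (V x) + rho (V x)))"
    proof (rule order_trans[OF integral_norm_bound], rule integral_mono)
      fix x
      have "cmod (e\<^sub>1 x) = \<bar>D j x\<bar> * cmod (iexp (t * V x) - 1 - \<i> * of_real (t * V x))"
        by (simp add: e\<^sub>1_def norm_mult)
      also have "\<dots> \<le> \<bar>D j x\<bar> * (2 * (\<bar>V x\<bar> * min 1 \<bar>V x\<bar>))"
        using t by (intro mult_left_mono norm_iexp_sub_linear_le) auto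
      also have "\<dots> \<le> 2 * (rho (D j x) + rho (V x) + rho (V x))"
        using prod_min_le_rho[of "D j x" "V x" "V x"] by simp
      finally show "cmod (e\<^sub>1 x) \<le> 2 * (rho (D j x) + rho (V x) + rho (V x))" .
    qed (use ie1 rD rV in auto)
    also have "\<dots> \<le> 750 * R" using rD rV by simp
    finally show ?thesis .
  qed
  have b2: "cmod (LINT x|Om. e\<^sub>2 x) \<le> 750 * R"
  proof -
    have "cmod (LINT x|Om. e\<^sub>2 x) \<le> (LINT x|Om. 2 * (rho (D j x) + rho (V x) + rho (U x)))"
    proof (rule order_trans[OF integral_norm_bound], rule integral_mono)
      fix x
      have "cmod (iexp (t * S1 x) - iexp (t * S2 x)) = cmod (iexp (t * U x) - 1)"
      proof -
        have "iexp (t * S1 x) - iexp (t * S2 x) = iexp (t * S2 x) * (iexp (t * U x) - 1)"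
          unfolding S12 pt by (simp add: algebra_simps)
        then show ?thesis by (simp add: norm_mult)
      qed
      also have "\<dots> \<le> 2 * min 1 \<bar>U x\<bar>"
        using norm_iexp_sub_one_le[of "t * U x"] t mult_left_le_one_le[of "\<bar>U x\<bar>" t]
        by (auto simp: abs_mult)
      finally have "cmod (e\<^sub>2 x) \<le> \<bar>D j x * V x\<bar> * (2 * min 1 \<bar>U x\<bar>)"
        unfolding e\<^sub>2_def norm_mult by (intro mult_mono) (auto simp: norm_mult abs_mult)
      also have "\<dots> \<le> 2 * (rho (D j x) + rho (V x) + rho (U x))"
        using prod_min_le_rho[of "D j x" "V x" "U x"] by (simp add: abs_mult)
      finally show "cmod (e\<^sub>2 x) \<le> 2 * (rho (D j x) + rho (V x) + rho (U x))" .
    qed (use ie2 rD rV rU in auto)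
    also have "\<dots> \<le> 750 * R" using rD rV rU by simp
    finally show ?thesis .
  qed
  have b3: "cmod (of_real ?c * (LINT x|Om. e\<^sub>3 x)) \<le> 750 * R"
  proof -
    have im: "integrable Om (\<lambda>x. min 1 \<bar>W x\<bar>)"
      by (rule Om.integrable_const_bound[where B = 1]) auto
    have "cmod (LINT x|Om. e\<^sub>3 x) \<le> (LINT x|Om. 2 * min 1 \<bar>W x\<bar>)"
    proof (rule order_trans[OF integral_norm_bound], rule integral_mono)
      fix x
      have "e\<^sub>3 x = - (iexp (t * S2 x) * (iexp (t * W x) - 1))"
        unfolding e\<^sub>3_def S2W pt by (simp add: algebra_simps)
      then have "cmod (e\<^sub>3 x) = cmod (iexp (t * W x) - 1)"
        by (simp add: norm_mult)
      also have "\<dots> \<le> 2 * min 1 \<bar>W x\<bar>"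
        using norm_iexp_sub_one_le[of "t * W x"] t mult_left_le_one_le[of "\<bar>W x\<bar>" t]
        by (auto simp: abs_mult)
      finally show "cmod (e\<^sub>3 x) \<le> 2 * min 1 \<bar>W x\<bar>" .
    qed (use ie3 im in auto)
    moreover have "\<bar>?c\<bar> \<le> (LINT x|Om. \<bar>D j x * V x\<bar>)" by (rule integral_abs_bound)
    ultimately have "cmod (of_real ?c * (LINT x|Om. e\<^sub>3 x)) \<le> (LINT x|Om. \<bar>D j x * V x\<bar>) * (LINT x|Om. 2 * min 1 \<bar>W x\<bar>)"
      unfolding norm_mult by (intro mult_mono) auto
    \<comment> \<open>The product of two expectations is read as an iterated integral over two
      copies, so that \<open>prod_min_le_rho\<close> can be applied pointwise with
      \<open>W y\<close> taken from the second copy.\<close>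
    also have "\<dots> = 2 * (LINT y|Om. (LINT x|Om. \<bar>D j x * V x\<bar> * min 1 \<bar>W y\<bar>))"
      by simp
    also have "(LINT y|Om. (LINT x|Om. \<bar>D j x * V x\<bar> * min 1 \<bar>W y\<bar>))
        \<le> (LINT y|Om. (LINT x|Om. rho (D j x) + rho (V x)) + rho (W y))"
    proof (rule integral_mono)
      fix y
      have "(LINT x|Om. \<bar>D j x * V x\<bar> * min 1 \<bar>W y\<bar>) \<le> (LINT x|Om. rho (D j x) + rho (V x) + rho (W y))"
        using prod_min_le_rho[of "D j x" "V x" "W y" for x] integrable_abs[OF DV] rD rV
        by (intro integral_mono) (auto simp: abs_mult)
      then show "(LINT x|Om. \<bar>D j x * V x\<bar> * min 1 \<bar>W y\<bar>) \<le> (LINT x|Om. rho (D j x) + rho (V x)) + rho (W y)"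
        using rD rV by (simp add: Om.prob_space)
    qed (use im rW in auto)
    also have "\<dots> \<le> 375 * R" using rD rV rW by (simp add: Om.prob_space)
    finally show ?thesis by simp
  qed
  have tl: "t * a \<le> a" if "a \<ge> 0" for a
    using t that by (simp add: mult_left_le_one_le)
  have "cmod ((LINT x|Om. of_real (D j x) * iexp (t * S x)) - \<i> * of_real t * of_real (LINT x|Om. D j x * S x) * ?phi)
    \<le> cmod (LINT x|Om. e\<^sub>1 x) + t * cmod (LINT x|Om. e\<^sub>2 x) + t * cmod (of_real ?c * (LINT x|Om. e\<^sub>3 x))"
    unfolding main using t
    by (intro order_trans[OF norm_triangle_ineq] add_mono) (auto simp: norm_mult mult.assoc)
  also have "\<dots> \<le> 2250 * R"
    using b1 b2 b3 tl[of "cmod (LINT x|Om. e\<^sub>2 x)"] tl[of "cmod (of_real ?c * (LINT x|Om. e\<^sub>3 x))"]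
    by (simp del: norm_of_real)
  finally show ?thesis by (simp add: R_def N2_def)
qed

text \<open>Since \<open>E [D\<^sub>j S]\<close> sums up to the variance \<open>v\<close>, the previous bound says that the characteristic
  function \<open>\<phi>\<close> of \<open>S\<close> nearly solves \<open>\<phi>' t = - v t \<phi> t\<close> on \<open>[0, 1]\<close>.\<close>

lemma local_dependence_char_bound:
  fixes D :: "nat \<Rightarrow> (nat \<Rightarrow> real) \<Rightarrow> real" and A :: "nat \<Rightarrow> nat set"
  assumes meas [measurable]: "\<And>i. i < Q \<Longrightarrow> D i \<in> borel_measurable Om"
    and sq: "\<And>i. i < Q \<Longrightarrow> integrable Om (\<lambda>x. (D i x)\<^sup>2)"
    and mean: "\<And>i. i < Q \<Longrightarrow> (LINT x|Om. D i x) = 0"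
    and dep: "\<And>i. i < Q \<Longrightarrow> dep (A i) (D i)"
    and disj: "\<And>i j. i + 2 \<le> j \<Longrightarrow> j < Q \<Longrightarrow> A i \<inter> A j = {}"
  defines "S \<equiv> (\<lambda>x. \<Sum>i<Q. D i x)"
  defines "v \<equiv> (LINT x|Om. (S x)\<^sup>2)"
  shows "cmod ((LINT x|Om. iexp (S x)) - of_real (exp (- v / 2)))
    \<le> exp (v / 2) * (11250 * (\<Sum>i<Q. LINT x|Om. rho (D i x)))"
proof -
  define R where "R = (\<Sum>i<Q. LINT x|Om. rho (D i x))"
  define \<phi> where "\<phi> t = (LINT x|Om. iexp (t * S x))" for t
  define err where "err j t = (LINT x|Om. of_real (D j x) * iexp (t * S x))
      - \<i> * of_real t * of_real (LINT x|Om. D j x * S x) * \<phi> t" for j t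
  have Sm [measurable]: "S \<in> borel_measurable Om"
    unfolding S_def by (intro borel_measurable_sum meas) auto
  have S2: "integrable Om (\<lambda>x. (S x)\<^sup>2)"
    unfolding S_def by (intro integrable_square_sum meas sq) auto
  have v0: "v \<ge> 0" unfolding v_def by (auto intro: Bochner_Integration.integral_nonneg)
  have DS: "integrable Om (\<lambda>x. D j x * S x)" if "j < Q" for j
    by (intro integrable_square_mult meas sq S2 Sm that)
  have vsum: "v = (\<Sum>j<Q. LINT x|Om. D j x * S x)"
  proof -
    have "v = (LINT x|Om. (\<Sum>j<Q. D j x * S x))"
      unfolding v_def by (simp add: power2_eq_square S_def sum_distrib_right)
    then show ?thesis using DS by (simp add: Bochner_Integration.integral_sum)
  qed
  have r0: "0 \<le> (LINT x|Om. rho (D i x))" for i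
    by (intro Bochner_Integration.integral_nonneg) auto
  have err_sum: "cmod (\<Sum>j<Q. err j t) \<le> 11250 * R" if t: "0 \<le> t" "t \<le> 1" for t
  proof -
    have "cmod (\<Sum>j<Q. err j t) \<le> (\<Sum>j<Q. 2250 * (\<Sum>i | i < Q \<and> i \<le> j + 2 \<and> j \<le> i + 2. LINT x|Om. rho (D i x)))"
      unfolding err_def \<phi>_def S_def using assms t
      by (intro sum_norm_le char_derivative_term_bound[where A = A]) auto
    also have "\<dots> = 2250 * (\<Sum>j<Q. \<Sum>i<Q. if i \<le> j + 2 \<and> j \<le> i + 2 then LINT x|Om. rho (D i x) else 0)"
    proof -
      have "(\<Sum>i | i < Q \<and> i \<le> j + 2 \<and> j \<le> i + 2. f i) = (\<Sum>i<Q. if i \<le> j + 2 \<and> j \<le> i + 2 then f i else 0)"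
        for f :: "nat \<Rightarrow> real" and j
        using sum.inter_filter[of "{..<Q}" f "\<lambda>i. i \<le> j + 2 \<and> j \<le> i + 2"] by simp
      then show ?thesis by (simp only: sum_distrib_left)
    qed
    \<comment> \<open>After the exchange of sums each \<open>i\<close> is counted for at most five
      \<open>j\<close>, whence 5 * 2250 = 11250.\<close>
    also have "(\<Sum>j<Q. \<Sum>i<Q. if i \<le> j + 2 \<and> j \<le> i + 2 then LINT x|Om. rho (D i x) else 0)
        = (\<Sum>i<Q. \<Sum>j<Q. if i \<le> j + 2 \<and> j \<le> i + 2 then LINT x|Om. rho (D i x) else 0)"
      by (rule sum.swap)
    also have "\<dots> \<le> (\<Sum>i<Q. 5 * (LINT x|Om. rho (D i x)))"
    proof (rule sum_mono)
      fix i
      let ?J = "{j \<in> {..<Q}. i \<le> j + 2 \<and> j \<le> i + 2}"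
      have "(\<Sum>j<Q. if i \<le> j + 2 \<and> j \<le> i + 2 then LINT x|Om. rho (D i x) else 0) = real (card ?J) * (LINT x|Om. rho (D i x))"
        by (simp add: sum.inter_filter[symmetric])
      moreover have "?J \<subseteq> {i - 2..i + 2}" by auto
      then have "card ?J \<le> 5" using card_mono[of "{i - 2..i + 2}" ?J] by simp
      ultimately show "(\<Sum>j<Q. if i \<le> j + 2 \<and> j \<le> i + 2 then LINT x|Om. rho (D i x) else 0) \<le> 5 * (LINT x|Om. rho (D i x))"
        using r0[of i] by (simp add: mult_right_mono)
    qed
    finally show ?thesis by (simp add: R_def sum_distrib_left mult.assoc)
  qed
  have deriv: "(\<phi> has_vector_derivative (\<i> * (\<Sum>j<Q. err j t) - of_real (t * v) * \<phi> t)) (at t)" for t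
  proof -
    have "(LINT x|Om. of_real (S x) * iexp (t * S x)) = (LINT x|Om. (\<Sum>j<Q. of_real (D j x) * iexp (t * S x)))"
      by (simp add: S_def sum_distrib_right)
    also have "\<dots> = (\<Sum>j<Q. LINT x|Om. of_real (D j x) * iexp (t * S x))"
      using integrable_square_imp[OF meas sq] by (intro Bochner_Integration.integral_sum integrable_mult_iexp) auto
    also have "\<dots> = (\<Sum>j<Q. err j t) + \<i> * of_real (t * v) * \<phi> t"
      unfolding vsum err_def by (simp add: sum_subtractf sum_distrib_left sum_distrib_right mult.assoc)
    finally have "\<i> * (LINT x|Om. of_real (S x) * iexp (t * S x)) = \<i> * (\<Sum>j<Q. err j t) - of_real (t * v) * \<phi> t"
      by (simp add: algebra_simps)
    then show ?thesis using char_has_vector_derivative[OF Sm S2, of t] unfolding \<phi>_def by simp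
  qed
  \<comment> \<open>The integrating factor of the differential equation: the derivative of
    \<open>F\<close> contains only the errors, so the mean value inequality on [0, 1]
    applies.\<close>
  define F where "F t = exp (v * t\<^sup>2 / 2) *\<^sub>R \<phi> t" for t
  have F_deriv: "(F has_vector_derivative (exp (v * t\<^sup>2 / 2) *\<^sub>R (\<i> * (\<Sum>j<Q. err j t)))) (at t)" for t
    unfolding F_def
    by (rule derivative_eq_intros deriv refl | simp)+
      (simp add: algebra_simps scaleR_conv_of_real)
  have "norm (F 1 - F 0) \<le> (exp (v / 2) * (11250 * R)) * norm (1 - 0 :: real)"
  proof (rule differentiable_bound[of "{0..1}"])
    fix t :: real assume t: "t \<in> {0..1}"
    show "(F has_derivative (\<lambda>h. h *\<^sub>R (exp (v * t\<^sup>2 / 2) *\<^sub>R (\<i> * (\<Sum>j<Q. err j t))))) (at t within {0..1})"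
      using F_deriv[of t] unfolding has_vector_derivative_def by (rule has_derivative_at_withinI)
    show "onorm (\<lambda>h. h *\<^sub>R (exp (v * t\<^sup>2 / 2) *\<^sub>R (\<i> * (\<Sum>j<Q. err j t)))) \<le> exp (v / 2) * (11250 * R)"
    proof (rule onorm_le)
      fix h :: real
      have "v * t\<^sup>2 \<le> v * 1" using t v0 by (intro mult_left_mono power_le_one) auto
      then have "exp (v * t\<^sup>2 / 2) * cmod (\<Sum>j<Q. err j t) \<le> exp (v / 2) * (11250 * R)"
        using t err_sum[of t] by (intro mult_mono) auto
      then have "\<bar>h\<bar> * (exp (v * t\<^sup>2 / 2) * cmod (\<Sum>j<Q. err j t)) \<le> \<bar>h\<bar> * (exp (v / 2) * (11250 * R))"
        by (intro mult_left_mono) auto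
      then show "norm (h *\<^sub>R (exp (v * t\<^sup>2 / 2) *\<^sub>R (\<i> * (\<Sum>j<Q. err j t)))) \<le> exp (v / 2) * (11250 * R) * norm h"
        by (simp add: norm_mult abs_mult ac_simps)
    qed
  qed auto
  moreover have "F 0 = 1" by (simp add: F_def \<phi>_def Om.prob_space)
  ultimately have *: "norm (exp (v / 2) *\<^sub>R \<phi> 1 - 1) \<le> exp (v / 2) * (11250 * R)"
    by (simp add: F_def)
  have "\<phi> 1 - of_real (exp (- v / 2)) = exp (- v / 2) *\<^sub>R (exp (v / 2) *\<^sub>R \<phi> 1 - 1)"
    unfolding scaleR_right_diff_distrib scaleR_scaleR exp_add[symmetric] by (simp add: scaleR_conv_of_real)
  then have "norm (\<phi> 1 - of_real (exp (- v / 2))) = exp (- v / 2) * norm (exp (v / 2) *\<^sub>R \<phi> 1 - 1)"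
    by simp
  also have "\<dots> \<le> 1 * norm (exp (v / 2) *\<^sub>R \<phi> 1 - 1)"
    using v0 by (intro mult_right_mono) auto
  finally show ?thesis using * by (simp add: \<phi>_def R_def)
qed

end

section \<open>Moment inequalities and martingale differences for chains of blocks\<close>

lemma abs_powr_add3_le:
  fixes a b c r :: real
  assumes "r > 0"
  shows "\<bar>a + b + c\<bar> powr r \<le> 3 powr r * (\<bar>a\<bar> powr r + \<bar>b\<bar> powr r + \<bar>c\<bar> powr r)"
proof -
  define M where "M = max \<bar>a\<bar> (max \<bar>b\<bar> \<bar>c\<bar>)"
  have "\<bar>a + b + c\<bar> powr r \<le> (3 * M) powr r"
    using assms by (intro powr_mono2) (auto simp: M_def)
  also have "\<dots> = 3 powr r * M powr r"
    by (simp add: powr_mult M_def)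
  also have "M powr r \<le> \<bar>a\<bar> powr r + \<bar>b\<bar> powr r + \<bar>c\<bar> powr r"
    unfolding M_def max_def by auto
  finally show ?thesis by simp
qed

lemma square_le_one_plus_powr:
  fixes x r :: real
  assumes "r > 2"
  shows "x\<^sup>2 \<le> 1 + \<bar>x\<bar> powr r"
proof (cases "\<bar>x\<bar> \<le> 1")
  case True
  then have "x\<^sup>2 \<le> 1" by (simp add: abs_square_le_1)
  then show ?thesis by (simp add: add_increasing2)
next
  case False
  then have "\<bar>x\<bar> powr 2 \<le> \<bar>x\<bar> powr r" using assms by (intro powr_mono) auto
  then show ?thesis using False by (simp add: powr_numeral)
qed

text \<open>With a half the modulus of the mean, |f| <= a + a^(1-r) |f|^r holds pointwise;
  integrating and cancelling one a gives a^r <= E |f|^r. The loss of 2^r against Jensen is harmless,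
  and a non-integrable \<open>f\<close> has Bochner integral 0 and falls under the trivial
  case.\<close>

lemma (in prob_space) powr_abs_expectation_le:
  fixes f :: "'a \<Rightarrow> real"
  assumes r: "r > 1" and [measurable]: "f \<in> borel_measurable M"
    and int: "integrable M (\<lambda>x. \<bar>f x\<bar> powr r)"
  shows "\<bar>expectation f\<bar> powr r \<le> 2 powr r * expectation (\<lambda>x. \<bar>f x\<bar> powr r)"
proof (cases "expectation f = 0")
  case True
  then show ?thesis using r by (simp add: Bochner_Integration.integral_nonneg)
next
  case False
  define a where "a = \<bar>expectation f\<bar> / 2"
  have a: "a > 0" using False by (simp add: a_def)
  have *: "\<bar>f x\<bar> \<le> a + a powr (1 - r) * \<bar>f x\<bar> powr r" for x
  proof (cases "\<bar>f x\<bar> \<le> a")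
    case True
    then show ?thesis by (simp add: add_increasing2)
  next
    case False
    then have "\<bar>f x\<bar> = \<bar>f x\<bar> powr r * \<bar>f x\<bar> powr (1 - r)" using a by (simp flip: powr_add)
    also have "\<dots> \<le> \<bar>f x\<bar> powr r * a powr (1 - r)"
      using False a r by (intro mult_left_mono powr_mono2') auto
    finally show ?thesis using a by (simp add: mult.commute)
  qed
  have "integrable M f" using False not_integrable_integral_eq by blast
  then have "2 * a \<le> expectation (\<lambda>x. \<bar>f x\<bar>)" by (simp add: a_def integral_abs_bound)
  also have "\<dots> \<le> expectation (\<lambda>x. a + a powr (1 - r) * \<bar>f x\<bar> powr r)"
    using * \<open>integrable M f\<close> int by (intro integral_mono) auto
  also have "\<dots> = a + a powr (1 - r) * expectation (\<lambda>x. \<bar>f x\<bar> powr r)"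
    using int by (simp add: prob_space)
  finally have "a \<le> a powr (1 - r) * expectation (\<lambda>x. \<bar>f x\<bar> powr r)" by simp
  then have "a powr (r - 1) * a \<le> a powr (r - 1) * (a powr (1 - r) * expectation (\<lambda>x. \<bar>f x\<bar> powr r))"
    by (intro mult_left_mono) auto
  also have "\<dots> = expectation (\<lambda>x. \<bar>f x\<bar> powr r)"
    using a by (simp add: mult.assoc[symmetric] flip: powr_add)
  also have "a powr (r - 1) * a = a powr r" using a by (simp add: powr_diff)
  finally have "2 powr r * a powr r \<le> 2 powr r * expectation (\<lambda>x. \<bar>f x\<bar> powr r)" by simp
  then show ?thesis using a by (simp add: a_def powr_divide)
qed

context iid_coordinates
begin

lemma integrable_square_if_powr:
  fixes f :: "(nat \<Rightarrow> real) \<Rightarrow> real"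
  assumes "r > 2" and [measurable]: "f \<in> borel_measurable Om"
    and "integrable Om (\<lambda>x. \<bar>f x\<bar> powr r)"
  shows "integrable Om (\<lambda>x. (f x)\<^sup>2)"
proof (rule Bochner_Integration.integrable_bound)
  show "integrable Om (\<lambda>x. 1 + \<bar>f x\<bar> powr r)" using assms by auto
  show "AE x in Om. norm ((f x)\<^sup>2) \<le> norm (1 + \<bar>f x\<bar> powr r)"
    using square_le_one_plus_powr[OF assms(1)] by (auto simp: add_increasing)
qed auto

text \<open>The preceding inequality is applied in each fibre over the coordinates in
  \<open>A\<close>; by Fubini almost every fibre has a finite moment.\<close>

lemma
  assumes r: "r > 1" and [measurable]: "f \<in> borel_measurable Om"
    and int: "integrable Om (\<lambda>x. \<bar>f x\<bar> powr r)"
  shows integrable_powr_cexp: "integrable Om (\<lambda>x. \<bar>cexp A f x\<bar> powr r)"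
    and powr_cexp_le: "(LINT x|Om. \<bar>cexp A f x\<bar> powr r) \<le> 2 powr r * (LINT x|Om. \<bar>f x\<bar> powr r)"
proof -
  let ?g = "cexp A (\<lambda>x. \<bar>f x\<bar> powr r)"
  have ig: "integrable Om ?g" by (rule integrable_cexp[OF int])
  have "AE x in Om. integrable Om (\<lambda>y. \<bar>f (mix A x y)\<bar> powr r)"
    using Om2.AE_integrable_fst'[OF integrable_mix[OF int, of A]] by simp
  then have ae: "AE x in Om. \<bar>cexp A f x\<bar> powr r \<le> 2 powr r * ?g x"
  proof eventually_elim
    case (elim x)
    then show ?case unfolding cexp_def by (intro Om.powr_abs_expectation_le r) auto
  qed
  show i: "integrable Om (\<lambda>x. \<bar>cexp A f x\<bar> powr r)"
  proof (rule Bochner_Integration.integrable_bound)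
    show "integrable Om (\<lambda>x. 2 powr r * ?g x)" using ig by simp
    show "AE x in Om. norm (\<bar>cexp A f x\<bar> powr r) \<le> norm (2 powr r * ?g x)"
      using ae by eventually_elim auto
  qed auto
  have "(LINT x|Om. \<bar>cexp A f x\<bar> powr r) \<le> (LINT x|Om. 2 powr r * ?g x)"
    using i ig ae by (intro integral_mono_AE) auto
  also have "\<dots> = 2 powr r * (LINT x|Om. \<bar>f x\<bar> powr r)"
    using integral_cexp[OF int] by simp
  finally show "(LINT x|Om. \<bar>cexp A f x\<bar> powr r) \<le> 2 powr r * (LINT x|Om. \<bar>f x\<bar> powr r)" .
qed

text \<open>Replacing \<open>\<xi>\<^sub>j\<close> by martingale differences removes all cancellation between the summands, so that
  the variances of the new summands add up to the variance of the sum.\<close>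

lemma chain_decomposition:
  fixes \<xi> :: "nat \<Rightarrow> (nat \<Rightarrow> real) \<Rightarrow> real" and Bl :: "nat \<Rightarrow> nat set"
  assumes r: "r > 2"
    and meas [measurable]: "\<And>j. Suc j < Q \<Longrightarrow> \<xi> j \<in> borel_measurable Om"
    and mom: "\<And>j. Suc j < Q \<Longrightarrow> integrable Om (\<lambda>x. \<bar>\<xi> j x\<bar> powr r)"
    and mean: "\<And>j. Suc j < Q \<Longrightarrow> (LINT x|Om. \<xi> j x) = 0"
    and dep: "\<And>j. Suc j < Q \<Longrightarrow> dep (Bl j \<union> Bl (Suc j)) (\<xi> j)"
    and disj: "\<And>i j. i < j \<Longrightarrow> j < Q \<Longrightarrow> Bl i \<inter> Bl j = {}"
    and Q: "Q \<ge> 1"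
  obtains D where "\<And>j. j < Q \<Longrightarrow> D j \<in> borel_measurable Om"
    and "\<And>j. j < Q \<Longrightarrow> integrable Om (\<lambda>x. \<bar>D j x\<bar> powr r)"
    and "\<And>j. j < Q \<Longrightarrow> (LINT x|Om. D j x) = 0"
    and "\<And>j. j < Q \<Longrightarrow> dep (Bl (j - 1) \<union> Bl j) (D j)"
    and "\<And>x. (\<Sum>j<Q. D j x) = (\<Sum>j<Q - 1. \<xi> j x)"
    and "(\<Sum>j<Q. LINT x|Om. (D j x)\<^sup>2) = (LINT x|Om. (\<Sum>j<Q - 1. \<xi> j x)\<^sup>2)"
    and "(\<Sum>j<Q. LINT x|Om. \<bar>D j x\<bar> powr r)
      \<le> 3 powr r * (1 + 2 * 2 powr r) * (\<Sum>j<Q - 1. LINT x|Om. \<bar>\<xi> j x\<bar> powr r)"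
proof -
  \<comment> \<open>Padding by zero: there is no summand with index Q - 1, but block Q - 1 still has
    an increment, which completes the summand with index Q - 2.\<close>
  define z where "z j = (if Suc j < Q then \<xi> j else (\<lambda>_. 0))" for j
  define al where "al j = cexp (Bl j) (z j)" for j
  define zp where "zp j = (if j = 0 then (\<lambda>_. 0) else z (j - 1))" for j
  define alp where "alp j = (if j = 0 then (\<lambda>_. 0) else al (j - 1))" for j
  \<comment> \<open>The increment of the conditional expectation of the whole sum when block
    \<open>j\<close> is revealed after the earlier ones: the summand with index j - 1 becomes known
    in full, and of the one with index \<open>j\<close> its conditional mean given block
    \<open>j\<close>.\<close>
  define D where "D j x = zp j x - alp j x + al j x" for j x
  have zm [measurable]: "z j \<in> borel_measurable Om" for j using meas by (simp add: z_def)
  have zr: "integrable Om (\<lambda>x. \<bar>z j x\<bar> powr r)" for j using mom r by (simp add: z_def)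
  have zint: "integrable Om (z j)" for j
    using integrable_square_imp[OF zm integrable_square_if_powr[OF r zm zr]] .
  have zmean: "(LINT x|Om. z j x) = 0" for j using mean by (simp add: z_def)
  have zdep: "dep (Bl j \<union> Bl (Suc j)) (z j)" for j using dep by (auto simp: z_def dep_const)
  have am [measurable]: "al j \<in> borel_measurable Om" for j by (simp add: al_def)
  have ar: "integrable Om (\<lambda>x. \<bar>al j x\<bar> powr r)"
    "(LINT x|Om. \<bar>al j x\<bar> powr r) \<le> 2 powr r * (LINT x|Om. \<bar>z j x\<bar> powr r)" for j
    unfolding al_def using r zr by (intro integrable_powr_cexp powr_cexp_le; simp)+
  have aint: "integrable Om (al j)" and amean: "(LINT x|Om. al j x) = 0" for j
    unfolding al_def using zint zmean by (simp_all add: integrable_cexp integral_cexp)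
  have adep: "dep (Bl j) (al j)" for j
    unfolding al_def by (rule dep_cexp_mono[OF zdep]) auto
  have zpm [measurable]: "zp j \<in> borel_measurable Om" and apm [measurable]: "alp j \<in> borel_measurable Om" for j
    by (simp_all add: zp_def alp_def)
  have zpr: "integrable Om (\<lambda>x. \<bar>zp j x\<bar> powr r)" and apr: "integrable Om (\<lambda>x. \<bar>alp j x\<bar> powr r)" for j
    using zr ar by (simp_all add: zp_def alp_def)
  have Dm [measurable]: "D j \<in> borel_measurable Om" for j unfolding D_def by measurable
  have Dbound: "\<bar>D j x\<bar> powr r \<le> 3 powr r * (\<bar>zp j x\<bar> powr r + \<bar>alp j x\<bar> powr r + \<bar>al j x\<bar> powr r)" for j x
    using abs_powr_add3_le[of r "zp j x" "- alp j x" "al j x"] r by (simp add: D_def)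
  have Dr: "integrable Om (\<lambda>x. \<bar>D j x\<bar> powr r)" for j
  proof (rule Bochner_Integration.integrable_bound)
    show "integrable Om (\<lambda>x. 3 powr r * (\<bar>zp j x\<bar> powr r + \<bar>alp j x\<bar> powr r + \<bar>al j x\<bar> powr r))"
      using zpr apr ar by simp
  qed (use Dbound in \<open>auto intro!: AE_I2 order_trans[OF Dbound] abs_ge_self\<close>)
  have Dsq: "integrable Om (\<lambda>x. (D j x)\<^sup>2)" for j
    by (intro integrable_square_if_powr[OF r] Dm Dr)
  have Dint: "integrable Om (D j)" for j using integrable_square_imp[OF Dm Dsq] .
  have zpint: "integrable Om (zp j)" "integrable Om (alp j)" for j
    using zint aint by (auto simp: zp_def alp_def)
  have Dmean: "(LINT x|Om. D j x) = 0" for j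
    unfolding D_def using zpint aint amean zmean by (simp add: zp_def alp_def)
  have zpdep: "dep (Bl (j - 1) \<union> Bl j) (zp j)" for j
    using zdep[of "j - 1"] by (auto simp: zp_def dep_const)
  have apdep: "dep (Bl (j - 1) \<union> Bl j) (alp j)" for j
    using dep_mono[OF adep[of "j - 1"], of "Bl (j - 1) \<union> Bl j"] by (auto simp: alp_def dep_const)
  have Ddep: "dep (Bl (j - 1) \<union> Bl j) (D j)" for j
    unfolding D_def
    by (intro dep_comp2[where F = "(+)"] dep_comp2[where F = "(-)"] zpdep apdep dep_mono[OF adep]) auto
  have aQ: "al j = (\<lambda>_. 0)" if "\<not> Suc j < Q" for j
    using that by (auto simp: al_def z_def cexp_def)
  have Dsum: "(\<Sum>j<Q. D j x) = (\<Sum>j<Q - 1. \<xi> j x)" for x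
  proof -
    obtain q where q: "Q = Suc q" using Q by (cases Q) auto
    have "(\<Sum>j<Q. D j x) = (\<Sum>j<Suc q. zp j x) - (\<Sum>j<Suc q. alp j x) + (\<Sum>j<Suc q. al j x)"
      by (simp only: D_def sum.distrib sum_subtractf q)
    also have "(\<Sum>j<Suc q. zp j x) = (\<Sum>j<q. z j x)"
      by (simp only: sum.lessThan_Suc_shift) (simp add: zp_def)
    also have "(\<Sum>j<Suc q. alp j x) = (\<Sum>j<q. al j x)"
      by (simp only: sum.lessThan_Suc_shift) (simp add: alp_def)
    also have "(\<Sum>j<Suc q. al j x) = (\<Sum>j<q. al j x)"
      using aQ[of q] q by simp
    finally show ?thesis using q by (simp add: z_def)
  qed
  have DD: "integrable Om (\<lambda>x. D i x * D j x)" for i j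
    by (intro integrable_square_mult Dm Dsq)
  \<comment> \<open>Increments two or more apart share no block. For neighbours, \<open>D i\<close>
    sees only block \<open>i\<close> among the two blocks of \<open>z i\<close>, so inside the
    integral \<open>z i\<close> may be replaced by its conditional expectation \<open>al i\<close>,
    and the two cancel.\<close>
  have orth: "(LINT x|Om. D i x * D j x) = 0" if ij: "i < j" "j < Q" for i j
  proof (cases "i + 2 \<le> j")
    case True
    have "(Bl (i - 1) \<union> Bl i) \<inter> (Bl (j - 1) \<union> Bl j) = {}"
    proof -
      have "i - 1 < j - 1" "i - 1 < j" "i < j - 1" "j - 1 < Q" using True ij by auto
      then show ?thesis using ij by (simp add: Int_Un_distrib Int_Un_distrib2 disj)
    qed
    from integral_mult_indep[OF Dint Ddep Dint Ddep this] show ?thesis by (simp add: Dmean)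
  next
    case False
    with ij have j: "j = Suc i" by simp
    have sqs: "integrable Om (\<lambda>x. (z i x)\<^sup>2)" "integrable Om (\<lambda>x. (al i x)\<^sup>2)" "integrable Om (\<lambda>x. (al j x)\<^sup>2)" for i
      by (intro integrable_square_if_powr[OF r] zm zr am ar)+
    have ints: "integrable Om (\<lambda>x. D i x * z i x)" "integrable Om (\<lambda>x. D i x * al i x)" "integrable Om (\<lambda>x. D i x * al j x)"
      by (intro integrable_square_mult Dm Dsq zm am sqs)+
    have "(Bl (i - 1) \<union> Bl i) \<inter> (Bl i \<union> Bl (Suc i)) \<subseteq> Bl i"
    proof -
      have "i - 1 < Suc i" by simp
      then show ?thesis using ij j disj[of "i - 1" "Suc i"] by auto
    qed
    then have "(LINT x|Om. D i x * z i x) = (LINT x|Om. D i x * al i x)"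
      unfolding al_def by (intro integral_mult_cexp[OF ints(1) Ddep zdep] zm)
    moreover have "(LINT x|Om. D i x * al j x) = 0"
    proof -
      have "(Bl (i - 1) \<union> Bl i) \<inter> Bl j = {}"
      proof -
        have "i - 1 < j" using ij by simp
        then show ?thesis using ij disj[of "i - 1" j] disj[of i j] by auto
      qed
      from integral_mult_indep[OF Dint Ddep aint adep this] show ?thesis by (simp add: amean)
    qed
    moreover have "(LINT x|Om. D i x * D j x) = (LINT x|Om. D i x * z i x - D i x * al i x + D i x * al j x)"
    proof -
      have "D j x = z i x - al i x + al j x" for x by (simp add: D_def j zp_def alp_def)
      then have "D i x * D j x = D i x * z i x - D i x * al i x + D i x * al j x" for x
        by (simp only: distrib_left right_diff_distrib)
      then show ?thesis by simp
    qed
    ultimately show ?thesis using ints by simp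
  qed
  have var: "(LINT x|Om. (\<Sum>j<Q. D j x)\<^sup>2) = (\<Sum>j<Q. LINT x|Om. (D j x)\<^sup>2)"
  proof -
    have "(LINT x|Om. (\<Sum>j<Q. D j x)\<^sup>2) = (\<Sum>i<Q. \<Sum>j<Q. LINT x|Om. D i x * D j x)"
      unfolding power2_eq_square sum_product using DD by (simp add: Bochner_Integration.integral_sum)
    also have "\<dots> = (\<Sum>i<Q. \<Sum>j<Q. if j = i then LINT x|Om. (D i x)\<^sup>2 else 0)"
    proof (intro sum.cong refl)
      fix i j assume "i \<in> {..<Q}" "j \<in> {..<Q}"
      then show "(LINT x|Om. D i x * D j x) = (if j = i then LINT x|Om. (D i x)\<^sup>2 else 0)"
        using orth[of i j] orth[of j i] by (cases i j rule: linorder_cases) (auto simp: power2_eq_square mult.commute)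
    qed
    finally show ?thesis by simp
  qed
  have mom_sum: "(\<Sum>j<Q. LINT x|Om. \<bar>D j x\<bar> powr r)
      \<le> 3 powr r * (1 + 2 * 2 powr r) * (\<Sum>j<Q - 1. LINT x|Om. \<bar>\<xi> j x\<bar> powr r)"
  proof -
    obtain q where q: "Q = Suc q" using Q by (cases Q) auto
    define lam where "lam = (\<Sum>j<q. LINT x|Om. \<bar>z j x\<bar> powr r)"
    have zq: "z q = (\<lambda>_. 0)" using q by (simp add: z_def)
    have "(LINT x|Om. \<bar>D j x\<bar> powr r) \<le> 3 powr r * ((LINT x|Om. \<bar>zp j x\<bar> powr r)
        + (LINT x|Om. \<bar>alp j x\<bar> powr r) + (LINT x|Om. \<bar>al j x\<bar> powr r))" for j
    proof -
      have "(LINT x|Om. \<bar>D j x\<bar> powr r) \<le> (LINT x|Om. 3 powr r * (\<bar>zp j x\<bar> powr r + \<bar>alp j x\<bar> powr r + \<bar>al j x\<bar> powr r))"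
        using Dr zpr apr ar Dbound by (intro integral_mono) auto
      then show ?thesis using zpr apr ar by simp
    qed
    then have "(\<Sum>j<Q. LINT x|Om. \<bar>D j x\<bar> powr r) \<le> (\<Sum>j<Suc q. 3 powr r * ((LINT x|Om. \<bar>zp j x\<bar> powr r)
        + (LINT x|Om. \<bar>alp j x\<bar> powr r) + (LINT x|Om. \<bar>al j x\<bar> powr r)))"
      unfolding q by (rule sum_mono)
    also have "\<dots> = 3 powr r * ((\<Sum>j<Suc q. LINT x|Om. \<bar>zp j x\<bar> powr r)
        + (\<Sum>j<Suc q. LINT x|Om. \<bar>alp j x\<bar> powr r) + (\<Sum>j<Suc q. LINT x|Om. \<bar>al j x\<bar> powr r))"
      by (simp only: sum.distrib sum_distrib_left distrib_left)
    also have "(\<Sum>j<Suc q. LINT x|Om. \<bar>zp j x\<bar> powr r) = lam"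
      unfolding lam_def by (simp only: sum.lessThan_Suc_shift) (use r in \<open>simp add: zp_def\<close>)
    also have "(\<Sum>j<Suc q. LINT x|Om. \<bar>alp j x\<bar> powr r) = (\<Sum>j<q. LINT x|Om. \<bar>al j x\<bar> powr r)"
      by (simp only: sum.lessThan_Suc_shift) (use r in \<open>simp add: alp_def\<close>)
    also have "(\<Sum>j<Suc q. LINT x|Om. \<bar>al j x\<bar> powr r) = (\<Sum>j<q. LINT x|Om. \<bar>al j x\<bar> powr r)"
      using aQ[of q] q r by simp
    also have "3 powr r * (lam + (\<Sum>j<q. LINT x|Om. \<bar>al j x\<bar> powr r) + (\<Sum>j<q. LINT x|Om. \<bar>al j x\<bar> powr r))
        \<le> 3 powr r * (lam + 2 powr r * lam + 2 powr r * lam)"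
      unfolding lam_def sum_distrib_left by (intro mult_left_mono add_mono sum_mono ar) auto
    also have "lam = (\<Sum>j<Q - 1. LINT x|Om. \<bar>\<xi> j x\<bar> powr r)"
      unfolding lam_def q by (simp add: z_def q)
    finally show ?thesis by (simp add: algebra_simps)
  qed
  show thesis
    using that[of D] Dm Dr Dmean Ddep Dsum var mom_sum by (simp only: Dsum)
qed

text \<open>A term depending on one block can be added to the martingale difference of that block
  without enlarging the set of blocks in use, so the local dependence bound applies to
  \<open>D j + \<tau> j\<close>. The constant is 8 * 11250, the 8 being that of
  \<open>rho_add_le\<close>. The summands \<open>\<xi>\<close> enter only through the second moment
  of their sum and their r-th moments.\<close>

lemma chain_char_bound:
  fixes \<xi> \<tau> :: "nat \<Rightarrow> (nat \<Rightarrow> real) \<Rightarrow> real" and Bl :: "nat \<Rightarrow> nat set"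
  assumes r: "r > 2"
    and meas: "\<And>j. Suc j < Q \<Longrightarrow> \<xi> j \<in> borel_measurable Om"
    and mom: "\<And>j. Suc j < Q \<Longrightarrow> integrable Om (\<lambda>x. \<bar>\<xi> j x\<bar> powr r)"
    and mean: "\<And>j. Suc j < Q \<Longrightarrow> (LINT x|Om. \<xi> j x) = 0"
    and dep: "\<And>j. Suc j < Q \<Longrightarrow> dep (Bl j \<union> Bl (Suc j)) (\<xi> j)"
    and disj: "\<And>i j. i < j \<Longrightarrow> j < Q \<Longrightarrow> Bl i \<inter> Bl j = {}"
    and Q: "Q \<ge> 1"
    and tau_meas: "\<And>j. j < Q \<Longrightarrow> \<tau> j \<in> borel_measurable Om"
    and tau_sq: "\<And>j. j < Q \<Longrightarrow> integrable Om (\<lambda>x. (\<tau> j x)\<^sup>2)"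
    and tau_mean: "\<And>j. j < Q \<Longrightarrow> (LINT x|Om. \<tau> j x) = 0"
    and tau_dep: "\<And>j. j < Q \<Longrightarrow> dep (Bl j) (\<tau> j)"
    and \<delta>: "\<delta> > 0"
  defines "S \<equiv> (\<lambda>x. (\<Sum>j<Q - 1. \<xi> j x) + (\<Sum>j<Q. \<tau> j x))"
  defines "v \<equiv> (LINT x|Om. (S x)\<^sup>2)"
  shows "cmod ((LINT x|Om. iexp (S x)) - of_real (exp (- v / 2)))
    \<le> exp (v / 2) * (90000 * (\<delta> * (LINT x|Om. (\<Sum>j<Q - 1. \<xi> j x)\<^sup>2)
        + \<delta> powr (2 - r) * (3 powr r * (1 + 2 * 2 powr r) * (\<Sum>j<Q - 1. LINT x|Om. \<bar>\<xi> j x\<bar> powr r))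
        + (\<Sum>j<Q. LINT x|Om. rho (\<tau> j x))))"
proof -
  obtain D where D: "\<And>j. j < Q \<Longrightarrow> D j \<in> borel_measurable Om"
    "\<And>j. j < Q \<Longrightarrow> integrable Om (\<lambda>x. \<bar>D j x\<bar> powr r)"
    "\<And>j. j < Q \<Longrightarrow> (LINT x|Om. D j x) = 0"
    "\<And>j. j < Q \<Longrightarrow> dep (Bl (j - 1) \<union> Bl j) (D j)"
    "\<And>x. (\<Sum>j<Q. D j x) = (\<Sum>j<Q - 1. \<xi> j x)"
    "(\<Sum>j<Q. LINT x|Om. (D j x)\<^sup>2) = (LINT x|Om. (\<Sum>j<Q - 1. \<xi> j x)\<^sup>2)"
    "(\<Sum>j<Q. LINT x|Om. \<bar>D j x\<bar> powr r)
      \<le> 3 powr r * (1 + 2 * 2 powr r) * (\<Sum>j<Q - 1. LINT x|Om. \<bar>\<xi> j x\<bar> powr r)"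
    using chain_decomposition[where Q = Q and \<xi> = \<xi> and Bl = Bl, OF r meas mom mean dep disj Q] by blast
  have Dsq: "integrable Om (\<lambda>x. (D j x)\<^sup>2)" if "j < Q" for j
    using integrable_square_if_powr[OF r D(1)[OF that] D(2)[OF that]] .
  have Dint: "integrable Om (D j)" if "j < Q" for j
    using integrable_square_imp[OF D(1) Dsq] that by blast
  have tint: "integrable Om (\<tau> j)" if "j < Q" for j
    using integrable_square_imp[OF tau_meas tau_sq] that by blast
  define F where "F j x = D j x + \<tau> j x" for j x
  have Fm: "F j \<in> borel_measurable Om" if "j < Q" for j
    unfolding F_def using D(1) tau_meas that by auto
  have Fsq: "integrable Om (\<lambda>x. (F j x)\<^sup>2)" if "j < Q" for j
    unfolding F_def power2_sum mult.assoc
    using Dsq[OF that] tau_sq[OF that] integrable_square_mult[OF D(1)[OF that] tau_meas[OF that] Dsq[OF that] tau_sq[OF that]]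
    by simp
  have SF: "(\<Sum>j<Q. F j x) = S x" for x
    by (simp add: F_def S_def sum.distrib D(5))
  have *: "cmod ((LINT x|Om. iexp (\<Sum>j<Q. F j x)) - of_real (exp (- (LINT x|Om. (\<Sum>j<Q. F j x)\<^sup>2) / 2)))
    \<le> exp ((LINT x|Om. (\<Sum>j<Q. F j x)\<^sup>2) / 2) * (11250 * (\<Sum>i<Q. LINT x|Om. rho (F i x)))"
  proof (rule local_dependence_char_bound[where A = "\<lambda>j. Bl (j - 1) \<union> Bl j"])
    fix i j assume ij: "i + 2 \<le> j" "j < Q"
    show "(Bl (i - 1) \<union> Bl i) \<inter> (Bl (j - 1) \<union> Bl j) = {}"
    proof -
      have "i - 1 < j - 1" "i - 1 < j" "i < j - 1" "i < j" "j - 1 < Q" using ij by auto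
      then show ?thesis using ij by (simp add: Int_Un_distrib Int_Un_distrib2 disj)
    qed
  next
    fix j assume j: "j < Q"
    show "(LINT x|Om. F j x) = 0"
      unfolding F_def using Dint tint D(3) tau_mean j by simp
    show "dep (Bl (j - 1) \<union> Bl j) (F j)"
      unfolding F_def using D(4) tau_dep j by (intro dep_comp2[where F = "(+)"] dep_mono[OF tau_dep]) auto
  qed (use Fm Fsq in auto)
  have "(\<Sum>i<Q. LINT x|Om. rho (F i x)) \<le> (\<Sum>i<Q. 8 * ((LINT x|Om. \<delta> * (D i x)\<^sup>2 + \<delta> powr (2 - r) * \<bar>D i x\<bar> powr r) + (LINT x|Om. rho (\<tau> i x))))"
  proof (rule sum_mono)
    fix i assume i: "i \<in> {..<Q}"
    have ir: "integrable Om (\<lambda>x. rho (\<tau> i x))" using i tau_meas tau_sq by (intro integrable_rho) auto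
    have id: "integrable Om (\<lambda>x. \<delta> * (D i x)\<^sup>2 + \<delta> powr (2 - r) * \<bar>D i x\<bar> powr r)"
      using i Dsq D(2) by auto
    have "(LINT x|Om. rho (F i x)) \<le> (LINT x|Om. 8 * ((\<delta> * (D i x)\<^sup>2 + \<delta> powr (2 - r) * \<bar>D i x\<bar> powr r) + rho (\<tau> i x)))"
    proof (rule integral_mono)
      show "integrable Om (\<lambda>x. rho (F i x))" using i Fm Fsq by (intro integrable_rho) auto
      show "integrable Om (\<lambda>x. 8 * ((\<delta> * (D i x)\<^sup>2 + \<delta> powr (2 - r) * \<bar>D i x\<bar> powr r) + rho (\<tau> i x)))"
        by (intro Bochner_Integration.integrable_mult_right Bochner_Integration.integrable_add[OF id ir])
      fix x
      have "rho (F i x) \<le> 8 * (rho (D i x) + rho (\<tau> i x))" unfolding F_def by (rule rho_add_le)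
      also have "\<dots> \<le> 8 * ((\<delta> * (D i x)\<^sup>2 + \<delta> powr (2 - r) * \<bar>D i x\<bar> powr r) + rho (\<tau> i x))"
        using rho_le_powr[OF \<delta> r, of "D i x"] by simp
      finally show "rho (F i x) \<le> 8 * ((\<delta> * (D i x)\<^sup>2 + \<delta> powr (2 - r) * \<bar>D i x\<bar> powr r) + rho (\<tau> i x))" .
    qed
    also have "\<dots> = 8 * ((LINT x|Om. \<delta> * (D i x)\<^sup>2 + \<delta> powr (2 - r) * \<bar>D i x\<bar> powr r) + (LINT x|Om. rho (\<tau> i x)))"
      unfolding integral_mult_right_zero using Bochner_Integration.integral_add[OF id ir] by simp
    finally show "(LINT x|Om. rho (F i x)) \<le> 8 * ((LINT x|Om. \<delta> * (D i x)\<^sup>2 + \<delta> powr (2 - r) * \<bar>D i x\<bar> powr r) + (LINT x|Om. rho (\<tau> i x)))" .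
  qed
  also have "\<dots> = 8 * ((\<delta> * (\<Sum>i<Q. LINT x|Om. (D i x)\<^sup>2) + \<delta> powr (2 - r) * (\<Sum>i<Q. LINT x|Om. \<bar>D i x\<bar> powr r)) + (\<Sum>i<Q. LINT x|Om. rho (\<tau> i x)))"
    using Dsq D(2) by (simp add: sum.distrib sum_distrib_left distrib_left)
  also have "\<dots> \<le> 8 * (\<delta> * (LINT x|Om. (\<Sum>j<Q - 1. \<xi> j x)\<^sup>2)
        + \<delta> powr (2 - r) * (3 powr r * (1 + 2 * 2 powr r) * (\<Sum>j<Q - 1. LINT x|Om. \<bar>\<xi> j x\<bar> powr r))
        + (\<Sum>j<Q. LINT x|Om. rho (\<tau> j x)))"
    unfolding D(6) using \<delta> by (intro mult_left_mono add_mono D(7)) auto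
  finally have "11250 * (\<Sum>i<Q. LINT x|Om. rho (F i x)) \<le> 90000 * (\<delta> * (LINT x|Om. (\<Sum>j<Q - 1. \<xi> j x)\<^sup>2)
        + \<delta> powr (2 - r) * (3 powr r * (1 + 2 * 2 powr r) * (\<Sum>j<Q - 1. LINT x|Om. \<bar>\<xi> j x\<bar> powr r))
        + (\<Sum>j<Q. LINT x|Om. rho (\<tau> j x)))"
    by simp
  then have "exp (v / 2) * (11250 * (\<Sum>i<Q. LINT x|Om. rho (F i x))) \<le> exp (v / 2) * (90000 * (\<delta> * (LINT x|Om. (\<Sum>j<Q - 1. \<xi> j x)\<^sup>2)
        + \<delta> powr (2 - r) * (3 powr r * (1 + 2 * 2 powr r) * (\<Sum>j<Q - 1. LINT x|Om. \<bar>\<xi> j x\<bar> powr r))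
        + (\<Sum>j<Q. LINT x|Om. rho (\<tau> j x))))"
    by (rule mult_left_mono) simp
  with * show ?thesis unfolding SF v_def by (rule order_trans)
qed

end

section \<open>Exponential coordinates\<close>

text \<open>
  If \<open>J\<close> contains all but \<open>a + 1\<close> of the indices, \<open>wt a (tau J x - 1)\<close> is, up to a constant, the
  density of the law of the scaled spacings with index in \<open>J\<close> relative to independent exponential
  variables (see \<open>spacings_law\<close>).
\<close>

definition wt :: "nat \<Rightarrow> real \<Rightarrow> real" where
  "wt a z = (if z < a then (1 - z / a) ^ a * exp z else 0)"

lemma wt_measurable [measurable]: "wt a \<in> borel_measurable borel"
  unfolding wt_def by measurable

lemma wt_nonneg [simp]: "0 \<le> wt a z"
  unfolding wt_def by (cases "a = 0") (auto simp: field_simps)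

lemma wt_le_1: "wt a z \<le> 1" if "a > 0"
proof (cases "z < a")
  case True
  have "(1 - z / a) ^ a \<le> exp (- (z / a)) ^ a"
    using True that exp_ge_add_one_self[of "- (z / a)"] by (intro power_mono) (auto simp: field_simps)
  also have "\<dots> = exp (- z)"
    using that by (simp flip: exp_of_nat_mult)
  finally have "(1 - z / a) ^ a * exp z \<le> exp (- z) * exp z" by (intro mult_right_mono) auto
  then show ?thesis using True by (simp add: wt_def flip: exp_add)
qed (simp add: wt_def)

lemma ln_one_minus_taylor2:
  fixes v :: real
  assumes "\<bar>v\<bar> \<le> 1 / 2"
  shows "\<bar>ln (1 - v) + v + v\<^sup>2 / 2\<bar> \<le> 2 * \<bar>v\<bar> ^ 3"
proof -
  define f where "f x = ln (1 - x) + x + x\<^sup>2 / 2" for x :: real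
  have "norm (f v - f 0) \<le> (2 * v\<^sup>2) * norm (v - 0)"
  proof (rule field_differentiable_bound[of "{-\<bar>v\<bar>..\<bar>v\<bar>}" f "\<lambda>x. - x\<^sup>2 / (1 - x)"])
    fix x assume x: "x \<in> {-\<bar>v\<bar>..\<bar>v\<bar>}"
    then have x1: "1 - x \<ge> 1 / 2" using assms by auto
    show "(f has_field_derivative - x\<^sup>2 / (1 - x)) (at x within {-\<bar>v\<bar>..\<bar>v\<bar>})"
      unfolding f_def using x1
      by (auto intro!: derivative_eq_intros simp: field_simps power2_eq_square)
    have "x\<^sup>2 \<le> v\<^sup>2" using x by (simp add: abs_le_square_iff[symmetric] abs_le_iff)
    then have "x\<^sup>2 / (1 - x) \<le> v\<^sup>2 / (1 / 2)"
      using x1 by (intro frac_le) auto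
    then show "norm (- x\<^sup>2 / (1 - x)) \<le> 2 * v\<^sup>2" using x1 by (simp add: abs_div)
  qed auto
  then show ?thesis by (simp add: f_def power3_eq_cube power2_eq_square abs_mult mult.assoc)
qed

lemma exp_diff_le_nonpos:
  fixes x y :: real
  assumes "x \<le> 0" "y \<le> 0"
  shows "\<bar>exp x - exp y\<bar> \<le> \<bar>x - y\<bar>"
proof -
  have *: "exp y - exp x \<le> y - x" if "x \<le> y" "y \<le> 0" for x y :: real
  proof -
    have "exp y - exp x = exp y * (1 - exp (x - y))" by (simp add: algebra_simps flip: exp_add)
    also have "\<dots> \<le> 1 * (1 - exp (x - y))"
      using that by (intro mult_right_mono) auto
    also have "\<dots> \<le> y - x"
      using exp_ge_add_one_self[of "x - y"] by (simp add: algebra_simps)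
    finally show ?thesis by simp
  qed
  show ?thesis using *[of x y] *[of y x] assms by (cases "x \<le> y") auto
qed

text \<open>Both sides are exponentials of nonpositive numbers, where exp is 1-Lipschitz, so it is
  enough to compare logarithms. With v = z / a the logarithm of the weight is a (ln (1 - v) + v),
  and its remainder beyond - a v^2 / 2 is cubic.\<close>

lemma wt_approx:
  assumes a: "a > 0" and z: "\<bar>z\<bar> \<le> a / 2"
  shows "\<bar>wt a z - exp (- z\<^sup>2 / (2 * real a))\<bar> \<le> 2 * \<bar>z\<bar> ^ 3 / (real a)\<^sup>2"
proof -
  define v where "v = z / a"
  have v: "\<bar>v\<bar> \<le> 1 / 2" using a z by (simp add: v_def field_simps)
  then have v1: "1 - v > 0" by auto
  have za: "z < a" using a z by auto
  have zv: "z = a * v" using a by (simp add: v_def)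
  have "wt a z = exp (a * ln (1 - v)) * exp z"
    using za v1 a unfolding wt_def v_def[symmetric] by (simp add: exp_of_nat_mult)
  also have "\<dots> = exp (a * (ln (1 - v) + v))" by (simp add: zv algebra_simps flip: exp_add)
  finally have w: "wt a z = exp (a * (ln (1 - v) + v))" .
  have e: "- z\<^sup>2 / (2 * real a) = a * (- v\<^sup>2 / 2)" using a by (simp add: zv power2_eq_square)
  have "ln (1 - v) + v \<le> 0" using ln_le_minus_one[OF v1] by simp
  then have "\<bar>wt a z - exp (- z\<^sup>2 / (2 * real a))\<bar> \<le> \<bar>a * (ln (1 - v) + v) - a * (- v\<^sup>2 / 2)\<bar>"
    unfolding w e by (intro exp_diff_le_nonpos) (auto simp: mult_nonneg_nonpos)
  also have "\<dots> = a * \<bar>ln (1 - v) + v + v\<^sup>2 / 2\<bar>"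
  proof -
    have "a * (ln (1 - v) + v) - a * (- v\<^sup>2 / 2) = a * (ln (1 - v) + v + v\<^sup>2 / 2)"
      by (simp add: algebra_simps)
    then show ?thesis by (simp only: abs_mult abs_of_nat)
  qed
  also have "\<dots> \<le> a * (2 * \<bar>v\<bar> ^ 3)"
    using a ln_one_minus_taylor2[OF v] by (intro mult_left_mono) auto
  also have "\<dots> = 2 * \<bar>z\<bar> ^ 3 / (real a)\<^sup>2"
    using a by (simp add: v_def power3_eq_cube power2_eq_square abs_div)
  finally show ?thesis .
qed

text \<open>For |T| + 1 <= L the shift by 1 is removed at a cost of order L / a. For larger |T| the
  trivial bound 1 is dominated by 4 T^2 / L^2, which after integration acts as Chebyshev's
  inequality.\<close>

lemma wt_approx_shift:
  assumes a: "a > 0" and L: "L \<ge> 2" "2 * L \<le> a"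
  shows "\<bar>wt a (T - 1) - exp (- T\<^sup>2 / (2 * real a))\<bar> \<le> 2 * L ^ 3 / (real a)\<^sup>2 + 2 * L / a + 4 * T\<^sup>2 / L\<^sup>2"
proof (cases "\<bar>T\<bar> + 1 \<le> L")
  case True
  then have z: "\<bar>T - 1\<bar> \<le> L" by auto
  have "\<bar>wt a (T - 1) - exp (- (T - 1)\<^sup>2 / (2 * real a))\<bar> \<le> 2 * \<bar>T - 1\<bar> ^ 3 / (real a)\<^sup>2"
    using a z L by (intro wt_approx) auto
  also have "\<dots> \<le> 2 * L ^ 3 / (real a)\<^sup>2"
    using z by (intro divide_right_mono mult_left_mono power_mono) auto
  finally have 1: "\<bar>wt a (T - 1) - exp (- (T - 1)\<^sup>2 / (2 * real a))\<bar> \<le> 2 * L ^ 3 / (real a)\<^sup>2" .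
  have "\<bar>exp (- (T - 1)\<^sup>2 / (2 * real a)) - exp (- T\<^sup>2 / (2 * real a))\<bar> \<le> \<bar>- (T - 1)\<^sup>2 / (2 * real a) - - T\<^sup>2 / (2 * real a)\<bar>"
    using a by (intro exp_diff_le_nonpos) auto
  also have "- (T - 1)\<^sup>2 / (2 * real a) - - T\<^sup>2 / (2 * real a) = (2 * T - 1) / (2 * real a)"
  proof -
    have "- (T - 1)\<^sup>2 - - T\<^sup>2 = 2 * T - 1" by (simp add: power2_eq_square algebra_simps)
    then show ?thesis by (simp only: diff_divide_distrib[symmetric])
  qed
  also have "\<bar>(2 * T - 1) / (2 * real a)\<bar> = \<bar>2 * T - 1\<bar> / (2 * real a)" by (simp add: abs_div)
  also have "\<dots> \<le> 2 * (2 * L) / (2 * real a)"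
    using True by (intro divide_right_mono) auto
  finally have 2: "\<bar>exp (- (T - 1)\<^sup>2 / (2 * real a)) - exp (- T\<^sup>2 / (2 * real a))\<bar> \<le> 2 * L / a" by simp
  have "0 \<le> 4 * T\<^sup>2 / L\<^sup>2" by simp
  with 1 2 show ?thesis by linarith
next
  case False
  then have "L \<le> 2 * \<bar>T\<bar>" using L by linarith
  then have "L\<^sup>2 \<le> (2 * \<bar>T\<bar>)\<^sup>2" using L by (intro power_mono) auto
    then have "1 \<le> 4 * T\<^sup>2 / L\<^sup>2" using L by (simp add: pos_le_divide_eq power_mult_distrib)
    moreover have "\<bar>wt a (T - 1) - exp (- T\<^sup>2 / (2 * real a))\<bar> \<le> 1"
    proof -
      have "exp (- T\<^sup>2 / (2 * real a)) \<le> 1" using a by auto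
      then show ?thesis using wt_le_1[OF a, of "T - 1"] wt_nonneg[of a "T - 1"] exp_ge_zero[of "- T\<^sup>2 / (2 * real a)"]
        unfolding abs_le_iff by linarith
    qed
    moreover have "0 \<le> 2 * L ^ 3 / (real a)\<^sup>2 + 2 * L / a" using L by simp
    ultimately show ?thesis by linarith
qed

lemma gaussian_as_char:
  "(LINT u|std_normal_distribution. iexp (u * y)) = of_real (exp (- y\<^sup>2 / 2))"
  using fun_cong[OF char_std_normal_distribution, of y] by (simp add: char_def mult.commute)

text \<open>Completing the square: multiplied by the standard normal density, the integrand is a
  constant times the normal density with mean - \<beta> / (1 + \<gamma>) and variance 1 / (1 +
  \<gamma>).\<close>

lemma gaussian_integral_quadratic:
  assumes \<gamma>: "\<gamma> \<ge> 0"
  shows "(LINT u|std_normal_distribution. exp (- (\<alpha> + 2 * \<beta> * u + \<gamma> * u\<^sup>2) / 2))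
    = exp (- (\<alpha> - \<beta>\<^sup>2 / (1 + \<gamma>)) / 2) / sqrt (1 + \<gamma>)"
proof -
  define s where "s = 1 / sqrt (1 + \<gamma>)"
  have g: "1 + \<gamma> > 0" using \<gamma> by simp
  have s: "s > 0" "s\<^sup>2 = 1 / (1 + \<gamma>)" using g by (auto simp: s_def power_divide)
  define c where "c = exp (- (\<alpha> - \<beta>\<^sup>2 / (1 + \<gamma>)) / 2) * s"
  have *: "std_normal_density u * exp (- (\<alpha> + 2 * \<beta> * u + \<gamma> * u\<^sup>2) / 2) = c * normal_density (- \<beta> / (1 + \<gamma>)) s u" for u
  proof -
    have e: "- u\<^sup>2 / 2 + - (\<alpha> + 2 * \<beta> * u + \<gamma> * u\<^sup>2) / 2
      = - (\<alpha> - \<beta>\<^sup>2 / (1 + \<gamma>)) / 2 + - (u - - \<beta> / (1 + \<gamma>))\<^sup>2 / (2 * s\<^sup>2)"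
    proof -
      have "(u - - \<beta> / (1 + \<gamma>))\<^sup>2 / (2 * s\<^sup>2) = (1 + \<gamma>) * (u + \<beta> / (1 + \<gamma>))\<^sup>2 / 2"
        using g unfolding s(2) by (simp add: field_simps)
      also have "\<dots> = ((1 + \<gamma>) * u\<^sup>2 + 2 * \<beta> * u + \<beta>\<^sup>2 / (1 + \<gamma>)) / 2"
      proof -
        define b where "b = \<beta> / (1 + \<gamma>)"
        have b: "(1 + \<gamma>) * b = \<beta>" "\<beta>\<^sup>2 / (1 + \<gamma>) = \<beta> * b"
          using g by (simp_all add: b_def power2_eq_square)
        have "(1 + \<gamma>) * (u + b)\<^sup>2 = (1 + \<gamma>) * u\<^sup>2 + 2 * ((1 + \<gamma>) * b) * u + ((1 + \<gamma>) * b) * b"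
          by (simp add: power2_eq_square algebra_simps)
        then show ?thesis unfolding b_def[symmetric] b by simp
      qed
      finally show ?thesis by (simp add: field_simps)
    qed
    have "sqrt (2 * pi * s\<^sup>2) = sqrt (2 * pi) * s"
      using s(1) by (simp only: real_sqrt_mult real_sqrt_abs abs_of_pos)
    then have "c * normal_density (- \<beta> / (1 + \<gamma>)) s u
      = 1 / sqrt (2 * pi) * (exp (- (\<alpha> - \<beta>\<^sup>2 / (1 + \<gamma>)) / 2) * exp (- (u - - \<beta> / (1 + \<gamma>))\<^sup>2 / (2 * s\<^sup>2)))"
      using s unfolding c_def normal_density_def by simp
    also have "\<dots> = 1 / sqrt (2 * pi) * (exp (- u\<^sup>2 / 2) * exp (- (\<alpha> + 2 * \<beta> * u + \<gamma> * u\<^sup>2) / 2))"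
      unfolding exp_add[symmetric] e ..
    finally show ?thesis by (simp add: std_normal_density_def)
  qed
  have "(LINT u|std_normal_distribution. exp (- (\<alpha> + 2 * \<beta> * u + \<gamma> * u\<^sup>2) / 2))
    = (LINT u|lborel. std_normal_density u * exp (- (\<alpha> + 2 * \<beta> * u + \<gamma> * u\<^sup>2) / 2))"
    by (subst integral_density) auto
  also have "\<dots> = c" unfolding * using s by simp
  finally show ?thesis by (simp add: c_def s_def)
qed

section \<open>Moments of centred exponential sums and the mean of the weight\<close>

definition exp_dist :: "real measure" where
  "exp_dist = density lborel (exponential_density 1)"

locale exp_coordinates = iid_coordinates exp_dist
begin

lemma distributed_coord: "distributed Om lborel (\<lambda>x. x i) (exponential_density 1)"
proof -
  have "distr Om lborel (\<lambda>x. x i) = distr Om exp_dist (\<lambda>x. x i)"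
    by (intro distr_cong) (auto simp: exp_dist_def)
  also have "\<dots> = exp_dist"
    unfolding Om_def by (intro prod.PiM_component) auto
  finally show ?thesis
    using measurable_coord[of i] by (simp add: distributed_def exp_dist_def)
qed

lemma
  shows integrable_coord_power: "integrable Om (\<lambda>x. x i ^ k)"
    and integral_coord_power: "(LINT x|Om. x i ^ k) = fact k"
  using Om.erlang_ith_moment_integrable[OF _ distributed_coord, of i k]
    Om.erlang_ith_moment[OF _ distributed_coord, of i k] by simp_all

definition tau :: "nat set \<Rightarrow> (nat \<Rightarrow> real) \<Rightarrow> real" where
  "tau A x = (\<Sum>i\<in>A. x i - 1)"

lemma tau_measurable [measurable]: "tau A \<in> borel_measurable Om"
  unfolding tau_def by measurable

lemma dep_tau: "dep A (tau A)"
  unfolding dep_def tau_def by (auto intro!: sum.cong)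

lemma tau_insert: "finite A \<Longrightarrow> i \<notin> A \<Longrightarrow> tau (insert i A) x = (x i - 1) + tau A x"
  by (simp add: tau_def)

lemma integrable_coord_centered_power: "integrable Om (\<lambda>x. (x i - 1) ^ k)"
proof -
  have "integrable Om (\<lambda>x. \<Sum>j\<le>k. of_nat (k choose j) * x i ^ j * (-1) ^ (k - j))"
    by (intro Bochner_Integration.integrable_sum integrable_mult_left integrable_mult_right integrable_coord_power)
  moreover have "(x i - 1) ^ k = (\<Sum>j\<le>k. of_nat (k choose j) * x i ^ j * (-1) ^ (k - j))" for x :: "nat \<Rightarrow> real"
    using binomial_ring[of "x i" "-1" k] by simp
  ultimately show ?thesis by simp
qed

lemma
  assumes "finite A" "i \<notin> A" "integrable Om (\<lambda>x. tau A x ^ q)"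
  shows integrable_coord_tau_mult: "integrable Om (\<lambda>x. (x i - 1) ^ p * tau A x ^ q)"
    and integral_coord_tau_mult: "(LINT x|Om. (x i - 1) ^ p * tau A x ^ q)
      = (LINT x|Om. (x i - 1) ^ p) * (LINT x|Om. tau A x ^ q)"
proof -
  have d: "dep {i} (\<lambda>x. (x i - 1) ^ p)" "dep A (\<lambda>x. tau A x ^ q)"
    using dep_comp[OF dep_tau, where F = "\<lambda>y. y ^ q"] by (auto simp: dep_def)
  have e: "{i} \<inter> A = {}" using assms by auto
  show "integrable Om (\<lambda>x. (x i - 1) ^ p * tau A x ^ q)"
    by (rule integrable_mult_indep[OF integrable_coord_centered_power d(1) assms(3) d(2) e])
  show "(LINT x|Om. (x i - 1) ^ p * tau A x ^ q) = (LINT x|Om. (x i - 1) ^ p) * (LINT x|Om. tau A x ^ q)"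
    by (rule integral_mult_indep[OF integrable_coord_centered_power d(1) assms(3) d(2) e])
qed

lemma integrable_tau_power: "finite A \<Longrightarrow> integrable Om (\<lambda>x. tau A x ^ k)"
proof (induction A arbitrary: k rule: finite_induct)
  case empty
  then show ?case by (simp add: tau_def)
next
  case (insert i A)
  have "tau (insert i A) x ^ k = (\<Sum>j\<le>k. of_nat (k choose j) * ((x i - 1) ^ j * tau A x ^ (k - j)))" for x
    using insert by (simp add: tau_insert binomial_ring mult.assoc)
  then show ?case
    using insert by (auto intro!: Bochner_Integration.integrable_sum integrable_coord_tau_mult)
qed

lemma integrable_tau: "finite A \<Longrightarrow> integrable Om (tau A)"
  using integrable_tau_power[of A 1] by simp

lemma integral_coord_centered:
  "(LINT x|Om. x i - 1) = 0" "(LINT x|Om. (x i - 1)\<^sup>2) = 1" "(LINT x|Om. (x i - 1) ^ 4) = 9"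
proof -
  note [simp] = integrable_coord_power integral_coord_power[of i]
  have i1: "integrable Om (\<lambda>x. x i)" using integrable_coord_power[of i 1] by simp
  have e1: "(LINT x|Om. x i) = 1" using integral_coord_power[of i 1] by simp
  show "(LINT x|Om. x i - 1) = 0" using i1 e1 by simp
  have "(x i - 1)\<^sup>2 = x i ^ 2 - 2 * x i + 1" for x :: "nat \<Rightarrow> real" by (simp add: power2_eq_square algebra_simps)
  then show "(LINT x|Om. (x i - 1)\<^sup>2) = 1" using i1 e1 by (simp add: fact_numeral)
  have "(x i - 1) ^ 4 = x i ^ 4 - 4 * x i ^ 3 + 6 * x i ^ 2 - 4 * x i + 1" for x :: "nat \<Rightarrow> real"
    by (simp add: eval_nat_numeral algebra_simps)
  then show "(LINT x|Om. (x i - 1) ^ 4) = 9" using i1 e1 by (simp add: fact_numeral)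
qed

lemma integral_tau: "finite A \<Longrightarrow> (LINT x|Om. tau A x) = 0"
proof (induction A rule: finite_induct)
  case empty
  then show ?case by (simp add: tau_def)
next
  case (insert i A)
  then show ?case
    using integrable_coord_centered_power[of i 1] integrable_tau[of A]
    by (simp add: tau_insert integral_coord_centered Bochner_Integration.integral_add del: Bochner_Integration.integral_diff)
qed

lemma integral_tau_square: "finite A \<Longrightarrow> (LINT x|Om. (tau A x)\<^sup>2) = card A"
proof (induction A rule: finite_induct)
  case empty
  then show ?case by (simp add: tau_def)
next
  case (insert i A)
  note m = integrable_coord_tau_mult[OF insert(1,2) integrable_tau_power[OF insert(1)]]
  note e = integral_coord_tau_mult[OF insert(1,2) integrable_tau_power[OF insert(1)]]
  have "(tau (insert i A) x)\<^sup>2 = (x i - 1) ^ 2 * tau A x ^ 0 + 2 * ((x i - 1) ^ 1 * tau A x ^ 1) + (x i - 1) ^ 0 * tau A x ^ 2" for x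
    using insert by (simp add: tau_insert power2_eq_square algebra_simps)
  then have "(LINT x|Om. (tau (insert i A) x)\<^sup>2) = (LINT x|Om. (x i - 1) ^ 2 * tau A x ^ 0)
      + 2 * (LINT x|Om. (x i - 1) ^ 1 * tau A x ^ 1) + (LINT x|Om. (x i - 1) ^ 0 * tau A x ^ 2)"
    using m by (simp only: Bochner_Integration.integral_add integrable_mult_right integral_mult_right_zero Bochner_Integration.integrable_add)
  then show ?case
    unfolding e using insert by (simp add: integral_coord_centered)
qed

text \<open>A new coordinate adds its own fourth central moment 9 and the cross term 6 k, where k is
  the size of \<open>A\<close>; the odd terms vanish. The induction closes because 9 + 6 k + 9 k^2
  <= 9 (k + 1)^2.\<close>

lemma integral_tau_power4_le: "finite A \<Longrightarrow> (LINT x|Om. tau A x ^ 4) \<le> 9 * (real (card A))\<^sup>2"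
proof (induction A rule: finite_induct)
  case empty
  then show ?case by (simp add: tau_def)
next
  case (insert i A)
  note m = integrable_coord_tau_mult[OF insert(1,2) integrable_tau_power[OF insert(1)]]
  note e = integral_coord_tau_mult[OF insert(1,2) integrable_tau_power[OF insert(1)]]
  have "(tau (insert i A) x) ^ 4 = (x i - 1) ^ 4 * tau A x ^ 0 + 4 * ((x i - 1) ^ 3 * tau A x ^ 1)
      + 6 * ((x i - 1) ^ 2 * tau A x ^ 2) + 4 * ((x i - 1) ^ 1 * tau A x ^ 3) + (x i - 1) ^ 0 * tau A x ^ 4" for x
    using insert by (simp add: tau_insert eval_nat_numeral algebra_simps)
  then have "(LINT x|Om. (tau (insert i A) x) ^ 4) = (LINT x|Om. (x i - 1) ^ 4 * tau A x ^ 0)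
      + 4 * (LINT x|Om. (x i - 1) ^ 3 * tau A x ^ 1) + 6 * (LINT x|Om. (x i - 1) ^ 2 * tau A x ^ 2)
      + 4 * (LINT x|Om. (x i - 1) ^ 1 * tau A x ^ 3) + (LINT x|Om. (x i - 1) ^ 0 * tau A x ^ 4)"
    using m by (simp only: Bochner_Integration.integral_add integrable_mult_right integral_mult_right_zero Bochner_Integration.integrable_add)
  also have "\<dots> = 9 + 6 * real (card A) + (LINT x|Om. tau A x ^ 4)"
    unfolding e using insert by (simp add: integral_coord_centered integral_tau integral_tau_square)
  also have "\<dots> \<le> 9 + 6 * real (card A) + 9 * (real (card A))\<^sup>2" using insert by simp
  also have "\<dots> \<le> 9 * (real (card (insert i A)))\<^sup>2"
    using insert by (simp add: power2_eq_square algebra_simps)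
  finally show ?case .
qed

text \<open>Take L = K sqrt n in \<open>wt_approx_shift\<close>. Since the variance of
  \<open>tau A\<close> is card A <= n, the quadratic term integrates to at most 4 / K^2, which is
  made small first; the others are O(1 / sqrt n) once a >= \<epsilon> n. Uniformity in
  \<open>A\<close> and \<open>a\<close> matters because the retained set is found by a pigeonhole
  argument and is not under control.\<close>

lemma wt_tau_approx:
  assumes \<epsilon>: "\<epsilon> > 0" and \<eta>: "\<eta> > 0"
  shows "\<forall>\<^sub>F n in sequentially. \<forall>A a. finite A \<longrightarrow> card A \<le> n \<longrightarrow> \<epsilon> * real n \<le> real a \<longrightarrow>
    (LINT x|Om. \<bar>wt a (tau A x - 1) - exp (- (tau A x)\<^sup>2 / (2 * real a))\<bar>) \<le> \<eta>"
proof -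
  define K where "K = 2 + 8 / \<eta>"
  have K: "K \<ge> 2" "8 / \<eta> \<le> K" using \<eta> by (auto simp: K_def)
  have K2: "4 / K\<^sup>2 \<le> \<eta> / 2"
  proof -
    have "8 \<le> \<eta> * K" using K \<eta> by (simp add: field_simps)
    also have "\<dots> \<le> \<eta> * K\<^sup>2" using K \<eta> by (intro mult_left_mono) (auto simp: power2_eq_square)
    finally show ?thesis using K by (simp add: field_simps)
  qed
  have K0: "K > 0" using K by simp
  have "(\<lambda>n. 2 * (K * sqrt (real n)) ^ 3 / (\<epsilon> * real n)\<^sup>2 + 2 * (K * sqrt (real n)) / (\<epsilon> * real n)) \<longlonglongrightarrow> 0"
    using \<epsilon> K0 by real_asymp
  then have "\<forall>\<^sub>F n in sequentially. 2 * (K * sqrt (real n)) ^ 3 / (\<epsilon> * real n)\<^sup>2 + 2 * (K * sqrt (real n)) / (\<epsilon> * real n) < \<eta> / 2"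
    by (rule order_tendstoD) (use \<eta> in auto)
  moreover have "\<forall>\<^sub>F n in sequentially. 2 * (K * sqrt (real n)) \<le> \<epsilon> * real n"
    using \<epsilon> K0 by real_asymp
  ultimately show ?thesis using eventually_ge_at_top[of 1]
  proof eventually_elim
    case (elim n)
    show ?case
    proof (intro allI impI)
      fix A :: "nat set" and a :: nat
      assume A: "finite A" "card A \<le> n" and a: "\<epsilon> * real n \<le> real a"
      have n0: "\<epsilon> * real n > 0" using \<epsilon> elim by simp
      then have a0: "a > 0" using a by simp
      define L where "L = K * sqrt (real n)"
      have L: "L \<ge> 2" using K elim mult_mono[of 2 K 1 "sqrt (real n)"] by (simp add: L_def)
      have La: "2 * L \<le> a" using elim a by (simp add: L_def)
      have tsq: "integrable Om (\<lambda>x. (tau A x)\<^sup>2)" by (rule integrable_tau_power[OF A(1)])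
      have abs_diff_le: "\<bar>wt a (tau A x - 1) - exp (- (tau A x)\<^sup>2 / (2 * real a))\<bar> \<le> 2" for x
      proof -
        have "exp (- (tau A x)\<^sup>2 / (2 * real a)) \<le> 1" by simp
        then show ?thesis
          using wt_le_1[OF a0, of "tau A x - 1"] wt_nonneg[of a "tau A x - 1"] exp_ge_zero[of "- (tau A x)\<^sup>2 / (2 * real a)"]
          unfolding abs_le_iff by linarith
      qed
      have "(LINT x|Om. \<bar>wt a (tau A x - 1) - exp (- (tau A x)\<^sup>2 / (2 * real a))\<bar>)
        \<le> (LINT x|Om. (2 * L ^ 3 / (real a)\<^sup>2 + 2 * L / a) + 4 * (tau A x)\<^sup>2 / L\<^sup>2)"
      proof (rule integral_mono)
        show "integrable Om (\<lambda>x. \<bar>wt a (tau A x - 1) - exp (- (tau A x)\<^sup>2 / (2 * real a))\<bar>)"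
          by (rule Om.integrable_const_bound[where B = 2])
            (use abs_diff_le in auto)
        show "integrable Om (\<lambda>x. (2 * L ^ 3 / (real a)\<^sup>2 + 2 * L / a) + 4 * (tau A x)\<^sup>2 / L\<^sup>2)"
          using tsq by simp
      qed (rule wt_approx_shift[OF a0 L La])
      also have "\<dots> = 2 * L ^ 3 / (real a)\<^sup>2 + 2 * L / a + 4 * card A / L\<^sup>2"
        using tsq integral_tau_square[OF A(1)] by simp
      also have "\<dots> \<le> 2 * L ^ 3 / (\<epsilon> * real n)\<^sup>2 + 2 * L / (\<epsilon> * real n) + 4 * n / L\<^sup>2"
        using A a n0 a0 L \<epsilon> elim by (intro add_mono divide_left_mono divide_right_mono power_mono mult_left_mono mult_pos_pos) auto
      also have "4 * n / L\<^sup>2 = 4 / K\<^sup>2"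
        using elim by (simp add: L_def power_mult_distrib)
      finally show "(LINT x|Om. \<bar>wt a (tau A x - 1) - exp (- (tau A x)\<^sup>2 / (2 * real a))\<bar>) \<le> \<eta>"
        using elim K2 by (simp add: L_def)
    qed
  qed
qed

text \<open>Jensen's inequality by way of the tangent of exp at the mean exponent, the second moment
  of \<open>tau A\<close> being card A.\<close>

lemma gauss_tau_lower:
  assumes "finite A" "a > 0"
  shows "exp (- real (card A) / (2 * real a)) \<le> (LINT x|Om. exp (- (tau A x)\<^sup>2 / (2 * real a)))"
proof -
  let ?m = "- real (card A) / (2 * real a)"
  have tsq: "integrable Om (\<lambda>x. (tau A x)\<^sup>2)" by (rule integrable_tau_power[OF assms(1)])
  have "exp ?m = (LINT x|Om. exp ?m * (1 + (- (tau A x)\<^sup>2 / (2 * real a) - ?m)))"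
    using tsq integral_tau_square[OF assms(1)] by simp
  also have "\<dots> \<le> (LINT x|Om. exp (- (tau A x)\<^sup>2 / (2 * real a)))"
  proof (rule integral_mono)
    show "integrable Om (\<lambda>x. exp ?m * (1 + (- (tau A x)\<^sup>2 / (2 * real a) - ?m)))" using tsq by simp
    show "integrable Om (\<lambda>x. exp (- (tau A x)\<^sup>2 / (2 * real a)))"
      by (rule Om.integrable_const_bound[where B = 1]) auto
    fix x
    have "exp ?m * (1 + (- (tau A x)\<^sup>2 / (2 * real a) - ?m)) \<le> exp ?m * exp (- (tau A x)\<^sup>2 / (2 * real a) - ?m)"
      by (intro mult_left_mono exp_ge_add_one_self) auto
    then show "exp ?m * (1 + (- (tau A x)\<^sup>2 / (2 * real a) - ?m)) \<le> exp (- (tau A x)\<^sup>2 / (2 * real a))"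
      by (simp flip: exp_add)
  qed
  finally show ?thesis .
qed

end

section \<open>The joint law of the spacings\<close>

text \<open>A finite sample supplies only the coordinates in \<open>I\<close>; filling up with zeros
  makes it a point of the sequence space, and functions depending on \<open>I\<close> do not
  notice.\<close>

definition clip :: "nat set \<Rightarrow> (nat \<Rightarrow> real) \<Rightarrow> (nat \<Rightarrow> real)" where
  "clip I x = (\<lambda>i. if i \<in> I then x i else 0)"

lemma dep_clip: "dep I f \<Longrightarrow> f (clip I x) = f x"
  by (erule depD) (auto simp: clip_def)

lemma measurable_fun_upd_seq [measurable]:
  fixes x :: "nat \<Rightarrow> real"
  shows "(\<lambda>z. x(i := z)) \<in> measurable borel (Pi\<^sub>M UNIV (\<lambda>_. borel))"
  by (rule measurable_PiM_single') (auto simp: space_PiM fun_upd_def)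

lemma measurable_clip:
  assumes "\<And>i. i \<in> I \<Longrightarrow> V i \<in> borel_measurable M"
  shows "(\<lambda>\<omega>. clip I (\<lambda>i. V i \<omega>)) \<in> measurable M (Pi\<^sub>M UNIV (\<lambda>_. borel))"
  unfolding clip_def
proof (rule measurable_PiM_single')
  fix i show "(\<lambda>\<omega>. if i \<in> I then V i \<omega> else 0) \<in> borel_measurable M"
    using assms by (cases "i \<in> I") auto
qed (auto simp: space_PiM)

context iid_coordinates
begin

lemma nn_integral_permute:
  assumes \<pi>: "bij \<pi>" and [measurable]: "f \<in> borel_measurable Om"
  shows "(\<integral>\<^sup>+ x. f (\<lambda>i. x (\<pi> i)) \<partial>Om) = (\<integral>\<^sup>+ x. f x \<partial>Om)"
proof -
  have d: "distr Om Om (\<lambda>x i. x (\<pi> i)) = Om"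
    using distr_PiM_reindex[of UNIV "\<lambda>_. \<mu>" \<pi> UNIV] bij_is_inj[OF \<pi>] prob_space_axioms
    by (simp add: Om_def restrict_def)
  have [measurable]: "(\<lambda>x i. x (\<pi> i)) \<in> measurable Om Om"
    unfolding measurable_cong_sets[OF refl sets_Om]
    by (rule measurable_PiM_single') (auto simp: space_PiM)
  show ?thesis
    by (subst (2) d[symmetric]) (simp add: nn_integral_distr)
qed

lemma distr_coord: "distr Om \<mu> (\<lambda>x. x i) = \<mu>"
  unfolding Om_def by (intro prod.PiM_component) auto

lemma measurable_fun_upd_Om [measurable]: "(\<lambda>z. x(i := z)) \<in> measurable borel Om"
  unfolding measurable_cong_sets[OF refl sets_Om] by (rule measurable_fun_upd_seq)

text \<open>The points \<open>mix A x y\<close> and \<open>x(i := y i)\<close> agree on all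
  coordinates that \<open>f\<close> sees, so only one fresh coordinate has to be integrated.\<close>

lemma nn_integral_coord:
  assumes [measurable]: "f \<in> borel_measurable Om" and f: "dep (insert i A) f" and i: "i \<notin> A"
  shows "(\<integral>\<^sup>+ x. f x \<partial>Om) = (\<integral>\<^sup>+ x. (\<integral>\<^sup>+ z. f (x(i := z)) \<partial>\<mu>) \<partial>Om)"
proof -
  have "(\<integral>\<^sup>+ y. f (mix A x y) \<partial>Om) = (\<integral>\<^sup>+ z. f (x(i := z)) \<partial>\<mu>)" for x
  proof -
    have "f (mix A x y) = f (x(i := y i))" for y
      using i by (intro depD[OF f]) (auto simp: mix_def)
    then have "(\<integral>\<^sup>+ y. f (mix A x y) \<partial>Om) = (\<integral>\<^sup>+ y. f (x(i := y i)) \<partial>Om)" by simp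
    also have "\<dots> = (\<integral>\<^sup>+ z. f (x(i := z)) \<partial>distr Om \<mu> (\<lambda>x. x i))"
      by (subst nn_integral_distr) auto
    finally show ?thesis by (simp add: distr_coord)
  qed
  then show ?thesis by (simp add: nn_integral_mix[of f A, symmetric])
qed

lemma nn_integral_coord_any:
  assumes "f \<in> borel_measurable Om"
  shows "(\<integral>\<^sup>+ x. f x \<partial>Om) = (\<integral>\<^sup>+ x. (\<integral>\<^sup>+ z. f (x(i := z)) \<partial>\<mu>) \<partial>Om)"
proof (rule nn_integral_coord[OF assms, where A = "- {i}"])
  have "insert i (- {i}) = UNIV" by auto
  then show "dep (insert i (- {i})) f" by (auto simp: dep_def intro: arg_cong[where f = f])
qed simp

lemma distr_sample:
  assumes M: "prob_space M" and ind: "prob_space.indep_vars M (\<lambda>_. borel) V I"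
    and I: "finite I" "I \<noteq> {}" and V: "\<And>i. i \<in> I \<Longrightarrow> distr M borel (V i) = \<mu>"
  shows "distr M Om (\<lambda>\<omega>. clip I (\<lambda>i. V i \<omega>)) = distr Om Om (clip I)"
proof -
  interpret M: prob_space M by fact
  have rv: "V i \<in> borel_measurable M" if "i \<in> I" for i
    using ind that by (auto simp: M.indep_vars_def)
  have "distr M (Pi\<^sub>M I (\<lambda>_. borel)) (\<lambda>\<omega>. \<lambda>i\<in>I. V i \<omega>) = Pi\<^sub>M I (\<lambda>i. distr M borel (V i))"
    using M.indep_vars_iff_distr_eq_PiM'[where M' = "\<lambda>_. borel", OF I(2) rv] ind by simp
  also have "\<dots> = Pi\<^sub>M I (\<lambda>_. \<mu>)" by (intro PiM_cong) (auto simp: V)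
  also have "\<dots> = distr Om (Pi\<^sub>M I (\<lambda>_. \<mu>)) (\<lambda>x. restrict x I)"
    using prod.distr_PiM_restrict_finite[of I] I by (simp add: Om_def)
  also have "\<dots> = distr Om (Pi\<^sub>M I (\<lambda>_. borel)) (\<lambda>x. restrict x I)"
    by (intro distr_cong sets_PiM_cong) auto
  finally have eq: "distr M (Pi\<^sub>M I (\<lambda>_. borel)) (\<lambda>\<omega>. \<lambda>i\<in>I. V i \<omega>) = distr Om (Pi\<^sub>M I (\<lambda>_. borel)) (\<lambda>x. restrict x I)" .
  have c: "clip I \<in> measurable (Pi\<^sub>M I (\<lambda>_. borel)) Om"
    unfolding measurable_cong_sets[OF refl sets_Om]
    using measurable_clip[of I "\<lambda>i x. x i" "Pi\<^sub>M I (\<lambda>_. borel)"] by auto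
  have mV: "(\<lambda>\<omega>. \<lambda>i\<in>I. V i \<omega>) \<in> measurable M (Pi\<^sub>M I (\<lambda>_. borel))"
    using rv by (rule measurable_restrict)
  have mr: "(\<lambda>x. restrict x I) \<in> measurable Om (Pi\<^sub>M I (\<lambda>_. borel))"
    by (rule measurable_restrict) auto
  have "distr M Om (\<lambda>\<omega>. clip I (\<lambda>i. V i \<omega>)) = distr (distr M (Pi\<^sub>M I (\<lambda>_. borel)) (\<lambda>\<omega>. \<lambda>i\<in>I. V i \<omega>)) Om (clip I)"
    by (subst distr_distr[OF c mV]) (auto intro!: distr_cong simp: clip_def comp_def fun_eq_iff)
  also have "\<dots> = distr Om Om (clip I)"
    unfolding eq by (subst distr_distr[OF c mr]) (auto intro!: distr_cong simp: clip_def comp_def fun_eq_iff)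
  finally show ?thesis .
qed

lemma clip_measurable [measurable]: "clip I \<in> measurable Om Om"
  using measurable_clip[of I "\<lambda>i x. x i" Om] by (simp add: measurable_cong_sets[OF refl sets_Om])

text \<open>Moves integrals over a finite independent family on an arbitrary probability space to
  the coordinate space.\<close>

lemma
  assumes M: "prob_space M" and ind: "prob_space.indep_vars M (\<lambda>_. borel) V I"
    and I: "finite I" "I \<noteq> {}" and V: "\<And>i. i \<in> I \<Longrightarrow> distr M borel (V i) = \<mu>"
  shows nn_integral_sample: "\<And>g :: _ \<Rightarrow> ennreal. g \<in> borel_measurable Om \<Longrightarrow> dep I g \<Longrightarrow>
        (\<integral>\<^sup>+ \<omega>. g (\<lambda>i. V i \<omega>) \<partial>M) = (\<integral>\<^sup>+ x. g x \<partial>Om)"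
    and integral_sample: "\<And>f :: _ \<Rightarrow> real. f \<in> borel_measurable Om \<Longrightarrow> dep I f \<Longrightarrow>
        (LINT \<omega>|M. f (\<lambda>i. V i \<omega>)) = (LINT x|Om. f x)"
    and integrable_sample: "\<And>f :: _ \<Rightarrow> real. f \<in> borel_measurable Om \<Longrightarrow> dep I f \<Longrightarrow>
        integrable M (\<lambda>\<omega>. f (\<lambda>i. V i \<omega>)) \<longleftrightarrow> integrable Om f"
    and measurable_sample: "\<And>f :: _ \<Rightarrow> real. f \<in> borel_measurable Om \<Longrightarrow> dep I f \<Longrightarrow>
        (\<lambda>\<omega>. f (\<lambda>i. V i \<omega>)) \<in> borel_measurable M"
proof -
  interpret M: prob_space M by fact
  have rv: "V i \<in> borel_measurable M" if "i \<in> I" for i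
    using ind that by (auto simp: M.indep_vars_def)
  have c [measurable]: "(\<lambda>\<omega>. clip I (\<lambda>i. V i \<omega>)) \<in> measurable M Om"
    using measurable_clip[OF rv] by (simp add: measurable_cong_sets[OF refl sets_Om])
  note d = distr_sample[OF assms]
  {
    fix g :: "(nat \<Rightarrow> real) \<Rightarrow> ennreal" assume [measurable]: "g \<in> borel_measurable Om" and g: "dep I g"
    show "(\<integral>\<^sup>+ \<omega>. g (\<lambda>i. V i \<omega>) \<partial>M) = (\<integral>\<^sup>+ x. g x \<partial>Om)"
      using arg_cong[OF d, of "\<lambda>D. nn_integral D g"] by (simp add: nn_integral_distr dep_clip[OF g])
  next
    fix f :: "(nat \<Rightarrow> real) \<Rightarrow> real" assume [measurable]: "f \<in> borel_measurable Om" and f: "dep I f"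
    show "(LINT \<omega>|M. f (\<lambda>i. V i \<omega>)) = (LINT x|Om. f x)"
      using arg_cong[OF d, of "\<lambda>D. integral\<^sup>L D f"] by (simp add: integral_distr dep_clip[OF f])
    show "integrable M (\<lambda>\<omega>. f (\<lambda>i. V i \<omega>)) \<longleftrightarrow> integrable Om f"
      using arg_cong[OF d, of "\<lambda>D. integrable D f"] by (simp add: integrable_distr_eq dep_clip[OF f])
    show "(\<lambda>\<omega>. f (\<lambda>i. V i \<omega>)) \<in> borel_measurable M"
      using measurable_compose[OF c, of f borel] by (simp add: dep_clip[OF f])
  }
qed

end

section \<open>Order statistics of a uniform sample\<close>

definition inc :: "nat \<Rightarrow> (nat \<Rightarrow> real) \<Rightarrow> bool" where
  "inc N v \<longleftrightarrow> (\<forall>i<N. (if i = 0 then 0 else v (i - 1)) < v i \<and> v i < 1)"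

lemma dep_inc: "dep {..<N} (inc N)"
  unfolding dep_def inc_def by auto

lemma inc_Suc: "inc (Suc N) v \<longleftrightarrow> inc N v \<and> (if N = 0 then 0 else v (N - 1)) < v N \<and> v N < 1"
  unfolding inc_def by (auto simp: less_Suc_eq)

lemma inc_iff:
  assumes "\<And>i. i < N \<Longrightarrow> 0 < v i \<and> v i < 1"
  shows "inc N v \<longleftrightarrow> sorted_wrt (<) (map v [0..<N])"
proof
  assume "inc N v"
  then have "v i < v (Suc i)" if "Suc i < N" for i
    using that unfolding inc_def by (auto dest: spec[of _ "Suc i"])
  then show "sorted_wrt (<) (map v [0..<N])"
    by (subst sorted_wrt_iff_nth_Suc_transp) (auto simp: transp_def)
next
  assume s: "sorted_wrt (<) (map v [0..<N])"
  show "inc N v"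
    unfolding inc_def
  proof (intro allI impI)
    fix i assume i: "i < N"
    have "v (i - 1) < v i" if "i \<noteq> 0"
      using sorted_wrt_nth_less[OF s, of "i - 1" i] i that by simp
    then show "(if i = 0 then 0 else v (i - 1)) < v i \<and> v i < 1"
      using assms[OF i] by auto
  qed
qed

text \<open>Distinct values are brought into increasing order by exactly one permutation, so all
  terms but one vanish and the remaining one evaluates \<open>F\<close> at the sorted
  vector.\<close>

lemma sum_permutations_inc:
  fixes F :: "(nat \<Rightarrow> real) \<Rightarrow> ennreal"
  assumes inj: "inj_on v {..<N}" and range: "\<And>i. i < N \<Longrightarrow> 0 < v i \<and> v i < 1"
    and F: "dep {..<N} F"
  shows "(\<Sum>\<pi> | \<pi> permutes {..<N}. indicator {v. inc N v} (\<lambda>i. v (\<pi> i)) * F (\<lambda>i. v (\<pi> i)))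
    = F (\<lambda>i. sort (map v [0..<N]) ! i)"
proof -
  define xs where "xs = map v [0..<N]"
  have mset_perm: "mset (map (\<lambda>i. v (\<pi> i)) [0..<N]) = mset xs" if \<pi>: "\<pi> permutes {..<N}" for \<pi>
  proof -
    have "map (\<lambda>i. v (\<pi> i)) [0..<N] = permute_list \<pi> xs"
      using permutes_in_image[OF \<pi>] by (auto simp: permute_list_def xs_def)
    then show ?thesis using \<pi> by (simp add: xs_def)
  qed
  have inc_eq: "inc N (\<lambda>i. v (\<pi> i)) \<longleftrightarrow> sort xs = map (\<lambda>i. v (\<pi> i)) [0..<N]" if \<pi>: "\<pi> permutes {..<N}" for \<pi>
  proof -
    have r: "0 < v (\<pi> i) \<and> v (\<pi> i) < 1" if "i < N" for i
      using range permutes_in_image[OF \<pi>, of i] that by auto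
    have d: "distinct (map (\<lambda>i. v (\<pi> i)) [0..<N])"
    proof -
      have "distinct xs" using inj by (simp add: xs_def distinct_map atLeast0LessThan)
      then show ?thesis using mset_perm[OF \<pi>] by (metis mset_eq_imp_distinct_iff)
    qed
    have ii: "inc N (\<lambda>i. v (\<pi> i)) \<longleftrightarrow> sorted_wrt (<) (map (\<lambda>i. v (\<pi> i)) [0..<N])"
      by (rule inc_iff) (rule r)
    show ?thesis
    proof (subst ii, rule iffI)
      assume "sorted_wrt (<) (map (\<lambda>i. v (\<pi> i)) [0..<N])"
      then show "sort xs = map (\<lambda>i. v (\<pi> i)) [0..<N]"
        using mset_perm[OF \<pi>] by (intro properties_for_sort) (auto simp: strict_sorted_iff)
    next
      assume "sort xs = map (\<lambda>i. v (\<pi> i)) [0..<N]"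
      then show "sorted_wrt (<) (map (\<lambda>i. v (\<pi> i)) [0..<N])"
        using d sorted_sort[of xs] by (simp add: strict_sorted_iff)
    qed
  qed
  obtain \<pi>0 where \<pi>0: "\<pi>0 permutes {..<N}" "permute_list \<pi>0 xs = sort xs"
    using mset_eq_permutation[of "sort xs" xs] by (auto simp: xs_def)
  have s0: "sort xs = map (\<lambda>i. v (\<pi>0 i)) [0..<N]"
    using permutes_in_image[OF \<pi>0(1)] \<pi>0(2)[symmetric] by (auto simp: permute_list_def xs_def)
  have uniq: "\<pi> = \<pi>0" if \<pi>: "\<pi> permutes {..<N}" "inc N (\<lambda>i. v (\<pi> i))" for \<pi>
  proof
    fix i
    show "\<pi> i = \<pi>0 i"
    proof (cases "i < N")
      case True
      have "v (\<pi> i) = v (\<pi>0 i)"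
        using inc_eq[OF \<pi>(1)] \<pi>(2) s0 True by auto
      then show ?thesis
        using inj permutes_in_image[OF \<pi>(1), of i] permutes_in_image[OF \<pi>0(1), of i] True
        by (auto dest: inj_onD)
    next
      case False
      then show ?thesis using \<pi>(1) \<pi>0(1) by (simp add: permutes_not_in)
    qed
  qed
  have i0: "inc N (\<lambda>i. v (\<pi>0 i))" using inc_eq[OF \<pi>0(1)] s0 by simp
  have "(\<Sum>\<pi> | \<pi> permutes {..<N}. indicator {v. inc N v} (\<lambda>i. v (\<pi> i)) * F (\<lambda>i. v (\<pi> i)))
    = (\<Sum>\<pi> | \<pi> permutes {..<N}. if \<pi> = \<pi>0 then F (\<lambda>i. v (\<pi>0 i)) else 0)"
  proof (rule sum.cong[OF refl])
    fix \<pi> assume "\<pi> \<in> {\<pi>. \<pi> permutes {..<N}}"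
    then have \<pi>: "\<pi> permutes {..<N}" by simp
    show "indicator {v. inc N v} (\<lambda>i. v (\<pi> i)) * F (\<lambda>i. v (\<pi> i)) = (if \<pi> = \<pi>0 then F (\<lambda>i. v (\<pi>0 i)) else 0)"
    proof (cases "\<pi> = \<pi>0")
      case True
      then show ?thesis using i0 by simp
    next
      case False
      then have "\<not> inc N (\<lambda>i. v (\<pi> i))" using uniq[OF \<pi>] by blast
      then show ?thesis using False by simp
    qed
  qed
  also have "\<dots> = F (\<lambda>i. v (\<pi>0 i))"
    using \<pi>0(1) by (simp add: finite_permutations)
  also have "\<dots> = F (\<lambda>i. sort xs ! i)"
    by (rule depD[OF F]) (simp add: s0)
  finally show ?thesis by (simp add: xs_def)
qed

lemma uniform_real_distribution: "real_distribution (uniform_measure lborel {0..1::real})"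
proof -
  interpret prob_space "uniform_measure lborel {0..1::real}"
    by (rule prob_space_uniform_measure) auto
  show ?thesis by unfold_locales simp
qed

interpretation unif: iid_coordinates "uniform_measure lborel {0..1::real}"
  using uniform_real_distribution by (simp add: iid_coordinates_def)

lemma nn_integral_uniform:
  assumes [measurable]: "f \<in> borel_measurable borel"
  shows "(\<integral>\<^sup>+ z. f z \<partial>uniform_measure lborel {0..1::real}) = (\<integral>\<^sup>+ z. f z * indicator {0..1} z \<partial>lborel)"
proof -
  have "x / 1 = x" for x :: ennreal using ennreal_times_divide[of x 1 1] by simp
  then show ?thesis by (subst nn_integral_uniform_measure) auto
qed

lemma AE_unif_inj: "AE v in unif.Om. inj_on v {..<N} \<and> (\<forall>i<N. 0 < v i \<and> v i < 1)"
proof -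
  have ne: "AE v in unif.Om. v i \<noteq> v j" if "i \<noteq> j" for i j
  proof -
    have "Measurable.pred unif.Om (\<lambda>v. v i - v j = 0)" by measurable
    then have [measurable]: "Measurable.pred unif.Om (\<lambda>v. v i = v j)" by simp
    then have [measurable]: "{v. v i = v j} \<in> sets unif.Om" by (simp add: pred_def)
    have "(\<integral>\<^sup>+ v. indicator {v. v i = v j} v \<partial>unif.Om)
        = (\<integral>\<^sup>+ v. (\<integral>\<^sup>+ z. indicator {v. v i = v j} (v(i := z)) \<partial>uniform_measure lborel {0..1::real}) \<partial>unif.Om)"
      by (rule unif.nn_integral_coord_any) measurable
    also have "\<dots> = (\<integral>\<^sup>+ v. (\<integral>\<^sup>+ z. indicator {v j} z \<partial>uniform_measure lborel {0..1::real}) \<partial>unif.Om)"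
      using that by (intro nn_integral_cong) (auto simp: indicator_def)
    also have "\<dots> = 0"
      by (simp add: emeasure_uniform_measure emeasure_lborel_countable)
    finally have "emeasure unif.Om {v. v i = v j} = 0"
      by (subst (asm) nn_integral_indicator) auto
    then show ?thesis
      by (intro AE_I[of _ _ "{v. v i = v j}"]) auto
  qed
  have r: "AE v in unif.Om. 0 < v i \<and> v i < 1" for i
  proof -
    have "AE z in uniform_measure lborel {0..1::real}. 0 < z \<and> z < 1"
    proof (rule AE_I)
      show "emeasure (uniform_measure lborel {0..1::real}) (- {0<..<1}) = 0"
      proof -
        have "{0..1::real} \<inter> - {0<..<1} = {0, 1}" by auto
        then show ?thesis by (simp add: emeasure_uniform_measure emeasure_lborel_countable)
      qed
    qed auto
    then have "AE z in distr unif.Om (uniform_measure lborel {0..1::real}) (\<lambda>x. x i). 0 < z \<and> z < 1"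
      unfolding unif.distr_coord .
    then show ?thesis by (subst (asm) AE_distr_iff) auto
  qed
  have "AE v in unif.Om. \<forall>i\<in>{..<N}. \<forall>j\<in>{..<N}. i \<noteq> j \<longrightarrow> v i \<noteq> v j"
    using ne by (intro AE_finite_allI) auto
  moreover have "AE v in unif.Om. \<forall>i\<in>{..<N}. 0 < v i \<and> v i < 1"
    using r by (intro AE_finite_allI) auto
  ultimately show ?thesis by eventually_elim (auto simp: inj_on_def)
qed

lemma inc_measurable [measurable]: "Measurable.pred (Pi\<^sub>M UNIV (\<lambda>_. borel)) (inc N)"
proof (induction N)
  case 0
  have "inc 0 = (\<lambda>_. True)" by (simp add: inc_def fun_eq_iff)
  then show ?case by simp
next
  case (Suc N)
  note [measurable] = Suc
  have "inc (Suc N) = (\<lambda>v. inc N v \<and> (if N = 0 then 0 else v (N - 1)) < v N \<and> v N < 1)"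
    by (simp add: inc_Suc fun_eq_iff)
  moreover have "Measurable.pred (Pi\<^sub>M UNIV (\<lambda>_. borel))
      (\<lambda>v. inc N v \<and> (if N = 0 then 0 else v (N - 1)) < v N \<and> v N < (1 :: real))"
  proof -
    have c: "(\<lambda>v. v i) \<in> borel_measurable (Pi\<^sub>M UNIV (\<lambda>_. borel :: real measure))" for i :: nat
      by simp
    have p: "(\<lambda>v. if N = 0 then 0 else v (N - 1)) \<in> borel_measurable (Pi\<^sub>M UNIV (\<lambda>_. borel :: real measure))"
      by (cases "N = 0") (auto intro: c)
    show ?thesis
      by (intro pred_intros_logic Suc borel_measurable_pred_less p c borel_measurable_const)
  qed
  ultimately show ?case by simp
qed

lemma sets_inc: "{v. inc N v} \<in> sets (Pi\<^sub>M UNIV (\<lambda>_. borel))"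
  using inc_measurable[of N] by (simp add: pred_def space_PiM)

text \<open>Up to a null set the cube splits into N! chambers, one for each ordering. Permuting
  coordinates preserves the measure, so all chambers contribute the same integral.\<close>

lemma nn_integral_sorted:
  assumes Fm: "F \<in> borel_measurable (Pi\<^sub>M UNIV (\<lambda>_. borel))" and F: "dep {..<N} F"
  shows "(\<integral>\<^sup>+ v. F (\<lambda>i. sort (map v [0..<N]) ! i) \<partial>unif.Om)
    = fact N * (\<integral>\<^sup>+ v. indicator {v. inc N v} v * F v \<partial>unif.Om)"
proof -
  let ?G = "\<lambda>v. indicator {v. inc N v} v * F v"
  have G: "?G \<in> borel_measurable unif.Om"
    unfolding measurable_cong_sets[OF unif.sets_Om refl]
    using Fm by (intro borel_measurable_times_ennreal borel_measurable_indicator sets_inc)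
  have mp: "(\<lambda>v. ?G (\<lambda>i. v (\<pi> i))) \<in> borel_measurable unif.Om" for \<pi>
  proof (rule measurable_compose[OF _ G])
    show "(\<lambda>v i. v (\<pi> i)) \<in> measurable unif.Om unif.Om"
      unfolding measurable_cong_sets[OF refl unif.sets_Om]
      by (rule measurable_PiM_single') (auto simp: space_PiM)
  qed
  have "(\<integral>\<^sup>+ v. F (\<lambda>i. sort (map v [0..<N]) ! i) \<partial>unif.Om)
    = (\<integral>\<^sup>+ v. (\<Sum>\<pi> | \<pi> permutes {..<N}. ?G (\<lambda>i. v (\<pi> i))) \<partial>unif.Om)"
    using AE_unif_inj[of N]
    by (intro nn_integral_cong_AE, eventually_elim) (simp add: sum_permutations_inc[OF _ _ F])
  also have "\<dots> = (\<Sum>\<pi> | \<pi> permutes {..<N}. (\<integral>\<^sup>+ v. ?G (\<lambda>i. v (\<pi> i)) \<partial>unif.Om))"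
    using mp by (rule nn_integral_sum)
  also have "\<dots> = (\<Sum>\<pi> | \<pi> permutes {..<N}. (\<integral>\<^sup>+ v. ?G v \<partial>unif.Om))"
  proof (rule sum.cong[OF refl])
    fix \<pi> assume "\<pi> \<in> {\<pi>. \<pi> permutes {..<N}}"
    then have "bij \<pi>" by (simp add: permutes_bij)
    from unif.nn_integral_permute[OF this G]
    show "(\<integral>\<^sup>+ v. ?G (\<lambda>i. v (\<pi> i)) \<partial>unif.Om) = (\<integral>\<^sup>+ v. ?G v \<partial>unif.Om)" .
  qed
  finally show ?thesis
    by (simp only: sum_constant card_permutations[OF card_lessThan finite_lessThan] of_nat_fact)
qed

abbreviation seqM :: "(nat \<Rightarrow> real) measure" where
  "seqM \<equiv> Pi\<^sub>M UNIV (\<lambda>_. borel)"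

lemma measurable_seqI:
  assumes "\<And>i. (\<lambda>\<omega>. f \<omega> i) \<in> borel_measurable M"
  shows "f \<in> measurable M seqM"
  using assms by (intro measurable_PiM_single') (auto simp: space_PiM)

lemma measurable_seq_coord: "(\<lambda>x. x i) \<in> borel_measurable seqM"
  by simp

lemma measurable_fun_upd_pair:
  assumes "f \<in> measurable M seqM" "g \<in> borel_measurable M"
  shows "(\<lambda>\<omega>. (f \<omega>)(i := g \<omega>)) \<in> measurable M seqM"
proof (rule measurable_seqI)
  fix j show "(\<lambda>\<omega>. ((f \<omega>)(i := g \<omega>)) j) \<in> borel_measurable M"
    using assms(2) measurable_compose[OF assms(1) measurable_seq_coord[of j]]
    by (cases "j = i") auto
qed

lemma sorted_nth_le_iff:
  fixes xs :: "real list"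
  assumes "sorted xs" "i < length xs"
  shows "xs ! i \<le> c \<longleftrightarrow> i < length (filter (\<lambda>x. x \<le> c) xs)"
  using assms
proof (induction xs arbitrary: i)
  case (Cons x xs)
  show ?case
  proof (cases "x \<le> c")
    case True
    then show ?thesis using Cons by (cases i) auto
  next
    case False
    then have "filter (\<lambda>x. x \<le> c) xs = []" using Cons.prems by (auto simp: filter_empty_conv)
    moreover have "x \<le> (x # xs) ! i" using Cons.prems by (cases i) auto
    ultimately show ?thesis using False by auto
  qed
qed simp

text \<open>The entry with index i (counted from 0) is at most c exactly if more than i of the
  values are; that count is a sum of measurable indicators.\<close>

lemma measurable_sort_nth:
  assumes i: "i < N"
  shows "(\<lambda>v. sort (map v [0..<N]) ! i) \<in> borel_measurable seqM"
proof (rule borel_measurable_iff_le[THEN iffD2], rule allI)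
  fix c :: real
  have "sort (map v [0..<N]) ! i \<le> c \<longleftrightarrow> real i < (\<Sum>j<N. indicator {..c} (v j))" for v
  proof -
    have "length (filter (\<lambda>x. x \<le> c) (sort (map v [0..<N]))) = length (filter (\<lambda>x. x \<le> c) (map v [0..<N]))"
      by (metis mset_filter mset_sort size_mset)
    also have "\<dots> = card {j. j < N \<and> v j \<le> c}"
      by (simp add: filter_map comp_def length_filter_conv_card cong: conj_cong)
    finally have "sort (map v [0..<N]) ! i \<le> c \<longleftrightarrow> i < card {j. j < N \<and> v j \<le> c}"
      using i by (subst sorted_nth_le_iff) auto
    have card_eq: "real (card {j. j < N \<and> v j \<le> c}) = (\<Sum>j<N. indicator {..c} (v j))"
    proof -
      have "{j. j < N \<and> v j \<le> c} = {j \<in> {..<N}. v j \<le> c}" by auto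
      then have "real (card {j. j < N \<and> v j \<le> c}) = (\<Sum>j \<in> {j \<in> {..<N}. v j \<le> c}. 1)" by simp
      also have "\<dots> = (\<Sum>j<N. if v j \<le> c then 1 else 0)" by (rule sum.inter_filter) simp
      also have "\<dots> = (\<Sum>j<N. indicator {..c} (v j))" by (intro sum.cong) (auto simp: indicator_def)
      finally show ?thesis .
    qed
    with \<open>sort (map v [0..<N]) ! i \<le> c \<longleftrightarrow> i < card {j. j < N \<and> v j \<le> c}\<close> have "sort (map v [0..<N]) ! i \<le> c \<longleftrightarrow> real i < (\<Sum>j<N. indicator {..c} (v j))"
      unfolding card_eq[symmetric] by simp
    then show ?thesis .
  qed
  moreover have "(\<lambda>v. \<Sum>j<N. indicator {..c} (v j) :: real) \<in> borel_measurable seqM"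
    by (intro borel_measurable_sum measurable_compose[OF measurable_seq_coord]) simp
  then have "{v \<in> space seqM. real i < (\<Sum>j<N. indicator {..c} (v j))} \<in> sets seqM"
    by (intro borel_measurable_less) auto
  ultimately show "{v \<in> space seqM. sort (map v [0..<N]) ! i \<le> c} \<in> sets seqM"
    by simp
qed

section \<open>From increasing vectors to partial sums of exponential variables\<close>

definition psum :: "nat \<Rightarrow> (nat \<Rightarrow> real) \<Rightarrow> real" where
  "psum k x = (\<Sum>i<k. x i)"

definition osimplex :: "nat \<Rightarrow> real \<Rightarrow> (nat \<Rightarrow> real) set" where
  "osimplex N c = {x. (\<forall>i<N. 0 < x i) \<and> psum N x < c}"

lemma psum_Suc_upd: "psum (Suc N) (x(N := z)) = psum N x + z"
  by (simp add: psum_def)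

lemma psum_upd_ge: "k \<le> N \<Longrightarrow> psum k (x(N := z)) = psum k x"
  by (simp add: psum_def)

lemma measurable_psum: "psum k \<in> borel_measurable seqM"
  unfolding psum_def by (intro borel_measurable_sum measurable_seq_coord)

lemma sets_osimplex: "osimplex N c \<in> sets seqM"
proof -
  have "{x \<in> space seqM. 0 < x i} \<in> sets seqM" for i
    by (intro borel_measurable_less borel_measurable_const measurable_seq_coord)
  moreover have "{x \<in> space seqM. psum N x < c} \<in> sets seqM"
    by (intro borel_measurable_less borel_measurable_const measurable_psum)
  moreover have "osimplex N c = (\<Inter>i\<in>{..<N}. {x \<in> space seqM. 0 < x i}) \<inter> {x \<in> space seqM. psum N x < c}"
    by (auto simp: osimplex_def space_PiM)
  ultimately show ?thesis
    by (cases "N = 0") (auto intro!: sets.Int sets.finite_INT)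
qed

lemma measurable_osimplex_integrand:
  assumes Hm: "H \<in> borel_measurable seqM"
  shows "(\<lambda>x. ennreal (exp (psum N x)) * indicator (osimplex N c) x * H (\<lambda>i. psum (Suc i) x / n)) \<in> borel_measurable seqM"
proof (intro borel_measurable_times_ennreal borel_measurable_indicator sets_osimplex)
  show "(\<lambda>x. ennreal (exp (psum N x))) \<in> borel_measurable seqM"
    using measurable_psum[of N] by simp
  show "(\<lambda>x. H (\<lambda>i. psum (Suc i) x / n)) \<in> borel_measurable seqM"
    by (intro measurable_compose[OF measurable_seqI Hm] borel_measurable_divide measurable_psum borel_measurable_const)
qed

context exp_coordinates
begin

lemma seqM_Om: "measurable Om M = measurable seqM M"
  by (rule measurable_cong_sets[OF sets_Om refl])

lemma seqM_Om': "measurable M Om = measurable M seqM"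
  by (rule measurable_cong_sets[OF refl sets_Om])

lemma nn_integral_exp_dist:
  assumes "f \<in> borel_measurable borel"
  shows "(\<integral>\<^sup>+ z. f z \<partial>exp_dist) = (\<integral>\<^sup>+ z. ennreal (exponential_density 1 z) * f z \<partial>lborel)"
  unfolding exp_dist_def using assms by (subst nn_integral_density) auto

lemma exp_density_cancel:
  assumes "z > 0"
  shows "ennreal (exponential_density 1 z) * ennreal (exp (s + z)) = ennreal (exp s)"
  using assms by (simp add: exponential_density_def flip: ennreal_mult exp_add)

text \<open>The substitution v_i = (x_0 + ... + x_i) / n maps the simplex onto the increasing
  vectors with Jacobian n^(-N). It is carried out one coordinate at a time. The factor
  \<open>exp (psum N x)\<close> cancels the exponential density, so the integral over
  \<open>Om\<close> is in effect a Lebesgue integral.\<close>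

lemma nn_integral_inc_eq:
  assumes n: "n > 0" and Hm: "H \<in> borel_measurable seqM" and H: "dep {..<N} H"
  shows "(\<integral>\<^sup>+ v. indicator {v. inc N v} v * H v \<partial>unif.Om)
    = ennreal (1 / n) ^ N * (\<integral>\<^sup>+ x. ennreal (exp (psum N x)) * indicator (osimplex N n) x * H (\<lambda>i. psum (Suc i) x / n) \<partial>Om)"
  using Hm H
proof (induction N arbitrary: H)
  case 0
  have "H v = H (\<lambda>_. 0)" for v by (rule depD[OF 0(2)]) simp
  then have "H = (\<lambda>_. H (\<lambda>_. 0))" by auto
  then obtain c where c: "H = (\<lambda>_. c)" by blast
  show ?case using n
    by (simp add: c inc_def psum_def osimplex_def Om.emeasure_space_1[simplified] unif.Om.emeasure_space_1[simplified])
next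
  case (Suc N)
  define prev where "prev v = (if N = 0 then 0 else v (N - 1))" for v :: "nat \<Rightarrow> real"
  have pm: "prev \<in> borel_measurable seqM"
    unfolding prev_def by (cases "N = 0") auto
  \<comment> \<open>The last coordinate is integrated out between its predecessor and 1, which
    leaves a function of the first \<open>N\<close> coordinates for the induction
    hypothesis.\<close>
  define H' where "H' v = (\<integral>\<^sup>+ y. indicator {prev v<..<1} y * H (v(N := y)) \<partial>lborel)" for v
  have Hu: "(\<lambda>y. H (v(N := y))) \<in> borel_measurable borel" for v
    using measurable_compose[OF measurable_fun_upd_seq Suc.prems(1)] .
  have H'm: "H' \<in> borel_measurable seqM"
  proof -
    have "(\<lambda>(v, y). indicator {prev v<..<1} y * H (v(N := y))) \<in> borel_measurable (seqM \<Otimes>\<^sub>M lborel)"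
    proof -
      have [measurable]: "(\<lambda>p. prev (fst p)) \<in> borel_measurable (seqM \<Otimes>\<^sub>M lborel)"
        by (rule measurable_compose[OF measurable_fst pm])
      have [measurable]: "(\<lambda>p. snd p) \<in> borel_measurable (seqM \<Otimes>\<^sub>M lborel)"
        using measurable_snd[of seqM lborel] by (simp add: measurable_lborel1)
      have [measurable]: "(\<lambda>p. H ((fst p)(N := snd p))) \<in> borel_measurable (seqM \<Otimes>\<^sub>M lborel)"
        by (rule measurable_compose[OF measurable_fun_upd_pair Suc.prems(1)]) (auto intro: measurable_fst)
      have "(\<lambda>p. (if prev (fst p) < snd p \<and> snd p < 1 then 1 else 0) * H ((fst p)(N := snd p))) \<in> borel_measurable (seqM \<Otimes>\<^sub>M lborel)"
        by measurable
      then show ?thesis by (simp add: split_beta' indicator_def)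
    qed
    then show ?thesis unfolding H'_def by (rule lborel.borel_measurable_nn_integral)
  qed
  have H'd: "dep {..<N} H'"
    unfolding dep_def
  proof (intro allI impI)
    fix x y :: "nat \<Rightarrow> real" assume xy: "\<forall>i\<in>{..<N}. x i = y i"
    have "prev x = prev y" using xy by (simp add: prev_def)
    moreover have "H (x(N := z)) = H (y(N := z))" for z
      using xy by (intro depD[OF Suc.prems(2)]) auto
    ultimately show "H' x = H' y" by (simp add: H'_def)
  qed
  have "(\<integral>\<^sup>+ v. indicator {v. inc (Suc N) v} v * H v \<partial>unif.Om)
    = (\<integral>\<^sup>+ v. (\<integral>\<^sup>+ y. indicator {v. inc (Suc N) v} (v(N := y)) * H (v(N := y)) \<partial>uniform_measure lborel {0..1::real}) \<partial>unif.Om)"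
  proof (rule unif.nn_integral_coord_any)
    show "(\<lambda>v. indicator {v. inc (Suc N) v} v * H v) \<in> borel_measurable unif.Om"
      unfolding measurable_cong_sets[OF unif.sets_Om refl]
      using Suc.prems by (intro borel_measurable_times_ennreal borel_measurable_indicator sets_inc)
  qed
  also have "\<dots> = (\<integral>\<^sup>+ v. indicator {v. inc N v} v * H' v \<partial>unif.Om)"
  proof (rule nn_integral_cong)
    fix v
    have incN: "inc N (v(N := y)) \<longleftrightarrow> inc N v" for y
      by (rule depD[OF dep_inc]) simp
    have prev_upd: "(if N = 0 then 0 else (v(N := y)) (N - 1)) = prev v" for y by (cases N) (auto simp: prev_def)
    have "(\<integral>\<^sup>+ y. indicator {v. inc (Suc N) v} (v(N := y)) * H (v(N := y)) \<partial>uniform_measure lborel {0..1::real})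
      = (\<integral>\<^sup>+ y. indicator {v. inc (Suc N) v} (v(N := y)) * H (v(N := y)) * indicator {0..1} y \<partial>lborel)"
    proof (rule nn_integral_uniform)
      have "(\<lambda>v. indicator {v. inc (Suc N) v} v * H v) \<in> borel_measurable seqM"
        using Suc.prems by (intro borel_measurable_times_ennreal borel_measurable_indicator sets_inc)
      from measurable_compose[OF measurable_fun_upd_seq this]
      show "(\<lambda>y. indicator {v. inc (Suc N) v} (v(N := y)) * H (v(N := y))) \<in> borel_measurable borel" .
    qed
    also have "\<dots> = (\<integral>\<^sup>+ y. indicator {v. inc N v} v * (indicator {prev v<..<1} y * H (v(N := y))) \<partial>lborel)"
    proof (rule nn_integral_cong)
      fix y
      have "prev v \<ge> 0" if "inc N v"
      proof (cases "N = 0")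
        case False
        have "(if i = 0 then 0 else v (i - 1)) < v i" if "i < N" for i using \<open>inc N v\<close> that by (simp add: inc_def)
        then have "0 < v i" if "i < N" for i
          using that
        proof (induction i)
          case 0
          then show ?case using \<open>\<And>i. i < N \<Longrightarrow> (if i = 0 then 0 else v (i - 1)) < v i\<close>[of 0] by simp
        next
          case (Suc i)
          then show ?case using \<open>\<And>i. i < N \<Longrightarrow> (if i = 0 then 0 else v (i - 1)) < v i\<close>[of "Suc i"] by simp
        qed
        then show ?thesis using False by (simp add: prev_def less_imp_le)
      qed (simp add: prev_def)
      moreover have "inc (Suc N) (v(N := y)) \<longleftrightarrow> inc N v \<and> prev v < y \<and> y < 1"
        unfolding inc_Suc incN prev_upd by simp
      ultimately show "indicator {v. inc (Suc N) v} (v(N := y)) * H (v(N := y)) * indicator {0..1} y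
        = indicator {v. inc N v} v * (indicator {prev v<..<1} y * H (v(N := y)))"
        by (auto simp: indicator_def)
    qed
    also have "\<dots> = indicator {v. inc N v} v * H' v"
      unfolding H'_def using Hu by (intro nn_integral_cmult) auto
    finally show "(\<integral>\<^sup>+ y. indicator {v. inc (Suc N) v} (v(N := y)) * H (v(N := y)) \<partial>uniform_measure lborel {0..1::real})
      = indicator {v. inc N v} v * H' v" .
  qed
  also have "\<dots> = ennreal (1 / n) ^ N * (\<integral>\<^sup>+ x. ennreal (exp (psum N x)) * indicator (osimplex N n) x * H' (\<lambda>i. psum (Suc i) x / n) \<partial>Om)"
    by (rule Suc.IH[OF H'm H'd])
  also have "(\<integral>\<^sup>+ x. ennreal (exp (psum N x)) * indicator (osimplex N n) x * H' (\<lambda>i. psum (Suc i) x / n) \<partial>Om)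
    = (\<integral>\<^sup>+ x. ennreal (1 / n) * (\<integral>\<^sup>+ z. ennreal (exp (psum (Suc N) (x(N := z)))) * indicator (osimplex (Suc N) n) (x(N := z)) * H (\<lambda>i. psum (Suc i) (x(N := z)) / n) \<partial>exp_dist) \<partial>Om)"
  proof (rule nn_integral_cong)
    fix x
    let ?s = "psum N x" and ?u = "\<lambda>i. psum (Suc i) x / n"
    have prev: "prev ?u = ?s / n" by (cases N) (auto simp: prev_def psum_def)
    have Hz: "(\<lambda>z. H (?u(N := z))) \<in> borel_measurable borel" by (rule Hu)
    then have Hz' [measurable]: "(\<lambda>z. H (?u(N := ?s / n + 1 / n * z))) \<in> borel_measurable borel"
      by (rule measurable_compose[rotated]) simp
    \<comment> \<open>Substitution y = (s + z) / n with s the partial sum; the condition s / n < y <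
      1 becomes 0 < z < n - s.\<close>
    have "H' ?u = ennreal (1 / n) * (\<integral>\<^sup>+ z. indicator {?s / n<..<1} (?s / n + 1 / n * z) * H (?u(N := ?s / n + 1 / n * z)) \<partial>lborel)"
      unfolding H'_def prev using n Hz by (subst nn_integral_real_affine[where t = "?s / n" and c = "1 / n"]) auto
    also have "(\<integral>\<^sup>+ z. indicator {?s / n<..<1} (?s / n + 1 / n * z) * H (?u(N := ?s / n + 1 / n * z)) \<partial>lborel)
      = (\<integral>\<^sup>+ z. indicator {0<..<n - ?s} z * H (?u(N := ?s / n + 1 / n * z)) \<partial>lborel)"
      using n by (intro nn_integral_cong arg_cong2[where f = "(*)"]) (auto simp: indicator_def field_simps)
    finally have "ennreal (exp ?s) * indicator (osimplex N n) x * H' ?u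
      = ennreal (1 / n) * (ennreal (exp ?s) * indicator (osimplex N n) x * (\<integral>\<^sup>+ z. indicator {0<..<n - ?s} z * H (?u(N := ?s / n + 1 / n * z)) \<partial>lborel))"
      by (simp add: ac_simps)
    also have "ennreal (exp ?s) * indicator (osimplex N n) x * (\<integral>\<^sup>+ z. indicator {0<..<n - ?s} z * H (?u(N := ?s / n + 1 / n * z)) \<partial>lborel)
      = (\<integral>\<^sup>+ z. ennreal (exp ?s) * indicator (osimplex N n) x * (indicator {0<..<n - ?s} z * H (?u(N := ?s / n + 1 / n * z))) \<partial>lborel)"
    proof (rule nn_integral_cmult[symmetric])
      show "(\<lambda>z. indicator {0<..<n - ?s} z * H (?u(N := ?s / n + 1 / n * z))) \<in> borel_measurable lborel"
        using Hz' by (intro borel_measurable_times_ennreal borel_measurable_indicator) simp_all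
    qed
    also have "\<dots> = (\<integral>\<^sup>+ z. ennreal (exponential_density 1 z) * (ennreal (exp (psum (Suc N) (x(N := z)))) * indicator (osimplex (Suc N) n) (x(N := z)) * H (\<lambda>i. psum (Suc i) (x(N := z)) / n)) \<partial>lborel)"
    proof (rule nn_integral_cong)
      fix z
      have HH: "H (\<lambda>i. psum (Suc i) (x(N := z)) / n) = H (?u(N := ?s / n + 1 / n * z))"
        by (rule depD[OF Suc.prems(2)]) (auto simp: psum_Suc_upd psum_upd_ge add_divide_distrib)
      have sx: "x(N := z) \<in> osimplex (Suc N) n \<longleftrightarrow> x \<in> osimplex N n \<and> 0 < z \<and> z < n - ?s"
        by (auto simp: osimplex_def psum_Suc_upd less_Suc_eq)
      show "ennreal (exp ?s) * indicator (osimplex N n) x * (indicator {0<..<n - ?s} z * H (?u(N := ?s / n + 1 / n * z)))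
        = ennreal (exponential_density 1 z) * (ennreal (exp (psum (Suc N) (x(N := z)))) * indicator (osimplex (Suc N) n) (x(N := z)) * H (\<lambda>i. psum (Suc i) (x(N := z)) / n))"
      proof (cases "x \<in> osimplex N n \<and> 0 < z \<and> z < n - ?s")
        case True
        then show ?thesis
          unfolding HH using exp_density_cancel[of z ?s] sx by (simp add: psum_Suc_upd mult.assoc[symmetric])
      next
        case False
        then show ?thesis using sx by auto
      qed
    qed
    also have "\<dots> = (\<integral>\<^sup>+ z. ennreal (exp (psum (Suc N) (x(N := z)))) * indicator (osimplex (Suc N) n) (x(N := z)) * H (\<lambda>i. psum (Suc i) (x(N := z)) / n) \<partial>exp_dist)"
    proof (rule nn_integral_exp_dist[symmetric])
      have "(\<lambda>x. ennreal (exp (psum (Suc N) x)) * indicator (osimplex (Suc N) n) x * H (\<lambda>i. psum (Suc i) x / n)) \<in> borel_measurable seqM"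
      by (rule measurable_osimplex_integrand[OF Suc.prems(1)])
      from measurable_compose[OF measurable_fun_upd_seq this]
      show "(\<lambda>z. ennreal (exp (psum (Suc N) (x(N := z)))) * indicator (osimplex (Suc N) n) (x(N := z)) * H (\<lambda>i. psum (Suc i) (x(N := z)) / n)) \<in> borel_measurable borel" .
    qed
    finally show "ennreal (exp ?s) * indicator (osimplex N n) x * H' ?u
      = ennreal (1 / n) * (\<integral>\<^sup>+ z. ennreal (exp (psum (Suc N) (x(N := z)))) * indicator (osimplex (Suc N) n) (x(N := z)) * H (\<lambda>i. psum (Suc i) (x(N := z)) / n) \<partial>exp_dist)" .
  qed
  also have "\<dots> = ennreal (1 / n) * (\<integral>\<^sup>+ x. (\<integral>\<^sup>+ z. ennreal (exp (psum (Suc N) (x(N := z)))) * indicator (osimplex (Suc N) n) (x(N := z)) * H (\<lambda>i. psum (Suc i) (x(N := z)) / n) \<partial>exp_dist) \<partial>Om)"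
  proof (rule nn_integral_cmult)
    have m: "(\<lambda>x. ennreal (exp (psum (Suc N) x)) * indicator (osimplex (Suc N) n) x * H (\<lambda>i. psum (Suc i) x / n)) \<in> borel_measurable seqM"
    by (rule measurable_osimplex_integrand[OF Suc.prems(1)])
    have "(\<lambda>(x, z). x(N := z)) \<in> measurable (Om \<Otimes>\<^sub>M exp_dist) seqM"
      unfolding split_beta'
      by (intro measurable_fun_upd_pair) (auto simp: seqM_Om'[symmetric] intro: measurable_fst)
    from measurable_compose[OF this m]
    show "(\<lambda>x. \<integral>\<^sup>+ z. ennreal (exp (psum (Suc N) (x(N := z)))) * indicator (osimplex (Suc N) n) (x(N := z)) * H (\<lambda>i. psum (Suc i) (x(N := z)) / n) \<partial>exp_dist) \<in> borel_measurable Om"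
      by (intro borel_measurable_nn_integral) (simp add: split_beta')
  qed
  also have "(\<integral>\<^sup>+ x. (\<integral>\<^sup>+ z. ennreal (exp (psum (Suc N) (x(N := z)))) * indicator (osimplex (Suc N) n) (x(N := z)) * H (\<lambda>i. psum (Suc i) (x(N := z)) / n) \<partial>exp_dist) \<partial>Om)
    = (\<integral>\<^sup>+ x. ennreal (exp (psum (Suc N) x)) * indicator (osimplex (Suc N) n) x * H (\<lambda>i. psum (Suc i) x / n) \<partial>Om)"
  proof (rule nn_integral_coord_any[symmetric])
    show "(\<lambda>x. ennreal (exp (psum (Suc N) x)) * indicator (osimplex (Suc N) n) x * H (\<lambda>i. psum (Suc i) x / n)) \<in> borel_measurable Om"
      unfolding seqM_Om by (rule measurable_osimplex_integrand[OF Suc.prems(1)])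
  qed
  finally show ?case by (simp add: mult.assoc mult.commute[of "ennreal (1 / n)"])
qed

end

section \<open>The law of the spacings as conditioned exponentials\<close>

context exp_coordinates
begin

text \<open>As the exponential cancels the density, this integrates over Lebesgue measure on the
  positive vectors of length \<open>N\<close> with sum below \<open>n\<close>; the coordinate with
  index \<open>N\<close> is set to what is missing up to \<open>n\<close>. It is the unnormalised
  law of \<open>Suc N\<close> independent exponential variables given that their sum is
  \<open>n\<close>.\<close>

definition simplex_integral :: "nat \<Rightarrow> real \<Rightarrow> ((nat \<Rightarrow> real) \<Rightarrow> ennreal) \<Rightarrow> ennreal" where
  "simplex_integral N n G =
    (\<integral>\<^sup>+ x. ennreal (exp (psum N x)) * indicator (osimplex N n) x * G (x(N := n - psum N x)) \<partial>Om)"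

lemma measurable_last_coord: "(\<lambda>x. x(N := n - psum N x)) \<in> measurable seqM seqM"
  by (intro measurable_fun_upd_pair borel_measurable_diff borel_measurable_const measurable_psum) simp

lemma measurable_simplex_integrand:
  assumes "G \<in> borel_measurable seqM"
  shows "(\<lambda>x. ennreal (exp (psum N x)) * indicator (osimplex N n) x * G (x(N := n - psum N x))) \<in> borel_measurable Om"
  unfolding seqM_Om
proof (intro borel_measurable_times_ennreal borel_measurable_indicator sets_osimplex)
  show "(\<lambda>x. ennreal (exp (psum N x))) \<in> borel_measurable seqM"
    using measurable_psum[of N] by simp
  show "(\<lambda>x. G (x(N := n - psum N x))) \<in> borel_measurable seqM"
    by (rule measurable_compose[OF measurable_last_coord assms])
qed

text \<open>Sort the sample, then pass to partial sums. The function \<open>U\<close> adjoins the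
  endpoints 0 and 1 to the ordered points, and their scaled increments become the coordinates
  \<open>x i\<close>.\<close>

lemma spacings_nn_integral:
  assumes V: "iid_uniform M N V" and N: "N \<ge> 1"
    and Gm: "G \<in> borel_measurable seqM" and G: "dep {..N} G"
  shows "(\<integral>\<^sup>+ \<omega>. G (\<lambda>i. real (Suc N) * spacing (Suc N) (\<lambda>i. V i \<omega>) i) \<partial>M)
    = fact N * (ennreal (1 / real (Suc N)) ^ N * simplex_integral N (real (Suc N)) G)"
proof -
  define n where "n = real (Suc N)"
  have n: "n > 0" by (simp add: n_def)
  define U where "U u k = (if k = 0 then 0 else if k = Suc N then 1 else u (k - 1))" for u :: "nat \<Rightarrow> real" and k
  define F where "F u = G (\<lambda>i. n * (U u (Suc i) - U u i))" for u
  have Um: "(\<lambda>u. U u k) \<in> borel_measurable seqM" for k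
    unfolding U_def by (cases "k = 0"; cases "k = Suc N") auto
  have Fm: "F \<in> borel_measurable seqM"
    unfolding F_def
    by (intro measurable_compose[OF measurable_seqI Gm] borel_measurable_times borel_measurable_diff Um borel_measurable_const)
  have Fd: "dep {..<N} F"
    unfolding dep_def F_def
  proof (intro allI impI)
    fix x y :: "nat \<Rightarrow> real" assume xy: "\<forall>i\<in>{..<N}. x i = y i"
    have "U x k = U y k" if "k \<le> Suc N" for k
    proof -
      have "k = 0 \<or> k = Suc N \<or> k - 1 < N" using that by auto
      then show ?thesis using xy by (auto simp: U_def)
    qed
    then show "G (\<lambda>i. n * (U x (Suc i) - U x i)) = G (\<lambda>i. n * (U y (Suc i) - U y i))"
      by (intro depD[OF G]) auto
  qed
  have s: "(\<lambda>v. F (\<lambda>i. sort (map v [0..<N]) ! i)) \<in> borel_measurable seqM"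
  proof -
    have "(\<lambda>v. F (\<lambda>i. if i < N then sort (map v [0..<N]) ! i else 0)) \<in> borel_measurable seqM"
    proof (rule measurable_compose[OF measurable_seqI Fm])
      fix i show "(\<lambda>v. if i < N then sort (map v [0..<N]) ! i else 0) \<in> borel_measurable seqM"
        by (cases "i < N") (auto intro: measurable_sort_nth)
    qed
    moreover have "F (\<lambda>i. if i < N then sort (map v [0..<N]) ! i else 0) = F (\<lambda>i. sort (map v [0..<N]) ! i)" for v
      by (rule depD[OF Fd]) simp
    ultimately show ?thesis by simp
  qed
  have sd: "dep {..<N} (\<lambda>v. F (\<lambda>i. sort (map v [0..<N]) ! i))"
    unfolding dep_def
  proof (intro allI impI)
    fix x y :: "nat \<Rightarrow> real" assume "\<forall>i\<in>{..<N}. x i = y i"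
    then have "map x [0..<N] = map y [0..<N]" by auto
    then show "F (\<lambda>i. sort (map x [0..<N]) ! i) = F (\<lambda>i. sort (map y [0..<N]) ! i)" by (simp only:)
  qed
  have "(\<integral>\<^sup>+ \<omega>. G (\<lambda>i. n * spacing (Suc N) (\<lambda>i. V i \<omega>) i) \<partial>M)
    = (\<integral>\<^sup>+ \<omega>. F (\<lambda>i. sort (map (\<lambda>i. V i \<omega>) [0..<N]) ! i) \<partial>M)"
  proof (rule nn_integral_cong)
    fix \<omega>
    have "spacing_pt (Suc N) (\<lambda>i. V i \<omega>) k = U (\<lambda>i. sort (map (\<lambda>i. V i \<omega>) [0..<N]) ! i) k" if "k \<le> Suc N" for k
    proof -
      have "k = 0 \<or> k = Suc N \<or> 1 \<le> k \<and> k < Suc N" using that by auto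
      then show ?thesis
        by (elim disjE conjE) (auto simp: U_def spacing_pt_0 spacing_pt_n spacing_pt_order_stat order_stat_def)
    qed
    then show "G (\<lambda>i. n * spacing (Suc N) (\<lambda>i. V i \<omega>) i) = F (\<lambda>i. sort (map (\<lambda>i. V i \<omega>) [0..<N]) ! i)"
      unfolding F_def by (intro depD[OF G]) (auto simp: spacing_def)
  qed
  also have "\<dots> = (\<integral>\<^sup>+ v. F (\<lambda>i. sort (map v [0..<N]) ! i) \<partial>unif.Om)"
  proof (rule unif.nn_integral_sample[where I = "{..<N}"])
    show "(\<lambda>v. F (\<lambda>i. sort (map v [0..<N]) ! i)) \<in> borel_measurable unif.Om"
      using s by (simp add: measurable_cong_sets[OF unif.sets_Om refl])
    show "{..<N} \<noteq> {}" using N by (auto simp: lessThan_empty_iff)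
  qed (use V sd in \<open>simp_all add: iid_uniform_def\<close>)
  also have "\<dots> = fact N * (\<integral>\<^sup>+ v. indicator {v. inc N v} v * F v \<partial>unif.Om)"
    by (rule nn_integral_sorted[OF Fm Fd])
  also have "(\<integral>\<^sup>+ v. indicator {v. inc N v} v * F v \<partial>unif.Om)
    = ennreal (1 / n) ^ N * (\<integral>\<^sup>+ x. ennreal (exp (psum N x)) * indicator (osimplex N n) x * F (\<lambda>i. psum (Suc i) x / n) \<partial>Om)"
    by (rule nn_integral_inc_eq[OF n Fm Fd])
  also have "(\<integral>\<^sup>+ x. ennreal (exp (psum N x)) * indicator (osimplex N n) x * F (\<lambda>i. psum (Suc i) x / n) \<partial>Om)
    = simplex_integral N n G"
    unfolding simplex_integral_def
  proof (rule nn_integral_cong)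
    fix x
    have "F (\<lambda>i. psum (Suc i) x / n) = G (x(N := n - psum N x))"
      unfolding F_def
    proof (rule depD[OF G])
      fix i assume "i \<in> {..N}"
      moreover have "U (\<lambda>i. psum (Suc i) x / n) k = (if k = Suc N then 1 else psum k x / n)" if "k \<le> Suc N" for k
        by (cases k) (auto simp: U_def psum_def)
      ultimately show "n * (U (\<lambda>i. psum (Suc i) x / n) (Suc i) - U (\<lambda>i. psum (Suc i) x / n) i) = (x(N := n - psum N x)) i"
        using n by (auto simp: psum_def field_simps)
    qed
    then show "ennreal (exp (psum N x)) * indicator (osimplex N n) x * F (\<lambda>i. psum (Suc i) x / n)
      = ennreal (exp (psum N x)) * indicator (osimplex N n) x * G (x(N := n - psum N x))" by simp
  qed
  finally show ?thesis by (simp add: n_def)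
qed

text \<open>Reflecting the \<open>i\<close>-th coordinate exchanges it with the last spacing.\<close>

lemma simplex_integral_transpose:
  assumes i: "i < N" and Gm: "G \<in> borel_measurable seqM"
  shows "simplex_integral N n (\<lambda>x. G (\<lambda>j. x (Transposition.transpose i N j))) = simplex_integral N n G"
proof -
  let ?\<pi> = "Transposition.transpose i N"
  define K where "K G x z = ennreal (exp (psum N (x(i := z)))) * indicator (osimplex N n) (x(i := z))
      * G ((x(i := z))(N := n - psum N (x(i := z))))" for G :: "(nat \<Rightarrow> real) \<Rightarrow> ennreal" and x z
  have G'm: "(\<lambda>x. G (\<lambda>j. x (?\<pi> j))) \<in> borel_measurable seqM"
    by (rule measurable_compose[OF measurable_seqI Gm]) simp
  have Km: "(\<lambda>z. K g x z) \<in> borel_measurable borel" if "g \<in> borel_measurable seqM" for g x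
    unfolding K_def
    using measurable_compose[OF measurable_fun_upd_Om measurable_simplex_integrand[OF that, of N n]] .
  have *: "simplex_integral N n g = (\<integral>\<^sup>+ x. (\<integral>\<^sup>+ z. ennreal (exponential_density 1 z) * K g x z \<partial>lborel) \<partial>Om)"
    if "g \<in> borel_measurable seqM" for g
    unfolding simplex_integral_def
    by (subst nn_integral_coord_any[where i = i, OF measurable_simplex_integrand[OF that]])
      (simp add: nn_integral_exp_dist Km[OF that] flip: K_def)
  have "(\<integral>\<^sup>+ z. ennreal (exponential_density 1 z) * K (\<lambda>x. G (\<lambda>j. x (?\<pi> j))) x z \<partial>lborel)
      = (\<integral>\<^sup>+ z. ennreal (exponential_density 1 z) * K G x z \<partial>lborel)" for x
  proof -
    define c where "c = (\<Sum>j\<in>{..<N} - {i}. x j)"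
    define b :: ennreal where "b = ennreal (exp c) * (if \<forall>j\<in>{..<N} - {i}. 0 < x j then 1 else 0)"
    define L where "L z = b * (indicator {0<..<n - c} z * G ((x(i := z))(N := n - c - z)))" for z
    have ps: "psum N (x(i := z)) = c + z" for z
      unfolding psum_def c_def using i by (subst sum.remove[of _ i]) auto
    have sx: "x(i := z) \<in> osimplex N n \<longleftrightarrow> (\<forall>j\<in>{..<N} - {i}. 0 < x j) \<and> 0 < z \<and> z < n - c" for z
      using i unfolding osimplex_def mem_Collect_eq ps by auto
    have KL: "ennreal (exponential_density 1 z) * K g x z
      = b * (indicator {0<..<n - c} z * g ((x(i := z))(N := n - c - z)))" for z and g :: "(nat \<Rightarrow> real) \<Rightarrow> ennreal"
    proof (cases "x(i := z) \<in> osimplex N n")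
      case True
      then have "0 < z" using sx by blast
      have "ennreal (exponential_density 1 z) * K g x z
        = (ennreal (exponential_density 1 z) * ennreal (exp (c + z))) * g ((x(i := z))(N := n - (c + z)))"
        using True by (simp add: K_def ps mult.assoc)
      also have "\<dots> = ennreal (exp c) * g ((x(i := z))(N := n - (c + z)))"
        using exp_density_cancel[OF \<open>0 < z\<close>] by simp
      finally show ?thesis using True sx[of z] by (simp add: b_def diff_diff_eq)
    next
      case False
      then have "b * (indicator {0<..<n - c} z * g ((x(i := z))(N := n - c - z))) = 0"
        using sx[of z] by (auto simp: b_def indicator_def)
      then show ?thesis using False by (simp add: K_def)
    qed
    have Lm: "L \<in> borel_measurable borel"
    proof -
      have "(\<lambda>z. (x(i := z))(N := n - c - z)) \<in> measurable borel seqM"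
        by (intro measurable_fun_upd_pair borel_measurable_diff measurable_fun_upd_seq) auto
      from measurable_compose[OF this Gm] show ?thesis
        unfolding L_def by (intro borel_measurable_times_ennreal borel_measurable_indicator) auto
    qed
    have "(\<integral>\<^sup>+ z. ennreal (exponential_density 1 z) * K G x z \<partial>lborel) = (\<integral>\<^sup>+ z. L z \<partial>lborel)"
      unfolding KL L_def ..
    also have "\<dots> = (\<integral>\<^sup>+ z. L ((n - c) + (-1) * z) \<partial>lborel)"
      using nn_integral_real_affine[OF Lm, of "-1" "n - c"] by simp
    also have "\<dots> = (\<integral>\<^sup>+ z. ennreal (exponential_density 1 z) * K (\<lambda>x. G (\<lambda>j. x (?\<pi> j))) x z \<partial>lborel)"
    proof (rule nn_integral_cong)
      fix z
      have "(\<lambda>j. ((x(i := z))(N := n - c - z)) (?\<pi> j)) = (x(i := n - c - z))(N := z)"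
        using i by (auto simp: fun_eq_iff Transposition.transpose_def)
      moreover have "indicator {0<..<n - c} (n - c - z) = (indicator {0<..<n - c} z :: ennreal)"
        by (auto simp: indicator_def)
      ultimately show "L ((n - c) + (-1) * z) = ennreal (exponential_density 1 z) * K (\<lambda>x. G (\<lambda>j. x (?\<pi> j))) x z"
        unfolding KL L_def by simp
    qed
    finally show ?thesis by simp
  qed
  then show ?thesis unfolding *[OF Gm] *[OF G'm] by simp
qed

lemma sum_coords_erlang:
  assumes "finite A" "A \<noteq> {}"
  shows "distributed Om lborel (\<lambda>x. \<Sum>i\<in>A. x i) (erlang_density (card A - 1) 1)"
proof (rule Om.exponential_distributed_sum[OF assms])
  have "distr Om (Pi\<^sub>M A (\<lambda>_. borel)) (\<lambda>x. \<lambda>i\<in>A. x i) = distr Om (Pi\<^sub>M A (\<lambda>_. exp_dist)) (\<lambda>x. restrict x A)"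
    by (intro distr_cong sets_PiM_cong) auto
  also have "\<dots> = Pi\<^sub>M A (\<lambda>_. exp_dist)"
    using prod.distr_PiM_restrict_finite[of A] assms by (simp add: Om_def)
  also have "\<dots> = Pi\<^sub>M A (\<lambda>i. distr Om borel (\<lambda>x. x i))"
  proof (rule PiM_cong)
    fix i
    show "exp_dist = distr Om borel (\<lambda>x. x i)"
      using distr_coord[of i] distr_cong[OF refl events_eq_borel, of Om "\<lambda>x. x i" "\<lambda>x. x i"] by simp
  qed simp
  finally show "Om.indep_vars (\<lambda>i. borel) (\<lambda>i x. x i) A"
    using Om.indep_vars_iff_distr_eq_PiM'[where M' = "\<lambda>_. borel" and I = A and X = "\<lambda>i x. x i"] assms by simp
qed (auto intro: distributed_coord)

text \<open>The factor exp turns the exponential law into Lebesgue measure, so this is the volume of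
  a simplex; it is computed from the Erlang density of the sum.\<close>

lemma nn_integral_exp_sum_less:
  assumes K: "finite K" "K \<noteq> {}"
  shows "(\<integral>\<^sup>+ y. ennreal (exp (\<Sum>i\<in>K. y i)) * indicator {..<c} (\<Sum>i\<in>K. y i) \<partial>Om)
    = ennreal (if 0 < c then c ^ card K / fact (card K) else 0)"
proof -
  obtain k where k: "card K = Suc k" using K by (cases "card K") auto
  have "(\<integral>\<^sup>+ y. ennreal (exp (\<Sum>i\<in>K. y i)) * indicator {..<c} (\<Sum>i\<in>K. y i) \<partial>Om)
    = (\<integral>\<^sup>+ t. ennreal (erlang_density k 1 t) * (ennreal (exp t) * indicator {..<c} t) \<partial>lborel)"
    using sum_coords_erlang[OF K] k by (subst distributed_nn_integral[symmetric]) auto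
  also have "\<dots> = (\<integral>\<^sup>+ t. ennreal (t ^ k / fact k) * indicator {0..<c} t \<partial>lborel)"
  proof (rule nn_integral_cong)
    fix t :: real
    have "erlang_density k 1 t * exp t = t ^ k / fact k" if "t \<ge> 0"
      using that by (simp add: erlang_density_def flip: exp_add)
    then show "ennreal (erlang_density k 1 t) * (ennreal (exp t) * indicator {..<c} t) = ennreal (t ^ k / fact k) * indicator {0..<c} t"
      by (auto simp: indicator_def erlang_density_def simp flip: ennreal_mult'')
  qed
  also have "\<dots> = (\<integral>\<^sup>+ t. ennreal (t ^ k / fact k) * indicator {0..c} t \<partial>lborel)"
  proof (rule nn_integral_cong_AE)
    have "AE t in lborel. t \<noteq> c" by (rule AE_lborel_singleton)
    then show "AE t in lborel. ennreal (t ^ k / fact k) * indicator {0..<c} t = ennreal (t ^ k / fact k) * indicator {0..c} t"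
      by eventually_elim (auto simp: indicator_def)
  qed
  also have "\<dots> = ennreal (if 0 < c then c ^ Suc k / fact (Suc k) else 0)"
  proof (cases "0 \<le> c")
    case True
    have "(\<integral>\<^sup>+ t. ennreal (t ^ k / fact k) * indicator {0..c} t \<partial>lborel) = ennreal (c ^ Suc k / fact (Suc k) - 0 ^ Suc k / fact (Suc k))"
    proof (rule nn_integral_FTC_Icc[where F = "\<lambda>t. t ^ Suc k / fact (Suc k)"])
      fix t assume "t \<in> {0..c}"
      have "((\<lambda>t. t ^ Suc k / fact (Suc k)) has_real_derivative (real (Suc k) * t ^ k / fact (Suc k))) (at t)"
        using DERIV_cdivide[OF DERIV_pow[of "Suc k" t], of "fact (Suc k)"] by (simp del: of_nat_Suc fact_Suc power_Suc)
      also have "real (Suc k) * t ^ k / fact (Suc k) = t ^ k / fact k"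
        by (simp add: field_simps del: of_nat_Suc)
      finally show "((\<lambda>t. t ^ Suc k / fact (Suc k)) has_real_derivative (t ^ k / fact k)) (at t)" .
    qed (use True in auto)
    then show ?thesis using True by (auto simp: le_less)
  next
    case False
    then show ?thesis by simp
  qed
  finally show ?thesis by (simp add: k)
qed

lemma AE_coord_pos: "AE x in Om. 0 < x i"
proof -
  have "AE z in lborel. 0 < exponential_density 1 z \<longrightarrow> 0 < (z :: real)"
    using AE_lborel_singleton[of "0 :: real"] by eventually_elim (auto simp: exponential_density_def split: if_splits)
  then show ?thesis
    using Om.distributed_AE2[OF distributed_coord[of i], of "\<lambda>z. 0 < z"] by simp
qed

text \<open>Outside \<open>J\<close> the coordinate with index \<open>N\<close> is determined and
  \<open>k\<close> others are free; integrating these over a simplex gives (n - s)^k / k! with s the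
  sum over \<open>J\<close>. The argument z = \<open>tau J x - 1\<close> of the weight is chosen so
  that n - s = k - z, because n = |J| + k + 1.\<close>

lemma simplex_integral_dep:
  assumes J: "J \<subseteq> {..<N}" and k: "N = card J + k" "k \<ge> 1"
    and Gm: "G \<in> borel_measurable seqM" and G: "dep J G"
  shows "simplex_integral N (real (Suc N)) G
    = ennreal (exp (real (card J) + 1) * real k ^ k / fact k) * (\<integral>\<^sup>+ x. G x * ennreal (wt k (tau J x - 1)) \<partial>Om)"
proof -
  define n where "n = real (Suc N)"
  define K where "K = {..<N} - J"
  have fJ: "finite J" using J by (rule finite_subset) simp
  have cK: "card K = k" unfolding K_def using J k by (simp add: card_Diff_subset fJ)
  have K: "finite K" "K \<noteq> {}" using cK k by (simp add: K_def, auto)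
  have ps: "psum N x = (\<Sum>i\<in>J. x i) + (\<Sum>i\<in>K. x i)" for x
    unfolding psum_def K_def using J by (subst sum.subset_diff[of J]) auto
  have Gx: "G (x(N := z)) = G x" for x z
    using J by (intro depD[OF G]) auto
  have sm: "(\<lambda>x. \<Sum>i\<in>A. x i) \<in> borel_measurable Om" for A
    unfolding seqM_Om by (intro borel_measurable_sum measurable_seq_coord)
  define Q where "Q x = ennreal (exp (psum N x)) * indicator {..<n} (psum N x) * G x" for x
  have GmO: "G \<in> borel_measurable Om" using Gm by (simp add: seqM_Om)
  have Qm: "Q \<in> borel_measurable Om"
    unfolding Q_def ps
    using sm[of J] sm[of K] GmO by (intro borel_measurable_times_ennreal) auto
  have "simplex_integral N n G = (\<integral>\<^sup>+ x. Q x \<partial>Om)"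
    unfolding simplex_integral_def
  proof (rule nn_integral_cong_AE)
    have "AE x in Om. \<forall>i\<in>{..<N}. 0 < x i" by (intro AE_finite_allI AE_coord_pos) auto
    then show "AE x in Om. ennreal (exp (psum N x)) * indicator (osimplex N n) x * G (x(N := n - psum N x)) = Q x"
      by eventually_elim (auto simp: Q_def Gx osimplex_def indicator_def)
  qed
  also have "\<dots> = (\<integral>\<^sup>+ x. (\<integral>\<^sup>+ y. Q (mix J x y) \<partial>Om) \<partial>Om)"
    by (rule nn_integral_mix[OF Qm, symmetric])
  also have "\<dots> = (\<integral>\<^sup>+ x. ennreal (exp (real (card J) + 1) * real k ^ k / fact k) * (G x * ennreal (wt k (tau J x - 1))) \<partial>Om)"
  proof (rule nn_integral_cong)
    fix x :: "nat \<Rightarrow> real"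
    define sJ where "sJ = (\<Sum>i\<in>J. x i)"
    have tauJ: "tau J x = sJ - card J" by (simp add: tau_def sJ_def sum_subtractf)
    have Qmix: "Q (mix J x y) = (ennreal (exp sJ) * G x) * (ennreal (exp (\<Sum>i\<in>K. y i)) * indicator {..<n - sJ} (\<Sum>i\<in>K. y i))" for y
    proof -
      have "psum N (mix J x y) = sJ + (\<Sum>i\<in>K. y i)"
        unfolding ps sJ_def by (intro arg_cong2[where f = "(+)"] sum.cong) (auto simp: mix_def K_def)
      moreover have "G (mix J x y) = G x" by (rule dep_mix_eq[OF G]) simp
      ultimately show ?thesis
        by (auto simp: Q_def indicator_def exp_add ennreal_mult ac_simps)
    qed
    have "(\<integral>\<^sup>+ y. Q (mix J x y) \<partial>Om) = (ennreal (exp sJ) * G x)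
        * (\<integral>\<^sup>+ y. ennreal (exp (\<Sum>i\<in>K. y i)) * indicator {..<n - sJ} (\<Sum>i\<in>K. y i) \<partial>Om)"
      unfolding Qmix using sm[of K] by (intro nn_integral_cmult) auto
    also have "\<dots> = (ennreal (exp sJ) * G x) * ennreal (if 0 < n - sJ then (n - sJ) ^ k / fact k else 0)"
      unfolding nn_integral_exp_sum_less[OF K] cK ..
    also have "\<dots> = G x * ennreal (exp sJ * (if 0 < n - sJ then (n - sJ) ^ k / fact k else 0))"
      by (subst ennreal_mult) (auto simp: ac_simps)
    also have "exp sJ * (if 0 < n - sJ then (n - sJ) ^ k / fact k else 0)
        = exp (real (card J) + 1) * real k ^ k / fact k * wt k (tau J x - 1)"
    proof -
      define z where "z = tau J x - 1"
      have 1: "n - sJ = k - z" unfolding z_def tauJ n_def using k by simp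
      have 2: "sJ = (real (card J) + 1) + z" unfolding z_def tauJ by simp
      show ?thesis
      proof (cases "z < k")
        case True
        have "(real k - z) ^ k = real k ^ k * (1 - z / k) ^ k"
          using k by (simp add: power_mult_distrib[symmetric] right_diff_distrib)
        then show ?thesis using True unfolding 1 z_def[symmetric] by (subst 2) (simp add: wt_def exp_add)
      next
        case False
        then show ?thesis unfolding 1 z_def[symmetric] by (simp add: wt_def)
      qed
    qed
    also have "G x * ennreal (exp (real (card J) + 1) * real k ^ k / fact k * wt k (tau J x - 1))
        = ennreal (exp (real (card J) + 1) * real k ^ k / fact k) * (G x * ennreal (wt k (tau J x - 1)))"
      by (subst ennreal_mult) (auto simp: ac_simps)
    finally show "(\<integral>\<^sup>+ y. Q (mix J x y) \<partial>Om) = ennreal (exp (real (card J) + 1) * real k ^ k / fact k) * (G x * ennreal (wt k (tau J x - 1)))" .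
  qed
  also have "\<dots> = ennreal (exp (real (card J) + 1) * real k ^ k / fact k) * (\<integral>\<^sup>+ x. G x * ennreal (wt k (tau J x - 1)) \<partial>Om)"
    using GmO by (intro nn_integral_cmult) auto
  finally show ?thesis by (simp add: n_def)
qed

text \<open>If \<open>J\<close> contains the index \<open>N\<close>, which
  \<open>simplex_integral\<close> treats as determined, it is exchanged with an index missing from
  \<open>J\<close>; there is one because \<open>J\<close> has fewer than N elements. The constant is
  left open, since normalisation will identify it.\<close>

lemma spacings_law_nn:
  assumes V: "iid_uniform M N V" and N: "N \<ge> 1"
    and J: "J \<subseteq> {..N}" and k: "N = card J + k" "k \<ge> 1"
  obtains c where "\<And>G. G \<in> borel_measurable seqM \<Longrightarrow> dep J G \<Longrightarrow>
    (\<integral>\<^sup>+ \<omega>. G (\<lambda>i. real (Suc N) * spacing (Suc N) (\<lambda>i. V i \<omega>) i) \<partial>M)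
      = c * (\<integral>\<^sup>+ x. G x * ennreal (wt k (tau J x - 1)) \<partial>Om)"
proof -
  define c where "c = fact N * (ennreal (1 / real (Suc N)) ^ N * ennreal (exp (real (card J) + 1) * real k ^ k / fact k))"
  have fJ: "finite J" using J by (rule finite_subset) simp
  have "(\<integral>\<^sup>+ \<omega>. G (\<lambda>i. real (Suc N) * spacing (Suc N) (\<lambda>i. V i \<omega>) i) \<partial>M)
      = c * (\<integral>\<^sup>+ x. G x * ennreal (wt k (tau J x - 1)) \<partial>Om)"
    if Gm: "G \<in> borel_measurable seqM" and G: "dep J G" for G
  proof -
    have "simplex_integral N (real (Suc N)) G
        = ennreal (exp (real (card J) + 1) * real k ^ k / fact k) * (\<integral>\<^sup>+ x. G x * ennreal (wt k (tau J x - 1)) \<partial>Om)"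
    proof (cases "N \<in> J")
      case False
      then have "J \<subseteq> {..<N}" using J by (auto simp: le_less)
      then show ?thesis by (rule simplex_integral_dep[OF _ k Gm G])
    next
      case True
      have "\<not> {..N} \<subseteq> J"
      proof
        assume "{..N} \<subseteq> J"
        then have "card {..N} \<le> card J" by (rule card_mono[OF fJ])
        then show False using k by simp
      qed
      then obtain i where "i \<le> N" "i \<notin> J" by blast
      then have i: "i < N" "i \<notin> J" using True by (auto simp: le_less)
      let ?\<pi> = "Transposition.transpose i N"
      have inj: "inj_on ?\<pi> J" by (rule inj_on_inverseI[where g = ?\<pi>]) simp
      have J': "?\<pi> ` J \<subseteq> {..<N}"
      proof
        fix a assume "a \<in> ?\<pi> ` J"
        then obtain b where b: "b \<in> J" "a = ?\<pi> b" by auto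
        then have "b \<le> N" "b \<noteq> i" using J i by auto
        then show "a \<in> {..<N}" using b i by (cases "b = N") auto
      qed
      have cJ': "card (?\<pi> ` J) = card J" by (rule card_image[OF inj])
      have G': "dep (?\<pi> ` J) (\<lambda>x. G (\<lambda>j. x (?\<pi> j)))"
        unfolding dep_def by (auto intro!: depD[OF G])
      have G'm: "(\<lambda>x. G (\<lambda>j. x (?\<pi> j))) \<in> borel_measurable seqM"
        by (rule measurable_compose[OF measurable_seqI Gm]) simp
      have tau': "tau (?\<pi> ` J) x = tau J (\<lambda>j. x (?\<pi> j))" for x
        unfolding tau_def by (simp add: sum.reindex[OF inj] comp_def)
      have "simplex_integral N (real (Suc N)) G = simplex_integral N (real (Suc N)) (\<lambda>x. G (\<lambda>j. x (?\<pi> j)))"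
        by (rule simplex_integral_transpose[OF i(1) Gm, symmetric])
      also have "\<dots> = ennreal (exp (real (card J) + 1) * real k ^ k / fact k)
          * (\<integral>\<^sup>+ x. G (\<lambda>j. x (?\<pi> j)) * ennreal (wt k (tau J (\<lambda>j. x (?\<pi> j)) - 1)) \<partial>Om)"
      proof -
        have "N = card (?\<pi> ` J) + k" using k(1) cJ' by simp
        from simplex_integral_dep[OF J' this k(2) G'm G'] show ?thesis unfolding cJ' tau' .
      qed
      also have "(\<integral>\<^sup>+ x. G (\<lambda>j. x (?\<pi> j)) * ennreal (wt k (tau J (\<lambda>j. x (?\<pi> j)) - 1)) \<partial>Om)
          = (\<integral>\<^sup>+ x. G x * ennreal (wt k (tau J x - 1)) \<partial>Om)"
      proof (rule nn_integral_permute)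
        show "(\<lambda>x. G x * ennreal (wt k (tau J x - 1))) \<in> borel_measurable Om"
          using Gm[folded seqM_Om] by measurable
      qed simp
      finally show ?thesis .
    qed
    then show ?thesis
      unfolding spacings_nn_integral[OF V N Gm dep_mono[OF G J]] c_def by (simp add: mult.assoc)
  qed
  then show thesis by (rule that)
qed

lemma measurable_spacing:
  assumes V: "iid_uniform M N V" and N: "N \<ge> 1"
  shows "(\<lambda>\<omega>. spacing (Suc N) (\<lambda>i. V i \<omega>) k) \<in> borel_measurable M"
proof -
  have o: "(\<lambda>v. order_stat N v (j mod Suc N)) \<in> borel_measurable seqM" if "j mod Suc N \<noteq> 0" for j
  proof -
    have "j mod Suc N < Suc N" by simp
    then have "j mod Suc N - 1 < N" using that by linarith
    then show ?thesis unfolding order_stat_def by (rule measurable_sort_nth)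
  qed
  have p: "(\<lambda>v. spacing_pt (Suc N) v j) \<in> borel_measurable seqM" for j
    unfolding spacing_pt_def using o[of j] by (cases "j mod Suc N = 0") auto
  have d: "dep {..<N} (\<lambda>v. spacing_pt (Suc N) v j)" for j
    unfolding dep_def
  proof (intro allI impI)
    fix x y :: "nat \<Rightarrow> real" assume "\<forall>i\<in>{..<N}. x i = y i"
    then have "map x [0..<N] = map y [0..<N]" by auto
    then show "spacing_pt (Suc N) x j = spacing_pt (Suc N) y j"
      by (simp only: spacing_pt_def order_stat_def diff_Suc_1)
  qed
  show ?thesis
  proof (rule unif.measurable_sample[where I = "{..<N}" and f = "\<lambda>v. spacing (Suc N) v k"])
    show "(\<lambda>v. spacing (Suc N) v k) \<in> borel_measurable unif.Om"
      unfolding spacing_def measurable_cong_sets[OF unif.sets_Om refl] by (intro borel_measurable_diff p)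
    show "dep {..<N} (\<lambda>v. spacing (Suc N) v k)"
      unfolding spacing_def by (intro dep_comp2[where F = "(-)"] d)
    show "{..<N} \<noteq> {}" using N by (auto simp: lessThan_empty_iff)
  qed (use V in \<open>simp_all add: iid_uniform_def\<close>)
qed

lemma integrable_wt_tau: "k \<ge> 1 \<Longrightarrow> integrable Om (\<lambda>x. wt k (tau J x - 1))"
  by (rule Om.integrable_const_bound[where B = 1]) (auto simp: wt_le_1)

text \<open>The constant function 1 identifies the unknown constant as the reciprocal of the mean
  weight. Equality of the image measures under \<open>clip J\<close> then carries the formula from
  nonnegative to vector valued functions, in particular to complex exponentials.\<close>

lemma spacings_law:
  fixes f :: "(nat \<Rightarrow> real) \<Rightarrow> 'c::{banach, second_countable_topology}"
  assumes V: "iid_uniform M N V" and N: "N \<ge> 1"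
    and J: "J \<subseteq> {..N}" and k: "N = card J + k" "k \<ge> 1"
    and fm: "f \<in> borel_measurable seqM" and f: "dep J f"
  shows "(LINT \<omega>|M. f (\<lambda>i. real (Suc N) * spacing (Suc N) (\<lambda>i. V i \<omega>) i))
    = (LINT x|Om. wt k (tau J x - 1) *\<^sub>R f x) /\<^sub>R (LINT x|Om. wt k (tau J x - 1))"
proof -
  interpret M: prob_space M using V by (simp add: iid_uniform_def)
  define W where "W = (LINT x|Om. wt k (tau J x - 1))"
  define nS where "nS \<omega> = (\<lambda>i. real (Suc N) * spacing (Suc N) (\<lambda>i. V i \<omega>) i)" for \<omega>
  have nSm: "nS \<in> measurable M seqM"
    unfolding nS_def by (intro measurable_seqI borel_measurable_times borel_measurable_const measurable_spacing[OF V N])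
  obtain c where c: "\<And>G. G \<in> borel_measurable seqM \<Longrightarrow> dep J G \<Longrightarrow>
    (\<integral>\<^sup>+ \<omega>. G (nS \<omega>) \<partial>M) = c * (\<integral>\<^sup>+ x. G x * ennreal (wt k (tau J x - 1)) \<partial>Om)"
    using spacings_law_nn[OF V N J k] unfolding nS_def by blast
  have W0: "W \<ge> 0" unfolding W_def by (intro Bochner_Integration.integral_nonneg) simp
  have nnW: "(\<integral>\<^sup>+ x. ennreal (wt k (tau J x - 1)) \<partial>Om) = ennreal W"
    unfolding W_def by (intro nn_integral_eq_integral integrable_wt_tau k) auto
  have cW: "1 = c * ennreal W"
    using c[of "\<lambda>_. 1"] by (simp add: dep_const nnW M.emeasure_space_1)
  then have W: "W > 0" using W0 by (cases "W = 0") auto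
  have c_eq: "c = ennreal (1 / W)"
  proof -
    have "c = c * (ennreal W * ennreal (1 / W))" using W by (simp flip: ennreal_mult)
    then show ?thesis using cW by (simp add: mult.assoc[symmetric])
  qed
  have wm [measurable]: "(\<lambda>x. ennreal (wt k (tau J x - 1) / W)) \<in> borel_measurable Om" by measurable
  have clipm: "clip J \<in> measurable seqM seqM"
    using measurable_clip[of J "\<lambda>i x. x i" seqM] by simp
  have clipm': "clip J \<in> measurable (density Om (\<lambda>x. ennreal (wt k (tau J x - 1) / W))) seqM"
    using clipm by (simp add: seqM_Om)
  have cS: "(\<lambda>\<omega>. clip J (nS \<omega>)) \<in> measurable M seqM"
    by (rule measurable_compose[OF nSm clipm])
  have "distr M seqM (\<lambda>\<omega>. clip J (nS \<omega>)) = distr (density Om (\<lambda>x. ennreal (wt k (tau J x - 1) / W))) seqM (clip J)"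
  proof (rule measure_eqI)
    fix A assume "A \<in> sets (distr M seqM (\<lambda>\<omega>. clip J (nS \<omega>)))"
    then have A: "A \<in> sets seqM" by simp
    have Am: "(\<lambda>x. indicator A (clip J x) :: ennreal) \<in> borel_measurable seqM"
      using measurable_compose[OF clipm borel_measurable_indicator[OF A]] .
    have Ad: "dep J (\<lambda>x. indicator A (clip J x) :: ennreal)"
    proof -
      have "clip J x = clip J y" if "\<forall>i\<in>J. x i = y i" for x y :: "nat \<Rightarrow> real"
        using that by (auto simp: clip_def fun_eq_iff)
      then show ?thesis unfolding dep_def by (intro allI impI arg_cong[where f = "indicator A"])
    qed
    have "emeasure (distr M seqM (\<lambda>\<omega>. clip J (nS \<omega>))) A = (\<integral>\<^sup>+ x. indicator A x \<partial>distr M seqM (\<lambda>\<omega>. clip J (nS \<omega>)))"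
      using A by simp
    also have "\<dots> = (\<integral>\<^sup>+ \<omega>. indicator A (clip J (nS \<omega>)) \<partial>M)"
      using A by (intro nn_integral_distr cS) simp
    also have "\<dots> = c * (\<integral>\<^sup>+ x. indicator A (clip J x) * ennreal (wt k (tau J x - 1)) \<partial>Om)"
      by (rule c[OF Am Ad])
    also have "\<dots> = (\<integral>\<^sup>+ x. c * (indicator A (clip J x) * ennreal (wt k (tau J x - 1))) \<partial>Om)"
    proof (rule nn_integral_cmult[symmetric], rule borel_measurable_times_ennreal)
      show "(\<lambda>x. indicator A (clip J x) :: ennreal) \<in> borel_measurable Om"
        using Am by (simp only: seqM_Om)
      show "(\<lambda>x. ennreal (wt k (tau J x - 1))) \<in> borel_measurable Om" by measurable
    qed
    also have "\<dots> = (\<integral>\<^sup>+ x. ennreal (wt k (tau J x - 1) / W) * indicator A (clip J x) \<partial>Om)"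
    proof (rule nn_integral_cong)
      fix x
      have "c * ennreal (wt k (tau J x - 1)) = ennreal (wt k (tau J x - 1) / W)"
        unfolding c_eq using W by (simp flip: ennreal_mult)
      moreover have "c * (indicator A (clip J x) * ennreal (wt k (tau J x - 1))) = (c * ennreal (wt k (tau J x - 1))) * indicator A (clip J x)"
        by (simp only: ac_simps)
      ultimately show "c * (indicator A (clip J x) * ennreal (wt k (tau J x - 1))) = ennreal (wt k (tau J x - 1) / W) * indicator A (clip J x)"
        by simp
    qed
    also have "\<dots> = (\<integral>\<^sup>+ x. indicator A (clip J x) \<partial>density Om (\<lambda>x. ennreal (wt k (tau J x - 1) / W)))"
      using Am by (intro nn_integral_density[symmetric] wm) (simp only: seqM_Om)
    also have "\<dots> = (\<integral>\<^sup>+ x. indicator A x \<partial>distr (density Om (\<lambda>x. ennreal (wt k (tau J x - 1) / W))) seqM (clip J))"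
      using A by (intro nn_integral_distr[symmetric] clipm') simp
    finally show "emeasure (distr M seqM (\<lambda>\<omega>. clip J (nS \<omega>))) A
      = emeasure (distr (density Om (\<lambda>x. ennreal (wt k (tau J x - 1) / W))) seqM (clip J)) A"
      using A by simp
  qed simp
  from arg_cong[OF this, of "\<lambda>D. integral\<^sup>L D f"]
  have "(LINT \<omega>|M. f (clip J (nS \<omega>))) = (LINT x|density Om (\<lambda>x. ennreal (wt k (tau J x - 1) / W)). f (clip J x))"
    by (simp only: integral_distr[OF cS fm] integral_distr[OF clipm' fm])
  also have "\<dots> = (LINT x|Om. (wt k (tau J x - 1) / W) *\<^sub>R f x)"
    unfolding dep_clip[OF f] using fm W by (intro integral_density) (auto simp: seqM_Om)
  also have "\<dots> = (LINT x|Om. (1 / W) *\<^sub>R (wt k (tau J x - 1) *\<^sub>R f x))"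
    by simp
  also have "\<dots> = (LINT x|Om. wt k (tau J x - 1) *\<^sub>R f x) /\<^sub>R W"
    by (simp only: integral_scaleR_right) (simp add: inverse_eq_divide)
  finally show ?thesis by (simp add: dep_clip[OF f] nS_def W_def)
qed

end

section \<open>Cyclic chains of blocks\<close>

lemma (in iid_coordinates) integral_square_sum:
  fixes f :: "'i \<Rightarrow> (nat \<Rightarrow> real) \<Rightarrow> real"
  assumes m: "\<And>i. i \<in> I \<Longrightarrow> f i \<in> borel_measurable Om"
    and sq: "\<And>i. i \<in> I \<Longrightarrow> integrable Om (\<lambda>x. (f i x)\<^sup>2)"
  shows "(LINT x|Om. (\<Sum>i\<in>I. f i x)\<^sup>2) = (\<Sum>i\<in>I. \<Sum>j\<in>I. LINT x|Om. f i x * f j x)"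
proof -
  have p: "integrable Om (\<lambda>x. f i x * f j x)" if "i \<in> I" "j \<in> I" for i j
    using that by (intro integrable_square_mult m sq)
  have "(LINT x|Om. (\<Sum>i\<in>I. f i x)\<^sup>2) = (LINT x|Om. (\<Sum>i\<in>I. \<Sum>j\<in>I. f i x * f j x))"
    by (simp add: power2_eq_square sum_product)
  also have "\<dots> = (\<Sum>i\<in>I. LINT x|Om. (\<Sum>j\<in>I. f i x * f j x))"
    by (intro Bochner_Integration.integral_sum Bochner_Integration.integrable_sum p)
  also have "\<dots> = (\<Sum>i\<in>I. \<Sum>j\<in>I. LINT x|Om. f i x * f j x)"
    by (intro sum.cong refl Bochner_Integration.integral_sum p)
  finally show ?thesis .
qed

text \<open>The situation after division by \<sigma>, freed from window functions: total variance
  one, no correlation with the sum of all coordinates, and \<open>lam\<close> bounding the Lyapunov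
  sum. Summand \<open>j\<close> uses block \<open>j\<close> and its cyclic successor. The block
  sizes make n and q m comparable.\<close>

locale cyclic_chain = exp_coordinates +
  fixes n m q :: nat and Bl :: "nat \<Rightarrow> nat set" and \<xi> :: "nat \<Rightarrow> (nat \<Rightarrow> real) \<Rightarrow> real"
    and r lam :: real
  assumes r: "r > 2" and m1: "m \<ge> 1"
    and Bl_union: "(\<Union>j<q. Bl j) = {..<n}"
    and Bl_disj: "\<And>i j. i < q \<Longrightarrow> j < q \<Longrightarrow> i \<noteq> j \<Longrightarrow> Bl i \<inter> Bl j = {}"
    and Bl_card: "\<And>j. j < q \<Longrightarrow> m \<le> card (Bl j) \<and> card (Bl j) \<le> 2 * m"
    and meas: "\<And>j. j < q \<Longrightarrow> \<xi> j \<in> borel_measurable Om"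
    and mom: "\<And>j. j < q \<Longrightarrow> integrable Om (\<lambda>x. \<bar>\<xi> j x\<bar> powr r)"
    and mean: "\<And>j. j < q \<Longrightarrow> (LINT x|Om. \<xi> j x) = 0"
    and dep_xi: "\<And>j. j < q \<Longrightarrow> dep (Bl j \<union> Bl (Suc j mod q)) (\<xi> j)"
    and lam: "(\<Sum>j<q. LINT x|Om. \<bar>\<xi> j x\<bar> powr r) \<le> lam"
    and var1: "(LINT x|Om. (\<Sum>j<q. \<xi> j x)\<^sup>2) = 1"
    and cov0: "(LINT x|Om. (\<Sum>j<q. \<xi> j x) * tau {..<n} x) = 0"
begin

lemma xi_sq: "j < q \<Longrightarrow> integrable Om (\<lambda>x. (\<xi> j x)\<^sup>2)"
  using integrable_square_if_powr[OF r meas mom] .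

lemma xi_int: "j < q \<Longrightarrow> integrable Om (\<xi> j)"
  using integrable_square_imp[OF meas xi_sq] .

lemma finite_Bl: "j < q \<Longrightarrow> finite (Bl j)"
  using Bl_union by (auto intro: finite_subset[of _ "{..<n}"])

lemma card_UN_Bl: "I \<subseteq> {..<q} \<Longrightarrow> card (\<Union>j\<in>I. Bl j) = (\<Sum>j\<in>I. card (Bl j))"
  by (intro card_UN_disjoint) (auto intro: finite_subset[of I "{..<q}"] finite_Bl dest: Bl_disj)

lemma card_UN_Bl_bounds:
  assumes "I \<subseteq> {..<q}"
  shows "card I * m \<le> card (\<Union>j\<in>I. Bl j)" "card (\<Union>j\<in>I. Bl j) \<le> card I * (2 * m)"
proof -
  have *: "m \<le> card (Bl j)" "card (Bl j) \<le> 2 * m" if "j \<in> I" for j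
    using that assms Bl_card[of j] by auto
  show "card I * m \<le> card (\<Union>j\<in>I. Bl j)"
    unfolding card_UN_Bl[OF assms] using sum_bounded_below[of I m "\<lambda>j. card (Bl j)"] *(1) by simp
  show "card (\<Union>j\<in>I. Bl j) \<le> card I * (2 * m)"
    unfolding card_UN_Bl[OF assms] using sum_bounded_above[of I "\<lambda>j. card (Bl j)" "2 * m"] *(2) by simp
qed

lemma q_bounds: "q * m \<le> n" "n \<le> q * (2 * m)"
  using card_UN_Bl_bounds[of "{..<q}"] by (simp_all add: Bl_union)

text \<open>Cauchy-Schwarz; too crude for a long sum, but sufficient for the few summands left over
  between the arcs.\<close>

lemma sum_sq_le:
  assumes I: "I \<subseteq> {..<q}" and \<gamma>: "\<And>j. j < q \<Longrightarrow> (LINT x|Om. (\<xi> j x)\<^sup>2) \<le> \<gamma>"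
  shows "(LINT x|Om. (\<Sum>j\<in>I. \<xi> j x)\<^sup>2) \<le> (real (card I))\<^sup>2 * \<gamma>"
proof -
  have fI: "finite I" using I by (rule finite_subset) simp
  have "(LINT x|Om. (\<Sum>j\<in>I. \<xi> j x)\<^sup>2) \<le> (LINT x|Om. real (card I) * (\<Sum>j\<in>I. (\<xi> j x)\<^sup>2))"
  proof (rule integral_mono)
    show "integrable Om (\<lambda>x. (\<Sum>j\<in>I. \<xi> j x)\<^sup>2)"
      using I meas xi_sq by (intro integrable_square_sum) auto
    show "integrable Om (\<lambda>x. real (card I) * (\<Sum>j\<in>I. (\<xi> j x)\<^sup>2))"
      using I xi_sq by (intro integrable_mult_right Bochner_Integration.integrable_sum) auto
    fix x
    show "(\<Sum>j\<in>I. \<xi> j x)\<^sup>2 \<le> real (card I) * (\<Sum>j\<in>I. (\<xi> j x)\<^sup>2)"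
      using sum_squared_le_sum_of_squares[of "\<lambda>j. \<xi> j x" I] by (simp add: mult.commute)
  qed
  also have "\<dots> = real (card I) * (\<Sum>j\<in>I. LINT x|Om. (\<xi> j x)\<^sup>2)"
    using I xi_sq by (subst integral_mult_right_zero, subst Bochner_Integration.integral_sum) auto
  also have "\<dots> \<le> real (card I) * (real (card I) * \<gamma>)"
    using I \<gamma> by (intro mult_left_mono sum_bounded_above) auto
  finally show ?thesis by (simp add: power2_eq_square mult.assoc)
qed

text \<open>Truncation at \<theta>. No single summand carries much variance, which permits
  discarding the summands at the boundaries of arcs.\<close>

lemma xi_sq_le:
  assumes \<theta>: "\<theta> > 0" and j: "j < q"
  shows "(LINT x|Om. (\<xi> j x)\<^sup>2) \<le> \<theta>\<^sup>2 + \<theta> powr (2 - r) * lam"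
proof -
  have pt: "y\<^sup>2 \<le> \<theta>\<^sup>2 + \<theta> powr (2 - r) * \<bar>y\<bar> powr r" for y :: real
  proof (cases "\<bar>y\<bar> \<le> \<theta>")
    case True
    then have "y\<^sup>2 \<le> \<theta>\<^sup>2" using power_mono[of "\<bar>y\<bar>" \<theta> 2] by simp
    then show ?thesis by (simp add: add_increasing2)
  next
    case False
    then have y: "\<bar>y\<bar> > 0" using \<theta> by auto
    have "y\<^sup>2 = \<bar>y\<bar> powr 2" using y by (simp add: powr_numeral)
    also have "\<dots> \<le> \<bar>y\<bar> powr 2 * (\<bar>y\<bar> / \<theta>) powr (r - 2)"
      using \<theta> False r ge_one_powr_ge_zero[of "\<bar>y\<bar> / \<theta>" "r - 2"] mult_left_mono[of 1 "(\<bar>y\<bar> / \<theta>) powr (r - 2)" "\<bar>y\<bar> powr 2"]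
      by (simp add: field_simps)
    also have "\<dots> = \<theta> powr (2 - r) * \<bar>y\<bar> powr r"
      using \<theta> y by (simp add: powr_divide powr_diff field_simps)
    finally show ?thesis by (simp add: add_increasing)
  qed
  have "(LINT x|Om. (\<xi> j x)\<^sup>2) \<le> (LINT x|Om. \<theta>\<^sup>2 + \<theta> powr (2 - r) * \<bar>\<xi> j x\<bar> powr r)"
    using pt xi_sq[OF j] mom[OF j] by (intro integral_mono) auto
  also have "\<dots> = \<theta>\<^sup>2 + \<theta> powr (2 - r) * (LINT x|Om. \<bar>\<xi> j x\<bar> powr r)"
    using mom[OF j] by simp
  also have "(LINT x|Om. \<bar>\<xi> j x\<bar> powr r) \<le> (\<Sum>j<q. LINT x|Om. \<bar>\<xi> j x\<bar> powr r)"
    using j by (intro member_le_sum) (auto intro: Bochner_Integration.integral_nonneg)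
  finally show ?thesis using lam by (meson add_left_mono mult_left_mono order_trans powr_ge_zero)
qed

text \<open>In each of \<open>K\<close> arcs of \<open>c\<close> blocks the first c - 1 summands
  stay inside the arc, so the arc sums are independent and their variances add. At most 2 K summands
  remain, and their sum has second moment at most 1/2. Hence the arc variances add up to at most 2 *
  1 + 2 * 1/2 = 3, and one of them is at most 3 / K.\<close>

lemma exists_light_arc:
  assumes K: "K \<ge> 1" "2 * K \<le> q" and \<gamma>: "\<And>j. j < q \<Longrightarrow> (LINT x|Om. (\<xi> j x)\<^sup>2) \<le> \<gamma>"
    and small: "8 * (real K)\<^sup>2 * \<gamma> \<le> 1"
  defines "c \<equiv> q div K"
  obtains i where "i < K" "(LINT x|Om. (\<Sum>j\<in>{i * c..<i * c + (c - 1)}. \<xi> j x)\<^sup>2) \<le> 3 / K"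
proof -
  define I where "I i = {i * c..<i * c + (c - 1)}" for i
  define A where "A i x = (\<Sum>j\<in>I i. \<xi> j x)" for i x
  have c2: "c \<ge> 2" unfolding c_def using K by (metis div_le_mono nonzero_mult_div_cancel_right not_one_le_zero)
  have cK: "c * K \<le> q" unfolding c_def by (simp add: mult.commute)
  have I_lt: "j < q \<and> Suc j < i * c + c \<and> i * c \<le> j \<and> Suc j < q" if "i < K" "j \<in> I i" for i j
  proof -
    have "i * c + c \<le> K * c" using that(1) by (metis Suc_leI mult.commute mult_Suc_right mult_le_mono2 add.commute)
    then have "i * c + c \<le> q" using cK by (simp add: mult.commute)
    then show ?thesis using that c2 by (auto simp: I_def)
  qed
  have Isub: "I i \<subseteq> {..<q}" if "i < K" for i using I_lt[OF that] by auto
  have arc_disj: "u \<noteq> v" if "i < K" "j < K" "i \<noteq> j" "u \<in> {i * c..<i * c + c}" "v \<in> {j * c..<j * c + c}" for i j u v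
  proof -
    have "u div c = i" "v div c = j" using that c2 by (auto simp: div_nat_eqI mult.commute)
    then show ?thesis using that by auto
  qed
  have Am: "A i \<in> borel_measurable Om" if "i < K" for i
    unfolding A_def using Isub[OF that] meas by (intro borel_measurable_sum) auto
  have Asq: "integrable Om (\<lambda>x. (A i x)\<^sup>2)" if "i < K" for i
    unfolding A_def using Isub[OF that] meas xi_sq by (intro integrable_square_sum) auto
  have Aint: "integrable Om (A i)" if "i < K" for i
    using integrable_square_imp[OF Am Asq] that by blast
  have Amean: "(LINT x|Om. A i x) = 0" if "i < K" for i
    unfolding A_def using Isub[OF that] xi_int mean
    by (subst Bochner_Integration.integral_sum) (auto intro!: sum.neutral)
  have Adep: "dep (\<Union>j\<in>{i * c..<i * c + c}. Bl j) (A i)" if "i < K" for i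
    unfolding A_def
  proof (rule dep_sum)
    fix j assume j: "j \<in> I i"
    note l = I_lt[OF that j]
    have "Suc j mod q = Suc j" "j \<in> {i * c..<i * c + c}" "Suc j \<in> {i * c..<i * c + c}" using l by auto
    then have "Bl j \<union> Bl (Suc j mod q) \<subseteq> (\<Union>j\<in>{i * c..<i * c + c}. Bl j)" by (metis Un_least UN_upper)
    then show "dep (\<Union>j\<in>{i * c..<i * c + c}. Bl j) (\<xi> j)"
      using l by (intro dep_mono[OF dep_xi]) auto
  qed
  have orth: "(LINT x|Om. A i x * A j x) = 0" if ij: "i < K" "j < K" "i \<noteq> j" for i j
  proof -
    have "(\<Union>u\<in>{i * c..<i * c + c}. Bl u) \<inter> (\<Union>v\<in>{j * c..<j * c + c}. Bl v) = {}"
    proof -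
      have lt: "u < q" if "k < K" "u \<in> {k * c..<k * c + c}" for k u
      proof -
        have "k * c + c \<le> K * c" using that(1) by (metis Suc_leI mult.commute mult_Suc_right mult_le_mono2 add.commute)
        then show ?thesis using that cK by (simp add: mult.commute)
      qed
      have "Bl u \<inter> Bl v = {}" if "u \<in> {i * c..<i * c + c}" "v \<in> {j * c..<j * c + c}" for u v
        using Bl_disj[OF lt[OF ij(1) that(1)] lt[OF ij(2) that(2)] arc_disj[OF ij that]] .
      then show ?thesis by blast
    qed
    from integral_mult_indep[OF Aint[OF ij(1)] Adep[OF ij(1)] Aint[OF ij(2)] Adep[OF ij(2)] this]
    show ?thesis using Amean ij by simp
  qed
  have var: "(LINT x|Om. (\<Sum>i<K. A i x)\<^sup>2) = (\<Sum>i<K. LINT x|Om. (A i x)\<^sup>2)"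
  proof -
    have "(LINT x|Om. (\<Sum>i<K. A i x)\<^sup>2) = (\<Sum>i<K. \<Sum>j<K. LINT x|Om. A i x * A j x)"
      using Am Asq by (intro integral_square_sum) auto
    also have "\<dots> = (\<Sum>i<K. \<Sum>j<K. if j = i then LINT x|Om. (A i x)\<^sup>2 else 0)"
      by (intro sum.cong refl) (use orth in \<open>auto simp: power2_eq_square\<close>)
    finally show ?thesis by simp
  qed
  define R where "R = {..<q} - (\<Union>i<K. I i)"
  have disjI: "I i \<inter> I j = {}" if "i < K" "j < K" "i \<noteq> j" for i j
  proof -
    have "u \<noteq> v" if "u \<in> I i" "v \<in> I j" for u v
      using that by (intro arc_disj[OF \<open>i < K\<close> \<open>j < K\<close> \<open>i \<noteq> j\<close>]) (auto simp: I_def)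
    then show ?thesis by blast
  qed
  have UI: "(\<Union>i<K. I i) \<subseteq> {..<q}" using Isub by auto
  have cU: "card (\<Union>i<K. I i) = K * (c - 1)"
    using disjI by (subst card_UN_disjoint) (auto simp: I_def)
  \<comment> \<open>One summand is lost at the end of each arc, and q mod K < K blocks belong to no
    arc.\<close>
  have cR: "card R \<le> 2 * K"
  proof -
    have "card R = q - K * (c - 1)" unfolding R_def using UI by (subst card_Diff_subset) (auto simp: cU intro: finite_subset)
    also have "q = c * K + q mod K" unfolding c_def by simp
    also have "c * K + q mod K - K * (c - 1) = K + q mod K"
      using c2 by (cases c) (auto simp: algebra_simps)
    also have "\<dots> \<le> 2 * K" using K mod_less_divisor[of K q] by simp
    finally show ?thesis .
  qed
  have split: "(\<Sum>i<K. A i x) = (\<Sum>j<q. \<xi> j x) - (\<Sum>j\<in>R. \<xi> j x)" for x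
  proof -
    have "(\<Sum>j<q. \<xi> j x) = (\<Sum>j\<in>R. \<xi> j x) + (\<Sum>j\<in>(\<Union>i<K. I i). \<xi> j x)"
      unfolding R_def using UI by (rule sum.subset_diff) simp
    also have "(\<Sum>j\<in>(\<Union>i<K. I i). \<xi> j x) = (\<Sum>i<K. A i x)"
      unfolding A_def using disjI by (intro sum.UNION_disjoint) (auto simp: I_def)
    finally show ?thesis by simp
  qed
  have Rsub: "R \<subseteq> {..<q}" by (auto simp: R_def)
  have g0: "\<gamma> \<ge> 0"
  proof -
    have "0 < q" using K by simp
    have "0 \<le> (LINT x|Om. (\<xi> 0 x)\<^sup>2)" by (intro Bochner_Integration.integral_nonneg) simp
    then show ?thesis using \<gamma>[OF \<open>0 < q\<close>] by linarith
  qed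
  have ER: "(LINT x|Om. (\<Sum>j\<in>R. \<xi> j x)\<^sup>2) \<le> 1 / 2"
  proof -
    have "(LINT x|Om. (\<Sum>j\<in>R. \<xi> j x)\<^sup>2) \<le> (real (card R))\<^sup>2 * \<gamma>" by (rule sum_sq_le[OF Rsub \<gamma>])
    also have "\<dots> \<le> (2 * real K)\<^sup>2 * \<gamma>"
      using cR g0 by (intro mult_right_mono power_mono) auto
    also have "\<dots> \<le> 1 / 2" using small by (simp add: power_mult_distrib)
    finally show ?thesis .
  qed
  have Zsq: "integrable Om (\<lambda>x. (\<Sum>j<q. \<xi> j x)\<^sup>2)" and Rsq: "integrable Om (\<lambda>x. (\<Sum>j\<in>R. \<xi> j x)\<^sup>2)"
    using meas xi_sq Rsub by (auto intro!: integrable_square_sum)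
  have "(\<Sum>i<K. LINT x|Om. (A i x)\<^sup>2) \<le> (LINT x|Om. 2 * (\<Sum>j<q. \<xi> j x)\<^sup>2 + 2 * (\<Sum>j\<in>R. \<xi> j x)\<^sup>2)"
    unfolding var[symmetric]
  proof (rule integral_mono)
    show "integrable Om (\<lambda>x. (\<Sum>i<K. A i x)\<^sup>2)" using Am Asq by (intro integrable_square_sum) auto
    show "integrable Om (\<lambda>x. 2 * (\<Sum>j<q. \<xi> j x)\<^sup>2 + 2 * (\<Sum>j\<in>R. \<xi> j x)\<^sup>2)" using Zsq Rsq by simp
    fix x
    show "(\<Sum>i<K. A i x)\<^sup>2 \<le> 2 * (\<Sum>j<q. \<xi> j x)\<^sup>2 + 2 * (\<Sum>j\<in>R. \<xi> j x)\<^sup>2"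
      unfolding split using zero_le_power2[of "(\<Sum>j<q. \<xi> j x) + (\<Sum>j\<in>R. \<xi> j x)"]
      by (simp add: power2_eq_square algebra_simps)
  qed
  also have "\<dots> \<le> 3" using Zsq Rsq ER var1 by simp
  finally have le3: "(\<Sum>i<K. LINT x|Om. (A i x)\<^sup>2) \<le> 3" .
  have "\<exists>i<K. (LINT x|Om. (A i x)\<^sup>2) \<le> 3 / K"
  proof (rule ccontr)
    assume "\<not> ?thesis"
    then have "(\<Sum>i<K. 3 / real K) < (\<Sum>i<K. LINT x|Om. (A i x)\<^sup>2)"
      using K by (intro sum_strict_mono) (auto simp: not_le lessThan_empty_iff)
    then show False using le3 K by simp
  qed
  then show thesis using that unfolding A_def I_def by blast
qed

end

section \<open>Leaving out a light arc\<close>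

lemma (in iid_coordinates) Cauchy_Schwarz_integral:
  fixes f g :: "(nat \<Rightarrow> real) \<Rightarrow> real"
  assumes m: "f \<in> borel_measurable Om" "g \<in> borel_measurable Om"
    and sq: "integrable Om (\<lambda>x. (f x)\<^sup>2)" "integrable Om (\<lambda>x. (g x)\<^sup>2)"
  shows "(LINT x|Om. f x * g x)\<^sup>2 \<le> (LINT x|Om. (f x)\<^sup>2) * (LINT x|Om. (g x)\<^sup>2)"
proof -
  define F where "F = (LINT x|Om. (f x)\<^sup>2)"
  define G where "G = (LINT x|Om. (g x)\<^sup>2)"
  define C where "C = (LINT x|Om. f x * g x)"
  have fg: "integrable Om (\<lambda>x. f x * g x)" by (rule integrable_square_mult[OF m(1) m(2) sq(1) sq(2)])
  have pos: "0 \<le> F - 2 * s * C + s\<^sup>2 * G" for s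
  proof -
    have "0 \<le> (LINT x|Om. (f x - s * g x)\<^sup>2)" by (intro Bochner_Integration.integral_nonneg) simp
    also have "\<dots> = (LINT x|Om. (f x)\<^sup>2 - (2 * s) * (f x * g x) + s\<^sup>2 * (g x)\<^sup>2)"
      by (intro Bochner_Integration.integral_cong refl) (simp add: power2_eq_square algebra_simps)
    also have "\<dots> = F - 2 * s * C + s\<^sup>2 * G"
      unfolding F_def G_def C_def using sq fg by (simp add: integral_diff)
    finally show ?thesis .
  qed
  have G0: "G \<ge> 0" unfolding G_def by (intro Bochner_Integration.integral_nonneg) simp
  show ?thesis
  proof (cases "G = 0")
    case True
    have "C = 0"
    proof (rule ccontr)
      assume "C \<noteq> 0"
      \<comment> \<open>With G = 0 the quadratic is linear in s, and this choice of s gives it the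
        value -1.\<close>
      then show False using pos[of "(F + 1) / (2 * C)"] True by (simp add: field_simps)
    qed
    then show ?thesis using True by (simp add: C_def G_def)
  next
    case False
    then have "0 \<le> (F - 2 * (C / G) * C + (C / G)\<^sup>2 * G) * G" using G0 pos[of "C / G"] by simp
    also have "\<dots> = F * G - C\<^sup>2" using False by (simp add: power2_eq_square field_simps)
    finally show ?thesis by (simp add: F_def G_def C_def)
  qed
qed

text \<open>
  The blocks \<open>e, \<dots>, e + c - 1\<close> form the arc that is left out; \<open>rot\<close> renumbers the blocks
  so that this arc comes last, and \<open>Y_sq\<close> says that the summands involving it are small.
\<close>

locale rotated_chain = cyclic_chain +
  fixes e c :: nat and y2 :: real
  assumes ec: "e + c \<le> q" and c2: "2 \<le> c" and cq: "c + 2 \<le> q"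
    and Y_sq: "(LINT x|Om. (\<Sum>s\<in>{q - c - 1..<q}. \<xi> ((e + c + s) mod q) x)\<^sup>2) \<le> y2"
begin

definition rot :: "nat \<Rightarrow> nat" where "rot s = (e + c + s) mod q"

text \<open>In the numbering by \<open>rot\<close> the retained blocks are 0, ..., q - c - 1. The
  summand with index q - c - 1 already reaches into the omitted arc, so the sum stops just before
  it.\<close>

definition Zp :: "(nat \<Rightarrow> real) \<Rightarrow> real" where "Zp x = (\<Sum>s<q - c - 1. \<xi> (rot s) x)"

definition Y :: "(nat \<Rightarrow> real) \<Rightarrow> real" where "Y x = (\<Sum>s\<in>{q - c - 1..<q}. \<xi> (rot s) x)"

definition JB :: "nat set" where "JB = (\<Union>s<q - c. Bl (rot s))"

text \<open>The blocks seen by \<open>Y\<close>: the arc, the block preceding it, and block 0 of the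
  new numbering, which follows the arc cyclically and is used by the last summand.\<close>

definition JY :: "nat set" where "JY = (\<Union>s\<in>insert 0 {q - c - 1..<q}. Bl (rot s))"

lemma q0: "q > 0" using cq by simp

lemma rot_lt: "rot s < q" using q0 by (simp add: rot_def)

lemma rot_inj: "inj_on rot {..<q}"
proof (rule inj_onI)
  have *: "s = s'" if "s \<le> s'" "s' < q" "rot s = rot s'" for s s'
  proof -
    have "(e + c + s') mod q = (e + c + s) mod q" using that(3) by (simp add: rot_def)
    then have "q dvd (e + c + s') - (e + c + s)" using that(1) by (subst mod_eq_dvd_iff_nat[symmetric]) auto
    then have "q dvd s' - s" by simp
    then have "s' - s = 0" using that(2) by (meson dvd_imp_le less_imp_diff_less not_gr_zero not_le)
    then show ?thesis using that(1) by simp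
  qed
  fix s s' assume "s \<in> {..<q}" "s' \<in> {..<q}" "rot s = rot s'"
  then show "s = s'" using *[of s s'] *[of s' s] by (cases "s \<le> s'") auto
qed

lemma rot_image: "rot ` {..<q} = {..<q}"
  using rot_inj rot_lt by (intro endo_inj_surj) auto

lemma rot_Suc: "Suc (rot s) mod q = rot (Suc s)"
  by (simp add: rot_def mod_Suc_eq)

lemma Z_split: "(\<Sum>j<q. \<xi> j x) = Zp x + Y x"
proof -
  have "(\<Sum>j<q. \<xi> j x) = (\<Sum>j\<in>rot ` {..<q}. \<xi> j x)" by (simp add: rot_image)
  also have "\<dots> = (\<Sum>s<q. \<xi> (rot s) x)" by (simp add: sum.reindex[OF rot_inj] comp_def)
  also have "\<dots> = Zp x + Y x"
    unfolding Zp_def Y_def lessThan_atLeast0 by (subst sum.atLeastLessThan_concat) auto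
  finally show ?thesis .
qed

lemma xi_rot_dep: "dep (Bl (rot s) \<union> Bl (rot (Suc s))) (\<xi> (rot s))"
  using dep_xi[OF rot_lt, of s] by (simp add: rot_Suc)

lemma Bl_rot_disj: "s < q \<Longrightarrow> s' < q \<Longrightarrow> s \<noteq> s' \<Longrightarrow> Bl (rot s) \<inter> Bl (rot s') = {}"
  using rot_inj by (intro Bl_disj rot_lt) (auto dest: inj_onD)

lemma Zp_measurable [measurable]: "Zp \<in> borel_measurable Om"
  unfolding Zp_def by (intro borel_measurable_sum meas rot_lt)

lemma Y_measurable [measurable]: "Y \<in> borel_measurable Om"
  unfolding Y_def by (intro borel_measurable_sum meas rot_lt)

lemma Zp_sq: "integrable Om (\<lambda>x. (Zp x)\<^sup>2)"
  unfolding Zp_def by (intro integrable_square_sum meas xi_sq rot_lt)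

lemma Y_sq_int: "integrable Om (\<lambda>x. (Y x)\<^sup>2)"
  unfolding Y_def by (intro integrable_square_sum meas xi_sq rot_lt)

lemma Y_sq_le: "(LINT x|Om. (Y x)\<^sup>2) \<le> y2"
  using Y_sq by (simp add: Y_def rot_def)

lemma y2_nonneg: "0 \<le> y2"
proof -
  have "0 \<le> (LINT x|Om. (Y x)\<^sup>2)" by (intro Bochner_Integration.integral_nonneg) simp
  then show ?thesis using Y_sq_le by linarith
qed

lemma Zp_int: "integrable Om Zp" and Y_int: "integrable Om Y"
  using integrable_square_imp[OF Zp_measurable Zp_sq] integrable_square_imp[OF Y_measurable Y_sq_int] by auto

lemma Zp_mean: "(LINT x|Om. Zp x) = 0"
  unfolding Zp_def by (subst Bochner_Integration.integral_sum) (auto intro: xi_int rot_lt simp: mean rot_lt)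

lemma Zp_dep: "dep JB Zp"
  unfolding Zp_def
proof (rule dep_sum)
  fix s assume "s \<in> {..<q - c - 1}"
  then have "Bl (rot s) \<union> Bl (rot (Suc s)) \<subseteq> JB" unfolding JB_def by (intro Un_least UN_upper) auto
  then show "dep JB (\<xi> (rot s))" by (rule dep_mono[OF xi_rot_dep])
qed

lemma Y_dep: "dep JY Y"
  unfolding Y_def
proof (rule dep_sum)
  fix s assume s: "s \<in> {q - c - 1..<q}"
  have "rot q = rot 0" by (simp add: rot_def)
  then have "Bl (rot (Suc s)) \<subseteq> JY"
    unfolding JY_def using s by (cases "Suc s = q") (auto intro!: UN_upper[of _ _ "\<lambda>s. Bl (rot s)"] simp del: UN_insert)
  moreover have "Bl (rot s) \<subseteq> JY" unfolding JY_def using s by (intro UN_upper) auto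
  ultimately show "dep JY (\<xi> (rot s))" by (intro dep_mono[OF xi_rot_dep]) auto
qed

lemma Bl_sub: "j < q \<Longrightarrow> Bl j \<subseteq> {..<n}"
  using Bl_union by auto

lemma JB_sub: "JB \<subseteq> {..<n}" unfolding JB_def using Bl_sub rot_lt by auto

lemma JY_sub: "JY \<subseteq> {..<n}" unfolding JY_def using Bl_sub rot_lt by blast

lemma finite_JB: "finite JB" using JB_sub by (rule finite_subset) simp

definition arc :: "nat set" where "arc = (\<Union>s\<in>{q - c..<q}. Bl (rot s))"

lemma JB_arc: "JB \<inter> arc = {}" "JB \<union> arc = {..<n}"
proof -
  show "JB \<inter> arc = {}"
    unfolding JB_def arc_def using Bl_rot_disj by (fastforce simp: disjoint_iff)
  have "{..<n} = (\<Union>j\<in>rot ` {..<q}. Bl j)" unfolding rot_image by (simp add: Bl_union)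
  also have "\<dots> = (\<Union>s<q. Bl (rot s))" by simp
  also have "{..<q} = {..<q - c} \<union> {q - c..<q}" by auto
  finally show "JB \<union> arc = {..<n}" by (simp add: JB_def arc_def UN_Un)
qed

lemma finite_arc: "finite arc" using JB_arc(2) by (metis finite_Un finite_lessThan)

lemma card_JB_arc: "card JB + card arc = n"
  using card_Un_disjoint[OF finite_JB finite_arc JB_arc(1)] JB_arc(2) by simp

lemma UN_rot_bounds:
  assumes I: "I \<subseteq> {..<q}"
  shows "card I * m \<le> card (\<Union>s\<in>I. Bl (rot s))" "card (\<Union>s\<in>I. Bl (rot s)) \<le> card I * (2 * m)"
proof -
  have "card (rot ` I) = card I" using I rot_inj by (intro card_image) (auto intro: inj_on_subset)
  moreover have "rot ` I \<subseteq> {..<q}" using rot_lt by auto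
  ultimately show "card I * m \<le> card (\<Union>s\<in>I. Bl (rot s))" "card (\<Union>s\<in>I. Bl (rot s)) \<le> card I * (2 * m)"
    using card_UN_Bl_bounds[of "rot ` I"] by simp_all
qed

lemma card_arc: "c * m \<le> card arc" "card arc \<le> c * (2 * m)"
proof -
  have s: "{q - c..<q} \<subseteq> {..<q}" by auto
  have c: "card {q - c..<q} = c" using ec by simp
  show "c * m \<le> card arc" "card arc \<le> c * (2 * m)"
    using UN_rot_bounds[OF s] unfolding arc_def c .
qed

lemma card_JY: "card JY \<le> (c + 2) * (2 * m)"
proof -
  have s: "insert 0 {q - c - 1..<q} \<subseteq> {..<q}" using q0 by auto
  have "card JY \<le> card (insert 0 {q - c - 1..<q}) * (2 * m)"
    unfolding JY_def by (rule UN_rot_bounds(2)[OF s])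
  also have "card (insert 0 {q - c - 1..<q}) \<le> c + 2"
    using cq by (intro order_trans[OF card_insert_le_m1]) auto
  finally show ?thesis by simp
qed

text \<open>Write \<open>Zp\<close> as the full sum minus \<open>Y\<close>; the full sum has
  variance one, and Cauchy-Schwarz handles the cross term.\<close>

lemma alpha_bound: "\<bar>(LINT x|Om. (Zp x)\<^sup>2) - 1\<bar> \<le> 2 * sqrt y2 + y2"
proof -
  define Z where "Z x = (\<Sum>j<q. \<xi> j x)" for x
  have Zm: "Z \<in> borel_measurable Om" and Zsq: "integrable Om (\<lambda>x. (Z x)\<^sup>2)"
    unfolding Z_def using meas xi_sq by (auto intro!: integrable_square_sum borel_measurable_sum)
  have ZY: "integrable Om (\<lambda>x. Z x * Y x)" by (intro integrable_square_mult Zm Zsq Y_measurable Y_sq_int)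
  have "Zp x = Z x - Y x" for x using Z_split[of x] by (simp add: Z_def)
  then have "(Zp x)\<^sup>2 = (Z x)\<^sup>2 - 2 * (Z x * Y x) + (Y x)\<^sup>2" for x
    by (simp add: power2_diff)
  then have "(LINT x|Om. (Zp x)\<^sup>2) = (LINT x|Om. (Z x)\<^sup>2 - 2 * (Z x * Y x) + (Y x)\<^sup>2)"
    by simp
  also have "\<dots> = 1 - 2 * (LINT x|Om. Z x * Y x) + (LINT x|Om. (Y x)\<^sup>2)"
    using Zsq ZY Y_sq_int var1 by (simp add: Z_def)
  finally have *: "(LINT x|Om. (Zp x)\<^sup>2) - 1 = - 2 * (LINT x|Om. Z x * Y x) + (LINT x|Om. (Y x)\<^sup>2)" by simp
  have "(LINT x|Om. Z x * Y x)\<^sup>2 \<le> 1 * y2"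
    using Cauchy_Schwarz_integral[OF Zm Y_measurable Zsq Y_sq_int] var1 Y_sq_le by (simp add: Z_def)
  then have "\<bar>LINT x|Om. Z x * Y x\<bar> \<le> sqrt y2"
    using real_sqrt_le_mono by fastforce
  moreover have "0 \<le> (LINT x|Om. (Y x)\<^sup>2)" by (intro Bochner_Integration.integral_nonneg) simp
  ultimately show ?thesis unfolding * using Y_sq_le by linarith
qed

text \<open>\<open>Zp\<close> is independent of the arc, so its covariance with the retained total
  equals that with the full total. The full sum is uncorrelated with the full total, hence only
  minus the covariance of \<open>Y\<close> with it remains, and Cauchy-Schwarz bounds its square by
  \<open>y2\<close> times the variance \<open>n\<close>.\<close>

lemma beta_bound: "(LINT x|Om. Zp x * tau JB x)\<^sup>2 \<le> y2 * n"
proof -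
  define Z where "Z x = (\<Sum>j<q. \<xi> j x)" for x
  have Zm: "Z \<in> borel_measurable Om" and Zsq: "integrable Om (\<lambda>x. (Z x)\<^sup>2)"
    unfolding Z_def using meas xi_sq by (auto intro!: integrable_square_sum borel_measurable_sum)
  have tsq: "integrable Om (\<lambda>x. (tau A x)\<^sup>2)" if "finite A" for A by (rule integrable_tau_power[OF that])
  have fn: "finite {..<n}" by simp
  have tau_split: "tau {..<n} x = tau JB x + tau arc x" for x
    unfolding tau_def JB_arc(2)[symmetric] by (rule sum.union_disjoint[OF finite_JB finite_arc JB_arc(1)])
  have i: "integrable Om (\<lambda>x. Zp x * tau JB x)" "integrable Om (\<lambda>x. Zp x * tau arc x)"
    "integrable Om (\<lambda>x. Z x * tau {..<n} x)" "integrable Om (\<lambda>x. Y x * tau {..<n} x)"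
    by (intro integrable_square_mult Zp_measurable Zp_sq Zm Zsq Y_measurable Y_sq_int tau_measurable tsq finite_JB finite_arc fn)+
  have "(LINT x|Om. Zp x * tau arc x) = 0"
    using integral_mult_indep[OF Zp_int Zp_dep integrable_tau[OF finite_arc] dep_tau JB_arc(1)] Zp_mean by simp
  moreover have "Zp x * tau JB x = Z x * tau {..<n} x - Y x * tau {..<n} x - Zp x * tau arc x" for x
    unfolding Z_def Z_split tau_split by (simp add: algebra_simps)
  ultimately have "(LINT x|Om. Zp x * tau JB x) = - (LINT x|Om. Y x * tau {..<n} x)"
    using i cov0 by (simp add: Z_def)
  then have "(LINT x|Om. Zp x * tau JB x)\<^sup>2 \<le> (LINT x|Om. (Y x)\<^sup>2) * (LINT x|Om. (tau {..<n} x)\<^sup>2)"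
    using Cauchy_Schwarz_integral[OF Y_measurable tau_measurable Y_sq_int tsq[OF fn]] by simp
  also have "\<dots> \<le> y2 * n"
    using Y_sq_le by (simp add: integral_tau_square mult_right_mono)
  finally show ?thesis .
qed

text \<open>Cutting the circle open at the arc leaves a linear chain, to which
  \<open>chain_char_bound\<close> applies with \<open>w * tau\<close> of each block as the one-block
  term. For that term \<open>rho\<close> is bounded with exponent 4: a block has at most 2 m
  coordinates, so the fourth moment of its \<open>tau\<close> is at most 18 m times its size, and
  the blocks together give a term of order u^4 (n / a)^2 (m / n).\<close>

lemma char_bound:
  fixes t u w \<kappa> :: real and a :: nat
  assumes \<delta>: "\<delta> > 0" and w: "w = u / sqrt a" and a: "a > 0" "real n \<le> \<kappa> * a" and y2: "y2 \<le> 1"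
  defines "v \<equiv> t\<^sup>2 * (LINT x|Om. (Zp x)\<^sup>2) + 2 * t * w * (LINT x|Om. Zp x * tau JB x) + w\<^sup>2 * card JB"
  shows "cmod ((LINT x|Om. iexp (t * Zp x + w * tau JB x)) - of_real (exp (- v / 2)))
    \<le> exp (v / 2) * (90000 * (\<delta> * (4 * t\<^sup>2) + \<delta> powr (2 - r) * (3 powr r * (1 + 2 * 2 powr r) * (\<bar>t\<bar> powr r * lam))
        + (\<delta> * (u\<^sup>2 * \<kappa>) + \<delta> powr (-2) * (18 * u ^ 4 * \<kappa>\<^sup>2 * (m / n)))))"
proof -
  define Q where "Q = q - c"
  have Q: "Q \<ge> 1" "Q \<le> q" using cq by (auto simp: Q_def)
  define X where "X s x = t * \<xi> (rot s) x" for s x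
  define T where "T s x = w * tau (Bl (rot s)) x" for s x
  have Tsum: "(\<Sum>s<Q. T s x) = w * tau JB x" for x
  proof -
    have "tau JB x = (\<Sum>s<Q. tau (Bl (rot s)) x)"
      unfolding tau_def JB_def Q_def[symmetric]
      using Q Bl_rot_disj finite_Bl[OF rot_lt] by (intro sum.UNION_disjoint) auto
    then show ?thesis by (simp add: T_def sum_distrib_left)
  qed
  have Xsum: "(\<Sum>s<Q - 1. X s x) = t * Zp x" for x
    by (simp add: X_def Zp_def Q_def sum_distrib_left)
  have tsq: "integrable Om (\<lambda>x. (tau JB x)\<^sup>2)" by (rule integrable_tau_power[OF finite_JB])
  have zt: "integrable Om (\<lambda>x. Zp x * tau JB x)"
    by (intro integrable_square_mult Zp_measurable Zp_sq tau_measurable tsq)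
  have v_eq: "(LINT x|Om. (t * Zp x + w * tau JB x)\<^sup>2) = v"
  proof -
    have "(LINT x|Om. (t * Zp x + w * tau JB x)\<^sup>2) = (LINT x|Om. t\<^sup>2 * (Zp x)\<^sup>2 + (2 * t * w) * (Zp x * tau JB x) + w\<^sup>2 * (tau JB x)\<^sup>2)"
      by (intro Bochner_Integration.integral_cong refl) (simp add: power2_eq_square algebra_simps)
    also have "\<dots> = v"
      using Zp_sq zt tsq by (simp add: v_def integral_tau_square[OF finite_JB])
    finally show ?thesis .
  qed
  have "cmod ((LINT x|Om. iexp ((\<Sum>s<Q - 1. X s x) + (\<Sum>s<Q. T s x))) - of_real (exp (- (LINT x|Om. ((\<Sum>s<Q - 1. X s x) + (\<Sum>s<Q. T s x))\<^sup>2) / 2)))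
    \<le> exp ((LINT x|Om. ((\<Sum>s<Q - 1. X s x) + (\<Sum>s<Q. T s x))\<^sup>2) / 2) * (90000 * (\<delta> * (LINT x|Om. (\<Sum>j<Q - 1. X j x)\<^sup>2)
        + \<delta> powr (2 - r) * (3 powr r * (1 + 2 * 2 powr r) * (\<Sum>j<Q - 1. LINT x|Om. \<bar>X j x\<bar> powr r))
        + (\<Sum>j<Q. LINT x|Om. rho (T j x))))"
  proof (rule chain_char_bound[where Bl = "\<lambda>s. Bl (rot s)", OF r])
    fix j
    show "X j \<in> borel_measurable Om" unfolding X_def using meas[OF rot_lt] by auto
    show "integrable Om (\<lambda>x. \<bar>X j x\<bar> powr r)" unfolding X_def using mom[OF rot_lt, of j] by (simp add: abs_mult powr_mult)
    show "(LINT x|Om. X j x) = 0" unfolding X_def using mean[OF rot_lt] by simp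
    show "dep (Bl (rot j) \<union> Bl (rot (Suc j))) (X j)" unfolding X_def by (rule dep_comp[OF xi_rot_dep])
    have fB: "finite (Bl (rot j))" by (rule finite_Bl[OF rot_lt])
    show "T j \<in> borel_measurable Om" unfolding T_def by measurable
    show "integrable Om (\<lambda>x. (T j x)\<^sup>2)" unfolding T_def using integrable_tau_power[OF fB, of 2] by (simp add: power_mult_distrib)
    show "(LINT x|Om. T j x) = 0" unfolding T_def using integral_tau[OF fB] by simp
    show "dep (Bl (rot j)) (T j)" unfolding T_def by (rule dep_comp[OF dep_tau])
  next
    fix i j assume "i < j" "j < Q"
    then show "Bl (rot i) \<inter> Bl (rot j) = {}" using Q by (intro Bl_rot_disj) auto
  qed (use Q \<delta> in auto)
  then have main: "cmod ((LINT x|Om. iexp (t * Zp x + w * tau JB x)) - of_real (exp (- v / 2)))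
    \<le> exp (v / 2) * (90000 * (\<delta> * (LINT x|Om. (t * Zp x)\<^sup>2)
        + \<delta> powr (2 - r) * (3 powr r * (1 + 2 * 2 powr r) * (\<Sum>j<Q - 1. LINT x|Om. \<bar>X j x\<bar> powr r))
        + (\<Sum>j<Q. LINT x|Om. rho (T j x))))"
    unfolding Xsum Tsum v_eq .
  have b1: "(LINT x|Om. (t * Zp x)\<^sup>2) \<le> 4 * t\<^sup>2"
  proof -
    have "sqrt y2 \<le> 1" using y2 by simp
    then have "(LINT x|Om. (Zp x)\<^sup>2) \<le> 4" using alpha_bound y2 by linarith
    then have "t\<^sup>2 * (LINT x|Om. (Zp x)\<^sup>2) \<le> t\<^sup>2 * 4" by (intro mult_left_mono) auto
    then show ?thesis by (simp add: power_mult_distrib)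
  qed
  have b2: "(\<Sum>j<Q - 1. LINT x|Om. \<bar>X j x\<bar> powr r) \<le> \<bar>t\<bar> powr r * lam"
  proof -
    have "(\<Sum>j<Q - 1. LINT x|Om. \<bar>X j x\<bar> powr r) = \<bar>t\<bar> powr r * (\<Sum>j<Q - 1. LINT x|Om. \<bar>\<xi> (rot j) x\<bar> powr r)"
      unfolding X_def by (simp add: abs_mult powr_mult sum_distrib_left)
    also have "(\<Sum>j<Q - 1. LINT x|Om. \<bar>\<xi> (rot j) x\<bar> powr r) \<le> (\<Sum>j<q. LINT x|Om. \<bar>\<xi> (rot j) x\<bar> powr r)"
      using Q by (intro sum_mono2) (auto intro: Bochner_Integration.integral_nonneg)
    also have "\<dots> = (\<Sum>j\<in>rot ` {..<q}. LINT x|Om. \<bar>\<xi> j x\<bar> powr r)"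
      by (simp add: sum.reindex[OF rot_inj] comp_def)
    also have "\<dots> \<le> lam" using lam by (simp add: rot_image)
    finally show ?thesis by (simp add: mult_left_mono)
  qed
  have n0: "n > 0" using q_bounds(1) q0 m1 by (metis gr_zeroI le_zero_eq mult_is_0 not_one_le_zero)
  have b3: "(\<Sum>j<Q. LINT x|Om. rho (T j x)) \<le> \<delta> * (u\<^sup>2 * \<kappa>) + \<delta> powr (-2) * (18 * u ^ 4 * \<kappa>\<^sup>2 * (m / n))"
  proof -
    have cJ: "(\<Sum>j<Q. card (Bl (rot j))) = card JB"
      unfolding JB_def Q_def[symmetric] using Q Bl_rot_disj finite_Bl[OF rot_lt]
      by (intro card_UN_disjoint[symmetric]) auto
    have cJn: "real (card JB) \<le> n" using card_JB_arc by simp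
    have "(LINT x|Om. rho (T j x)) \<le> \<delta> * (w\<^sup>2 * card (Bl (rot j))) + \<delta> powr (-2) * (w ^ 4 * (9 * (2 * m) * card (Bl (rot j))))" for j
    proof -
      have fB: "finite (Bl (rot j))" by (rule finite_Bl[OF rot_lt])
      have p4: "\<bar>y\<bar> powr 4 = y ^ 4" for y :: real by (cases "y = 0") (auto simp: powr_numeral)
      have i2: "integrable Om (\<lambda>x. (tau (Bl (rot j)) x)\<^sup>2)" and i4: "integrable Om (\<lambda>x. tau (Bl (rot j)) x ^ 4)"
        by (rule integrable_tau_power[OF fB])+
      have "(LINT x|Om. rho (T j x)) \<le> (LINT x|Om. \<delta> * (w\<^sup>2 * (tau (Bl (rot j)) x)\<^sup>2) + \<delta> powr (-2) * (w ^ 4 * tau (Bl (rot j)) x ^ 4))"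
      proof (rule integral_mono)
        show "integrable Om (\<lambda>x. rho (T j x))"
          unfolding T_def using i2 by (intro integrable_rho) (auto simp: power_mult_distrib)
        show "integrable Om (\<lambda>x. \<delta> * (w\<^sup>2 * (tau (Bl (rot j)) x)\<^sup>2) + \<delta> powr (-2) * (w ^ 4 * tau (Bl (rot j)) x ^ 4))"
          using i2 i4 by auto
        fix x
        show "rho (T j x) \<le> \<delta> * (w\<^sup>2 * (tau (Bl (rot j)) x)\<^sup>2) + \<delta> powr (-2) * (w ^ 4 * tau (Bl (rot j)) x ^ 4)"
          using rho_le_powr[OF \<delta>, of 4 "T j x"] by (simp add: p4 T_def power_mult_distrib)
      qed
      also have "\<dots> = \<delta> * (w\<^sup>2 * card (Bl (rot j))) + \<delta> powr (-2) * (w ^ 4 * (LINT x|Om. tau (Bl (rot j)) x ^ 4))"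
        using i2 i4 integral_tau_square[OF fB] by simp
      also have "\<dots> \<le> \<delta> * (w\<^sup>2 * card (Bl (rot j))) + \<delta> powr (-2) * (w ^ 4 * (9 * (2 * m) * card (Bl (rot j))))"
      proof -
        have "(LINT x|Om. tau (Bl (rot j)) x ^ 4) \<le> 9 * (real (card (Bl (rot j))))\<^sup>2" by (rule integral_tau_power4_le[OF fB])
        also have "\<dots> = 9 * real (card (Bl (rot j))) * card (Bl (rot j))" by (simp add: power2_eq_square)
        also have "\<dots> \<le> 9 * real (2 * m) * card (Bl (rot j))"
          using Bl_card[OF rot_lt, of j] by (intro mult_right_mono mult_left_mono) (auto simp del: of_nat_mult)
        finally have "(LINT x|Om. tau (Bl (rot j)) x ^ 4) \<le> real (9 * (2 * m) * card (Bl (rot j)))" by simp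
        then show ?thesis by (intro add_left_mono mult_left_mono) auto
      qed
      finally show ?thesis .
    qed
    then have "(\<Sum>j<Q. LINT x|Om. rho (T j x)) \<le> (\<Sum>j<Q. \<delta> * (w\<^sup>2 * card (Bl (rot j))) + \<delta> powr (-2) * (w ^ 4 * (9 * (2 * m) * card (Bl (rot j)))))"
      by (rule sum_mono)
    also have "\<dots> = \<delta> * (w\<^sup>2 * card JB) + \<delta> powr (-2) * (w ^ 4 * (18 * m * card JB))"
      unfolding cJ[symmetric] by (simp add: sum.distrib sum_distrib_left mult.assoc)
    also have "\<dots> \<le> \<delta> * (u\<^sup>2 * \<kappa>) + \<delta> powr (-2) * (18 * u ^ 4 * \<kappa>\<^sup>2 * (m / n))"
    proof (intro add_mono mult_left_mono)
      have wu: "w\<^sup>2 = u\<^sup>2 / a" using a by (simp add: w power_divide)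
      have na: "n / a \<le> \<kappa>" using a by (simp add: pos_divide_le_eq)
      have "w\<^sup>2 * card JB \<le> w\<^sup>2 * n" using cJn by (intro mult_left_mono) auto
      also have "\<dots> = u\<^sup>2 * (n / a)" by (simp add: wu)
      also have "\<dots> \<le> u\<^sup>2 * \<kappa>" using na by (intro mult_left_mono) auto
      finally show "w\<^sup>2 * card JB \<le> u\<^sup>2 * \<kappa>" .
      have w4: "w ^ 4 = u ^ 4 / a\<^sup>2"
      proof -
        have "w ^ 4 = (w\<^sup>2)\<^sup>2" by simp
        then show ?thesis unfolding wu by (simp add: power_divide)
      qed
      have "w ^ 4 * (18 * m * card JB) \<le> w ^ 4 * (18 * m * n)"
        using cJn by (intro mult_left_mono) (auto intro: mult_left_mono)
      also have "\<dots> = 18 * u ^ 4 * (n / a)\<^sup>2 * (m / n)"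
        using n0 a by (simp add: w4 power2_eq_square field_simps)
      also have "\<dots> \<le> 18 * u ^ 4 * \<kappa>\<^sup>2 * (m / n)"
        using na a by (intro mult_right_mono mult_left_mono power_mono) auto
      finally show "w ^ 4 * real (18 * m * card JB) \<le> 18 * u ^ 4 * \<kappa>\<^sup>2 * (m / n)" by simp
    qed (use \<delta> in auto)
    finally show ?thesis .
  qed
  have "\<delta> * (LINT x|Om. (t * Zp x)\<^sup>2) + \<delta> powr (2 - r) * (3 powr r * (1 + 2 * 2 powr r) * (\<Sum>j<Q - 1. LINT x|Om. \<bar>X j x\<bar> powr r))
        + (\<Sum>j<Q. LINT x|Om. rho (T j x))
     \<le> \<delta> * (4 * t\<^sup>2) + \<delta> powr (2 - r) * (3 powr r * (1 + 2 * 2 powr r) * (\<bar>t\<bar> powr r * lam))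
        + (\<delta> * (u\<^sup>2 * \<kappa>) + \<delta> powr (-2) * (18 * u ^ 4 * \<kappa>\<^sup>2 * (m / n)))"
    using \<delta> by (intro add_mono mult_left_mono b1 b2 b3) auto
  then have "exp (v / 2) * (90000 * (\<delta> * (LINT x|Om. (t * Zp x)\<^sup>2) + \<delta> powr (2 - r) * (3 powr r * (1 + 2 * 2 powr r) * (\<Sum>j<Q - 1. LINT x|Om. \<bar>X j x\<bar> powr r))
        + (\<Sum>j<Q. LINT x|Om. rho (T j x))))
     \<le> exp (v / 2) * (90000 * (\<delta> * (4 * t\<^sup>2) + \<delta> powr (2 - r) * (3 powr r * (1 + 2 * 2 powr r) * (\<bar>t\<bar> powr r * lam))
        + (\<delta> * (u\<^sup>2 * \<kappa>) + \<delta> powr (-2) * (18 * u ^ 4 * \<kappa>\<^sup>2 * (m / n)))))"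
    by (intro mult_left_mono) auto
  with main show ?thesis by (rule order_trans)
qed

end

section \<open>Gaussian averages and the conditional characteristic function\<close>

lemma std_normal_second_moment:
  "integrable std_normal_distribution (\<lambda>u. u\<^sup>2)" "(LINT u|std_normal_distribution. u\<^sup>2) = 1"
  using integrable_std_normal_distribution_moment[of 2] std_normal_distribution_even_moments(1)[of 1] by simp_all

lemma measurable_iexp [measurable]: "iexp \<in> borel_measurable borel"
  by (intro borel_measurable_continuous_onI continuous_intros)

context rotated_chain
begin

text \<open>One less than the size of the arc: n - 1 = card JB + a, so this is the exponent
  \<open>k\<close> of \<open>spacings_law\<close> for the retained set.\<close>

definition a :: nat where "a = card arc - 1"

definition vf :: "real \<Rightarrow> real \<Rightarrow> real" where
  "vf t u = t\<^sup>2 * (LINT x|Om. (Zp x)\<^sup>2) + 2 * t * (u / sqrt a) * (LINT x|Om. Zp x * tau JB x) + (u / sqrt a)\<^sup>2 * card JB"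

lemma vf_eq: "vf t u = (LINT x|Om. (t * Zp x + (u / sqrt a) * tau JB x)\<^sup>2)"
proof -
  have tsq: "integrable Om (\<lambda>x. (tau JB x)\<^sup>2)" by (rule integrable_tau_power[OF finite_JB])
  have zt: "integrable Om (\<lambda>x. Zp x * tau JB x)"
    by (intro integrable_square_mult Zp_measurable Zp_sq tau_measurable tsq)
  have "(LINT x|Om. (t * Zp x + (u / sqrt a) * tau JB x)\<^sup>2)
    = (LINT x|Om. t\<^sup>2 * (Zp x)\<^sup>2 + (2 * t * (u / sqrt a)) * (Zp x * tau JB x) + (u / sqrt a)\<^sup>2 * (tau JB x)\<^sup>2)"
  proof -
    have "(t * z + w * y)\<^sup>2 = t\<^sup>2 * z\<^sup>2 + (2 * t * w) * (z * y) + w\<^sup>2 * y\<^sup>2" for z w y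
      by (simp add: power2_eq_square algebra_simps)
    then show ?thesis by presburger
  qed
  also have "\<dots> = vf t u"
    using Zp_sq zt tsq unfolding vf_def by (simp add: integral_tau_square[OF finite_JB])
  finally show ?thesis by simp
qed

lemma vf_nonneg: "0 \<le> vf t u"
  unfolding vf_eq by (intro Bochner_Integration.integral_nonneg) simp

lemma gauss_mixture:
  assumes a: "a > 0"
  shows "(LINT x|Om. iexp (t * Zp x) * of_real (exp (- (tau JB x)\<^sup>2 / (2 * real a))))
    = (LINT u|std_normal_distribution. LINT x|Om. iexp (t * Zp x + (u / sqrt a) * tau JB x))"
proof -
  interpret N: real_distribution std_normal_distribution by (rule real_dist_normal_dist)
  interpret pair: pair_prob_space std_normal_distribution Om by unfold_locales
  have e: "iexp (t * Zp x) * of_real (exp (- (tau JB x)\<^sup>2 / (2 * real a)))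
      = (LINT u|std_normal_distribution. iexp (t * Zp x + (u / sqrt a) * tau JB x))" for x
  proof -
    have "(LINT u|std_normal_distribution. iexp (t * Zp x + (u / sqrt a) * tau JB x))
        = (LINT u|std_normal_distribution. iexp (t * Zp x) * iexp (u * (tau JB x / sqrt a)))"
      by (intro Bochner_Integration.integral_cong refl) (simp add: distrib_left exp_add)
    also have "\<dots> = iexp (t * Zp x) * of_real (exp (- (tau JB x / sqrt a)\<^sup>2 / 2))"
      unfolding integral_mult_right_zero gaussian_as_char ..
    also have "- (tau JB x / sqrt a)\<^sup>2 / 2 = - (tau JB x)\<^sup>2 / (2 * real a)"
      using a by (simp add: power_divide)
    finally show ?thesis by simp
  qed
  have "integrable (std_normal_distribution \<Otimes>\<^sub>M Om) (\<lambda>(u, x). iexp (t * Zp x + (u / sqrt a) * tau JB x))"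
  proof (rule pair.P.integrable_const_bound[where B = 1])
    have [measurable]: "(\<lambda>p. t * Zp (snd p) + (fst p / sqrt a) * tau JB (snd p)) \<in> borel_measurable (std_normal_distribution \<Otimes>\<^sub>M Om)"
      by measurable
    show "(\<lambda>(u, x). iexp (t * Zp x + (u / sqrt a) * tau JB x)) \<in> borel_measurable (std_normal_distribution \<Otimes>\<^sub>M Om)"
      unfolding split_beta' by (rule measurable_compose[OF _ measurable_iexp]) measurable
  qed (auto intro!: AE_I2 simp del: of_real_add of_real_mult of_real_divide)
  from pair.Fubini_integral[OF this] show ?thesis unfolding e by simp
qed

text \<open>For |u| <= U the hypothesis is used, for larger u the trivial bound 2 <= 2 u^2 / U^2
  together with the second moment of the Gaussian. The average of \<open>exp (- vf t u / 2)\<close>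
  is explicit: completing the square subtracts the squared covariance divided by a + card JB = n -
  1.\<close>

lemma mixture_bound:
  fixes t U \<epsilon> :: real
  assumes a: "a > 0" and U: "U > 0"
    and bound: "\<And>u. \<bar>u\<bar> \<le> U \<Longrightarrow> cmod ((LINT x|Om. iexp (t * Zp x + (u / sqrt a) * tau JB x)) - of_real (exp (- vf t u / 2))) \<le> \<epsilon>"
  shows "cmod ((LINT x|Om. iexp (t * Zp x) * of_real (exp (- (tau JB x)\<^sup>2 / (2 * real a))))
      - of_real (exp (- (t\<^sup>2 * ((LINT x|Om. (Zp x)\<^sup>2) - (LINT x|Om. Zp x * tau JB x)\<^sup>2 / (n - 1))) / 2) / sqrt (1 + card JB / a)))
    \<le> \<epsilon> + 2 / U\<^sup>2"
proof -
  interpret N: real_distribution std_normal_distribution by (rule real_dist_normal_dist)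
  interpret pair: pair_prob_space std_normal_distribution Om by unfold_locales
  define \<phi> where "\<phi> u = (LINT x|Om. iexp (t * Zp x + (u / sqrt a) * tau JB x))" for u
  have \<epsilon>: "\<epsilon> \<ge> 0" using order_trans[OF norm_ge_zero bound[of 0]] U by simp
  have phi1: "cmod (\<phi> u) \<le> 1" for u
  proof -
    have "cmod (\<phi> u) \<le> (LINT x|Om. cmod (iexp (t * Zp x + (u / sqrt a) * tau JB x)))"
      unfolding \<phi>_def by (rule integral_norm_bound)
    then show ?thesis by (simp del: of_real_add of_real_mult of_real_divide)
  qed
  have phim: "\<phi> \<in> borel_measurable std_normal_distribution"
    unfolding \<phi>_def
  proof (rule Om.borel_measurable_lebesgue_integral)
    have [measurable]: "(\<lambda>p. t * Zp (snd p) + (fst p / sqrt a) * tau JB (snd p)) \<in> borel_measurable (std_normal_distribution \<Otimes>\<^sub>M Om)"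
      by measurable
    show "(\<lambda>(u, x). iexp (t * Zp x + (u / sqrt a) * tau JB x)) \<in> borel_measurable (std_normal_distribution \<Otimes>\<^sub>M Om)"
      unfolding split_beta' by (rule measurable_compose[OF _ measurable_iexp]) measurable
  qed
  have phii: "integrable std_normal_distribution \<phi>"
    by (rule N.integrable_const_bound[where B = 1]) (use phi1 phim in auto)
  have gm: "(\<lambda>u. exp (- vf t u / 2)) \<in> borel_measurable std_normal_distribution"
  proof -
    define c\<^sub>1 where "c\<^sub>1 = (LINT x|Om. (Zp x)\<^sup>2)"
    define c\<^sub>2 where "c\<^sub>2 = (LINT x|Om. Zp x * tau JB x)"
    have "(\<lambda>u. exp (- (t\<^sup>2 * c\<^sub>1 + 2 * t * (u / sqrt a) * c\<^sub>2 + (u / sqrt a)\<^sup>2 * card JB) / 2)) \<in> borel_measurable borel"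
      using a by (intro borel_measurable_continuous_onI continuous_intros) auto
    then show ?thesis unfolding vf_def c\<^sub>1_def c\<^sub>2_def by simp
  qed
  have gi: "integrable std_normal_distribution (\<lambda>u. exp (- vf t u / 2))"
    by (rule N.integrable_const_bound[where B = 1]) (use vf_nonneg gm in auto)
  have "cmod ((LINT u|std_normal_distribution. \<phi> u) - (LINT u|std_normal_distribution. complex_of_real (exp (- vf t u / 2))))
      = cmod (LINT u|std_normal_distribution. \<phi> u - complex_of_real (exp (- vf t u / 2)))"
    using phii gi by (subst Bochner_Integration.integral_diff) auto
  also have "\<dots> \<le> (LINT u|std_normal_distribution. \<epsilon> + 2 / U\<^sup>2 * u\<^sup>2)"
  proof (rule order_trans[OF integral_norm_bound], rule integral_mono)
    show "integrable std_normal_distribution (\<lambda>u. cmod (\<phi> u - complex_of_real (exp (- vf t u / 2))))"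
      using phii gi by auto
    show "integrable std_normal_distribution (\<lambda>u. \<epsilon> + 2 / U\<^sup>2 * u\<^sup>2)"
      using std_normal_second_moment by simp
    fix u
    show "cmod (\<phi> u - complex_of_real (exp (- vf t u / 2))) \<le> \<epsilon> + 2 / U\<^sup>2 * u\<^sup>2"
    proof (cases "\<bar>u\<bar> \<le> U")
      case True
      then show ?thesis using bound[OF True] by (simp add: \<phi>_def add_increasing2)
    next
      case False
      have "cmod (\<phi> u - complex_of_real (exp (- vf t u / 2))) \<le> 1 + 1"
        using phi1[of u] vf_nonneg[of t u] by (intro order_trans[OF norm_triangle_ineq4] add_mono) auto
      also have "\<dots> \<le> 2 * (u\<^sup>2 / U\<^sup>2)"
        using False U power_mono[of U "\<bar>u\<bar>" 2] by (simp add: pos_le_divide_eq)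
      finally show ?thesis using \<epsilon> by simp
    qed
  qed
  also have "\<dots> = \<epsilon> + 2 / U\<^sup>2"
    using std_normal_second_moment N.prob_space by simp
  finally have *: "cmod ((LINT u|std_normal_distribution. \<phi> u) - of_real (LINT u|std_normal_distribution. exp (- vf t u / 2))) \<le> \<epsilon> + 2 / U\<^sup>2"
    by simp
  have na: "real n - 1 = a + card JB"
    using card_JB_arc a unfolding a_def by linarith
  define \<rho> where "\<rho> = (LINT x|Om. Zp x * tau JB x)"
  have "(LINT u|std_normal_distribution. exp (- vf t u / 2))
    = (LINT u|std_normal_distribution. exp (- (t\<^sup>2 * (LINT x|Om. (Zp x)\<^sup>2) + 2 * (t * \<rho> / sqrt a) * u + (card JB / a) * u\<^sup>2) / 2))"
    using a by (intro Bochner_Integration.integral_cong refl) (simp add: vf_def \<rho>_def power_divide ac_simps)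
  also have "\<dots> = exp (- (t\<^sup>2 * (LINT x|Om. (Zp x)\<^sup>2) - (t * \<rho> / sqrt a)\<^sup>2 / (1 + card JB / a)) / 2) / sqrt (1 + card JB / a)"
    by (rule gaussian_integral_quadratic) simp
  also have "(t * \<rho> / sqrt a)\<^sup>2 / (1 + card JB / a) = t\<^sup>2 * (\<rho>\<^sup>2 / (real n - 1))"
    using a unfolding na by (simp add: power_divide power_mult_distrib field_simps)
  finally have val: "(LINT u|std_normal_distribution. exp (- vf t u / 2))
    = exp (- (t\<^sup>2 * (LINT x|Om. (Zp x)\<^sup>2) - t\<^sup>2 * (\<rho>\<^sup>2 / (real n - 1))) / 2) / sqrt (1 + card JB / a)" .
  have "real (n - 1) = real n - 1" using na a by simp
  then show ?thesis
    using * unfolding val unfolding gauss_mixture[OF a] \<phi>_def \<rho>_def right_diff_distrib by simp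
qed

text \<open>The numerator (s = t) and the normaliser (s = 0) are compared with Gaussian averages
  that contain the same factor \<open>1 / sqrt (1 + card JB / a)\<close>. It cancels in the ratio,
  and dividing by it costs at most sqrt (1 + \<kappa>). The last term of the bound stems from the
  variance and the covariance that the omitted arc takes away.\<close>

lemma conditional_char_Zp:
  fixes \<kappa> t U \<epsilon> \<eta> :: real
  assumes V: "iid_uniform M (n - 1) V" and a: "a > 0" "real n \<le> \<kappa> * a" and U: "U > 0"
    and bound: "\<And>s u. s = t \<or> s = 0 \<Longrightarrow> \<bar>u\<bar> \<le> U \<Longrightarrow>
      cmod ((LINT x|Om. iexp (s * Zp x + (u / sqrt a) * tau JB x)) - of_real (exp (- vf s u / 2))) \<le> \<epsilon>"
    and \<eta>: "(LINT x|Om. \<bar>wt a (tau JB x - 1) - exp (- (tau JB x)\<^sup>2 / (2 * real a))\<bar>) \<le> \<eta>"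
  shows "cmod ((LINT \<omega>|M. iexp (t * Zp (\<lambda>i. real n * spacing n (\<lambda>i. V i \<omega>) i))) - of_real (exp (- t\<^sup>2 / 2)))
    \<le> 2 * (\<eta> + \<epsilon> + 2 / U\<^sup>2) * sqrt (1 + \<kappa>) + t\<^sup>2 / 2 * (2 * sqrt y2 + y2 + y2 * n / (n - 1))"
proof -
  interpret M: prob_space M using V by (simp add: iid_uniform_def)
  define W where "W = (LINT x|Om. wt a (tau JB x - 1))"
  define num where "num = (LINT x|Om. wt a (tau JB x - 1) *\<^sub>R iexp (t * Zp x))"
  define E\<^sub>M where "E\<^sub>M = (LINT \<omega>|M. iexp (t * Zp (\<lambda>i. real n * spacing n (\<lambda>i. V i \<omega>) i)))"
  define \<alpha> where "\<alpha> = (LINT x|Om. (Zp x)\<^sup>2)"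
  define \<rho> where "\<rho> = (LINT x|Om. Zp x * tau JB x)"
  define x where "x = \<alpha> - \<rho>\<^sup>2 / (n - 1)"
  define I\<^sub>0 where "I\<^sub>0 = 1 / sqrt (1 + card JB / a)"
  define e\<^sub>0 where "e\<^sub>0 = \<eta> + \<epsilon> + 2 / U\<^sup>2"
  have n_eq: "n = card JB + a + 1" using card_JB_arc a by (simp add: a_def)
  have n2: "n - 1 \<ge> 1" "Suc (n - 1) = n" using n_eq a by auto
  have "JB \<subseteq> {..n - 1}" using JB_sub n2 by auto
  have Zf: "(\<lambda>x. iexp (t * Zp x)) \<in> borel_measurable seqM"
    unfolding seqM_Om[symmetric] by (rule measurable_compose[OF _ measurable_iexp]) measurable
  have EM: "E\<^sub>M = num /\<^sub>R W"
    using spacings_law[OF V n2(1) \<open>JB \<subseteq> {..n - 1}\<close> _ _ Zf dep_comp[OF Zp_dep], of a] n_eq a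
    unfolding n2(2) E\<^sub>M_def num_def W_def by simp
  have EM1: "cmod E\<^sub>M \<le> 1"
  proof -
    have "cmod E\<^sub>M \<le> (LINT \<omega>|M. cmod (iexp (t * Zp (\<lambda>i. real n * spacing n (\<lambda>i. V i \<omega>) i))))"
      unfolding E\<^sub>M_def by (rule integral_norm_bound)
    then show ?thesis by (simp add: M.prob_space del: of_real_mult)
  qed
  have iW: "integrable Om (\<lambda>x. wt a (tau JB x - 1))" using a by (intro integrable_wt_tau) simp
  have iG: "integrable Om (\<lambda>x. exp (- (tau JB x)\<^sup>2 / (2 * real a)))"
    by (rule Om.integrable_const_bound[where B = 1]) auto
  have weight: "cmod ((LINT x|Om. wt a (tau JB x - 1) *\<^sub>R iexp (s * Zp x))
      - (LINT x|Om. iexp (s * Zp x) * of_real (exp (- (tau JB x)\<^sup>2 / (2 * real a))))) \<le> \<eta>" for s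
  proof -
    have i1: "integrable Om (\<lambda>x. wt a (tau JB x - 1) *\<^sub>R iexp (s * Zp x))"
      using integrable_mult_iexp[OF iW, of "\<lambda>x. s * Zp x"] by (simp add: scaleR_conv_of_real)
    have i2: "integrable Om (\<lambda>x. iexp (s * Zp x) * of_real (exp (- (tau JB x)\<^sup>2 / (2 * real a))))"
      using integrable_mult_iexp[OF iG, of "\<lambda>x. s * Zp x"] by (simp add: mult.commute)
    have "cmod ((LINT x|Om. wt a (tau JB x - 1) *\<^sub>R iexp (s * Zp x))
      - (LINT x|Om. iexp (s * Zp x) * of_real (exp (- (tau JB x)\<^sup>2 / (2 * real a)))))
      = cmod (LINT x|Om. wt a (tau JB x - 1) *\<^sub>R iexp (s * Zp x) - iexp (s * Zp x) * of_real (exp (- (tau JB x)\<^sup>2 / (2 * real a))))"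
      using i1 i2 by (subst Bochner_Integration.integral_diff) auto
    also have "\<dots> \<le> (LINT x|Om. \<bar>wt a (tau JB x - 1) - exp (- (tau JB x)\<^sup>2 / (2 * real a))\<bar>)"
    proof (rule order_trans[OF integral_norm_bound], rule Bochner_Integration.integral_mono)
      show "integrable Om (\<lambda>x. cmod (wt a (tau JB x - 1) *\<^sub>R iexp (s * Zp x) - iexp (s * Zp x) * of_real (exp (- (tau JB x)\<^sup>2 / (2 * real a)))))"
        using i1 i2 by (intro integrable_norm Bochner_Integration.integrable_diff)
      show "integrable Om (\<lambda>x. \<bar>wt a (tau JB x - 1) - exp (- (tau JB x)\<^sup>2 / (2 * real a))\<bar>)"
        using iW iG by (intro integrable_abs Bochner_Integration.integrable_diff)
      fix x
      have "wt a (tau JB x - 1) *\<^sub>R iexp (s * Zp x) - iexp (s * Zp x) * of_real (exp (- (tau JB x)\<^sup>2 / (2 * real a)))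
        = of_real (wt a (tau JB x - 1) - exp (- (tau JB x)\<^sup>2 / (2 * real a))) * iexp (s * Zp x)"
        by (simp add: scaleR_conv_of_real algebra_simps)
      then have "cmod (wt a (tau JB x - 1) *\<^sub>R iexp (s * Zp x) - iexp (s * Zp x) * of_real (exp (- (tau JB x)\<^sup>2 / (2 * real a))))
        = \<bar>wt a (tau JB x - 1) - exp (- (tau JB x)\<^sup>2 / (2 * real a))\<bar>"
        by (simp only: norm_mult norm_of_real norm_exp_i_times mult_1_right)
      then show "cmod (wt a (tau JB x - 1) *\<^sub>R iexp (s * Zp x) - iexp (s * Zp x) * of_real (exp (- (tau JB x)\<^sup>2 / (2 * real a))))
        \<le> \<bar>wt a (tau JB x - 1) - exp (- (tau JB x)\<^sup>2 / (2 * real a))\<bar>" by simp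
    qed
    finally show ?thesis using \<eta> by linarith
  qed
  have total: "cmod ((LINT x|Om. wt a (tau JB x - 1) *\<^sub>R iexp (s * Zp x)) - of_real (exp (- (s\<^sup>2 * x) / 2) * I\<^sub>0)) \<le> e\<^sub>0"
    if s: "s = t \<or> s = 0" for s
    using norm_triangle_ineq[of "(LINT x|Om. wt a (tau JB x - 1) *\<^sub>R iexp (s * Zp x)) - (LINT x|Om. iexp (s * Zp x) * of_real (exp (- (tau JB x)\<^sup>2 / (2 * real a))))"
        "(LINT x|Om. iexp (s * Zp x) * of_real (exp (- (tau JB x)\<^sup>2 / (2 * real a)))) - of_real (exp (- (s\<^sup>2 * x) / 2) * I\<^sub>0)"]
      weight[of s] mixture_bound[OF a(1) U bound[OF s]]
    unfolding e\<^sub>0_def x_def \<alpha>_def \<rho>_def I\<^sub>0_def by simp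
  have t1: "cmod (num - of_real (exp (- (t\<^sup>2 * x) / 2) * I\<^sub>0)) \<le> e\<^sub>0"
    using total[of t] by (simp add: num_def)
  have t0: "\<bar>W - I\<^sub>0\<bar> \<le> e\<^sub>0"
  proof -
    have "cmod (of_real W - of_real I\<^sub>0) \<le> e\<^sub>0"
      using total[of 0] by (simp add: W_def scaleR_conv_of_real)
    then show ?thesis by (simp only: norm_of_real flip: of_real_diff)
  qed
  have I0: "I\<^sub>0 > 0" unfolding I\<^sub>0_def by (simp add: add_pos_nonneg)
  have gk: "card JB / a \<le> \<kappa>"
  proof -
    have "real (card JB) \<le> \<kappa> * a" using a(2) card_JB_arc by linarith
    then show ?thesis using a by (simp add: pos_divide_le_eq)
  qed
  \<comment> \<open>If the mean weight were zero, division by zero would make the right-hand side of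
    \<open>spacings_law\<close> vanish even for the constant function 1.\<close>
  have W0: "W > 0"
  proof (rule ccontr)
    assume "\<not> W > 0"
    moreover have "W \<ge> 0" unfolding W_def by (intro Bochner_Integration.integral_nonneg) simp
    ultimately have "W = 0" by simp
    moreover have "(LINT \<omega>|M. (1 :: real)) = (LINT x|Om. wt a (tau JB x - 1) *\<^sub>R 1) /\<^sub>R W"
      using spacings_law[OF V n2(1) \<open>JB \<subseteq> {..n - 1}\<close> _ _ _ dep_const, of a "1 :: real"] n_eq a
      unfolding n2(2) W_def by simp
    ultimately show False by (simp add: M.prob_space)
  qed
  have "num = of_real W * E\<^sub>M" using W0 by (simp add: EM scaleR_conv_of_real)
  then have "E\<^sub>M * of_real I\<^sub>0 - of_real (exp (- (t\<^sup>2 * x) / 2) * I\<^sub>0)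
      = (num - of_real (exp (- (t\<^sup>2 * x) / 2) * I\<^sub>0)) - of_real (W - I\<^sub>0) * E\<^sub>M"
    by (simp add: algebra_simps)
  then have "cmod (E\<^sub>M * of_real I\<^sub>0 - of_real (exp (- (t\<^sup>2 * x) / 2) * I\<^sub>0)) \<le> e\<^sub>0 + \<bar>W - I\<^sub>0\<bar> * cmod E\<^sub>M"
    using t1 norm_triangle_ineq4[of "num - of_real (exp (- (t\<^sup>2 * x) / 2) * I\<^sub>0)" "of_real (W - I\<^sub>0) * E\<^sub>M"]
    by (simp only: norm_mult norm_of_real)
  also have "\<dots> \<le> e\<^sub>0 + e\<^sub>0 * 1"
    using t0 EM1 by (intro add_left_mono mult_mono) auto
  finally have "cmod ((E\<^sub>M - of_real (exp (- (t\<^sup>2 * x) / 2))) * of_real I\<^sub>0) \<le> 2 * e\<^sub>0"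
    by (simp add: left_diff_distrib)
  then have "cmod (E\<^sub>M - of_real (exp (- (t\<^sup>2 * x) / 2))) * I\<^sub>0 \<le> 2 * e\<^sub>0"
    using I0 by (simp only: norm_mult norm_of_real abs_of_pos)
  then have "cmod (E\<^sub>M - of_real (exp (- (t\<^sup>2 * x) / 2))) \<le> 2 * e\<^sub>0 * sqrt (1 + card JB / a)"
    by (simp add: I\<^sub>0_def pos_divide_le_eq add_pos_nonneg)
  also have "\<dots> \<le> 2 * e\<^sub>0 * sqrt (1 + \<kappa>)"
    using t0 gk by (intro mult_left_mono real_sqrt_le_mono) auto
  finally have part1: "cmod (E\<^sub>M - of_real (exp (- (t\<^sup>2 * x) / 2))) \<le> 2 * e\<^sub>0 * sqrt (1 + \<kappa>)" .
  have nr: "real (n - 1) = real n - 1" "real n - 1 > 0" using n2 by auto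
  \<comment> \<open>By Cauchy-Schwarz and card JB <= n - 1 the corrected variance is nonnegative, so
    both exponents compared below are nonpositive and exp is 1-Lipschitz there.\<close>
  have x0: "x \<ge> 0"
  proof -
    have "\<rho>\<^sup>2 \<le> \<alpha> * card JB"
      using Cauchy_Schwarz_integral[OF Zp_measurable tau_measurable Zp_sq integrable_tau_power[OF finite_JB], of ]
      by (simp add: \<rho>_def \<alpha>_def integral_tau_square[OF finite_JB])
    also have "\<dots> \<le> \<alpha> * (real n - 1)"
      using n_eq unfolding \<alpha>_def by (intro mult_left_mono Bochner_Integration.integral_nonneg) auto
    finally show ?thesis using nr by (simp add: x_def pos_divide_le_eq)
  qed
  have xb: "\<bar>x - 1\<bar> \<le> 2 * sqrt y2 + y2 + y2 * n / (n - 1)"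
  proof -
    have "\<rho>\<^sup>2 / (real n - 1) \<le> y2 * n / (real n - 1)"
      using beta_bound nr by (intro divide_right_mono) (auto simp: \<rho>_def)
    moreover have "0 \<le> \<rho>\<^sup>2 / (real n - 1)" using nr by simp
    ultimately show ?thesis using alpha_bound unfolding x_def \<alpha>_def nr(1) by linarith
  qed
  have "\<bar>exp (- (t\<^sup>2 * x) / 2) - exp (- t\<^sup>2 / 2)\<bar> \<le> \<bar>- (t\<^sup>2 * x) / 2 - - t\<^sup>2 / 2\<bar>"
    using x0 by (intro exp_diff_le_nonpos) auto
  also have "- (t\<^sup>2 * x) / 2 - - t\<^sup>2 / 2 = - (t\<^sup>2 / 2 * (x - 1))" by (simp add: field_simps)
  also have "\<bar>- (t\<^sup>2 / 2 * (x - 1))\<bar> = t\<^sup>2 / 2 * \<bar>x - 1\<bar>" by (simp add: abs_mult)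
  also have "\<dots> \<le> t\<^sup>2 / 2 * (2 * sqrt y2 + y2 + y2 * n / (n - 1))"
    using xb by (intro mult_left_mono) auto
  finally have "cmod (of_real (exp (- (t\<^sup>2 * x) / 2)) - of_real (exp (- t\<^sup>2 / 2))) \<le> t\<^sup>2 / 2 * (2 * sqrt y2 + y2 + y2 * n / (n - 1))"
    by (simp only: norm_of_real flip: of_real_diff)
  with part1 have "cmod (E\<^sub>M - of_real (exp (- t\<^sup>2 / 2))) \<le> 2 * e\<^sub>0 * sqrt (1 + \<kappa>) + t\<^sup>2 / 2 * (2 * sqrt y2 + y2 + y2 * n / (n - 1))"
    using norm_triangle_ineq[of "E\<^sub>M - of_real (exp (- (t\<^sup>2 * x) / 2))" "of_real (exp (- (t\<^sup>2 * x) / 2)) - of_real (exp (- t\<^sup>2 / 2))"]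
    unfolding diff_add_cancel add_diff_eq by linarith
  then show ?thesis by (simp add: E\<^sub>M_def e\<^sub>0_def)
qed

text \<open>A weight bounded by 1 with mean at least 1/2 at most doubles the expectation of |Y|.
  This requires the set \<open>JY\<close> in place of \<open>JB\<close>, since \<open>Y\<close>
  depends on the omitted arc.\<close>

lemma conditional_Y_small:
  assumes V: "iid_uniform M (n - 1) V" and k: "n - 1 = card JY + k" "k \<ge> 1" and half: "2 * card JY \<le> k"
    and \<eta>: "(LINT x|Om. \<bar>wt k (tau JY x - 1) - exp (- (tau JY x)\<^sup>2 / (2 * real k))\<bar>) \<le> 1 / 10"
  shows "cmod ((LINT \<omega>|M. iexp (t * (\<Sum>j<q. \<xi> j (\<lambda>i. real n * spacing n (\<lambda>i. V i \<omega>) i))))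
      - (LINT \<omega>|M. iexp (t * Zp (\<lambda>i. real n * spacing n (\<lambda>i. V i \<omega>) i)))) \<le> \<bar>t\<bar> * (2 * sqrt y2)"
proof -
  interpret M: prob_space M using V by (simp add: iid_uniform_def)
  define nS where "nS \<omega> = (\<lambda>i. real n * spacing n (\<lambda>i. V i \<omega>) i)" for \<omega>
  have n2: "n - 1 \<ge> 1" "Suc (n - 1) = n" using k by auto
  have nSm: "nS \<in> measurable M seqM"
    unfolding nS_def using measurable_spacing[OF V n2(1)] n2(2)
    by (intro measurable_seqI borel_measurable_times borel_measurable_const) simp
  have JYs: "JY \<subseteq> {..n - 1}" using JY_sub n2 by auto
  have fJY: "finite JY" using JY_sub by (rule finite_subset) simp
  define W where "W = (LINT x|Om. wt k (tau JY x - 1))"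
  have iW: "integrable Om (\<lambda>x. wt k (tau JY x - 1))" using k by (intro integrable_wt_tau)
  have iG: "integrable Om (\<lambda>x. exp (- (tau JY x)\<^sup>2 / (2 * real k)))"
    by (rule Om.integrable_const_bound[where B = 1]) auto
  \<comment> \<open>From 2 card JY <= k the Gaussian mean is at least exp (- 1/4) >= 3/4, and the
    approximation error 1/10 leaves more than 1/2.\<close>
  have W: "W \<ge> 1 / 2"
  proof -
    have "exp (- (1 / 4)) \<le> exp (- real (card JY) / (2 * real k))"
      using half k by (simp add: field_simps)
    also have "\<dots> \<le> (LINT x|Om. exp (- (tau JY x)\<^sup>2 / (2 * real k)))"
      using k by (intro gauss_tau_lower fJY) simp
    also have "\<dots> = (LINT x|Om. exp (- (tau JY x)\<^sup>2 / (2 * real k)) - wt k (tau JY x - 1)) + W"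
      unfolding W_def using iW iG by simp
    also have "(LINT x|Om. exp (- (tau JY x)\<^sup>2 / (2 * real k)) - wt k (tau JY x - 1)) \<le> (LINT x|Om. \<bar>wt k (tau JY x - 1) - exp (- (tau JY x)\<^sup>2 / (2 * real k))\<bar>)"
      using iW iG by (intro integral_mono) auto
    also have "\<dots> \<le> 1 / 10" by (rule \<eta>)
    finally have "exp (- (1 / 4)) \<le> 1 / 10 + W" by simp
    moreover have "3 / 4 \<le> exp (- (1 / 4) :: real)"
      using exp_ge_add_one_self[of "- (1 / 4) :: real"] by simp
    ultimately show ?thesis by simp
  qed
  \<comment> \<open>The cap at 2 keeps \<open>f\<close> bounded, hence integrable under the law of
    the spacings without any moment assumption there.\<close>
  define f where "f x = min 2 (\<bar>t\<bar> * \<bar>Y x\<bar>)" for x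
  have fO: "f \<in> borel_measurable Om" unfolding f_def by measurable
  then have fm: "f \<in> borel_measurable seqM" by (simp only: seqM_Om)
  have fd: "dep JY f" unfolding f_def by (rule dep_comp[OF Y_dep])
  have f0: "0 \<le> f x" "f x \<le> \<bar>t\<bar> * \<bar>Y x\<bar>" for x by (auto simp: f_def)
  have iY: "integrable Om (\<lambda>x. \<bar>Y x\<bar>)" using Y_int by simp
  have EY: "(LINT x|Om. \<bar>Y x\<bar>) \<le> sqrt y2"
  proof -
    have "(LINT x|Om. \<bar>Y x\<bar> * 1)\<^sup>2 \<le> (LINT x|Om. \<bar>Y x\<bar>\<^sup>2) * (LINT x|Om. 1\<^sup>2)"
      using Y_sq_int by (intro Cauchy_Schwarz_integral) auto
    then have "(LINT x|Om. \<bar>Y x\<bar>)\<^sup>2 \<le> y2" using Y_sq_le by simp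
    then show ?thesis by (rule real_le_rsqrt)
  qed
  have law: "(LINT \<omega>|M. f (nS \<omega>)) = (LINT x|Om. wt k (tau JY x - 1) *\<^sub>R f x) /\<^sub>R W"
    using spacings_law[OF V n2(1) JYs k fm fd] unfolding n2(2) nS_def W_def .
  have wf: "wt k (tau JY x - 1) * f x \<le> \<bar>t\<bar> * \<bar>Y x\<bar>" "0 \<le> wt k (tau JY x - 1) * f x" for x
    using k wt_le_1[of k "tau JY x - 1"] f0[of x] mult_left_le_one_le[of "f x" "wt k (tau JY x - 1)"] by auto
  have "(LINT x|Om. wt k (tau JY x - 1) * f x) \<le> (LINT x|Om. \<bar>t\<bar> * \<bar>Y x\<bar>)"
  proof (rule integral_mono)
    show "integrable Om (\<lambda>x. wt k (tau JY x - 1) * f x)"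
    proof (rule Bochner_Integration.integrable_bound)
      show "integrable Om (\<lambda>x. \<bar>t\<bar> * \<bar>Y x\<bar>)" using iY by simp
      show "(\<lambda>x. wt k (tau JY x - 1) * f x) \<in> borel_measurable Om" using fO by measurable
      show "AE x in Om. norm (wt k (tau JY x - 1) * f x) \<le> norm (\<bar>t\<bar> * \<bar>Y x\<bar>)"
        using wf f0(1) by (intro AE_I2) (simp add: abs_mult)
    qed
  qed (use iY wf in auto)
  also have "\<dots> \<le> \<bar>t\<bar> * sqrt y2" using EY by (simp add: mult_left_mono)
  finally have "(LINT x|Om. wt k (tau JY x - 1) * f x) / W \<le> (\<bar>t\<bar> * sqrt y2) / (1 / 2)"
    using W y2_nonneg by (intro frac_le) auto
  moreover have "(LINT \<omega>|M. f (nS \<omega>)) = (LINT x|Om. wt k (tau JY x - 1) * f x) / W"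
    unfolding law real_scaleR_def divide_inverse by (rule mult.commute)
  ultimately have EM: "(LINT \<omega>|M. f (nS \<omega>)) \<le> \<bar>t\<bar> * (2 * sqrt y2)" by simp
  have Zpm: "(\<lambda>\<omega>. Zp (nS \<omega>)) \<in> borel_measurable M"
    by (rule measurable_compose[OF nSm Zp_measurable[unfolded seqM_Om]])
  have Ym: "(\<lambda>\<omega>. Y (nS \<omega>)) \<in> borel_measurable M"
    by (rule measurable_compose[OF nSm Y_measurable[unfolded seqM_Om]])
  have m1: "(\<lambda>\<omega>. iexp (t * (Zp (nS \<omega>) + Y (nS \<omega>)))) \<in> borel_measurable M"
    using Zpm Ym by (intro measurable_compose[OF _ measurable_iexp]) auto
  have m2: "(\<lambda>\<omega>. iexp (t * Zp (nS \<omega>))) \<in> borel_measurable M"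
    using Zpm by (intro measurable_compose[OF _ measurable_iexp]) auto
  have i1: "integrable M (\<lambda>\<omega>. iexp (t * (Zp (nS \<omega>) + Y (nS \<omega>))))"
    using m1 by (intro M.integrable_const_bound[where B = 1]) (auto simp del: of_real_add of_real_mult)
  have i2: "integrable M (\<lambda>\<omega>. iexp (t * Zp (nS \<omega>)))"
    using m2 by (intro M.integrable_const_bound[where B = 1]) (auto simp del: of_real_mult)
  have "cmod ((LINT \<omega>|M. iexp (t * (Zp (nS \<omega>) + Y (nS \<omega>)))) - (LINT \<omega>|M. iexp (t * Zp (nS \<omega>))))
      = cmod (LINT \<omega>|M. iexp (t * (Zp (nS \<omega>) + Y (nS \<omega>))) - iexp (t * Zp (nS \<omega>)))"
    using i1 i2 by (simp only: Bochner_Integration.integral_diff)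
  also have "\<dots> \<le> (LINT \<omega>|M. f (nS \<omega>))"
  proof (rule order_trans[OF integral_norm_bound], rule Bochner_Integration.integral_mono)
    show "integrable M (\<lambda>\<omega>. cmod (iexp (t * (Zp (nS \<omega>) + Y (nS \<omega>))) - iexp (t * Zp (nS \<omega>))))"
      using i1 i2 by (intro integrable_norm Bochner_Integration.integrable_diff)
    show "integrable M (\<lambda>\<omega>. f (nS \<omega>))"
      using measurable_compose[OF nSm fm] f0(1) by (intro M.integrable_const_bound[where B = 2]) (auto simp: f_def)
    fix \<omega>
    have "iexp (t * (Zp (nS \<omega>) + Y (nS \<omega>))) - iexp (t * Zp (nS \<omega>)) = iexp (t * Zp (nS \<omega>)) * (iexp (t * Y (nS \<omega>)) - 1)"
      by (simp add: algebra_simps exp_add)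
    then have "cmod (iexp (t * (Zp (nS \<omega>) + Y (nS \<omega>))) - iexp (t * Zp (nS \<omega>))) = cmod (iexp (t * Y (nS \<omega>)) - 1)"
      by (simp only: norm_mult norm_exp_i_times mult_1_left)
    also have "\<dots> \<le> f (nS \<omega>)"
      using iexp_approx1[of "t * Y (nS \<omega>)" 0] iexp_approx2[of "t * Y (nS \<omega>)" 0] by (simp add: f_def abs_mult)
    finally show "cmod (iexp (t * (Zp (nS \<omega>) + Y (nS \<omega>))) - iexp (t * Zp (nS \<omega>))) \<le> f (nS \<omega>)" .
  qed
  finally show ?thesis using EM unfolding Z_split nS_def by linarith
qed

end

section \<open>A central limit theorem uniform over cyclic chains\<close>

lemma ex_small_factor:
  fixes C e :: real
  assumes "C \<ge> 0" "e > 0"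
  obtains d where "d > 0" "\<And>x. x \<le> d \<Longrightarrow> C * x \<le> e"
proof
  show "e / (C + 1) > 0" using assms by simp
  fix x assume "x \<le> e / (C + 1)"
  then have "C * x \<le> C * (e / (C + 1))" using assms by (intro mult_left_mono)
  also have "\<dots> \<le> e" using assms by (simp add: field_simps)
  finally show "C * x \<le> e" .
qed

text \<open>The dependence on s and u is removed, so that three terms remain, each linear in a
  quantity made small in turn: \<delta> once \<kappa> and U are fixed, then \<open>lam\<close> and m
  / n, whose coefficients depend on \<delta>.\<close>

lemma (in rotated_chain) char_bound_uniform:
  fixes s t u U \<kappa> \<delta> :: real
  assumes s: "\<bar>s\<bar> \<le> \<bar>t\<bar>" and u: "\<bar>u\<bar> \<le> U" and \<delta>: "\<delta> > 0" and a: "a > 0" "real n \<le> \<kappa> * a" and y2: "y2 \<le> 1"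
  shows "cmod ((LINT x|Om. iexp (s * Zp x + (u / sqrt a) * tau JB x)) - of_real (exp (- vf s u / 2)))
    \<le> exp (4 * t\<^sup>2 + U\<^sup>2 * \<kappa>) * 90000 * (\<delta> * (4 * t\<^sup>2 + U\<^sup>2 * \<kappa>))
      + exp (4 * t\<^sup>2 + U\<^sup>2 * \<kappa>) * 90000 * (\<delta> powr (2 - r) * (3 powr r * (1 + 2 * 2 powr r)) * \<bar>t\<bar> powr r) * lam
      + exp (4 * t\<^sup>2 + U\<^sup>2 * \<kappa>) * 90000 * (\<delta> powr (-2) * (18 * U ^ 4 * \<kappa>\<^sup>2)) * (m / n)"
proof -
  have lam0: "0 \<le> lam"
    using lam by (rule order_trans[rotated]) (auto intro!: sum_nonneg Bochner_Integration.integral_nonneg)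
  have \<kappa>: "\<kappa> \<ge> 0" using a by (metis mult_neg_pos not_le of_nat_0_le_iff of_nat_0_less_iff order_trans)
  have s2: "s\<^sup>2 \<le> t\<^sup>2" using s by (simp add: abs_le_square_iff)
  have u2: "u\<^sup>2 \<le> U\<^sup>2" using u power_mono[of "\<bar>u\<bar>" U 2] by simp
  have u4: "u ^ 4 \<le> U ^ 4" using power_mono[OF u, of 4] by simp
  have v_le: "vf s u / 2 \<le> 4 * t\<^sup>2 + U\<^sup>2 * \<kappa>"
  proof -
    have tsq: "integrable Om (\<lambda>x. (tau JB x)\<^sup>2)" by (rule integrable_tau_power[OF finite_JB])
    have "vf s u \<le> (LINT x|Om. 2 * (s\<^sup>2 * (Zp x)\<^sup>2) + 2 * ((u / sqrt a)\<^sup>2 * (tau JB x)\<^sup>2))"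
      unfolding vf_eq
    proof (rule integral_mono)
      show "integrable Om (\<lambda>x. 2 * (s\<^sup>2 * (Zp x)\<^sup>2) + 2 * ((u / sqrt a)\<^sup>2 * (tau JB x)\<^sup>2))"
        using Zp_sq tsq by simp
      have "integrable Om (\<lambda>x. (Zp x * tau JB x))"
        by (intro integrable_square_mult Zp_measurable Zp_sq tau_measurable tsq)
      then have "integrable Om (\<lambda>x. s\<^sup>2 * (Zp x)\<^sup>2 + (u / sqrt a)\<^sup>2 * (tau JB x)\<^sup>2 + (2 * s * (u / sqrt a)) * (Zp x * tau JB x))"
        using Zp_sq tsq by (intro Bochner_Integration.integrable_add integrable_mult_right)
      moreover have "(s * z + w * y)\<^sup>2 = s\<^sup>2 * z\<^sup>2 + w\<^sup>2 * y\<^sup>2 + (2 * s * w) * (z * y)" for z w y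
        by (simp add: power2_eq_square algebra_simps)
      ultimately show "integrable Om (\<lambda>x. (s * Zp x + u / sqrt a * tau JB x)\<^sup>2)" by presburger
      fix x
      have "(p + q)\<^sup>2 \<le> 2 * p\<^sup>2 + 2 * q\<^sup>2" for p q :: real
        using zero_le_power2[of "p - q"] by (simp add: power2_eq_square algebra_simps)
      from this[of "s * Zp x" "u / sqrt a * tau JB x"]
      show "(s * Zp x + u / sqrt a * tau JB x)\<^sup>2 \<le> 2 * (s\<^sup>2 * (Zp x)\<^sup>2) + 2 * ((u / sqrt a)\<^sup>2 * (tau JB x)\<^sup>2)"
        by (simp only: power_mult_distrib)
    qed
    also have "\<dots> = 2 * (s\<^sup>2 * (LINT x|Om. (Zp x)\<^sup>2)) + 2 * (u\<^sup>2 * (card JB / a))"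
      using Zp_sq tsq integral_tau_square[OF finite_JB] by (simp add: power_divide)
    also have "\<dots> \<le> 2 * (t\<^sup>2 * 4) + 2 * (U\<^sup>2 * \<kappa>)"
    proof -
      have "sqrt y2 \<le> 1" using y2 by simp
      then have Z4: "(LINT x|Om. (Zp x)\<^sup>2) \<le> 4" using alpha_bound y2 by linarith
      have "real (card JB) \<le> \<kappa> * a" using a(2) card_JB_arc by linarith
      then have "card JB / a \<le> \<kappa>" using a by (simp add: pos_divide_le_eq)
      then show ?thesis
        using Z4 s2 u2 by (intro add_mono mult_left_mono mult_mono) (auto intro: Bochner_Integration.integral_nonneg)
    qed
    finally show ?thesis by simp
  qed
  have "cmod ((LINT x|Om. iexp (s * Zp x + (u / sqrt a) * tau JB x)) - of_real (exp (- vf s u / 2)))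
    \<le> exp (vf s u / 2) * (90000 * (\<delta> * (4 * s\<^sup>2) + \<delta> powr (2 - r) * (3 powr r * (1 + 2 * 2 powr r) * (\<bar>s\<bar> powr r * lam))
        + (\<delta> * (u\<^sup>2 * \<kappa>) + \<delta> powr (-2) * (18 * u ^ 4 * \<kappa>\<^sup>2 * (m / n)))))"
    unfolding vf_def by (rule char_bound[OF \<delta> refl a y2])
  also have "\<dots> \<le> exp (4 * t\<^sup>2 + U\<^sup>2 * \<kappa>) * (90000 * (\<delta> * (4 * t\<^sup>2) + \<delta> powr (2 - r) * (3 powr r * (1 + 2 * 2 powr r) * (\<bar>t\<bar> powr r * lam))
        + (\<delta> * (U\<^sup>2 * \<kappa>) + \<delta> powr (-2) * (18 * U ^ 4 * \<kappa>\<^sup>2 * (m / n)))))"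
  proof (rule mult_mono)
    show "exp (vf s u / 2) \<le> exp (4 * t\<^sup>2 + U\<^sup>2 * \<kappa>)" using v_le by simp
    have c1: "\<delta> * (4 * s\<^sup>2) \<le> \<delta> * (4 * t\<^sup>2)" using s2 \<delta> by simp
    have "\<bar>s\<bar> powr r * lam \<le> \<bar>t\<bar> powr r * lam"
      using s r lam0 by (intro mult_right_mono powr_mono2) auto
    then have c2: "\<delta> powr (2 - r) * (3 powr r * (1 + 2 * 2 powr r) * (\<bar>s\<bar> powr r * lam))
        \<le> \<delta> powr (2 - r) * (3 powr r * (1 + 2 * 2 powr r) * (\<bar>t\<bar> powr r * lam))"
      by (intro mult_left_mono) auto
    have c3: "\<delta> * (u\<^sup>2 * \<kappa>) \<le> \<delta> * (U\<^sup>2 * \<kappa>)"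
      using u2 \<delta> \<kappa> by (intro mult_left_mono mult_right_mono) auto
    have c4: "\<delta> powr (-2) * (18 * u ^ 4 * \<kappa>\<^sup>2 * (m / n)) \<le> \<delta> powr (-2) * (18 * U ^ 4 * \<kappa>\<^sup>2 * (m / n))"
      using u4 by (intro mult_left_mono mult_right_mono) auto
    show "90000 * (\<delta> * (4 * s\<^sup>2) + \<delta> powr (2 - r) * (3 powr r * (1 + 2 * 2 powr r) * (\<bar>s\<bar> powr r * lam))
        + (\<delta> * (u\<^sup>2 * \<kappa>) + \<delta> powr (-2) * (18 * u ^ 4 * \<kappa>\<^sup>2 * (m / n))))
      \<le> 90000 * (\<delta> * (4 * t\<^sup>2) + \<delta> powr (2 - r) * (3 powr r * (1 + 2 * 2 powr r) * (\<bar>t\<bar> powr r * lam))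
        + (\<delta> * (U\<^sup>2 * \<kappa>) + \<delta> powr (-2) * (18 * U ^ 4 * \<kappa>\<^sup>2 * (m / n))))"
      by (rule mult_left_mono[OF add_mono[OF add_mono[OF c1 c2] add_mono[OF c3 c4]]]) simp
    show "0 \<le> 90000 * (\<delta> * (4 * s\<^sup>2) + \<delta> powr (2 - r) * (3 powr r * (1 + 2 * 2 powr r) * (\<bar>s\<bar> powr r * lam))
        + (\<delta> * (u\<^sup>2 * \<kappa>) + \<delta> powr (-2) * (18 * u ^ 4 * \<kappa>\<^sup>2 * (m / n))))"
      using \<delta> \<kappa> lam0 by (intro mult_nonneg_nonneg add_nonneg_nonneg) auto
  qed simp
  also have "\<dots> = exp (4 * t\<^sup>2 + U\<^sup>2 * \<kappa>) * 90000 * (\<delta> * (4 * t\<^sup>2 + U\<^sup>2 * \<kappa>))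
      + exp (4 * t\<^sup>2 + U\<^sup>2 * \<kappa>) * 90000 * (\<delta> powr (2 - r) * (3 powr r * (1 + 2 * 2 powr r)) * \<bar>t\<bar> powr r) * lam
      + exp (4 * t\<^sup>2 + U\<^sup>2 * \<kappa>) * 90000 * (\<delta> powr (-2) * (18 * U ^ 4 * \<kappa>\<^sup>2)) * (m / n)"
  proof -
    have "E * (90000 * (d * p + D * (C * (T * l)) + (d * q + F * (G * h))))
      = E * 90000 * (d * (p + q)) + E * 90000 * (D * C * T) * l + E * 90000 * (F * G) * h"
      for E d p D C T l q F G h :: real
      by (simp add: algebra_simps)
    then show ?thesis .
  qed
  finally show ?thesis .
qed

text \<open>With the light arc placed last, the omitted part is the inner sum of the arc plus the
  two summands straddling its ends. The square of a sum of three terms gives at most 3 * 3 / K + 6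
  \<gamma>, and 6 \<gamma> <= 1 / K.\<close>

lemma (in cyclic_chain) exists_rotation:
  assumes K: "K \<ge> 4" "2 * K \<le> q" and \<gamma>: "\<And>j. j < q \<Longrightarrow> (LINT x|Om. (\<xi> j x)\<^sup>2) \<le> \<gamma>"
    and small: "16 * (real K)\<^sup>2 * \<gamma> \<le> 1"
  obtains e where "rotated_chain n m q Bl \<xi> r lam e (q div K) (10 / K)"
proof -
  define c where "c = q div K"
  have q0: "0 < q" using K by simp
  have g0: "\<gamma> \<ge> 0"
  proof -
    have "0 \<le> (LINT x|Om. (\<xi> 0 x)\<^sup>2)" by (intro Bochner_Integration.integral_nonneg) simp
    then show ?thesis using \<gamma>[OF q0] by linarith
  qed
  have "8 * (real K)\<^sup>2 * \<gamma> \<le> 16 * (real K)\<^sup>2 * \<gamma>" using g0 by (intro mult_right_mono) auto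
  then have small8: "8 * (real K)\<^sup>2 * \<gamma> \<le> 1" using small by linarith
  have "1 \<le> K" using K by simp
  then obtain i where i: "i < K" "(LINT x|Om. (\<Sum>j\<in>{i * c..<i * c + (c - 1)}. \<xi> j x)\<^sup>2) \<le> 3 / K"
    using exists_light_arc[OF _ K(2) \<gamma> small8] unfolding c_def by blast
  define e where "e = i * c"
  have c2: "c \<ge> 2" unfolding c_def using K by (metis div_le_mono nonzero_mult_div_cancel_right not_numeral_le_zero)
  have cK: "c * K \<le> q" unfolding c_def by simp
  have ec: "e + c \<le> q"
  proof -
    have "e + c = Suc i * c" by (simp add: e_def)
    also have "\<dots> \<le> K * c" using i(1) by (intro mult_right_mono) auto
    finally show ?thesis using cK by (simp add: mult.commute)
  qed
  have c4: "c * 4 \<le> q" using cK K(1) by (meson le_trans mult_le_mono2)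
  then have cq: "c + 2 \<le> q" using c2 by linarith
  have rot: "(e + c + s) mod q = e + s - (q - c)" if "s \<in> {q - c..<q}" for s
  proof -
    have "e + c + s = q + (e + s - (q - c))" "e + s - (q - c) < q" using that ec c4 by auto
    then show ?thesis by (metis mod_add_self1 mod_less)
  qed
  define f where "f s = \<xi> ((e + c + s) mod q)" for s
  have split: "(\<Sum>s\<in>{q - c - 1..<q}. f s x) = f (q - c - 1) x + (\<Sum>j\<in>{e..<e + (c - 1)}. \<xi> j x) + f (q - 1) x" for x
  proof -
    have "{q - c - 1..<q} = insert (q - c - 1) (insert (q - 1) {q - c..<q - 1})" using cq c2 by auto
    then have "(\<Sum>s\<in>{q - c - 1..<q}. f s x) = f (q - c - 1) x + (f (q - 1) x + (\<Sum>s\<in>{q - c..<q - 1}. f s x))"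
      using cq c2 by simp
    also have "(\<Sum>s\<in>{q - c..<q - 1}. f s x) = (\<Sum>j\<in>{e..<e + (c - 1)}. \<xi> j x)"
    proof (rule sum.reindex_bij_witness[where i = "\<lambda>j. j - e + (q - c)" and j = "\<lambda>s. e + s - (q - c)"])
      fix s assume s: "s \<in> {q - c..<q - 1}"
      then show "\<xi> (e + s - (q - c)) x = f s x" unfolding f_def by (subst rot) auto
      show "e + s - (q - c) - e + (q - c) = s" using s by auto
      show "e + s - (q - c) \<in> {e..<e + (c - 1)}" using s cq c2 by auto
    next
      fix j assume "j \<in> {e..<e + (c - 1)}"
      then show "e + (j - e + (q - c)) - (q - c) = j" "j - e + (q - c) \<in> {q - c..<q - 1}" using cq c2 by auto
    qed
    finally show ?thesis by simp
  qed
  have fm: "f s \<in> borel_measurable Om" "integrable Om (\<lambda>x. (f s x)\<^sup>2)" "(LINT x|Om. (f s x)\<^sup>2) \<le> \<gamma>" for s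
    unfolding f_def using q0 by (auto intro!: meas xi_sq \<gamma>)
  define A where "A x = (\<Sum>j\<in>{e..<e + (c - 1)}. \<xi> j x)" for x
  have Am: "A \<in> borel_measurable Om" "integrable Om (\<lambda>x. (A x)\<^sup>2)"
    unfolding A_def using ec by (auto intro!: borel_measurable_sum integrable_square_sum meas xi_sq)
  have A3: "(LINT x|Om. (A x)\<^sup>2) \<le> 3 / K" using i(2) by (simp add: A_def e_def)
  have "(LINT x|Om. (\<Sum>s\<in>{q - c - 1..<q}. f s x)\<^sup>2) \<le> (LINT x|Om. 3 * (f (q - c - 1) x)\<^sup>2 + 3 * (A x)\<^sup>2 + 3 * (f (q - 1) x)\<^sup>2)"
  proof (rule integral_mono)
    show "integrable Om (\<lambda>x. (\<Sum>s\<in>{q - c - 1..<q}. f s x)\<^sup>2)" by (intro integrable_square_sum fm)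
    show "integrable Om (\<lambda>x. 3 * (f (q - c - 1) x)\<^sup>2 + 3 * (A x)\<^sup>2 + 3 * (f (q - 1) x)\<^sup>2)" using fm Am by simp
    fix x
    have "(p + q + s)\<^sup>2 \<le> 3 * p\<^sup>2 + 3 * q\<^sup>2 + 3 * s\<^sup>2" for p q s :: real
      using zero_le_power2[of "p - q"] zero_le_power2[of "p - s"] zero_le_power2[of "q - s"]
      by (simp add: power2_eq_square algebra_simps)
    then show "(\<Sum>s\<in>{q - c - 1..<q}. f s x)\<^sup>2 \<le> 3 * (f (q - c - 1) x)\<^sup>2 + 3 * (A x)\<^sup>2 + 3 * (f (q - 1) x)\<^sup>2"
      unfolding split A_def .
  qed
  also have "\<dots> = 3 * (LINT x|Om. (f (q - c - 1) x)\<^sup>2) + 3 * (LINT x|Om. (A x)\<^sup>2) + 3 * (LINT x|Om. (f (q - 1) x)\<^sup>2)"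
    using fm Am by simp
  also have "\<dots> \<le> 3 * \<gamma> + 3 * (3 / K) + 3 * \<gamma>"
    using fm(3) A3 by (intro add_mono mult_left_mono) auto
  also have "\<dots> \<le> 10 / K"
  proof -
    have "6 * real K * \<gamma> \<le> 16 * (real K)\<^sup>2 * \<gamma>"
      using g0 K by (intro mult_right_mono) (auto simp: power2_eq_square)
    then have "6 * real K * \<gamma> \<le> 1" using small by linarith
    then have "6 * \<gamma> \<le> 1 / K" using K by (simp add: field_simps)
    then show ?thesis by simp
  qed
  finally have "(LINT x|Om. (\<Sum>s\<in>{q - c - 1..<q}. f s x)\<^sup>2) \<le> 10 / K" .
  then have "rotated_chain n m q Bl \<xi> r lam e c (10 / K)"
    by unfold_locales (use ec c2 cq in \<open>simp_all add: f_def\<close>)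
  then show thesis using that unfolding c_def by blast
qed

text \<open>The constants are chosen in the order K (loss through the arc), \<kappa> (bound for n /
  a), U (cut-off of the Gaussian variable), \<delta> (truncation), and at last \<open>d\<close>, the
  bound for the Lyapunov sum and for m / n. One \<open>d\<close> serves all chains, so the chains
  themselves need not converge in any sense.\<close>

lemma (in exp_coordinates) uniform_clt:
  fixes t eps r :: real
  assumes r: "r > 2" and eps: "eps > 0"
  shows "\<exists>d>0. \<forall>n m q Bl \<xi> lam (M :: 'a measure) V. cyclic_chain n m q Bl \<xi> r lam \<longrightarrow> lam \<le> d \<longrightarrow>
    real m \<le> d * real n \<longrightarrow> iid_uniform M (n - 1) V \<longrightarrow>
    cmod ((LINT \<omega>|M. iexp (t * (\<Sum>j<q. \<xi> j (\<lambda>i. real n * spacing n (\<lambda>i. V i \<omega>) i)))) - of_real (exp (- t\<^sup>2 / 2))) \<le> eps"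
proof -
  have "(\<lambda>K. \<bar>t\<bar> * (2 * sqrt (10 / real K)) + t\<^sup>2 / 2 * (2 * sqrt (10 / real K) + 10 / real K + 20 / real K)) \<longlonglongrightarrow> \<bar>t\<bar> * (2 * sqrt 0) + t\<^sup>2 / 2 * (2 * sqrt 0 + 0 + 0)"
    by (intro tendsto_intros lim_const_over_n)
  then have "\<forall>\<^sub>F K in sequentially. \<bar>t\<bar> * (2 * sqrt (10 / real K)) + t\<^sup>2 / 2 * (2 * sqrt (10 / real K) + 10 / real K + 20 / real K) < eps / 2"
    using eps by (intro order_tendstoD) auto
  then have "\<forall>\<^sub>F K in sequentially. 16 \<le> K \<and> \<bar>t\<bar> * (2 * sqrt (10 / real K)) + t\<^sup>2 / 2 * (2 * sqrt (10 / real K) + 10 / real K + 20 / real K) < eps / 2"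
    using eventually_ge_at_top[of 16] by eventually_elim auto
  then obtain K :: nat where K: "16 \<le> K"
    "\<bar>t\<bar> * (2 * sqrt (10 / real K)) + t\<^sup>2 / 2 * (2 * sqrt (10 / real K) + 10 / real K + 20 / real K) < eps / 2"
    using eventually_happens'[OF sequentially_bot] by blast
  \<comment> \<open>From n <= 2 m q, q < (c + 1) K <= 2 c K and c m <= card arc <= 2 a follows n <=
    8 K a.\<close>
  define \<kappa> where "\<kappa> = 8 * real K"
  have \<kappa>: "\<kappa> > 0" using K by (simp add: \<kappa>_def)
  \<comment> \<open>Three errors of size at most \<open>e1\<close> (weight, characteristic
    functions, Gaussian tail) occur with the factor 2 sqrt (1 + \<kappa>) and use up half of
    \<open>eps\<close>; the other half is reserved for the arc.\<close>
  define e1 where "e1 = eps / (12 * sqrt (1 + \<kappa>))"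
  have e1: "e1 > 0" "2 * (e1 + e1 + e1) * sqrt (1 + \<kappa>) = eps / 2"
    using eps \<kappa> by (simp_all add: e1_def)
  define U where "U = sqrt (2 / e1)"
  have U: "U > 0" "2 / U\<^sup>2 = e1" using e1 by (simp_all add: U_def)
  define B where "B = exp (4 * t\<^sup>2 + U\<^sup>2 * \<kappa>) * 90000"
  have B: "B \<ge> 0" by (simp add: B_def)
  have "0 \<le> B * (4 * t\<^sup>2 + U\<^sup>2 * \<kappa>)" using B \<kappa> by simp
  then obtain \<delta> where \<delta>: "\<delta> > 0" and \<delta>': "\<And>x. x \<le> \<delta> \<Longrightarrow> B * (4 * t\<^sup>2 + U\<^sup>2 * \<kappa>) * x \<le> e1 / 3"
    using ex_small_factor[of _ "e1 / 3"] e1 by (metis divide_pos_pos zero_less_numeral)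
  have "0 \<le> B * (\<delta> powr (2 - r) * (3 powr r * (1 + 2 * 2 powr r)) * \<bar>t\<bar> powr r)" using B by simp
  then obtain d1 where d1: "d1 > 0" "\<And>x. x \<le> d1 \<Longrightarrow> B * (\<delta> powr (2 - r) * (3 powr r * (1 + 2 * 2 powr r)) * \<bar>t\<bar> powr r) * x \<le> e1 / 3"
    using ex_small_factor[of _ "e1 / 3"] e1 by (metis divide_pos_pos zero_less_numeral)
  have "0 \<le> B * (\<delta> powr (-2) * (18 * U ^ 4 * \<kappa>\<^sup>2))" using B by simp
  then obtain d2 where d2: "d2 > 0" "\<And>x. x \<le> d2 \<Longrightarrow> B * (\<delta> powr (-2) * (18 * U ^ 4 * \<kappa>\<^sup>2)) * x \<le> e1 / 3"
    using ex_small_factor[of _ "e1 / 3"] e1 by (metis divide_pos_pos zero_less_numeral)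
  \<comment> \<open>This makes the second moment of each summand at most \<gamma> = 2 / (36 K^2), so
    that 16 K^2 \<gamma> = 8/9 meets the requirement of \<open>exists_rotation\<close>.\<close>
  define \<theta> where "\<theta> = 1 / (6 * real K)"
  have \<theta>: "\<theta> > 0" using K by (simp add: \<theta>_def)
  have "0 \<le> \<theta> powr (2 - r)" "1 / (36 * (real K)\<^sup>2) > 0" using K by auto
  then obtain d3 where d3: "d3 > 0" "\<And>x. x \<le> d3 \<Longrightarrow> \<theta> powr (2 - r) * x \<le> 1 / (36 * (real K)\<^sup>2)"
    using ex_small_factor by metis
  define \<eta> where "\<eta> = min e1 (1 / 10)"
  have \<eta>: "\<eta> > 0" using e1 by (simp add: \<eta>_def)
  have "1 / \<kappa> > 0" using \<kappa> by simp
  from wt_tau_approx[OF this \<eta>] obtain n0 where n0: "\<And>n A a. n0 \<le> n \<Longrightarrow> finite A \<Longrightarrow> card A \<le> n \<Longrightarrow> 1 / \<kappa> * real n \<le> real a \<Longrightarrow>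
    (LINT x|Om. \<bar>wt a (tau A x - 1) - exp (- (tau A x)\<^sup>2 / (2 * real a))\<bar>) \<le> \<eta>"
    unfolding eventually_sequentially by blast
  \<comment> \<open>The entry 1 / (n0 + 1) forces n >= n0, because 1 <= m <= d n; the entry 1 / (4
    K) forces q >= 2 K.\<close>
  define d where "d = min (min d1 d2) (min d3 (min (1 / (real n0 + 1)) (1 / (4 * real K))))"
  have d: "d > 0" "d \<le> d1" "d \<le> d2" "d \<le> d3" "d \<le> 1 / (real n0 + 1)" "d \<le> 1 / (4 * real K)"
    using d1 d2 d3 K by (auto simp: d_def)
  show ?thesis
  proof (intro exI[of _ d] conjI allI impI)
    show "d > 0" by (rule d)
    fix n m q Bl \<xi> lam and M :: "'a measure" and V
    assume chain: "cyclic_chain n m q Bl \<xi> r lam" and lam: "lam \<le> d" and md: "real m \<le> d * real n"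
      and V: "iid_uniform M (n - 1) V"
    interpret C: cyclic_chain n m q Bl \<xi> r lam by (rule chain)
    have m1: "real m \<ge> 1" using C.m1 by simp
    have dn: "1 \<le> d * real n" using m1 md by linarith
    have n_n0: "n0 \<le> n"
    proof -
      have "d * real n \<le> 1 / (real n0 + 1) * real n" using d by (intro mult_right_mono) auto
      also have "1 / (real n0 + 1) * real n = real n / (real n0 + 1)" by simp
      finally have "1 \<le> real n / (real n0 + 1)" using dn by linarith
      moreover have "real n0 + 1 > 0" by simp
      ultimately have "1 * (real n0 + 1) \<le> real n" by (simp only: pos_le_divide_eq)
      then show ?thesis by simp
    qed
    have npos: "real n > 0" using dn d(1) by (meson less_le_trans zero_less_mult_pos zero_less_one)
    have qK: "2 * K \<le> q"
    proof -
      have "real n \<le> real q * (2 * real m)" using C.q_bounds(2) by (metis of_nat_le_iff of_nat_mult of_nat_numeral)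
      also have "\<dots> \<le> real q * (2 * (1 / (4 * real K) * real n))"
      proof (intro mult_left_mono)
        have "d * real n \<le> 1 / (4 * real K) * real n" using d(6) by (intro mult_right_mono) auto
        then show "real m \<le> 1 / (4 * real K) * real n" using md by linarith
      qed auto
      also have "\<dots> = real q / (2 * real K) * real n" by (simp add: field_simps)
      finally have "1 * real n \<le> real q / (2 * real K) * real n" by simp
      then have "1 \<le> real q / (2 * real K)" using npos by (simp only: mult_le_cancel_right_pos)
      then have "2 * real K \<le> real q" using K by (simp add: pos_le_divide_eq)
      then show ?thesis by linarith
    qed
    have \<gamma>: "(LINT x|Om. (\<xi> j x)\<^sup>2) \<le> 1 / (36 * (real K)\<^sup>2) + 1 / (36 * (real K)\<^sup>2)" if "j < q" for j
    proof -
      have "(LINT x|Om. (\<xi> j x)\<^sup>2) \<le> \<theta>\<^sup>2 + \<theta> powr (2 - r) * lam" by (rule C.xi_sq_le[OF \<theta> that])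
      also have "\<theta>\<^sup>2 = 1 / (36 * (real K)\<^sup>2)" by (simp add: \<theta>_def power_divide power_mult_distrib)
      finally show ?thesis using d3(2)[of lam] lam d by linarith
    qed
    have K4: "4 \<le> K" using K by simp
    have small: "16 * (real K)\<^sup>2 * (1 / (36 * (real K)\<^sup>2) + 1 / (36 * (real K)\<^sup>2)) \<le> 1"
      using K by (simp add: field_simps)
    obtain e where "rotated_chain n m q Bl \<xi> r lam e (q div K) (10 / K)"
      using C.exists_rotation[OF K4 qK \<gamma> small] by blast
    then interpret R: rotated_chain n m q Bl \<xi> r lam e "q div K" "10 / K" .
    define c where "c = q div K"
    have c2: "c \<ge> 2" using R.c2 by (simp add: c_def)
    have cK: "c * K \<le> q" "q < (c + 1) * K" unfolding c_def using K dividend_less_div_times[of K q] by (auto simp: algebra_simps)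
    have arc2: "card R.arc \<ge> 2"
    proof -
      have "2 * 1 \<le> c * m" using c2 C.m1 by (intro mult_le_mono)
      then show ?thesis using R.card_arc(1) unfolding c_def by linarith
    qed
    have a0: "R.a > 0" using arc2 by (simp add: R.a_def)
    have na: "real n \<le> \<kappa> * real R.a"
    proof -
      have "n \<le> q * (2 * m)" by (rule C.q_bounds)
      also have "\<dots> \<le> ((c + 1) * K) * (2 * m)" using cK by (intro mult_right_mono) auto
      also have "\<dots> \<le> (2 * c * K) * (2 * m)" using c2 by (intro mult_right_mono) auto
      also have "\<dots> = 4 * K * (c * m)" by simp
      also have "\<dots> \<le> 4 * K * card R.arc" using R.card_arc(1) unfolding c_def by (intro mult_left_mono) auto
      also have "\<dots> \<le> 4 * K * (2 * R.a)" using arc2 by (intro mult_left_mono) (auto simp: R.a_def)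
      finally have "n \<le> 8 * K * R.a" by simp
      then have "real n \<le> real (8 * K * R.a)" by (simp only: of_nat_le_iff)
      then show ?thesis by (simp add: \<kappa>_def)
    qed
    \<comment> \<open>K >= 16 is used here: the blocks seen by \<open>Y\<close> make up at most a
      quarter of the circle.\<close>
    have JY4: "4 * card R.JY \<le> n"
    proof -
      have "card R.JY \<le> (c + 2) * (2 * m)" using R.card_JY unfolding c_def .
      also have "\<dots> \<le> (2 * c) * (2 * m)" using c2 by (intro mult_right_mono) auto
      finally have "4 * card R.JY \<le> 16 * (c * m)" by simp
      also have "\<dots> \<le> K * (c * m)" using K by (intro mult_right_mono) auto
      also have "\<dots> = (c * K) * m" by simp
      also have "\<dots> \<le> q * m" using cK by (intro mult_right_mono) auto
      also have "\<dots> \<le> n" by (rule C.q_bounds)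
      finally show ?thesis .
    qed
    have n32: "n \<ge> 32"
    proof -
      have "32 * 1 \<le> q * m" using qK K C.m1 by (intro mult_le_mono) auto
      then show ?thesis using C.q_bounds(1) by linarith
    qed
    define k where "k = n - 1 - card R.JY"
    have k: "n - 1 = card R.JY + k" "k \<ge> 1" "2 * card R.JY \<le> k" using JY4 n32 by (auto simp: k_def)
    have kn: "1 / \<kappa> * real n \<le> real k"
    proof -
      have "real n \<le> 2 * real k" using k JY4 n32 by linarith
      moreover have "2 * real k \<le> \<kappa> * real k" using K unfolding \<kappa>_def by (intro mult_right_mono) auto
      ultimately show ?thesis using \<kappa> by (simp add: pos_divide_le_eq mult.commute)
    qed
    have fJY: "finite R.JY" using R.JY_sub by (rule finite_subset) simp
    have y2: "10 / real K \<le> 1" using K by simp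
    have Ypart: "cmod ((LINT \<omega>|M. iexp (t * (\<Sum>j<q. \<xi> j (\<lambda>i. real n * spacing n (\<lambda>i. V i \<omega>) i))))
      - (LINT \<omega>|M. iexp (t * R.Zp (\<lambda>i. real n * spacing n (\<lambda>i. V i \<omega>) i)))) \<le> \<bar>t\<bar> * (2 * sqrt (10 / K))"
    proof (rule R.conditional_Y_small[OF V k])
      have "(LINT x|Om. \<bar>wt k (tau R.JY x - 1) - exp (- (tau R.JY x)\<^sup>2 / (2 * real k))\<bar>) \<le> \<eta>"
        using JY4 by (intro n0[OF n_n0 fJY _ kn]) simp
      then show "(LINT x|Om. \<bar>wt k (tau R.JY x - 1) - exp (- (tau R.JY x)\<^sup>2 / (2 * real k))\<bar>) \<le> 1 / 10"
        by (simp add: \<eta>_def)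
    qed
    have Zpart: "cmod ((LINT \<omega>|M. iexp (t * R.Zp (\<lambda>i. real n * spacing n (\<lambda>i. V i \<omega>) i))) - of_real (exp (- t\<^sup>2 / 2)))
      \<le> 2 * (e1 + e1 + 2 / U\<^sup>2) * sqrt (1 + \<kappa>) + t\<^sup>2 / 2 * (2 * sqrt (10 / K) + 10 / K + 10 / K * n / (n - 1))"
    proof (rule R.conditional_char_Zp[OF V a0 na U(1)])
      fix s u :: real assume s: "s = t \<or> s = 0" and u: "\<bar>u\<bar> \<le> U"
      have "\<bar>s\<bar> \<le> \<bar>t\<bar>" using s by auto
      from R.char_bound_uniform[OF this u \<delta> a0 na y2, folded B_def]
      have "cmod ((LINT x|Om. iexp (s * R.Zp x + (u / sqrt R.a) * tau R.JB x)) - of_real (exp (- R.vf s u / 2)))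
        \<le> B * (\<delta> * (4 * t\<^sup>2 + U\<^sup>2 * \<kappa>)) + B * (\<delta> powr (2 - r) * (3 powr r * (1 + 2 * 2 powr r)) * \<bar>t\<bar> powr r) * lam
          + B * (\<delta> powr (-2) * (18 * U ^ 4 * \<kappa>\<^sup>2)) * (m / n)" .
      moreover have "B * (\<delta> * (4 * t\<^sup>2 + U\<^sup>2 * \<kappa>)) \<le> e1 / 3" using \<delta>'[of \<delta>] by (simp add: mult.commute mult.left_commute)
      moreover have "B * (\<delta> powr (2 - r) * (3 powr r * (1 + 2 * 2 powr r)) * \<bar>t\<bar> powr r) * lam \<le> e1 / 3"
        using lam d by (intro d1) auto
      moreover have "B * (\<delta> powr (-2) * (18 * U ^ 4 * \<kappa>\<^sup>2)) * (m / n) \<le> e1 / 3"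
      proof (rule d2(2))
        have "real m / real n \<le> d" using md npos by (simp add: pos_divide_le_eq)
        then show "real m / real n \<le> d2" using d by linarith
      qed
      ultimately show "cmod ((LINT x|Om. iexp (s * R.Zp x + (u / sqrt R.a) * tau R.JB x)) - of_real (exp (- R.vf s u / 2))) \<le> e1"
        by linarith
    next
      have "(LINT x|Om. \<bar>wt R.a (tau R.JB x - 1) - exp (- (tau R.JB x)\<^sup>2 / (2 * real R.a))\<bar>) \<le> \<eta>"
      proof (rule n0[OF n_n0 R.finite_JB])
        show "card R.JB \<le> n" using R.card_JB_arc by simp
        show "1 / \<kappa> * real n \<le> real R.a" using na \<kappa> by (simp add: pos_divide_le_eq mult.commute)
      qed
      then show "(LINT x|Om. \<bar>wt R.a (tau R.JB x - 1) - exp (- (tau R.JB x)\<^sup>2 / (2 * real R.a))\<bar>) \<le> e1"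
        by (simp add: \<eta>_def)
    qed
    have "10 / real K * n / (n - 1) \<le> 20 / real K"
    proof -
      have "real n \<le> 2 * real (n - 1)" using n32 by simp
      then have "real n / real (n - 1) \<le> 2" using n32 by (simp add: pos_divide_le_eq)
      then have "10 / real K * (real n / real (n - 1)) \<le> 10 / real K * 2" by (intro mult_left_mono) auto
      then show ?thesis by simp
    qed
    then have "t\<^sup>2 / 2 * (2 * sqrt (10 / K) + 10 / K + 10 / K * n / (n - 1)) \<le> t\<^sup>2 / 2 * (2 * sqrt (10 / K) + 10 / K + 20 / K)"
      by (intro mult_left_mono add_left_mono) auto
    moreover have "2 * (e1 + e1 + 2 / U\<^sup>2) * sqrt (1 + \<kappa>) = eps / 2" using e1(2) U(2) by simp
    ultimately have "\<bar>t\<bar> * (2 * sqrt (10 / K)) + (2 * (e1 + e1 + 2 / U\<^sup>2) * sqrt (1 + \<kappa>) + t\<^sup>2 / 2 * (2 * sqrt (10 / K) + 10 / K + 10 / K * n / (n - 1))) \<le> eps"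
      using K(2) by linarith
    then show "cmod ((LINT \<omega>|M. iexp (t * (\<Sum>j<q. \<xi> j (\<lambda>i. real n * spacing n (\<lambda>i. V i \<omega>) i)))) - of_real (exp (- t\<^sup>2 / 2))) \<le> eps"
      using norm_triangle_ineq[of "(LINT \<omega>|M. iexp (t * (\<Sum>j<q. \<xi> j (\<lambda>i. real n * spacing n (\<lambda>i. V i \<omega>) i)))) - (LINT \<omega>|M. iexp (t * R.Zp (\<lambda>i. real n * spacing n (\<lambda>i. V i \<omega>) i)))"
        "(LINT \<omega>|M. iexp (t * R.Zp (\<lambda>i. real n * spacing n (\<lambda>i. V i \<omega>) i))) - of_real (exp (- t\<^sup>2 / 2))"]
        Ypart Zpart unfolding diff_add_cancel add_diff_eq by linarith
  qed
qed

section \<open>Window functions of the spacings\<close>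

text \<open>The power mean inequality, obtained from \<open>powr_abs_expectation_le\<close> for the
  uniform law on \<open>I\<close>. For sums over blocks of at most 2 m indices this is the origin of
  the factor m^(r-1).\<close>

lemma powr_sum_le:
  fixes y :: "'i \<Rightarrow> real"
  assumes I: "finite I" "I \<noteq> {}" and r: "r > 1"
  shows "\<bar>\<Sum>i\<in>I. y i\<bar> powr r \<le> 2 powr r * real (card I) powr (r - 1) * (\<Sum>i\<in>I. \<bar>y i\<bar> powr r)"
proof -
  interpret prob_space "uniform_count_measure I" using I by (rule prob_space_uniform_count_measure)
  have c: "real (card I) > 0" using I by (simp add: card_gt_0_iff)
  have "\<bar>(\<Sum>i\<in>I. y i) / card I\<bar> powr r \<le> 2 powr r * ((\<Sum>i\<in>I. \<bar>y i\<bar> powr r) / card I)"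
  proof -
    have "integrable (uniform_count_measure I) (\<lambda>i. \<bar>y i\<bar> powr r)"
      unfolding uniform_count_measure_def using I by (simp add: integrable_point_measure_finite)
    moreover have "y \<in> borel_measurable (uniform_count_measure I)"
      unfolding uniform_count_measure_def by simp
    ultimately show ?thesis
      using powr_abs_expectation_le[of r y] I r by (simp add: integral_uniform_count_measure)
  qed
  then have "\<bar>\<Sum>i\<in>I. y i\<bar> powr r / real (card I) powr r \<le> 2 powr r * (\<Sum>i\<in>I. \<bar>y i\<bar> powr r) / card I"
    using c by (simp add: powr_divide)
  then have "\<bar>\<Sum>i\<in>I. y i\<bar> powr r \<le> 2 powr r * (\<Sum>i\<in>I. \<bar>y i\<bar> powr r) / card I * real (card I) powr r"
    using c by (simp add: pos_divide_le_eq)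
  also have "\<dots> = 2 powr r * real (card I) powr (r - 1) * (\<Sum>i\<in>I. \<bar>y i\<bar> powr r)"
    using c by (simp add: powr_diff)
  finally show ?thesis .
qed

lemma (in iid_coordinates) measurable_cyc_window:
  assumes F: "F \<in> borel_measurable (borel_vec m)"
  shows "(\<lambda>x. F (cyc_window n m x k)) \<in> borel_measurable Om"
proof -
  have "(\<lambda>x. cyc_window n m x k) \<in> measurable Om (borel_vec m)"
    unfolding cyc_window_def by (rule measurable_restrict) simp
  from measurable_compose[OF this F] show ?thesis .
qed

locale window_functions = exp_coordinates +
  fixes n m :: nat and h :: "nat \<Rightarrow> (nat \<Rightarrow> real) \<Rightarrow> real"
  assumes m1: "m \<ge> 1" and mn: "2 * m \<le> n"
    and h_meas: "\<And>k. k < n \<Longrightarrow> h k \<in> borel_measurable (borel_vec m)"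
    and h_sq: "\<And>k. k < n \<Longrightarrow> integrable Om (\<lambda>x. (h k (cyc_window n m x k))\<^sup>2)"
begin

abbreviation coords :: "nat \<Rightarrow> (nat \<Rightarrow> real) \<Rightarrow> real" where "coords \<equiv> \<lambda>j x. x j"

definition H :: "nat \<Rightarrow> (nat \<Rightarrow> real) \<Rightarrow> real" where "H k x = h k (cyc_window n m x k)"

definition win :: "nat \<Rightarrow> nat set" where "win k = (\<lambda>i. (k + i) mod n) ` {..<m}"

definition Hc :: "nat \<Rightarrow> (nat \<Rightarrow> real) \<Rightarrow> real" where "Hc k x = H k x - (LINT x|Om. H k x)"

abbreviation "cB \<equiv> B_const Om coords h n m"
abbreviation "cC \<equiv> C_const Om coords h n m"

definition g :: "nat \<Rightarrow> (nat \<Rightarrow> real) \<Rightarrow> real" where "g k x = Hc k x - cB * (x k - 1)"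

lemma n0: "n > 0" using m1 mn by simp

lemma H_Xwin: "h k (Xwin coords n m k x) = H k x"
  by (simp add: H_def Xwin_def)

lemma g_rv_eq: "g_rv Om coords h n m k x = g k x"
  by (simp add: g_rv_def g_def Hc_def H_Xwin)

lemma H_measurable: "k < n \<Longrightarrow> H k \<in> borel_measurable Om"
  unfolding H_def by (rule measurable_cyc_window[OF h_meas])

lemma win_sub: "win k \<subseteq> {..<n}" using n0 by (auto simp: win_def)

lemma finite_win: "finite (win k)" by (simp add: win_def)

lemma win_inj: "inj_on (\<lambda>i. (k + i) mod n) {..<m}"
proof (rule inj_onI)
  have *: "i = j" if "i \<le> j" "j < m" "(k + i) mod n = (k + j) mod n" for i j
  proof -
    have "n dvd (k + j) - (k + i)" using that by (subst mod_eq_dvd_iff_nat[symmetric]) auto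
    then have "n dvd j - i" by simp
    moreover have "j - i < n" using that(2) mn by linarith
    ultimately have "j - i = 0" using nat_dvd_not_less[of "j - i" n] by auto
    then show ?thesis using that(1) by simp
  qed
  fix i j assume "i \<in> {..<m}" "j \<in> {..<m}" "(k + i) mod n = (k + j) mod n"
  then show "i = j" using *[of i j] *[of j i] by (cases "i \<le> j") auto
qed

lemma H_dep: "dep (win k) (H k)"
  unfolding dep_def H_def
proof (intro allI impI)
  fix x y :: "nat \<Rightarrow> real" assume "\<forall>i\<in>win k. x i = y i"
  then have "cyc_window n m x k = cyc_window n m y k" by (auto simp: cyc_window_def win_def)
  then show "h k (cyc_window n m x k) = h k (cyc_window n m y k)" by simp
qed

lemma win_self: "k < n \<Longrightarrow> k \<in> win k"
  using m1 by (auto simp: win_def intro!: image_eqI[of _ _ 0])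

lemma H_sq: "k < n \<Longrightarrow> integrable Om (\<lambda>x. (H k x)\<^sup>2)"
  using h_sq by (simp add: H_def)

lemma H_int: "k < n \<Longrightarrow> integrable Om (H k)"
  using integrable_square_imp[OF H_measurable H_sq] .

lemma Hc_measurable: "k < n \<Longrightarrow> Hc k \<in> borel_measurable Om"
  unfolding Hc_def using H_measurable by simp

lemma Hc_sq: "k < n \<Longrightarrow> integrable Om (\<lambda>x. (Hc k x)\<^sup>2)"
  unfolding Hc_def power2_diff using H_sq H_int by simp

lemma Hc_int: "k < n \<Longrightarrow> integrable Om (Hc k)"
  unfolding Hc_def using H_int by simp

lemma Hc_mean: "k < n \<Longrightarrow> (LINT x|Om. Hc k x) = 0"
  unfolding Hc_def using H_int by simp

lemma Hc_dep: "dep (win k) (Hc k)"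
  unfolding Hc_def by (rule dep_comp[OF H_dep])

lemma g_measurable: "k < n \<Longrightarrow> g k \<in> borel_measurable Om"
  unfolding g_def using Hc_measurable by simp

lemma g_dep: "k < n \<Longrightarrow> dep (win k) (g k)"
  unfolding g_def
  by (rule dep_comp2[OF Hc_dep dep_coord[OF win_self], where F = "\<lambda>a b. a - cB * (b - 1)"])

lemma coord_int: "integrable Om (\<lambda>x. x k - 1)"
  using integrable_coord_centered_power[of k 1] by simp

lemma g_int: "k < n \<Longrightarrow> integrable Om (g k)"
  unfolding g_def by (rule Bochner_Integration.integrable_diff[OF Hc_int integrable_mult_right[OF coord_int]])

lemma g_mean:
  assumes k: "k < n" shows "(LINT x|Om. g k x) = 0"
proof -
  have "(LINT x|Om. g k x) = (LINT x|Om. Hc k x) - (LINT x|Om. cB * (x k - 1))"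
    unfolding g_def by (rule Bochner_Integration.integral_diff[OF Hc_int[OF k] integrable_mult_right[OF coord_int]])
  then show ?thesis by (simp only: Hc_mean[OF k] integral_mult_right_zero integral_coord_centered(1))
qed

lemma tau_win: "tau (win k) x = win_sum m (cyc_window n m x k) - m"
  unfolding tau_def win_def sum.reindex[OF win_inj] by (simp add: win_sum_def cyc_window_def sum_subtractf)

text \<open>The window sum and \<open>tau (win k)\<close> differ by the constant \<open>m\<close>,
  which drops out of the covariance.\<close>

lemma B_eq: "real n * cB = (\<Sum>k<n. LINT x|Om. Hc k x * tau (win k) x)"
proof -
  have "cov Om (\<lambda>x. h k (Xwin coords n m k x)) (\<lambda>x. win_sum m (Xwin coords n m k x)) = (LINT x|Om. Hc k x * tau (win k) x)" for k
  proof -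
    have ws: "win_sum m (Xwin coords n m k x) = tau (win k) x + m" for x
      by (simp add: tau_win Xwin_def)
    have "(LINT x|Om. tau (win k) x + real m) = m"
      using integrable_tau[OF finite_win] integral_tau[OF finite_win] by simp
    then show ?thesis unfolding cov_def ws H_Xwin by (simp add: Hc_def)
  qed
  then show ?thesis using n0 by (simp add: B_const_def)
qed

lemma Hc_tau_int: "k < n \<Longrightarrow> finite A \<Longrightarrow> integrable Om (\<lambda>x. Hc k x * tau A x)"
  by (intro integrable_square_mult Hc_measurable Hc_sq tau_measurable integrable_tau_power)

text \<open>The coordinates outside the window are independent of \<open>Hc k\<close> and contribute
  no covariance.\<close>

lemma Hc_tau:
  assumes k: "k < n"
  shows "(LINT x|Om. Hc k x * tau {..<n} x) = (LINT x|Om. Hc k x * tau (win k) x)"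
proof -
  note i = Hc_tau_int[OF k]
  let ?R = "{..<n} - win k"
  have split: "tau {..<n} x = tau (win k) x + tau ?R x" for x
    unfolding tau_def using win_sub[of k] by (subst sum.subset_diff[of "win k"]) auto
  have "(LINT x|Om. Hc k x * tau ?R x) = 0"
    using integral_mult_indep[OF Hc_int[OF k] Hc_dep integrable_tau dep_tau, of ?R] Hc_mean[OF k] by simp
  then show "(LINT x|Om. Hc k x * tau {..<n} x) = (LINT x|Om. Hc k x * tau (win k) x)"
    unfolding split distrib_left using i[OF finite_win] i[of ?R] by simp
qed

text \<open>Windows that are not neighbours in the sense of \<open>C_const\<close> are disjoint, so
  its inner sum omits only zero covariances. Its 2 m - 1 indices have distinct residues because 2 m
  <= n, so no pair is counted twice.\<close>

lemma C_eq: "real n * cC = (LINT x|Om. (\<Sum>k<n. Hc k x)\<^sup>2)"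
proof -
  define N where "N k = (\<lambda>j. nat (j mod int n)) ` {int k - int m + 1..int k + int m - 1}" for k
  have cov_eq: "cov Om (\<lambda>x. h k (Xwin coords n m k x)) (\<lambda>x. h j (Xwin coords n m j x)) = (LINT x|Om. Hc k x * Hc j x)" for k j
    by (simp add: cov_def H_Xwin Hc_def)
  have N_inj: "inj_on (\<lambda>j. nat (j mod int n)) {int k - int m + 1..int k + int m - 1}" for k
  proof (rule inj_onI)
    fix i j assume ij: "i \<in> {int k - int m + 1..int k + int m - 1}" "j \<in> {int k - int m + 1..int k + int m - 1}"
      and "nat (i mod int n) = nat (j mod int n)"
    moreover have "0 \<le> i mod int n" "0 \<le> j mod int n" using n0 by simp_all
    ultimately have "i mod int n = j mod int n" by (simp only: eq_nat_nat_iff)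
    then have "int n dvd i - j" by (simp add: mod_eq_dvd_iff)
    moreover have "\<bar>i - j\<bar> < int n" using ij mn m1 by auto
    ultimately have "i - j = 0" using zdvd_not_zless[of "\<bar>i - j\<bar>" "int n"] by (cases "i - j = 0") auto
    then show "i = j" by simp
  qed
  have N_sub: "N k \<subseteq> {..<n}" for k using n0 by (auto simp: N_def nat_less_iff)
  have zero: "(LINT x|Om. Hc k x * Hc j x) = 0" if kj: "k < n" "j < n" "j \<notin> N k" for k j
  proof -
    have "win k \<inter> win j = {}"
    proof (rule ccontr)
      assume "win k \<inter> win j \<noteq> {}"
      then obtain a b where ab: "a < m" "b < m" "(k + a) mod n = (j + b) mod n" by (auto simp: win_def)
      then have "int ((k + a) mod n) = int ((j + b) mod n)" by simp
      then have "(int k + int a) mod int n = (int j + int b) mod int n" by (simp add: zmod_int)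
      then have "(int k + int a - int b) mod int n = int j mod int n" by (metis add_diff_cancel_right' mod_diff_left_eq)
      then have "nat ((int k + int a - int b) mod int n) = j" using kj by (simp add: mod_pos_pos_trivial)
      moreover have "int k + int a - int b \<in> {int k - int m + 1..int k + int m - 1}" using ab by auto
      ultimately have "j \<in> N k" unfolding N_def by (metis image_eqI)
      then show False using kj by simp
    qed
    from integral_mult_indep[OF Hc_int[OF kj(1)] Hc_dep Hc_int[OF kj(2)] Hc_dep this]
    show ?thesis using Hc_mean kj by simp
  qed
  have "(LINT x|Om. (\<Sum>k<n. Hc k x)\<^sup>2) = (\<Sum>k<n. \<Sum>j<n. LINT x|Om. Hc k x * Hc j x)"
    by (intro integral_square_sum) (auto intro: Hc_measurable Hc_sq)
  also have "\<dots> = (\<Sum>k<n. \<Sum>j\<in>N k. LINT x|Om. Hc k x * Hc j x)"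
    using zero N_sub by (intro sum.cong refl sum.mono_neutral_right) auto
  also have "\<dots> = (\<Sum>k<n. \<Sum>j\<in>{int k - int m + 1..int k + int m - 1}. LINT x|Om. Hc k x * Hc (nat (j mod int n)) x)"
    unfolding N_def by (simp add: sum.reindex[OF N_inj] comp_def)
  also have "\<dots> = real n * cC"
    using n0 by (simp add: C_const_def Let_def cov_eq)
  finally show ?thesis by simp
qed

definition Z :: "(nat \<Rightarrow> real) \<Rightarrow> real" where "Z x = (\<Sum>k<n. g k x)"

lemma Z_eq: "Z x = (\<Sum>k<n. Hc k x) - cB * tau {..<n} x"
  by (simp only: Z_def g_def sum_subtractf tau_def sum_distrib_left[symmetric])

text \<open>\<open>cB\<close> is the regression coefficient of the sum of the \<open>Hc k\<close> on
  the total of the coordinates: the covariance is n * cB and the variance of the total is n. Thus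
  \<open>Z\<close> is the regression residual, with variance n (C - B^2) and no correlation with the
  total.\<close>

lemma
  shows Z_var: "(LINT x|Om. (Z x)\<^sup>2) = sigma2_const Om coords h n m"
    and Z_cov: "(LINT x|Om. Z x * tau {..<n} x) = 0"
proof -
  let ?S = "\<lambda>x. \<Sum>k<n. Hc k x"
  have Sm: "?S \<in> borel_measurable Om" and Ssq: "integrable Om (\<lambda>x. (?S x)\<^sup>2)"
    by (auto intro!: borel_measurable_sum integrable_square_sum Hc_measurable Hc_sq)
  have tsq: "integrable Om (\<lambda>x. (tau {..<n} x)\<^sup>2)" by (rule integrable_tau_power) simp
  have St: "integrable Om (\<lambda>x. ?S x * tau {..<n} x)"
    by (intro integrable_square_mult Sm Ssq tau_measurable tsq)
  have ESt: "(LINT x|Om. ?S x * tau {..<n} x) = real n * cB"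
  proof -
    have "(LINT x|Om. ?S x * tau {..<n} x) = (\<Sum>k<n. LINT x|Om. Hc k x * tau {..<n} x)"
      unfolding sum_distrib_right by (rule Bochner_Integration.integral_sum) (auto intro: Hc_tau_int)
    then show ?thesis unfolding B_eq by (simp add: Hc_tau)
  qed
  have Et: "(LINT x|Om. (tau {..<n} x)\<^sup>2) = n" by (simp add: integral_tau_square)
  have "(LINT x|Om. (Z x)\<^sup>2) = (LINT x|Om. (?S x)\<^sup>2 - (2 * cB) * (?S x * tau {..<n} x) + cB\<^sup>2 * (tau {..<n} x)\<^sup>2)"
  proof (intro Bochner_Integration.integral_cong refl)
    fix x
    have "(s - b * t)\<^sup>2 = s\<^sup>2 - (2 * b) * (s * t) + b\<^sup>2 * t\<^sup>2" for s b t :: real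
      by (simp add: power2_eq_square algebra_simps)
    then show "(Z x)\<^sup>2 = (?S x)\<^sup>2 - (2 * cB) * (?S x * tau {..<n} x) + cB\<^sup>2 * (tau {..<n} x)\<^sup>2"
      unfolding Z_eq .
  qed
  also have "\<dots> = (LINT x|Om. (?S x)\<^sup>2) - (2 * cB) * (LINT x|Om. ?S x * tau {..<n} x) + cB\<^sup>2 * (LINT x|Om. (tau {..<n} x)\<^sup>2)"
    using Ssq St tsq by simp
  also have "\<dots> = sigma2_const Om coords h n m"
    unfolding ESt Et C_eq[symmetric] sigma2_const_def by (simp add: power2_eq_square algebra_simps)
  finally show "(LINT x|Om. (Z x)\<^sup>2) = sigma2_const Om coords h n m" .
  have "(LINT x|Om. Z x * tau {..<n} x) = (LINT x|Om. ?S x * tau {..<n} x - cB * (tau {..<n} x)\<^sup>2)"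
    by (intro Bochner_Integration.integral_cong refl) (simp add: Z_eq power2_eq_square algebra_simps)
  also have "\<dots> = real n * cB - cB * n" using St tsq ESt Et by simp
  finally show "(LINT x|Om. Z x * tau {..<n} x) = 0" by simp
qed

lemma spacing_periodic: "spacing n v (j mod n) = spacing n v j"
proof -
  have "spacing n v (i + l * n) = spacing n v i" for i l
  proof (induction l)
    case (Suc l)
    have "spacing_pt n v (Suc (i + Suc l * n)) = 1 + spacing_pt n v (Suc (i + l * n))"
      "spacing_pt n v (i + Suc l * n) = 1 + spacing_pt n v (i + l * n)"
      using n0 spacing_pt_shift[of n "Suc (i + Suc l * n)" v] spacing_pt_shift[of n "i + Suc l * n" v]
      by (simp_all add: algebra_simps)
    then show ?case using Suc by (simp add: spacing_def)
  qed simp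
  from this[of "j mod n" "j div n"] show ?thesis by simp
qed

lemma spacing_stat_eq:
  "spacing_stat n m h v - A_const Om coords h n m = Z (\<lambda>i. real n * spacing n v i)"
proof -
  let ?s = "\<lambda>i. real n * spacing n v i"
  have H: "h k (\<lambda>i\<in>{..<m}. real n * spacing n v (k + i)) = H k ?s" for k
    by (simp add: H_def cyc_window_def spacing_periodic)
  have "(\<Sum>k<n. spacing n v k) = spacing_pt n v n - spacing_pt n v 0"
    unfolding spacing_def by (rule sum_lessThan_telescope)
  then have "(\<Sum>k<n. spacing n v k) = 1" using n0 spacing_pt_n[of n v] by (simp add: spacing_pt_0)
  then have "tau {..<n} ?s = 0"
    by (simp add: tau_def sum_subtractf flip: sum_distrib_left)
  then show ?thesis
    unfolding Z_eq by (simp add: spacing_stat_def H A_const_def H_Xwin Hc_def sum_subtractf)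
qed

section \<open>Cutting the circle of windows into blocks\<close>

definition q :: nat where "q = n div m"

text \<open>The last block also takes the remainder of \<open>n\<close> modulo \<open>m\<close>, so
  its size stays below 2 m.\<close>

definition Bl :: "nat \<Rightarrow> nat set" where
  "Bl j = (if Suc j < q then {j * m..<Suc j * m} else {j * m..<n})"

lemma q2: "2 \<le> q" unfolding q_def using mn m1 by (metis div_le_mono div_mult_self_is_m less_eq_Suc_le One_nat_def)

lemma qm: "q * m \<le> n" "n < Suc q * m"
  unfolding q_def using m1 dividend_less_div_times[of m n] by auto

lemma Bl_union: "(\<Union>j<q. Bl j) = {..<n}"
proof
  show "(\<Union>j<q. Bl j) \<subseteq> {..<n}"
  proof
    fix x assume "x \<in> (\<Union>j<q. Bl j)"
    then obtain j where j: "j < q" "x \<in> Bl j" by auto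
    have "Suc j * m \<le> q * m" using j by (intro mult_right_mono) auto
    then have "Suc j * m \<le> n" using qm(1) by linarith
    then show "x \<in> {..<n}" using j by (auto simp: Bl_def split: if_splits)
  qed
  show "{..<n} \<subseteq> (\<Union>j<q. Bl j)"
  proof
    fix x assume x: "x \<in> {..<n}"
    define j where "j = min (x div m) (q - 1)"
    have jq: "j < q" using q2 by (simp add: j_def)
    have lo: "j * m \<le> x"
    proof -
      have "j * m \<le> x div m * m" by (intro mult_right_mono) (auto simp: j_def)
      then show ?thesis by (meson div_times_less_eq_dividend le_trans)
    qed
    have "x < Suc j * m" if "Suc j < q"
    proof -
      have "j = x div m" using that by (auto simp: j_def min_def split: if_splits)
      then show ?thesis using m1 dividend_less_div_times[of m x] by simp
    qed
    then have "x \<in> Bl j" using lo x by (auto simp: Bl_def)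
    then show "x \<in> (\<Union>j<q. Bl j)" using jq by auto
  qed
qed

lemma Bl_disj:
  assumes "i < q" "j < q" "i \<noteq> j"
  shows "Bl i \<inter> Bl j = {}"
proof -
  have *: "Bl i \<inter> Bl j = {}" if "i < j" "j < q" for i j
  proof -
    have "Suc i * m \<le> j * m" using that by (intro mult_right_mono) auto
    moreover have "Suc i < q" using that by simp
    ultimately show ?thesis by (auto simp: Bl_def)
  qed
  show ?thesis using *[of i j] *[of j i] assms by (cases "i < j") auto
qed

lemma Bl_card: "j < q \<Longrightarrow> m \<le> card (Bl j) \<and> card (Bl j) \<le> 2 * m"
proof (cases "Suc j < q")
  case False
  assume "j < q"
  then have "Suc j = q" using False by simp
  then have "n < (j + 2) * m" "Suc j * m \<le> n" using qm by auto
  then show ?thesis using False by (auto simp: Bl_def algebra_simps)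
qed (simp add: Bl_def)

text \<open>A window of length \<open>m\<close> starting in a block cannot pass beyond the next one,
  since every block has at least \<open>m\<close> elements; from the last block it may wrap around
  into block 0.\<close>

lemma win_in_Bl:
  assumes j: "j < q" and k: "k \<in> Bl j"
  shows "win k \<subseteq> Bl j \<union> Bl (Suc j mod q)"
proof
  fix x assume "x \<in> win k"
  then obtain i where i: "i < m" "x = (k + i) mod n" by (auto simp: win_def)
  show "x \<in> Bl j \<union> Bl (Suc j mod q)"
  proof (cases "Suc j < q")
    case True
    have k': "j * m \<le> k" "k < Suc j * m" using k True by (auto simp: Bl_def)
    have b: "k + i < Suc (Suc j) * m" using k' i by simp
    have "Suc (Suc j) * m \<le> q * m" using True by (intro mult_right_mono) auto
    then have kn: "k + i < n" using b qm(1) by linarith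
    then have x: "x = k + i" using i by simp
    have "x \<in> Bl j \<or> x \<in> Bl (Suc j)"
    proof (cases "k + i < Suc j * m")
      case True
      then show ?thesis using k' x \<open>Suc j < q\<close> by (auto simp: Bl_def)
    next
      case False
      then show ?thesis using b kn x by (auto simp: Bl_def)
    qed
    then show ?thesis using True by simp
  next
    case False
    then have jq: "Suc j = q" using j by simp
    have k': "j * m \<le> k" "k < n" using k False by (auto simp: Bl_def)
    show ?thesis
    proof (cases "k + i < n")
      case True
      then have "x = k + i" using i by simp
      then have "x \<in> Bl j" using k' True False by (simp add: Bl_def)
      then show ?thesis by simp
    next
      case wrap: False
      have "k + i - n < m" using k' i by linarith
      moreover have "x = k + i - n"
        using i wrap k' mn by (simp add: le_mod_geq)
      ultimately have "x \<in> Bl 0" using q2 by (auto simp: Bl_def)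
      then show ?thesis using jq by simp
    qed
  qed
qed

text \<open>Division by \<sigma> turns \<open>Z_var\<close> and \<open>Z_cov\<close> into the
  normalisation of \<open>cyclic_chain\<close>. The bound for the r-th moments comes from
  \<open>powr_sum_le\<close> applied to each block.\<close>

lemma chain:
  assumes s2: "sigma2_const Om coords h n m > 0" and r: "r > 2"
    and mom: "\<And>k. k < n \<Longrightarrow> integrable Om (\<lambda>x. \<bar>g k x\<bar> powr r)"
  defines "\<sigma> \<equiv> sigma_const Om coords h n m"
  shows "cyclic_chain n m q Bl (\<lambda>j x. (\<Sum>k\<in>Bl j. g k x) / \<sigma>) r
    (2 powr r * (2 * real m) powr (r - 1) / \<sigma> powr r * (\<Sum>k<n. LINT x|Om. \<bar>g k x\<bar> powr r))"
    and "(\<Sum>j<q. (\<Sum>k\<in>Bl j. g k x) / \<sigma>) = Z x / \<sigma>"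
proof -
  have \<sigma>: "\<sigma> > 0" "\<sigma>\<^sup>2 = sigma2_const Om coords h n m"
    using s2 by (simp_all add: \<sigma>_def sigma_const_def)
  have Bsub: "Bl j \<subseteq> {..<n}" if "j < q" for j using Bl_union that by auto
  have Bfin: "finite (Bl j)" for j by (simp add: Bl_def)
  show sum_eq: "(\<Sum>j<q. (\<Sum>k\<in>Bl j. g k x) / \<sigma>) = Z x / \<sigma>" for x
  proof -
    have "Z x = (\<Sum>j<q. \<Sum>k\<in>Bl j. g k x)"
      unfolding Z_def Bl_union[symmetric] using Bl_disj by (intro sum.UNION_disjoint Bfin ballI) (auto simp: Bfin)
    then show ?thesis by (simp add: sum_divide_distrib)
  qed
  define \<xi> where "\<xi> j x = (\<Sum>k\<in>Bl j. g k x) / \<sigma>" for j x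
  have pt: "\<bar>\<xi> j x\<bar> powr r \<le> 2 powr r * (2 * real m) powr (r - 1) / \<sigma> powr r * (\<Sum>k\<in>Bl j. \<bar>g k x\<bar> powr r)" if j: "j < q" for j x
  proof -
    have ne: "Bl j \<noteq> {}" using Bl_card[OF j] m1 by auto
    have "\<bar>\<Sum>k\<in>Bl j. g k x\<bar> powr r \<le> 2 powr r * real (card (Bl j)) powr (r - 1) * (\<Sum>k\<in>Bl j. \<bar>g k x\<bar> powr r)"
      using r by (intro powr_sum_le Bfin ne) auto
    also have "\<dots> \<le> 2 powr r * (2 * real m) powr (r - 1) * (\<Sum>k\<in>Bl j. \<bar>g k x\<bar> powr r)"
    proof -
      have "real (card (Bl j)) \<le> 2 * real m" using Bl_card[OF j] by linarith
      then show ?thesis using r by (intro mult_right_mono mult_left_mono powr_mono2) (auto intro: sum_nonneg)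
    qed
    finally have "\<bar>\<Sum>k\<in>Bl j. g k x\<bar> powr r / \<sigma> powr r \<le> 2 powr r * (2 * real m) powr (r - 1) * (\<Sum>k\<in>Bl j. \<bar>g k x\<bar> powr r) / \<sigma> powr r"
      by (rule divide_right_mono) simp
    then show ?thesis using \<sigma>(1) by (simp add: \<xi>_def powr_divide)
  qed
  have gsum: "integrable Om (\<lambda>x. \<Sum>k\<in>Bl j. \<bar>g k x\<bar> powr r)" if "j < q" for j
    using Bsub[OF that] by (intro Bochner_Integration.integrable_sum mom) auto
  have xm: "\<xi> j \<in> borel_measurable Om" if "j < q" for j
    unfolding \<xi>_def using Bsub[OF that] g_measurable by (intro borel_measurable_divide borel_measurable_sum) auto
  have xr: "integrable Om (\<lambda>x. \<bar>\<xi> j x\<bar> powr r)" if "j < q" for j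
  proof (rule Bochner_Integration.integrable_bound)
    show "integrable Om (\<lambda>x. 2 powr r * (2 * real m) powr (r - 1) / \<sigma> powr r * (\<Sum>k\<in>Bl j. \<bar>g k x\<bar> powr r))"
      using gsum[OF that] by (intro integrable_mult_right)
    show "(\<lambda>x. \<bar>\<xi> j x\<bar> powr r) \<in> borel_measurable Om" using xm[OF that] by measurable
    show "AE x in Om. norm (\<bar>\<xi> j x\<bar> powr r) \<le> norm (2 powr r * (2 * real m) powr (r - 1) / \<sigma> powr r * (\<Sum>k\<in>Bl j. \<bar>g k x\<bar> powr r))"
    proof (rule AE_I2)
      fix x
      have "norm (\<bar>\<xi> j x\<bar> powr r) = \<bar>\<xi> j x\<bar> powr r" by simp
      then show "norm (\<bar>\<xi> j x\<bar> powr r) \<le> norm (2 powr r * (2 * real m) powr (r - 1) / \<sigma> powr r * (\<Sum>k\<in>Bl j. \<bar>g k x\<bar> powr r))"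
        using pt[OF that, of x] by (metis abs_ge_self order_trans real_norm_def)
    qed
  qed
  have "cyclic_chain n m q Bl \<xi> r (2 powr r * (2 * real m) powr (r - 1) / \<sigma> powr r * (\<Sum>k<n. LINT x|Om. \<bar>g k x\<bar> powr r))"
  proof unfold_locales
    show "2 < r" "1 \<le> m" "(\<Union>j<q. Bl j) = {..<n}" by (rule r m1 Bl_union)+
    fix j assume j: "j < q"
    show "m \<le> card (Bl j) \<and> card (Bl j) \<le> 2 * m" by (rule Bl_card[OF j])
    show "\<xi> j \<in> borel_measurable Om" "integrable Om (\<lambda>x. \<bar>\<xi> j x\<bar> powr r)" by (rule xm[OF j] xr[OF j])+
    show "(LINT x|Om. \<xi> j x) = 0"
      unfolding \<xi>_def using Bsub[OF j] g_int g_mean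
      by (simp add: Bochner_Integration.integral_sum subset_eq)
    show "dep (Bl j \<union> Bl (Suc j mod q)) (\<xi> j)"
      unfolding \<xi>_def
    proof (rule dep_comp[OF dep_sum])
      fix k assume k: "k \<in> Bl j"
      then have "k < n" using Bsub[OF j] by auto
      then show "dep (Bl j \<union> Bl (Suc j mod q)) (g k)"
        by (intro dep_mono[OF g_dep] win_in_Bl[OF j k])
    qed
  next
    fix i j assume "i < q" "j < q" "i \<noteq> j"
    then show "Bl i \<inter> Bl j = {}" by (rule Bl_disj)
  next
    have "(\<Sum>j<q. LINT x|Om. \<bar>\<xi> j x\<bar> powr r) \<le> (\<Sum>j<q. LINT x|Om. 2 powr r * (2 * real m) powr (r - 1) / \<sigma> powr r * (\<Sum>k\<in>Bl j. \<bar>g k x\<bar> powr r))"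
      using xr gsum pt by (intro sum_mono integral_mono) auto
    also have "\<dots> = 2 powr r * (2 * real m) powr (r - 1) / \<sigma> powr r * (\<Sum>j<q. \<Sum>k\<in>Bl j. LINT x|Om. \<bar>g k x\<bar> powr r)"
    proof -
      have "(LINT x|Om. (\<Sum>k\<in>Bl j. \<bar>g k x\<bar> powr r)) = (\<Sum>k\<in>Bl j. LINT x|Om. \<bar>g k x\<bar> powr r)" if "j < q" for j
        using Bsub[OF that] by (intro Bochner_Integration.integral_sum mom) auto
      then have "(\<Sum>j<q. LINT x|Om. 2 powr r * (2 * real m) powr (r - 1) / \<sigma> powr r * (\<Sum>k\<in>Bl j. \<bar>g k x\<bar> powr r))
        = (\<Sum>j<q. 2 powr r * (2 * real m) powr (r - 1) / \<sigma> powr r * (\<Sum>k\<in>Bl j. LINT x|Om. \<bar>g k x\<bar> powr r))"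
        by (intro sum.cong refl) (simp only: integral_mult_right_zero lessThan_iff)
      then show ?thesis by (simp only: sum_distrib_left)
    qed
    also have "(\<Sum>j<q. \<Sum>k\<in>Bl j. LINT x|Om. \<bar>g k x\<bar> powr r) = (\<Sum>k<n. LINT x|Om. \<bar>g k x\<bar> powr r)"
      unfolding Bl_union[symmetric] using Bl_disj by (intro sum.UNION_disjoint[symmetric]) (auto simp: Bfin)
    finally show "(\<Sum>j<q. LINT x|Om. \<bar>\<xi> j x\<bar> powr r) \<le> 2 powr r * (2 * real m) powr (r - 1) / \<sigma> powr r * (\<Sum>k<n. LINT x|Om. \<bar>g k x\<bar> powr r)" .
    show "(LINT x|Om. (\<Sum>j<q. \<xi> j x)\<^sup>2) = 1"
      unfolding \<xi>_def sum_eq power_divide using Z_var \<sigma> s2 by simp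
    show "(LINT x|Om. (\<Sum>j<q. \<xi> j x) * tau {..<n} x) = 0"
      unfolding \<xi>_def sum_eq using Z_cov by simp
  qed
  then show "cyclic_chain n m q Bl (\<lambda>j x. (\<Sum>k\<in>Bl j. g k x) / \<sigma>) r
    (2 powr r * (2 * real m) powr (r - 1) / \<sigma> powr r * (\<Sum>k<n. LINT x|Om. \<bar>g k x\<bar> powr r))"
    unfolding \<xi>_def .
qed

end

section \<open>Transfer to the given samples and convergence in distribution\<close>

lemma exp_coordinates: exp_coordinates
proof -
  interpret prob_space exp_dist
    unfolding exp_dist_def by (rule prob_space_exponential_density) simp
  show ?thesis
    unfolding exp_coordinates_def iid_coordinates_def
    by unfold_locales (simp_all add: exp_dist_def)
qed

text \<open>The constants A, B, C and \<sigma> are given through spaces \<open>P\<close> and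
  variables \<open>X\<close> that change with \<open>n\<close>. They depend only on the joint law of
  these variables and can therefore be computed on the fixed coordinate space.\<close>

locale exp_sample = exp_coordinates +
  fixes P :: "'b measure" and X :: "nat \<Rightarrow> 'b \<Rightarrow> real" and n m :: nat
    and h :: "nat \<Rightarrow> (nat \<Rightarrow> real) \<Rightarrow> real"
  assumes X: "iid_std_exponential P n X" and n0: "n > 0"
    and h_meas: "\<And>k. k < n \<Longrightarrow> h k \<in> borel_measurable (borel_vec m)"
begin

abbreviation coords :: "nat \<Rightarrow> (nat \<Rightarrow> real) \<Rightarrow> real" where "coords \<equiv> \<lambda>j x. x j"

lemma
  fixes f :: "(nat \<Rightarrow> real) \<Rightarrow> real"
  assumes f: "f \<in> borel_measurable Om" "dep {..<n} f"
  shows sample_integral: "(LINT \<omega>|P. f (\<lambda>i. X i \<omega>)) = (LINT x|Om. f x)"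
    and sample_integrable: "integrable P (\<lambda>\<omega>. f (\<lambda>i. X i \<omega>)) \<longleftrightarrow> integrable Om f"
proof -
  have P: "prob_space P" "prob_space.indep_vars P (\<lambda>_. borel) X {..<n}"
    using X by (simp_all add: iid_std_exponential_def)
  have ne: "finite {..<n}" "{..<n} \<noteq> {}" using n0 by auto
  have d: "distr P borel (X i) = exp_dist" if "i \<in> {..<n}" for i
  proof -
    have "distributed P lborel (X i) (exponential_density 1)"
      using X that by (simp add: iid_std_exponential_def)
    then have "distr P lborel (X i) = exp_dist" by (simp add: distributed_def exp_dist_def)
    moreover have "distr P borel (X i) = distr P lborel (X i)" by (rule distr_cong) simp_all
    ultimately show ?thesis by simp
  qed
  show "(LINT \<omega>|P. f (\<lambda>i. X i \<omega>)) = (LINT x|Om. f x)"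
    by (rule integral_sample[OF P ne d f])
  show "integrable P (\<lambda>\<omega>. f (\<lambda>i. X i \<omega>)) \<longleftrightarrow> integrable Om f"
    by (rule integrable_sample[OF P ne d f])
qed

lemma sample_cov:
  assumes f: "f \<in> borel_measurable Om" "dep {..<n} f"
    and f': "f' \<in> borel_measurable Om" "dep {..<n} f'"
  shows "cov P (\<lambda>\<omega>. f (\<lambda>i. X i \<omega>)) (\<lambda>\<omega>. f' (\<lambda>i. X i \<omega>)) = cov Om f f'"
  unfolding cov_def sample_integral[OF f] sample_integral[OF f']
proof (rule sample_integral)
  show "(\<lambda>x. (f x - (LINT x|Om. f x)) * (f' x - (LINT x|Om. f' x))) \<in> borel_measurable Om"
    using f(1) f'(1) by measurable
  show "dep {..<n} (\<lambda>x. (f x - (LINT x|Om. f x)) * (f' x - (LINT x|Om. f' x)))"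
    by (rule dep_comp2[OF f(2) f'(2)])
qed

lemma dep_window: "dep {..<n} (\<lambda>x. F (cyc_window n m x k))"
  unfolding dep_def
proof (intro allI impI)
  fix x y :: "nat \<Rightarrow> real" assume "\<forall>i\<in>{..<n}. x i = y i"
  then have "cyc_window n m x k = cyc_window n m y k" using n0 by (auto simp: cyc_window_def)
  then show "F (cyc_window n m x k) = F (cyc_window n m y k)" by simp
qed

lemma win_sum_measurable: "(\<lambda>x. win_sum m (cyc_window n m x k)) \<in> borel_measurable Om"
  unfolding win_sum_def cyc_window_def by simp

lemma integral_h:
  "k < n \<Longrightarrow> (LINT \<omega>|P. h k (Xwin X n m k \<omega>)) = (LINT x|Om. h k (Xwin coords n m k x))"
  unfolding Xwin_def by (rule sample_integral[OF measurable_cyc_window[OF h_meas] dep_window])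

lemma A_const_sample: "A_const P X h n m = A_const Om coords h n m"
  by (simp add: A_const_def integral_h)

lemma B_const_sample: "B_const P X h n m = B_const Om coords h n m"
  unfolding B_const_def Xwin_def
  by (intro arg_cong2[where f = "(/)"] sum.cong refl sample_cov[OF measurable_cyc_window[OF h_meas] dep_window win_sum_measurable dep_window]) simp

lemma C_const_sample: "C_const P X h n m = C_const Om coords h n m"
  unfolding C_const_def Xwin_def Let_def
proof (intro arg_cong2[where f = "(/)"] sum.cong refl sample_cov[OF measurable_cyc_window[OF h_meas] dep_window measurable_cyc_window[OF h_meas] dep_window])
  fix j :: int show "nat (j mod int n) < n" using n0 by (simp add: nat_less_iff)
qed simp

lemma sigma2_const_sample: "sigma2_const P X h n m = sigma2_const Om coords h n m"
  by (simp add: sigma2_const_def B_const_sample C_const_sample)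

lemma sigma_const_sample: "sigma_const P X h n m = sigma_const Om coords h n m"
  by (simp add: sigma_const_def sigma2_const_sample)

lemma
  assumes k: "k < n"
  shows integrable_g_rv: "integrable P (\<lambda>\<omega>. \<bar>g_rv P X h n m k \<omega>\<bar> powr r) \<longleftrightarrow>
      integrable Om (\<lambda>x. \<bar>g_rv Om coords h n m k x\<bar> powr r)"
    and integral_g_rv: "(LINT \<omega>|P. \<bar>g_rv P X h n m k \<omega>\<bar> powr r) =
      (LINT x|Om. \<bar>g_rv Om coords h n m k x\<bar> powr r)"
proof -
  let ?f = "\<lambda>x. \<bar>g_rv Om coords h n m k x\<bar> powr r"
  have eq: "\<bar>g_rv P X h n m k \<omega>\<bar> powr r = ?f (\<lambda>i. X i \<omega>)" for \<omega>
    by (simp add: g_rv_def integral_h[OF k] B_const_sample) (simp add: Xwin_def)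
  have f: "?f \<in> borel_measurable Om"
    unfolding g_rv_def Xwin_def using measurable_cyc_window[OF h_meas[OF k]] by measurable
  have d: "dep {..<n} ?f"
    unfolding g_rv_def Xwin_def
    by (rule dep_comp2[OF dep_window[of "h k" k] dep_coord[of k],
        where F = "\<lambda>a b. \<bar>a - (LINT x|Om. h k (cyc_window n m x k)) - B_const Om coords h n m * (b - 1)\<bar> powr r"]) (simp add: k)
  show "integrable P (\<lambda>\<omega>. \<bar>g_rv P X h n m k \<omega>\<bar> powr r) \<longleftrightarrow> integrable Om ?f"
    unfolding eq by (rule sample_integrable[OF f d])
  show "(LINT \<omega>|P. \<bar>g_rv P X h n m k \<omega>\<bar> powr r) = (LINT x|Om. ?f x)"
    unfolding eq by (rule sample_integral[OF f d])
qed

lemma square_integrable_h: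
  assumes "finite_moments P X h n m" "k < n"
  shows "integrable Om (\<lambda>x. (h k (cyc_window n m x k))\<^sup>2)"
proof -
  have "integrable P (\<lambda>\<omega>. (h k (cyc_window n m (\<lambda>j. X j \<omega>) k))\<^sup>2)"
    using assms by (simp add: finite_moments_def Xwin_def)
  moreover have "(\<lambda>x. (h k (cyc_window n m x k))\<^sup>2) \<in> borel_measurable Om"
    using measurable_cyc_window[OF h_meas[OF assms(2)]] by measurable
  ultimately show ?thesis
    using sample_integrable[of "\<lambda>x. (h k (cyc_window n m x k))\<^sup>2"] dep_window[of "\<lambda>w. (h k w)\<^sup>2" k] by simp
qed

end

lemma measurable_spacing_stat:
  assumes V: "iid_uniform M (n - 1) V" and n: "n \<ge> 2"
    and h: "\<And>k. k < n \<Longrightarrow> h k \<in> borel_measurable (borel_vec m)"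
  shows "(\<lambda>\<omega>. spacing_stat n m h (\<lambda>i. V i \<omega>)) \<in> borel_measurable M"
  unfolding spacing_stat_def
proof (intro borel_measurable_sum)
  interpret exp_coordinates by (rule exp_coordinates)
  have s: "(\<lambda>\<omega>. spacing n (\<lambda>i. V i \<omega>) j) \<in> borel_measurable M" for j
    using measurable_spacing[OF V, of j] n by simp
  fix k assume k: "k \<in> {..<n}"
  have "(\<lambda>\<omega>. \<lambda>i\<in>{..<m}. real n * spacing n (\<lambda>i. V i \<omega>) (k + i)) \<in> measurable M (borel_vec m)"
    using s by (intro measurable_restrict) simp
  from measurable_compose[OF this h] k
  show "(\<lambda>\<omega>. h k (\<lambda>i\<in>{..<m}. real n * spacing n (\<lambda>i. V i \<omega>) (k + i))) \<in> borel_measurable M" by simp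
qed

text \<open>Levy's continuity theorem wants every member of the sequence to be a distribution,
  whereas here this is known for large indices only. Replacing the other members by the limit law
  changes no limit.\<close>

lemma weak_conv_m_eventually:
  assumes ev: "\<forall>\<^sub>F n in sequentially. real_distribution (D n)"
    and D: "real_distribution \<mu>"
    and char: "\<And>t. (\<lambda>n. char (D n) t) \<longlonglongrightarrow> char \<mu> t"
  shows "weak_conv_m D \<mu>"
proof -
  define D' where "D' n = (if real_distribution (D n) then D n else \<mu>)" for n
  have ev': "\<forall>\<^sub>F n in sequentially. D n = D' n"
    using ev by eventually_elim (simp add: D'_def)
  have "weak_conv_m D' \<mu>"
  proof (rule levy_continuity)
    show "real_distribution (D' n)" for n using D by (simp add: D'_def)
    show "(\<lambda>n. char (D' n) t) \<longlonglongrightarrow> char \<mu> t" for t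
      by (rule Lim_transform_eventually[OF char]) (use ev' in eventually_elim, simp)
  qed fact
  then show ?thesis
    unfolding weak_conv_m_def weak_conv_def
  proof (intro allI impI)
    fix x assume *: "\<forall>x. isCont (cdf \<mu>) x \<longrightarrow> (\<lambda>n. cdf (D' n) x) \<longlonglongrightarrow> cdf \<mu> x" "isCont (cdf \<mu>) x"
    show "(\<lambda>n. cdf (D n) x) \<longlonglongrightarrow> cdf \<mu> x"
      by (rule Lim_transform_eventually[OF *(1)[rule_format, OF *(2)]]) (use ev' in eventually_elim, simp)
  qed
qed

theorem theorem2p1:
  fixes M :: "nat \<Rightarrow> 'a measure" and V :: "nat \<Rightarrow> nat \<Rightarrow> 'a \<Rightarrow> real"
    and P :: "nat \<Rightarrow> 'b measure" and X :: "nat \<Rightarrow> nat \<Rightarrow> 'b \<Rightarrow> real"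
    and m :: "nat \<Rightarrow> nat" and h :: "nat \<Rightarrow> nat \<Rightarrow> (nat \<Rightarrow> real) \<Rightarrow> real"
    and r :: real
  assumes uniform_sample: "\<And>n. n \<ge> 1 \<Longrightarrow> iid_uniform (M n) (n - 1) (V n)"
    and exponential_sample: "\<And>N. N \<ge> 1 \<Longrightarrow> iid_std_exponential (P N) N (X N)"
    and m_pos: "\<And>n. n \<ge> 1 \<Longrightarrow> m n \<ge> 1"
    and m_small: "(\<lambda>n. real (m n)) \<in> o(\<lambda>n. real n)"
    and h_measurable: "\<And>n k. k < n \<Longrightarrow> h n k \<in> borel_measurable (borel_vec (m n))"
    and sigma_pos: "eventually (\<lambda>n. sigma2_const (P n) (X n) (h n) n (m n) > 0) sequentially"
    and moments_n: "eventually (\<lambda>n. finite_moments (P n) (X n) (h n) n (m n)) sequentially"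
    and moments_n_minus_m: "eventually (\<lambda>n.
          finite_moments (P (n - m n)) (X (n - m n)) (h n) (n - m n) (m n)) sequentially"
    and C_asymp: "(\<lambda>n. C_const (P (n - m n)) (X (n - m n)) (h n) (n - m n) (m n))
          \<sim>[sequentially] (\<lambda>n. C_const (P n) (X n) (h n) n (m n))"
    and B_asymp: "(\<lambda>n. B_const (P (n - m n)) (X (n - m n)) (h n) (n - m n) (m n))
          \<sim>[sequentially] (\<lambda>n. B_const (P n) (X n) (h n) n (m n))"
    and r_gt_2: "r > 2"
    and g_moments: "eventually (\<lambda>n. \<forall>k<n.
          integrable (P n) (\<lambda>\<omega>. \<bar>g_rv (P n) (X n) (h n) n (m n) k \<omega>\<bar> powr r)) sequentially"
    and lyapunov: "(\<lambda>n. real (m n) powr (r - 1) / sigma_const (P n) (X n) (h n) n (m n) powr r *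
          (\<Sum>k<n. LINT \<omega>|P n. \<bar>g_rv (P n) (X n) (h n) n (m n) k \<omega>\<bar> powr r)) \<longlonglongrightarrow> 0"
  shows "weak_conv_m
      (\<lambda>n. distr (M n) borel (\<lambda>\<omega>.
        (spacing_stat n (m n) (h n) (\<lambda>i. V n i \<omega>) - A_const (P n) (X n) (h n) n (m n))
          / sigma_const (P n) (X n) (h n) n (m n)))
      std_normal_distribution"
proof (rule weak_conv_m_eventually[OF _ real_dist_normal_dist])
  interpret exp_coordinates by (rule exp_coordinates)
  define D where "D n = distr (M n) borel (\<lambda>\<omega>. (spacing_stat n (m n) (h n) (\<lambda>i. V n i \<omega>) - A_const (P n) (X n) (h n) n (m n))
          / sigma_const (P n) (X n) (h n) n (m n))" for n
  define L where "L n = real (m n) powr (r - 1) / sigma_const (P n) (X n) (h n) n (m n) powr r *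
          (\<Sum>k<n. LINT \<omega>|P n. \<bar>g_rv (P n) (X n) (h n) n (m n) k \<omega>\<bar> powr r)" for n
  have m_le: "\<forall>\<^sub>F n in sequentially. real (m n) \<le> c * real n" if "c > 0" for c
    using landau_o.smallD[OF m_small that] by simp
  have n2: "\<forall>\<^sub>F n in sequentially. 2 * m n \<le> n"
    using m_le[of "1 / 2"] by (auto elim: eventually_mono)
  have meas: "(\<lambda>\<omega>. (spacing_stat n (m n) (h n) (\<lambda>i. V n i \<omega>) - A_const (P n) (X n) (h n) n (m n))
          / sigma_const (P n) (X n) (h n) n (m n)) \<in> borel_measurable (M n)" if "n \<ge> 2" for n
    using measurable_spacing_stat[OF uniform_sample _ h_measurable] that by simp
  have "real_distribution (D n)" if "n \<ge> 2" for n
  proof -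
    interpret Mn: prob_space "M n" using uniform_sample[of n] that by (simp add: iid_uniform_def)
    show ?thesis unfolding D_def by (rule Mn.real_distribution_distr[OF meas[OF that]])
  qed
  then show "\<forall>\<^sub>F n in sequentially. real_distribution (D n)"
    by (rule eventually_mono[OF eventually_ge_at_top[of 2]])
  fix t :: real
  show "(\<lambda>n. char (D n) t) \<longlonglongrightarrow> char std_normal_distribution t"
    unfolding char_std_normal_distribution tendsto_iff
  proof (intro allI impI)
    fix eps :: real assume "eps > 0"
    then have "eps / 2 > 0" by simp
    \<comment> \<open>The constant \<open>d\<close> is obtained before \<open>n\<close> enters; what
      remains is to meet its two conditions for all large \<open>n\<close>.\<close>
    from uniform_clt[OF r_gt_2 this, of t, where ?'a = 'a] obtain d where d: "d > 0" and
      clt: "\<And>n m q Bl \<xi> lam (M :: 'a measure) V. cyclic_chain n m q Bl \<xi> r lam \<Longrightarrow> lam \<le> d \<Longrightarrow>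
        real m \<le> d * real n \<Longrightarrow> iid_uniform M (n - 1) V \<Longrightarrow>
        cmod ((LINT \<omega>|M. iexp (t * (\<Sum>j<q. \<xi> j (\<lambda>i. real n * spacing n (\<lambda>i. V i \<omega>) i)))) - of_real (exp (- t\<^sup>2 / 2))) \<le> eps / 2"
      by metis
    \<comment> \<open>The factor 2^r 2^(r-1) is the one in the moment bound of \<open>chain\<close>:
      the loss in the power mean inequality and the block size 2 m.\<close>
    have "(\<lambda>n. 2 powr r * 2 powr (r - 1) * L n) \<longlonglongrightarrow> 2 powr r * 2 powr (r - 1) * 0"
      unfolding L_def by (intro tendsto_intros lyapunov)
    then have "\<forall>\<^sub>F n in sequentially. 2 powr r * 2 powr (r - 1) * L n < d"
      by (rule order_tendstoD) (simp add: d)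
    then show "\<forall>\<^sub>F n in sequentially. dist (char (D n) t) (of_real (exp (- t\<^sup>2 / 2))) < eps"
      using m_le[OF d] n2 eventually_ge_at_top[of 2] sigma_pos moments_n g_moments
    proof eventually_elim
      case (elim n)
      interpret S: exp_sample "P n" "X n" n "m n" "h n"
        by unfold_locales (use elim exponential_sample h_measurable in auto)
      interpret W: window_functions n "m n" "h n"
        by unfold_locales (use elim m_pos h_measurable S.square_integrable_h in auto)
      define \<sigma> where "\<sigma> = sigma_const Om S.coords (h n) n (m n)"
      have s2: "sigma2_const Om S.coords (h n) n (m n) > 0"
        using elim by (simp add: S.sigma2_const_sample)
      have mom: "integrable Om (\<lambda>x. \<bar>W.g k x\<bar> powr r)" if "k < n" for k
        using elim that S.integrable_g_rv[OF that, of r] by (simp add: W.g_rv_eq)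
      have "cyclic_chain n (m n) W.q W.Bl (\<lambda>j x. (\<Sum>k\<in>W.Bl j. W.g k x) / \<sigma>) r
         (2 powr r * (2 * real (m n)) powr (r - 1) / \<sigma> powr r * (\<Sum>k<n. LINT x|Om. \<bar>W.g k x\<bar> powr r))"
        unfolding \<sigma>_def by (rule W.chain(1)[OF s2 r_gt_2 mom])
      also have "2 powr r * (2 * real (m n)) powr (r - 1) / \<sigma> powr r * (\<Sum>k<n. LINT x|Om. \<bar>W.g k x\<bar> powr r)
        = 2 powr r * 2 powr (r - 1) * L n"
      proof -
        have "(\<Sum>k<n. LINT \<omega>|P n. \<bar>g_rv (P n) (X n) (h n) n (m n) k \<omega>\<bar> powr r) = (\<Sum>k<n. LINT x|Om. \<bar>W.g k x\<bar> powr r)"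
          by (intro sum.cong refl) (simp add: S.integral_g_rv W.g_rv_eq)
        then show ?thesis by (simp add: L_def \<sigma>_def S.sigma_const_sample powr_mult)
      qed
      finally have chain: "cyclic_chain n (m n) W.q W.Bl (\<lambda>j x. (\<Sum>k\<in>W.Bl j. W.g k x) / \<sigma>) r (2 powr r * 2 powr (r - 1) * L n)" .
      have sum: "(\<Sum>j<W.q. (\<Sum>k\<in>W.Bl j. W.g k x) / \<sigma>) = W.Z x / \<sigma>" for x
        unfolding \<sigma>_def by (rule W.chain(2)[OF s2 r_gt_2 mom])
      have "char (D n) t = (LINT \<omega>|M n. iexp (t * ((spacing_stat n (m n) (h n) (\<lambda>i. V n i \<omega>) - A_const (P n) (X n) (h n) n (m n))
          / sigma_const (P n) (X n) (h n) n (m n))))"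
        unfolding char_def D_def
        by (rule integral_distr[OF meas]) (use elim(4) in \<open>auto intro: measurable_compose[OF _ measurable_iexp]\<close>)
      also have "\<dots> = (LINT \<omega>|M n. iexp (t * (\<Sum>j<W.q. (\<Sum>k\<in>W.Bl j. W.g k (\<lambda>i. real n * spacing n (\<lambda>i. V n i \<omega>) i)) / \<sigma>)))"
        unfolding sum S.A_const_sample S.sigma_const_sample W.spacing_stat_eq \<sigma>_def[symmetric] ..
      finally have "cmod (char (D n) t - of_real (exp (- t\<^sup>2 / 2))) \<le> eps / 2"
        using clt[OF chain less_imp_le[OF elim(1)] elim(2) uniform_sample[of n]] elim(4) by simp
      then show ?case using \<open>eps > 0\<close> by (simp add: dist_norm)
    qed
  qed
qed

end
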